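(* Let $R$ be a commutative ring, let $\alpha,z,\zeta\in R^\times$ with $\zeta^{-1}-\zeta=z$, and let $n\ge 2$. The functor $$Z_{\alpha,\zeta}:\mathbf{HOMFLY\text{-}PT}_{\alpha,z}\to\mathbf{MOY}_{\alpha,\zeta}$$ (the rigid braided monoidal functor with $Z_{\alpha,\zeta}(\uparrow)=\uparrow^1$) is an isomorphism of rigid braided untwisted monoidal categories.
   Context: Diagrams are read bottom to top, up to plane isotopy; $\circ$ is stacking (left factor on top), $\otimes$ juxtaposition; all categories are enriched in $R$-modules; tensor ideals are families of submodules of Hom-modules closed under composition and tensor product with arbitrary morphisms. **Tangles.** $\mathbf{PTD}$: objects are finite sequences of $\uparrow,\downarrow$; morphisms are $R$-linear combinations of oriented plane tangle diagrams. $\mathbf{TD}$ is its quotient by the tensor ideal generated by the oriented Reidemeister moves (all variants); it is rigid, with cups and caps as dualities, and braided untwisted. Let $X_+$ (resp. $X_-$) be the crossing of two upward strands with over-strand running from bottom left to top right (resp. from bottom right to top left). $\mathbf{HOMFLY\text{-}PT}_{\alpha,z}$ is the quotient of $\mathbf{TD}$ by the tensor ideal generated by $\alpha X_+-\alpha^{-1}X_--z\,\mathrm{id}_{\uparrow\uparrow}$ and $\bigcirc-\frac{\alpha-\alpha^{-1}}{z}\emptyset$, where $\bigcirc$ is the unknot. **Trivalent graphs.** $\mathbf{TrPD}$: objects are finite sequences of $\uparrow^1,\downarrow^1$; morphisms are $R$-linear combinations of oriented plane trivalent graphs with edges labelled in $\{1,2\}$, boundary edges labelled 1, such that at each vertex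 the sum of incoming labels equals the sum of outgoing labels (two incoming and one outgoing edge, or vice versa). It is rigid monoidal; morphisms are generated by identities, caps $\overrightarrow{ev}:\uparrow^1\downarrow^1\to\emptyset$, $\overleftarrow{ev}:\downarrow^1\uparrow^1\to\emptyset$, cups $\overrightarrow{coev}:\emptyset\to\uparrow^1\downarrow^1$, $\overleftarrow{coev}:\emptyset\to\downarrow^1\uparrow^1$, the graph $S:\uparrow^1\uparrow^1\to\uparrow^1\uparrow^1$ (two 1-edges merge into a 2-edge which splits into two 1-edges) and its dual $S^\vee$ (reversed orientations). Write $\mathrm{id}=\mathrm{id}_{\uparrow^1}$, $\mathrm{id}^\vee=\mathrm{id}_{\downarrow^1}$. **$\mathbf{MOY}_{\alpha,\zeta}$.** Put $[k]_{\alpha,\zeta}=\dfrac{\alpha^{-1}(-\zeta)^{k-n}-\alpha(-\zeta)^{n-k}}{\zeta-\zeta^{-1}}\in R$. $\mathbf{MOY}_{\alpha,\zeta}$ is the quotient of $\mathbf{TrPD}$ by the tensor ideal generated by the following relations and their duals (same diagrams with all orientations reversed): (1) $\overrightarrow{ev}\circ\overrightarrow{coev}$ and the oppositely oriented circle... i.e. the circle labelled 1 equals $[n]_{\alpha,\zeta}\,\emptyset$; (2) $S\circ S=-(\zeta+\zeta^{-1})S$; (3) $(\overleftarrow{ev}\otimes\mathrm{id})\circ(\mathrm{id}^\vee\otimes S)\circ(\overleftarrow{coev}\otimes\mathrm{id})=[n-1]_{\alpha,\zeta}\,\mathrm{id}$; (4) $(\mathrm{id}\otimes\overrightarrow{ev}\otimes\mathrm{id}^\vee)\circ(S\otimes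 S^\vee)\circ(\mathrm{id}\otimes\overrightarrow{coev}\otimes\mathrm{id}^\vee)=\overrightarrow{coev}\circ\overrightarrow{ev}+[n-2]_{\alpha,\zeta}\,\mathrm{id}\otimes\mathrm{id}^\vee$; (5) $(S\otimes\mathrm{id})(\mathrm{id}\otimes S)(S\otimes\mathrm{id})+\mathrm{id}\otimes S=(\mathrm{id}\otimes S)(S\otimes\mathrm{id})(\mathrm{id}\otimes S)+S\otimes\mathrm{id}$. It is rigid braided untwisted with braidings $\sigma^+=\alpha^{-1}(\zeta^{-1}\mathrm{id}_{\uparrow^1\uparrow^1}+S)$ and $\sigma^-=\alpha(\zeta\,\mathrm{id}_{\uparrow^1\uparrow^1}+S)$. **$Z_{\alpha,\zeta}$** is the rigid monoidal $R$-linear functor sending $\uparrow\mapsto\uparrow^1$, cups and caps to cups and caps, $X_\pm\mapsto\sigma^\pm$. *)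

theory Defs
  imports "HOL-Library.Poly_Mapping"
begin

section \<open>Rigid and braided monoidal categories enriched in modules\<close>

text \<open>
  The sort \<open>{comm_ring, comm_monoid_mult}\<close> is that of unital commutative rings, the zero ring
  included (\<open>comm_ring_1\<close> would exclude it).

  All categories here are strict monoidal. A morphism determines its source and target. Every
  object \<open>A\<close> has a chosen dual with \<open>A** = A\<close>; \<open>evl A : A \<otimes> A* \<rightarrow> 1\<close> and \<open>coevl A : 1 \<rightarrow> A \<otimes> A*\<close>,
  so the second pair of duality morphisms of \<open>A\<close> is \<open>evl A*\<close>, \<open>coevl A*\<close>.
\<close>

record ('o, 'm, 'r) rigid_cat =
  Obj :: "'o set"
  Mor :: "'m set"
  Src :: "'m \<Rightarrow> 'o"
  Tgt :: "'m \<Rightarrow> 'o"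
  ide :: "'o \<Rightarrow> 'm"
  comp :: "'m \<Rightarrow> 'm \<Rightarrow> 'm" (infixr "\<cdot>\<index>" 68)
  zero :: "'o \<Rightarrow> 'o \<Rightarrow> 'm"
  add :: "'m \<Rightarrow> 'm \<Rightarrow> 'm" (infixl "\<oplus>\<index>" 65)
  scale :: "'r \<Rightarrow> 'm \<Rightarrow> 'm" (infixr "\<odot>\<index>" 67)
  unit_ob :: "'o"
  tensor_ob :: "'o \<Rightarrow> 'o \<Rightarrow> 'o"
  tensor :: "'m \<Rightarrow> 'm \<Rightarrow> 'm" (infixr "\<otimes>\<index>" 72)
  dual :: "'o \<Rightarrow> 'o"
  evl :: "'o \<Rightarrow> 'm"
  coevl :: "'o \<Rightarrow> 'm"

definition Hom :: "('o, 'm, 'r, 'x) rigid_cat_scheme \<Rightarrow> 'o \<Rightarrow> 'o \<Rightarrow> 'm set" where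
  "Hom C A B = {f \<in> Mor C. Src C f = A \<and> Tgt C f = B}"

definition diff :: "('o, 'm, 'r::{comm_ring, comm_monoid_mult}, 'x) rigid_cat_scheme \<Rightarrow> 'm \<Rightarrow> 'm \<Rightarrow> 'm"
    (infixl "\<ominus>\<index>" 65) where
  "f \<ominus>\<^bsub>C\<^esub> g = f \<oplus>\<^bsub>C\<^esub> ((- 1) \<odot>\<^bsub>C\<^esub> g)"

locale linear_monoidal_category =
  fixes C :: "('o, 'm, 'r::{comm_ring, comm_monoid_mult}, 'x) rigid_cat_scheme" (structure)
  assumes Src_in: "f \<in> Mor C \<Longrightarrow> Src C f \<in> Obj C"
    and Tgt_in: "f \<in> Mor C \<Longrightarrow> Tgt C f \<in> Obj C"
    and ide_in: "A \<in> Obj C \<Longrightarrow> ide C A \<in> Hom C A A"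
    and comp_in: "\<lbrakk>f \<in> Hom C A B; g \<in> Hom C B D\<rbrakk> \<Longrightarrow> g \<cdot> f \<in> Hom C A D"
    and comp_assoc: "\<lbrakk>f \<in> Hom C A B; g \<in> Hom C B D; h \<in> Hom C D E\<rbrakk> \<Longrightarrow> (h \<cdot> g) \<cdot> f = h \<cdot> (g \<cdot> f)"
    and ide_left: "f \<in> Hom C A B \<Longrightarrow> ide C B \<cdot> f = f"
    and ide_right: "f \<in> Hom C A B \<Longrightarrow> f \<cdot> ide C A = f"
    and zero_in: "\<lbrakk>A \<in> Obj C; B \<in> Obj C\<rbrakk> \<Longrightarrow> zero C A B \<in> Hom C A B"
    and add_in: "\<lbrakk>f \<in> Hom C A B; g \<in> Hom C A B\<rbrakk> \<Longrightarrow> f \<oplus> g \<in> Hom C A B"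
    and scale_in: "f \<in> Hom C A B \<Longrightarrow> r \<odot> f \<in> Hom C A B"
    and add_assoc: "\<lbrakk>f \<in> Hom C A B; g \<in> Hom C A B; h \<in> Hom C A B\<rbrakk> \<Longrightarrow> (f \<oplus> g) \<oplus> h = f \<oplus> (g \<oplus> h)"
    and add_commute: "\<lbrakk>f \<in> Hom C A B; g \<in> Hom C A B\<rbrakk> \<Longrightarrow> f \<oplus> g = g \<oplus> f"
    and add_zero: "f \<in> Hom C A B \<Longrightarrow> f \<oplus> zero C A B = f"
    and add_inverse: "f \<in> Hom C A B \<Longrightarrow> f \<ominus> f = zero C A B"
    and scale_one: "f \<in> Hom C A B \<Longrightarrow> 1 \<odot> f = f"
    and scale_scale: "f \<in> Hom C A B \<Longrightarrow> r \<odot> (s \<odot> f) = (r * s) \<odot> f"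
    and scale_add_left: "f \<in> Hom C A B \<Longrightarrow> (r + s) \<odot> f = (r \<odot> f) \<oplus> (s \<odot> f)"
    and scale_add_right: "\<lbrakk>f \<in> Hom C A B; g \<in> Hom C A B\<rbrakk> \<Longrightarrow> r \<odot> (f \<oplus> g) = (r \<odot> f) \<oplus> (r \<odot> g)"
    and comp_add_left: "\<lbrakk>f \<in> Hom C A B; g \<in> Hom C B D; h \<in> Hom C B D\<rbrakk> \<Longrightarrow>
      (g \<oplus> h) \<cdot> f = (g \<cdot> f) \<oplus> (h \<cdot> f)"
    and comp_add_right: "\<lbrakk>f \<in> Hom C A B; g \<in> Hom C A B; h \<in> Hom C B D\<rbrakk> \<Longrightarrow>
      h \<cdot> (f \<oplus> g) = (h \<cdot> f) \<oplus> (h \<cdot> g)"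
    and comp_scale_left: "\<lbrakk>f \<in> Hom C A B; g \<in> Hom C B D\<rbrakk> \<Longrightarrow> (r \<odot> g) \<cdot> f = r \<odot> (g \<cdot> f)"
    and comp_scale_right: "\<lbrakk>f \<in> Hom C A B; g \<in> Hom C B D\<rbrakk> \<Longrightarrow> g \<cdot> (r \<odot> f) = r \<odot> (g \<cdot> f)"
    and unit_in: "unit_ob C \<in> Obj C"
    and tensor_ob_in: "\<lbrakk>A \<in> Obj C; B \<in> Obj C\<rbrakk> \<Longrightarrow> tensor_ob C A B \<in> Obj C"
    and tensor_ob_assoc: "\<lbrakk>A \<in> Obj C; B \<in> Obj C; D \<in> Obj C\<rbrakk> \<Longrightarrow>
      tensor_ob C (tensor_ob C A B) D = tensor_ob C A (tensor_ob C B D)"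
    and tensor_ob_unit_left: "A \<in> Obj C \<Longrightarrow> tensor_ob C (unit_ob C) A = A"
    and tensor_ob_unit_right: "A \<in> Obj C \<Longrightarrow> tensor_ob C A (unit_ob C) = A"
    and tensor_in: "\<lbrakk>f \<in> Hom C A B; g \<in> Hom C D E\<rbrakk> \<Longrightarrow>
      f \<otimes> g \<in> Hom C (tensor_ob C A D) (tensor_ob C B E)"
    and tensor_assoc: "\<lbrakk>f \<in> Mor C; g \<in> Mor C; h \<in> Mor C\<rbrakk> \<Longrightarrow> (f \<otimes> g) \<otimes> h = f \<otimes> (g \<otimes> h)"
    and tensor_unit_left: "f \<in> Mor C \<Longrightarrow> ide C (unit_ob C) \<otimes> f = f"
    and tensor_unit_right: "f \<in> Mor C \<Longrightarrow> f \<otimes> ide C (unit_ob C) = f"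
    and tensor_ide: "\<lbrakk>A \<in> Obj C; B \<in> Obj C\<rbrakk> \<Longrightarrow> ide C A \<otimes> ide C B = ide C (tensor_ob C A B)"
    and interchange: "\<lbrakk>f \<in> Hom C A B; g \<in> Hom C B D; f' \<in> Hom C A' B'; g' \<in> Hom C B' D'\<rbrakk> \<Longrightarrow>
      (g \<otimes> g') \<cdot> (f \<otimes> f') = (g \<cdot> f) \<otimes> (g' \<cdot> f')"
    and tensor_add_left: "\<lbrakk>f \<in> Hom C A B; g \<in> Hom C A B; h \<in> Mor C\<rbrakk> \<Longrightarrow>
      (f \<oplus> g) \<otimes> h = (f \<otimes> h) \<oplus> (g \<otimes> h)"
    and tensor_add_right: "\<lbrakk>f \<in> Hom C A B; g \<in> Hom C A B; h \<in> Mor C\<rbrakk> \<Longrightarrow>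
      h \<otimes> (f \<oplus> g) = (h \<otimes> f) \<oplus> (h \<otimes> g)"
    and tensor_scale_left: "\<lbrakk>f \<in> Mor C; g \<in> Mor C\<rbrakk> \<Longrightarrow> (r \<odot> f) \<otimes> g = r \<odot> (f \<otimes> g)"
    and tensor_scale_right: "\<lbrakk>f \<in> Mor C; g \<in> Mor C\<rbrakk> \<Longrightarrow> f \<otimes> (r \<odot> g) = r \<odot> (f \<otimes> g)"

locale rigid_category = linear_monoidal_category +
  assumes dual_in: "A \<in> Obj C \<Longrightarrow> dual C A \<in> Obj C"
    and dual_dual: "A \<in> Obj C \<Longrightarrow> dual C (dual C A) = A"
    and ev_in: "A \<in> Obj C \<Longrightarrow> evl C A \<in> Hom C (tensor_ob C A (dual C A)) (unit_ob C)"
    and coev_in: "A \<in> Obj C \<Longrightarrow> coevl C A \<in> Hom C (unit_ob C) (tensor_ob C A (dual C A))"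
    and zigzag_left: "A \<in> Obj C \<Longrightarrow>
      (evl C A \<otimes> ide C A) \<cdot> (ide C A \<otimes> coevl C (dual C A)) = ide C A"
    and zigzag_right: "A \<in> Obj C \<Longrightarrow>
      (ide C A \<otimes> evl C (dual C A)) \<cdot> (coevl C A \<otimes> ide C A) = ide C A"

text \<open>
  A rigid category with a braiding and a set of objects, the strands, on which the twist is
  considered. In a braided category the twist of \<open>A \<otimes> B\<close> involves the double braiding of
  \<open>A\<close> and \<open>B\<close>, so triviality of the twist can only be asked on generating objects: a single
  strand may be freely untwisted, but two parallel strands may not.
\<close>

record ('o, 'm, 'r) braided_cat = "('o, 'm, 'r) rigid_cat" +
  braid :: "'o \<Rightarrow> 'o \<Rightarrow> 'm"
  strands :: "'o set"

context
  fixes C :: "('o, 'm, 'r, 'x) rigid_cat_scheme" (structure)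
begin

definition right_curl :: "'o \<Rightarrow> 'm \<Rightarrow> 'm" where
  "right_curl A c = (ide C A \<otimes> evl C A) \<cdot> (c \<otimes> ide C (dual C A)) \<cdot> (ide C A \<otimes> coevl C A)"

definition left_curl :: "'o \<Rightarrow> 'm \<Rightarrow> 'm" where
  "left_curl A c = (evl C (dual C A) \<otimes> ide C A) \<cdot> (ide C (dual C A) \<otimes> c) \<cdot>
    (coevl C (dual C A) \<otimes> ide C A)"

definition mate :: "'m \<Rightarrow> 'm" where
  "mate f = (ide C (dual C (Src C f)) \<otimes> evl C (Tgt C f)) \<cdot>
     (ide C (dual C (Src C f)) \<otimes> f \<otimes> ide C (dual C (Tgt C f))) \<cdot>
     (coevl C (dual C (Src C f)) \<otimes> ide C (dual C (Tgt C f)))"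

end

inductive_set strand_words :: "('o, 'm, 'r, 'x) braided_cat_scheme \<Rightarrow> 'o set"
  for C :: "('o, 'm, 'r, 'x) braided_cat_scheme" where
    "unit_ob C \<in> strand_words C"
  | "\<lbrakk>A \<in> strands C; B \<in> strand_words C\<rbrakk> \<Longrightarrow> tensor_ob C A B \<in> strand_words C"

locale rigid_braided_untwisted =
  rigid_category C for C :: "('o, 'm, 'r::{comm_ring, comm_monoid_mult}, 'x) braided_cat_scheme" (structure) +
  assumes braid_in: "\<lbrakk>A \<in> Obj C; B \<in> Obj C\<rbrakk> \<Longrightarrow>
      braid C A B \<in> Hom C (tensor_ob C A B) (tensor_ob C B A)"
    and braid_iso: "\<lbrakk>A \<in> Obj C; B \<in> Obj C\<rbrakk> \<Longrightarrow>
      \<exists>g \<in> Hom C (tensor_ob C B A) (tensor_ob C A B).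
        g \<cdot> braid C A B = ide C (tensor_ob C A B) \<and> braid C A B \<cdot> g = ide C (tensor_ob C B A)"
    and braid_natural: "\<lbrakk>f \<in> Hom C A A'; g \<in> Hom C B B'\<rbrakk> \<Longrightarrow>
      braid C A' B' \<cdot> (f \<otimes> g) = (g \<otimes> f) \<cdot> braid C A B"
    and hexagon_left: "\<lbrakk>A \<in> Obj C; B \<in> Obj C; D \<in> Obj C\<rbrakk> \<Longrightarrow>
      braid C (tensor_ob C A B) D = (braid C A D \<otimes> ide C B) \<cdot> (ide C A \<otimes> braid C B D)"
    and hexagon_right: "\<lbrakk>A \<in> Obj C; B \<in> Obj C; D \<in> Obj C\<rbrakk> \<Longrightarrow>
      braid C A (tensor_ob C B D) = (ide C B \<otimes> braid C A D) \<cdot> (braid C A B \<otimes> ide C D)"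
    and strands_dual: "A \<in> strands C \<Longrightarrow> dual C A \<in> strands C"
    and strands_generate: "strand_words C = Obj C"
    and untwisted_right: "A \<in> strands C \<Longrightarrow> right_curl C A (braid C A A) = ide C A"
    and untwisted_left: "A \<in> strands C \<Longrightarrow> left_curl C A (braid C A A) = ide C A"


section \<open>Functors\<close>

record ('o, 'm, 'p, 'n) cat_map =
  on_obj :: "'o \<Rightarrow> 'p"
  on_mor :: "'m \<Rightarrow> 'n"

definition rigid_monoidal_functor ::
    "('o, 'm, 'r, 'x) rigid_cat_scheme \<Rightarrow> ('p, 'n, 'r, 'y) rigid_cat_scheme \<Rightarrow>
      ('o, 'm, 'p, 'n) cat_map \<Rightarrow> bool" where
  "rigid_monoidal_functor C D F \<longleftrightarrow>
    (\<forall>A \<in> Obj C. on_obj F A \<in> Obj D) \<and>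
    (\<forall>f \<in> Mor C. on_mor F f \<in> Hom D (on_obj F (Src C f)) (on_obj F (Tgt C f))) \<and>
    (\<forall>A \<in> Obj C. on_mor F (ide C A) = ide D (on_obj F A)) \<and>
    (\<forall>f \<in> Mor C. \<forall>g \<in> Mor C. Src C g = Tgt C f \<longrightarrow>
       on_mor F (g \<cdot>\<^bsub>C\<^esub> f) = on_mor F g \<cdot>\<^bsub>D\<^esub> on_mor F f) \<and>
    (\<forall>f \<in> Mor C. \<forall>g \<in> Mor C. Src C f = Src C g \<and> Tgt C f = Tgt C g \<longrightarrow>
       on_mor F (f \<oplus>\<^bsub>C\<^esub> g) = on_mor F f \<oplus>\<^bsub>D\<^esub> on_mor F g) \<and>
    (\<forall>r. \<forall>f \<in> Mor C. on_mor F (r \<odot>\<^bsub>C\<^esub> f) = r \<odot>\<^bsub>D\<^esub> on_mor F f) \<and>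
    on_obj F (unit_ob C) = unit_ob D \<and>
    (\<forall>A \<in> Obj C. \<forall>B \<in> Obj C.
       on_obj F (tensor_ob C A B) = tensor_ob D (on_obj F A) (on_obj F B)) \<and>
    (\<forall>f \<in> Mor C. \<forall>g \<in> Mor C. on_mor F (f \<otimes>\<^bsub>C\<^esub> g) = on_mor F f \<otimes>\<^bsub>D\<^esub> on_mor F g) \<and>
    (\<forall>A \<in> Obj C. on_obj F (dual C A) = dual D (on_obj F A)) \<and>
    (\<forall>A \<in> Obj C. on_mor F (evl C A) = evl D (on_obj F A)) \<and>
    (\<forall>A \<in> Obj C. on_mor F (coevl C A) = coevl D (on_obj F A))"

definition rigid_braided_functor ::
    "('o, 'm, 'r, 'x) braided_cat_scheme \<Rightarrow> ('p, 'n, 'r, 'y) braided_cat_scheme \<Rightarrow>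
      ('o, 'm, 'p, 'n) cat_map \<Rightarrow> bool" where
  "rigid_braided_functor C D F \<longleftrightarrow>
    rigid_monoidal_functor C D F \<and>
    (\<forall>A \<in> Obj C. \<forall>B \<in> Obj C. on_mor F (braid C A B) = braid D (on_obj F A) (on_obj F B)) \<and>
    (\<forall>A \<in> strands C. on_obj F A \<in> strands D)"

definition rbu_isomorphism ::
    "('o, 'm, 'r::{comm_ring, comm_monoid_mult}, 'x) braided_cat_scheme \<Rightarrow>
      ('p, 'n, 'r, 'y) braided_cat_scheme \<Rightarrow> ('o, 'm, 'p, 'n) cat_map \<Rightarrow> bool" where
  "rbu_isomorphism C D F \<longleftrightarrow>
    rigid_braided_untwisted C \<and> rigid_braided_untwisted D \<and> rigid_braided_functor C D F \<and>
    (\<exists>G :: ('p, 'n, 'o, 'm) cat_map. rigid_braided_functor D C G \<and>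
      (\<forall>A \<in> Obj C. on_obj G (on_obj F A) = A) \<and> (\<forall>f \<in> Mor C. on_mor G (on_mor F f) = f) \<and>
      (\<forall>A \<in> Obj D. on_obj F (on_obj G A) = A) \<and> (\<forall>f \<in> Mor D. on_mor F (on_mor G f) = f))"

definition cat_map_eq ::
    "('o, 'm, 'r, 'x) rigid_cat_scheme \<Rightarrow> ('o, 'm, 'p, 'n) cat_map \<Rightarrow> ('o, 'm, 'p, 'n) cat_map \<Rightarrow> bool" where
  "cat_map_eq C F G \<longleftrightarrow>
    (\<forall>A \<in> Obj C. on_obj F A = on_obj G A) \<and> (\<forall>f \<in> Mor C. on_mor F f = on_mor G f)"


section \<open>Tensor ideals and quotients\<close>

text \<open>A tensor ideal is given by the union of its submodules \<open>I \<inter> Hom C A B\<close>.\<close>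

definition tensor_ideal :: "('o, 'm, 'r, 'x) rigid_cat_scheme \<Rightarrow> 'm set \<Rightarrow> bool" where
  "tensor_ideal C I \<longleftrightarrow>
    I \<subseteq> Mor C \<and>
    (\<forall>A \<in> Obj C. \<forall>B \<in> Obj C. zero C A B \<in> I) \<and>
    (\<forall>f \<in> I. \<forall>g \<in> I. Src C f = Src C g \<and> Tgt C f = Tgt C g \<longrightarrow> f \<oplus>\<^bsub>C\<^esub> g \<in> I) \<and>
    (\<forall>r. \<forall>f \<in> I. r \<odot>\<^bsub>C\<^esub> f \<in> I) \<and>
    (\<forall>f \<in> I. \<forall>g \<in> Mor C. Src C g = Tgt C f \<longrightarrow> g \<cdot>\<^bsub>C\<^esub> f \<in> I) \<and>
    (\<forall>f \<in> I. \<forall>g \<in> Mor C. Src C f = Tgt C g \<longrightarrow> f \<cdot>\<^bsub>C\<^esub> g \<in> I) \<and>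
    (\<forall>f \<in> I. \<forall>g \<in> Mor C. f \<otimes>\<^bsub>C\<^esub> g \<in> I \<and> g \<otimes>\<^bsub>C\<^esub> f \<in> I)"

definition ideal_generated :: "('o, 'm, 'r, 'x) rigid_cat_scheme \<Rightarrow> 'm set \<Rightarrow> 'm set" where
  "ideal_generated C G = \<Inter> {I. tensor_ideal C I \<and> G \<subseteq> I}"

definition coset :: "('o, 'm, 'r, 'x) rigid_cat_scheme \<Rightarrow> 'm set \<Rightarrow> 'm \<Rightarrow> 'm set" where
  "coset C I f = {f \<oplus>\<^bsub>C\<^esub> i | i. i \<in> I \<and> Src C i = Src C f \<and> Tgt C i = Tgt C f}"

definition quotient_cat ::
    "('o, 'm, 'r) rigid_cat \<Rightarrow> 'm set \<Rightarrow> ('o, 'm set, 'r) rigid_cat" where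
  "quotient_cat C I = \<lparr>
     Obj = Obj C,
     Mor = coset C I ` Mor C,
     Src = (\<lambda>F. Src C (SOME f. f \<in> F)),
     Tgt = (\<lambda>F. Tgt C (SOME f. f \<in> F)),
     ide = (\<lambda>A. coset C I (ide C A)),
     comp = (\<lambda>G F. \<Union>g \<in> G. \<Union>f \<in> F. coset C I (g \<cdot>\<^bsub>C\<^esub> f)),
     zero = (\<lambda>A B. coset C I (zero C A B)),
     add = (\<lambda>F G. \<Union>f \<in> F. \<Union>g \<in> G. coset C I (f \<oplus>\<^bsub>C\<^esub> g)),
     scale = (\<lambda>r F. \<Union>f \<in> F. coset C I (r \<odot>\<^bsub>C\<^esub> f)),
     unit_ob = unit_ob C,
     tensor_ob = tensor_ob C,
     tensor = (\<lambda>F G. \<Union>f \<in> F. \<Union>g \<in> G. coset C I (f \<otimes>\<^bsub>C\<^esub> g)),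
     dual = dual C,
     evl = (\<lambda>A. coset C I (evl C A)),
     coevl = (\<lambda>A. coset C I (coevl C A))\<rparr>"


section \<open>Plane diagrams up to isotopy\<close>

text \<open>
  A plane diagram in generic position with respect to the height function is a word in
  elementary pieces. Strands carry decorations of type \<open>'s\<close> (an orientation, possibly with
  an edge label); \<open>opp\<close> reverses the orientation. Nodes of type \<open>'v\<close> are the vertices of
  the diagram; each kind is listed in one standard position and all others are obtained by
  turning it with cups and caps. \<open>Cup s\<close> is \<open>\<emptyset> \<rightarrow> s s*\<close> and \<open>Cap s\<close> is \<open>s s* \<rightarrow> \<emptyset>\<close>;
  \<open>Stack g f\<close> puts \<open>g\<close> on top of \<open>f\<close>.
\<close>

record ('s, 'v) signature =
  opp :: "'s \<Rightarrow> 's"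
  node_src :: "'v \<Rightarrow> 's list"
  node_tgt :: "'v \<Rightarrow> 's list"

datatype ('s, 'v) diagram =
    Strands "'s list"
  | Cup 's
  | Cap 's
  | Node 'v
  | Stack "('s, 'v) diagram" "('s, 'v) diagram"
  | Beside "('s, 'v) diagram" "('s, 'v) diagram"

primrec src :: "('s, 'v) signature \<Rightarrow> ('s, 'v) diagram \<Rightarrow> 's list" where
  "src \<Sigma> (Strands w) = w"
| "src \<Sigma> (Cup s) = []"
| "src \<Sigma> (Cap s) = [s, opp \<Sigma> s]"
| "src \<Sigma> (Node v) = node_src \<Sigma> v"
| "src \<Sigma> (Stack g f) = src \<Sigma> f"
| "src \<Sigma> (Beside f g) = src \<Sigma> f @ src \<Sigma> g"

primrec tgt :: "('s, 'v) signature \<Rightarrow> ('s, 'v) diagram \<Rightarrow> 's list" where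
  "tgt \<Sigma> (Strands w) = w"
| "tgt \<Sigma> (Cup s) = [s, opp \<Sigma> s]"
| "tgt \<Sigma> (Cap s) = []"
| "tgt \<Sigma> (Node v) = node_tgt \<Sigma> v"
| "tgt \<Sigma> (Stack g f) = tgt \<Sigma> g"
| "tgt \<Sigma> (Beside f g) = tgt \<Sigma> f @ tgt \<Sigma> g"

primrec wf_diagram :: "('s, 'v) signature \<Rightarrow> ('s, 'v) diagram \<Rightarrow> bool" where
  "wf_diagram \<Sigma> (Strands w) = True"
| "wf_diagram \<Sigma> (Cup s) = True"
| "wf_diagram \<Sigma> (Cap s) = True"
| "wf_diagram \<Sigma> (Node v) = True"
| "wf_diagram \<Sigma> (Stack g f) = (wf_diagram \<Sigma> g \<and> wf_diagram \<Sigma> f \<and> src \<Sigma> g = tgt \<Sigma> f)"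
| "wf_diagram \<Sigma> (Beside f g) = (wf_diagram \<Sigma> f \<and> wf_diagram \<Sigma> g)"

definition dual_word :: "('s, 'v) signature \<Rightarrow> 's list \<Rightarrow> 's list" where
  "dual_word \<Sigma> w = rev (map (opp \<Sigma>) w)"

primrec cups :: "('s, 'v) signature \<Rightarrow> 's list \<Rightarrow> ('s, 'v) diagram" where
  "cups \<Sigma> [] = Strands []"
| "cups \<Sigma> (s # w) =
     Stack (Beside (Strands [s]) (Beside (cups \<Sigma> w) (Strands [opp \<Sigma> s]))) (Cup s)"

primrec caps :: "('s, 'v) signature \<Rightarrow> 's list \<Rightarrow> ('s, 'v) diagram" where
  "caps \<Sigma> [] = Strands []"
| "caps \<Sigma> (s # w) =
     Stack (Cap s) (Beside (Strands [s]) (Beside (caps \<Sigma> w) (Strands [opp \<Sigma> s])))"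

text \<open>A diagram \<open>A \<rightarrow> B\<close> rotated by half a turn, in either direction, is a diagram \<open>B* \<rightarrow> A*\<close>.\<close>

definition turn_right :: "('s, 'v) signature \<Rightarrow> ('s, 'v) diagram \<Rightarrow> ('s, 'v) diagram" where
  "turn_right \<Sigma> d =
    (let A' = dual_word \<Sigma> (src \<Sigma> d); B' = dual_word \<Sigma> (tgt \<Sigma> d) in
     Stack (Beside (Strands A') (caps \<Sigma> (tgt \<Sigma> d)))
       (Stack (Beside (Strands A') (Beside d (Strands B')))
          (Beside (cups \<Sigma> A') (Strands B'))))"

definition turn_left :: "('s, 'v) signature \<Rightarrow> ('s, 'v) diagram \<Rightarrow> ('s, 'v) diagram" where
  "turn_left \<Sigma> d =
    (let A' = dual_word \<Sigma> (src \<Sigma> d); B' = dual_word \<Sigma> (tgt \<Sigma> d) in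
     Stack (Beside (caps \<Sigma> B') (Strands A'))
       (Stack (Beside (Strands B') (Beside d (Strands A')))
          (Beside (Strands B') (cups \<Sigma> (src \<Sigma> d)))))"

text \<open>
  Plane isotopy of diagrams: height exchange of distant pieces (with the bookkeeping laws of
  stacking and juxtaposition), cancellation of a maximum with an adjacent minimum, and invariance
  of a vertex under a full turn.
\<close>

inductive isotopic :: "('s, 'v) signature \<Rightarrow> ('s, 'v) diagram \<Rightarrow> ('s, 'v) diagram \<Rightarrow> bool"
  for \<Sigma> :: "('s, 'v) signature" where
  iso_refl: "wf_diagram \<Sigma> d \<Longrightarrow> isotopic \<Sigma> d d"
| iso_sym: "isotopic \<Sigma> d e \<Longrightarrow> isotopic \<Sigma> e d"
| iso_trans: "\<lbrakk>isotopic \<Sigma> d e; isotopic \<Sigma> e f\<rbrakk> \<Longrightarrow> isotopic \<Sigma> d f"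
| iso_Stack: "\<lbrakk>isotopic \<Sigma> g g'; isotopic \<Sigma> f f'; src \<Sigma> g = tgt \<Sigma> f\<rbrakk> \<Longrightarrow>
    isotopic \<Sigma> (Stack g f) (Stack g' f')"
| iso_Beside: "\<lbrakk>isotopic \<Sigma> f f'; isotopic \<Sigma> g g'\<rbrakk> \<Longrightarrow> isotopic \<Sigma> (Beside f g) (Beside f' g')"
| iso_Stack_assoc: "wf_diagram \<Sigma> (Stack h (Stack g f)) \<Longrightarrow>
    isotopic \<Sigma> (Stack (Stack h g) f) (Stack h (Stack g f))"
| iso_Stack_left: "wf_diagram \<Sigma> f \<Longrightarrow> isotopic \<Sigma> (Stack (Strands (tgt \<Sigma> f)) f) f"
| iso_Stack_right: "wf_diagram \<Sigma> f \<Longrightarrow> isotopic \<Sigma> (Stack f (Strands (src \<Sigma> f))) f"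
| iso_Beside_assoc: "\<lbrakk>wf_diagram \<Sigma> f; wf_diagram \<Sigma> g; wf_diagram \<Sigma> h\<rbrakk> \<Longrightarrow>
    isotopic \<Sigma> (Beside (Beside f g) h) (Beside f (Beside g h))"
| iso_Beside_left: "wf_diagram \<Sigma> f \<Longrightarrow> isotopic \<Sigma> (Beside (Strands []) f) f"
| iso_Beside_right: "wf_diagram \<Sigma> f \<Longrightarrow> isotopic \<Sigma> (Beside f (Strands [])) f"
| iso_Strands: "isotopic \<Sigma> (Beside (Strands v) (Strands w)) (Strands (v @ w))"
| iso_interchange: "\<lbrakk>wf_diagram \<Sigma> (Stack g f); wf_diagram \<Sigma> (Stack g' f')\<rbrakk> \<Longrightarrow>
    isotopic \<Sigma> (Stack (Beside g g') (Beside f f')) (Beside (Stack g f) (Stack g' f'))"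
| iso_zigzag_left: "isotopic \<Sigma>
    (Stack (Beside (Cap s) (Strands [s])) (Beside (Strands [s]) (Cup (opp \<Sigma> s)))) (Strands [s])"
| iso_zigzag_right: "isotopic \<Sigma>
    (Stack (Beside (Strands [s]) (Cap (opp \<Sigma> s))) (Beside (Cup s) (Strands [s]))) (Strands [s])"
| iso_turn: "isotopic \<Sigma> (turn_right \<Sigma> (Node v)) (turn_left \<Sigma> (Node v))"

definition isotopy_class :: "('s, 'v) signature \<Rightarrow> ('s, 'v) diagram \<Rightarrow> ('s, 'v) diagram set" where
  "isotopy_class \<Sigma> d = {e. isotopic \<Sigma> d e}"

definition class_stack ::
    "('s, 'v) signature \<Rightarrow> ('s, 'v) diagram set \<Rightarrow> ('s, 'v) diagram set \<Rightarrow> ('s, 'v) diagram set" where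
  "class_stack \<Sigma> X Y = (\<Union>g \<in> X. \<Union>f \<in> Y. isotopy_class \<Sigma> (Stack g f))"

definition class_beside ::
    "('s, 'v) signature \<Rightarrow> ('s, 'v) diagram set \<Rightarrow> ('s, 'v) diagram set \<Rightarrow> ('s, 'v) diagram set" where
  "class_beside \<Sigma> X Y = (\<Union>f \<in> X. \<Union>g \<in> Y. isotopy_class \<Sigma> (Beside f g))"

definition bilinear_ext ::
    "('a \<Rightarrow> 'b \<Rightarrow> 'c) \<Rightarrow> ('a \<Rightarrow>\<^sub>0 'r) \<Rightarrow> ('b \<Rightarrow>\<^sub>0 'r) \<Rightarrow> ('c \<Rightarrow>\<^sub>0 'r::{comm_ring, comm_monoid_mult})" where
  "bilinear_ext m p q =
    (\<Sum>a \<in> Poly_Mapping.keys p. \<Sum>b \<in> Poly_Mapping.keys q.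
       Poly_Mapping.single (m a b) (Poly_Mapping.lookup p a * Poly_Mapping.lookup q b))"

text \<open>
  A morphism is a triple of source, target and a finite formal linear combination of isotopy classes.
  The set \<open>obs\<close> and the set \<open>ds\<close> select the admissible objects and diagrams.
\<close>

type_synonym ('s, 'v, 'r) diag_mor = "'s list \<times> 's list \<times> (('s, 'v) diagram set \<Rightarrow>\<^sub>0 'r)"

definition of_diagram ::
    "('s, 'v) signature \<Rightarrow> ('s, 'v) diagram \<Rightarrow> ('s, 'v, 'r::{comm_ring, comm_monoid_mult}) diag_mor" where
  "of_diagram \<Sigma> d = (src \<Sigma> d, tgt \<Sigma> d, Poly_Mapping.single (isotopy_class \<Sigma> d) 1)"

definition diagram_cat ::
    "('s, 'v) signature \<Rightarrow> 's list set \<Rightarrow> ('s, 'v) diagram set \<Rightarrow>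
      ('s list, ('s, 'v, 'r::{comm_ring, comm_monoid_mult}) diag_mor, 'r) rigid_cat" where
  "diagram_cat \<Sigma> obs ds = \<lparr>
     Obj = obs,
     Mor = {(A, B, p). A \<in> obs \<and> B \<in> obs \<and>
       Poly_Mapping.keys p \<subseteq> {isotopy_class \<Sigma> d | d. d \<in> ds \<and> src \<Sigma> d = A \<and> tgt \<Sigma> d = B}},
     Src = (\<lambda>(A, B, p). A),
     Tgt = (\<lambda>(A, B, p). B),
     ide = (\<lambda>A. of_diagram \<Sigma> (Strands A)),
     comp = (\<lambda>(_, D, q) (A, _, p). (A, D, bilinear_ext (class_stack \<Sigma>) q p)),
     zero = (\<lambda>A B. (A, B, 0)),
     add = (\<lambda>(A, B, p) (_, _, q). (A, B, p + q)),
     scale = (\<lambda>r (A, B, p). (A, B, Poly_Mapping.map ((*) r) p)),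
     unit_ob = [],
     tensor_ob = (@),
     tensor = (\<lambda>(A, B, p) (A', B', q). (A @ A', B @ B', bilinear_ext (class_beside \<Sigma>) p q)),
     dual = dual_word \<Sigma>,
     evl = (\<lambda>A. of_diagram \<Sigma> (caps \<Sigma> A)),
     coevl = (\<lambda>A. of_diagram \<Sigma> (cups \<Sigma> A))\<rparr>"


section \<open>Crossings of oriented strands\<close>

datatype ori = Up | Down

fun reverse :: "ori \<Rightarrow> ori" where
  "reverse Up = Down"
| "reverse Down = Up"

text \<open>
  Let \<open>e\<close> embed the orientations into the strand decorations, and let \<open>p\<close>, \<open>m\<close> be morphisms
  playing the roles of the crossings of two upward strands with over-strand of positive and
  of negative slope. Then \<open>crossing C e p m over a b : a b \<rightarrow> b a\<close> is the crossing of strands with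
  orientations \<open>a\<close> and \<open>b\<close> at the bottom in which the strand starting at the bottom left is the
  over-strand iff \<open>over\<close> holds. A quarter turn exchanges positive and negative slopes,
  a half turn does not.
\<close>

definition crossing ::
    "('s list, 'm, 'r, 'x) rigid_cat_scheme \<Rightarrow> (ori \<Rightarrow> 's) \<Rightarrow> 'm \<Rightarrow> 'm \<Rightarrow> bool \<Rightarrow> ori \<Rightarrow> ori \<Rightarrow> 'm" where
  "crossing C e p m over a b =
    (let x = (if over then p else m); y = (if over then m else p); u = e Up; d = e Down in
     case (a, b) of
       (Up, Up) \<Rightarrow> x
     | (Down, Up) \<Rightarrow>
         (evl C [d] \<otimes>\<^bsub>C\<^esub> ide C [u, d]) \<cdot>\<^bsub>C\<^esub> (ide C [d] \<otimes>\<^bsub>C\<^esub> y \<otimes>\<^bsub>C\<^esub> ide C [d]) \<cdot>\<^bsub>C\<^esub>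
         (ide C [d, u] \<otimes>\<^bsub>C\<^esub> coevl C [u])
     | (Up, Down) \<Rightarrow>
         (ide C [d, u] \<otimes>\<^bsub>C\<^esub> evl C [u]) \<cdot>\<^bsub>C\<^esub> (ide C [d] \<otimes>\<^bsub>C\<^esub> y \<otimes>\<^bsub>C\<^esub> ide C [d]) \<cdot>\<^bsub>C\<^esub>
         (coevl C [d] \<otimes>\<^bsub>C\<^esub> ide C [u, d])
     | (Down, Down) \<Rightarrow> mate C x)"

text \<open>
  The braiding of words determined by the crossings \<open>x s t : s t \<rightarrow> t s\<close> of single strands:
  all strands of the left word pass over all strands of the right word.
\<close>

primrec strand_over_word ::
    "('s list, 'm, 'r, 'x) rigid_cat_scheme \<Rightarrow> ('s \<Rightarrow> 's \<Rightarrow> 'm) \<Rightarrow> 's \<Rightarrow> 's list \<Rightarrow> 'm" where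
  "strand_over_word C x s [] = ide C [s]"
| "strand_over_word C x s (t # B) =
     (ide C [t] \<otimes>\<^bsub>C\<^esub> strand_over_word C x s B) \<cdot>\<^bsub>C\<^esub> (x s t \<otimes>\<^bsub>C\<^esub> ide C B)"

primrec word_over_word ::
    "('s list, 'm, 'r, 'x) rigid_cat_scheme \<Rightarrow> ('s \<Rightarrow> 's \<Rightarrow> 'm) \<Rightarrow> 's list \<Rightarrow> 's list \<Rightarrow> 'm" where
  "word_over_word C x [] B = ide C B"
| "word_over_word C x (s # A) B =
     (strand_over_word C x s B \<otimes>\<^bsub>C\<^esub> ide C A) \<cdot>\<^bsub>C\<^esub> (ide C [s] \<otimes>\<^bsub>C\<^esub> word_over_word C x A B)"

definition with_braiding ::
    "('s list, 'm, 'r) rigid_cat \<Rightarrow> ('s \<Rightarrow> 's \<Rightarrow> 'm) \<Rightarrow> 's set \<Rightarrow> ('s list, 'm, 'r) braided_cat" where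
  "with_braiding C x U =
    rigid_cat.extend C (braided_cat.fields (word_over_word C x) {[s] | s. s \<in> U})"


section \<open>Tangles and the HOMFLY-PT category\<close>

text \<open>\<open>Xp\<close> and \<open>Xm\<close>: over-strand from bottom left to top right, from bottom right to top left.\<close>

datatype xing = Xp | Xm

definition tangle_sig :: "(ori, xing) signature" where
  "tangle_sig = \<lparr>opp = reverse, node_src = (\<lambda>_. [Up, Up]), node_tgt = (\<lambda>_. [Up, Up])\<rparr>"

type_synonym 'r tangle_mor = "(ori, xing, 'r) diag_mor"

definition PTD :: "(ori list, 'r::{comm_ring, comm_monoid_mult} tangle_mor, 'r) rigid_cat" where
  "PTD = diagram_cat tangle_sig UNIV {d. wf_diagram tangle_sig d}"

definition tangle_crossing ::
    "bool \<Rightarrow> ori \<Rightarrow> ori \<Rightarrow> 'r::{comm_ring, comm_monoid_mult} tangle_mor" where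
  "tangle_crossing = crossing PTD (\<lambda>a. a)
     (of_diagram tangle_sig (Node Xp)) (of_diagram tangle_sig (Node Xm))"

definition reidemeister1 :: "'r::{comm_ring, comm_monoid_mult} tangle_mor set" where
  "reidemeister1 =
    (\<Union>a. \<Union>over.
      {right_curl PTD [a] (tangle_crossing over a a) \<ominus>\<^bsub>PTD\<^esub> ide PTD [a],
       left_curl PTD [a] (tangle_crossing over a a) \<ominus>\<^bsub>PTD\<^esub> ide PTD [a]})"

definition reidemeister2 :: "'r::{comm_ring, comm_monoid_mult} tangle_mor set" where
  "reidemeister2 =
    {(tangle_crossing (\<not> over) b a \<cdot>\<^bsub>PTD\<^esub> tangle_crossing over a b) \<ominus>\<^bsub>PTD\<^esub> ide PTD [a, b]
     | over a b. True}"

text \<open>The three strands lie at pairwise different heights \<open>i\<close>, \<open>j\<close>, \<open>k\<close>; the higher one passes over.\<close>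

definition reidemeister3 :: "'r::{comm_ring, comm_monoid_mult} tangle_mor set" where
  "reidemeister3 =
    {((tangle_crossing (j > k) b c \<otimes>\<^bsub>PTD\<^esub> ide PTD [a]) \<cdot>\<^bsub>PTD\<^esub>
      (ide PTD [b] \<otimes>\<^bsub>PTD\<^esub> tangle_crossing (i > k) a c) \<cdot>\<^bsub>PTD\<^esub>
      (tangle_crossing (i > j) a b \<otimes>\<^bsub>PTD\<^esub> ide PTD [c])) \<ominus>\<^bsub>PTD\<^esub>
     ((ide PTD [c] \<otimes>\<^bsub>PTD\<^esub> tangle_crossing (i > j) a b) \<cdot>\<^bsub>PTD\<^esub>
      (tangle_crossing (i > k) a c \<otimes>\<^bsub>PTD\<^esub> ide PTD [b]) \<cdot>\<^bsub>PTD\<^esub>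
      (ide PTD [a] \<otimes>\<^bsub>PTD\<^esub> tangle_crossing (j > k) b c))
     | a b c (i::nat) (j::nat) (k::nat). distinct [i, j, k]}"

definition TD_ideal :: "'r::{comm_ring, comm_monoid_mult} tangle_mor set" where
  "TD_ideal = ideal_generated PTD (reidemeister1 \<union> reidemeister2 \<union> reidemeister3)"

definition TD :: "(ori list, 'r::{comm_ring, comm_monoid_mult} tangle_mor set, 'r) rigid_cat" where
  "TD = quotient_cat PTD TD_ideal"

definition TD_xing :: "xing \<Rightarrow> 'r::{comm_ring, comm_monoid_mult} tangle_mor set" where
  "TD_xing v = coset PTD TD_ideal (of_diagram tangle_sig (Node v))"

text \<open>The inverse of a unit; unspecified on other elements.\<close>

definition uinv :: "'r::{comm_ring, comm_monoid_mult} \<Rightarrow> 'r" where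
  "uinv x = (THE y. x * y = 1)"

text \<open>The circle is taken with both orientations (they are isotopic as tangles).\<close>

definition HOMFLY_ideal ::
    "'r::{comm_ring, comm_monoid_mult} \<Rightarrow> 'r \<Rightarrow> 'r tangle_mor set set" where
  "HOMFLY_ideal \<alpha> z = ideal_generated TD
    ({(\<alpha> \<odot>\<^bsub>TD\<^esub> TD_xing Xp) \<ominus>\<^bsub>TD\<^esub> (uinv \<alpha> \<odot>\<^bsub>TD\<^esub> TD_xing Xm) \<ominus>\<^bsub>TD\<^esub> (z \<odot>\<^bsub>TD\<^esub> ide TD [Up, Up])} \<union>
     {(evl TD [a] \<cdot>\<^bsub>TD\<^esub> coevl TD [a]) \<ominus>\<^bsub>TD\<^esub> (((\<alpha> - uinv \<alpha>) * uinv z) \<odot>\<^bsub>TD\<^esub> ide TD []) | a. True})"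

definition HOMFLY_rigid ::
    "'r::{comm_ring, comm_monoid_mult} \<Rightarrow> 'r \<Rightarrow> (ori list, 'r tangle_mor set set, 'r) rigid_cat" where
  "HOMFLY_rigid \<alpha> z = quotient_cat TD (HOMFLY_ideal \<alpha> z)"

definition HOMFLY_xing ::
    "'r::{comm_ring, comm_monoid_mult} \<Rightarrow> 'r \<Rightarrow> xing \<Rightarrow> 'r tangle_mor set set" where
  "HOMFLY_xing \<alpha> z v = coset TD (HOMFLY_ideal \<alpha> z) (TD_xing v)"

definition HOMFLY ::
    "'r::{comm_ring, comm_monoid_mult} \<Rightarrow> 'r \<Rightarrow> (ori list, 'r tangle_mor set set, 'r) braided_cat" where
  "HOMFLY \<alpha> z = with_braiding (HOMFLY_rigid \<alpha> z)
     (crossing (HOMFLY_rigid \<alpha> z) (\<lambda>a. a) (HOMFLY_xing \<alpha> z Xp) (HOMFLY_xing \<alpha> z Xm) True) UNIV"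


section \<open>Trivalent graphs and the MOY category\<close>

datatype label = One | Two

type_synonym edge = "label \<times> ori"

datatype trivalent = Merge | Split

definition trivalent_sig :: "(edge, trivalent) signature" where
  "trivalent_sig = \<lparr>
     opp = (\<lambda>(l, a). (l, reverse a)),
     node_src = (\<lambda>v. case v of Merge \<Rightarrow> [(One, Up), (One, Up)] | Split \<Rightarrow> [(Two, Up)]),
     node_tgt = (\<lambda>v. case v of Merge \<Rightarrow> [(Two, Up)] | Split \<Rightarrow> [(One, Up), (One, Up)])\<rparr>"

definition S_graph :: "(edge, trivalent) diagram" where
  "S_graph = Stack (Node Split) (Node Merge)"

definition S_dual_graph :: "(edge, trivalent) diagram" where
  "S_dual_graph = turn_right trivalent_sig S_graph"

text \<open>
  Graphs with boundary labels 1, up to isotopy. Every edge labelled 2 joins two vertices: a closed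
  loop labelled 2 without vertices does not occur in them.
\<close>

inductive_set trivalent_graphs :: "(edge, trivalent) diagram set" where
  "fst ` set w \<subseteq> {One} \<Longrightarrow> Strands w \<in> trivalent_graphs"
| "Cup (One, a) \<in> trivalent_graphs"
| "Cap (One, a) \<in> trivalent_graphs"
| "S_graph \<in> trivalent_graphs"
| "S_dual_graph \<in> trivalent_graphs"
| "\<lbrakk>g \<in> trivalent_graphs; f \<in> trivalent_graphs; src trivalent_sig g = tgt trivalent_sig f\<rbrakk> \<Longrightarrow>
    Stack g f \<in> trivalent_graphs"
| "\<lbrakk>f \<in> trivalent_graphs; g \<in> trivalent_graphs\<rbrakk> \<Longrightarrow> Beside f g \<in> trivalent_graphs"

type_synonym 'r graph_mor = "(edge, trivalent, 'r) diag_mor"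

definition TrPD :: "(edge list, 'r::{comm_ring, comm_monoid_mult} graph_mor, 'r) rigid_cat" where
  "TrPD = diagram_cat trivalent_sig {w. fst ` set w \<subseteq> {One}} trivalent_graphs"

definition unit_power :: "'r::{comm_ring, comm_monoid_mult} \<Rightarrow> int \<Rightarrow> 'r" where
  "unit_power x k = (if k \<ge> 0 then x ^ nat k else uinv x ^ nat (- k))"

definition quantum_int :: "'r::{comm_ring, comm_monoid_mult} \<Rightarrow> 'r \<Rightarrow> int \<Rightarrow> int \<Rightarrow> 'r" where
  "quantum_int \<alpha> \<zeta> n k =
    (uinv \<alpha> * unit_power (- \<zeta>) (k - n) - \<alpha> * unit_power (- \<zeta>) (n - k)) * uinv (\<zeta> - uinv \<zeta>)"

context
  fixes C :: "(edge list, 'm, 'r::{comm_ring, comm_monoid_mult}, 'x) rigid_cat_scheme" (structure)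
    and S :: "ori \<Rightarrow> 'm"
    and \<alpha> \<zeta> :: 'r
    and n :: nat
begin

text \<open>
  \<open>S Up\<close> is \<open>S\<close> and \<open>S Down\<close> its dual; the instances for \<open>Down\<close> are the relations for \<open>Up\<close> with
  all orientations reversed. For \<open>a = Up\<close> the rightward evaluation is \<open>ev a\<close> and the leftward
  one is \<open>ev (reverse a)\<close>; similarly for coevaluations.
\<close>

definition MOY_relations :: "ori \<Rightarrow> 'm set" where
  "MOY_relations a =
    (let i = ide C [(One, a)]; i' = ide C [(One, reverse a)];
         ev = (\<lambda>a. evl C [(One, a)]); coev = (\<lambda>a. coevl C [(One, a)]);
         q = quantum_int \<alpha> \<zeta> (int n) in
     {(ev a \<cdot> coev a) \<ominus> (q (int n) \<odot> ide C []),
      (S a \<cdot> S a) \<ominus> ((- (\<zeta> + uinv \<zeta>)) \<odot> S a),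
      ((ev (reverse a) \<otimes> i) \<cdot> (i' \<otimes> S a) \<cdot> (coev (reverse a) \<otimes> i)) \<ominus> (q (int n - 1) \<odot> i),
      ((i \<otimes> ev a \<otimes> i') \<cdot> (S a \<otimes> S (reverse a)) \<cdot> (i \<otimes> coev a \<otimes> i')) \<ominus>
        ((coev a \<cdot> ev a) \<oplus> (q (int n - 2) \<odot> (i \<otimes> i'))),
      (((S a \<otimes> i) \<cdot> (i \<otimes> S a) \<cdot> (S a \<otimes> i)) \<oplus> (i \<otimes> S a)) \<ominus>
        (((i \<otimes> S a) \<cdot> (S a \<otimes> i) \<cdot> (i \<otimes> S a)) \<oplus> (S a \<otimes> i))})"

end

definition TrPD_S :: "ori \<Rightarrow> 'r::{comm_ring, comm_monoid_mult} graph_mor" where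
  "TrPD_S a = of_diagram trivalent_sig (case a of Up \<Rightarrow> S_graph | Down \<Rightarrow> S_dual_graph)"

definition MOY_ideal ::
    "'r::{comm_ring, comm_monoid_mult} \<Rightarrow> 'r \<Rightarrow> nat \<Rightarrow> 'r graph_mor set" where
  "MOY_ideal \<alpha> \<zeta> n = ideal_generated TrPD (\<Union>a. MOY_relations TrPD TrPD_S \<alpha> \<zeta> n a)"

definition MOY_rigid ::
    "'r::{comm_ring, comm_monoid_mult} \<Rightarrow> 'r \<Rightarrow> nat \<Rightarrow> (edge list, 'r graph_mor set, 'r) rigid_cat" where
  "MOY_rigid \<alpha> \<zeta> n = quotient_cat TrPD (MOY_ideal \<alpha> \<zeta> n)"

definition MOY_S :: "'r::{comm_ring, comm_monoid_mult} \<Rightarrow> 'r \<Rightarrow> nat \<Rightarrow> 'r graph_mor set" where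
  "MOY_S \<alpha> \<zeta> n = coset TrPD (MOY_ideal \<alpha> \<zeta> n) (TrPD_S Up)"

definition MOY_sigma ::
    "'r::{comm_ring, comm_monoid_mult} \<Rightarrow> 'r \<Rightarrow> nat \<Rightarrow> xing \<Rightarrow> 'r graph_mor set" where
  "MOY_sigma \<alpha> \<zeta> n v =
    (let C = MOY_rigid \<alpha> \<zeta> n; i = ide C [(One, Up), (One, Up)]; S = MOY_S \<alpha> \<zeta> n in
     case v of
       Xp \<Rightarrow> uinv \<alpha> \<odot>\<^bsub>C\<^esub> ((uinv \<zeta> \<odot>\<^bsub>C\<^esub> i) \<oplus>\<^bsub>C\<^esub> S)
     | Xm \<Rightarrow> \<alpha> \<odot>\<^bsub>C\<^esub> ((\<zeta> \<odot>\<^bsub>C\<^esub> i) \<oplus>\<^bsub>C\<^esub> S))"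

definition MOY ::
    "'r::{comm_ring, comm_monoid_mult} \<Rightarrow> 'r \<Rightarrow> nat \<Rightarrow> (edge list, 'r graph_mor set, 'r) braided_cat" where
  "MOY \<alpha> \<zeta> n = with_braiding (MOY_rigid \<alpha> \<zeta> n)
     (\<lambda>s t. crossing (MOY_rigid \<alpha> \<zeta> n) (Pair One) (MOY_sigma \<alpha> \<zeta> n Xp) (MOY_sigma \<alpha> \<zeta> n Xm) True
        (snd s) (snd t))
     {(One, Up), (One, Down)}"


section \<open>The functor\<close>

text \<open>That cups and caps go to cups and caps is part of \<open>rigid_monoidal_functor\<close>.\<close>

definition is_Z ::
    "'r::{comm_ring, comm_monoid_mult} \<Rightarrow> 'r \<Rightarrow> 'r \<Rightarrow> nat \<Rightarrow>
      (ori list, 'r tangle_mor set set, edge list, 'r graph_mor set) cat_map \<Rightarrow> bool" where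
  "is_Z \<alpha> z \<zeta> n Z \<longleftrightarrow>
    rigid_monoidal_functor (HOMFLY \<alpha> z) (MOY \<alpha> \<zeta> n) Z \<and>
    on_obj Z [Up] = [(One, Up)] \<and>
    (\<forall>v. on_mor Z (HOMFLY_xing \<alpha> z v) = MOY_sigma \<alpha> \<zeta> n v)"

end

theory Submission
  imports Defs
begin

text \<open>
  The skein relation and \<open>uinv \<zeta> - \<zeta> = z\<close> say that \<open>S = \<alpha> X\<^sub>+ - \<zeta>\<inverse> id = \<alpha>\<inverse> X\<^sub>- - \<zeta> id\<close>, so \<open>X\<^sub>\<plusminus>\<close> and
  \<open>S\<close> determine each other, and it remains to see that the Reidemeister moves and the MOY relations
  correspond. Expanding \<open>S\<close> in the crossings turns relation (2) into \<open>X\<^sub>+ X\<^sub>- = id\<close>, (3) into the first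
  move, (5) into the third move for \<open>X\<^sub>+\<close>, and (4) into the second move for antiparallel strands. All
  other oriented moves follow from these: a crossing of other orientations is a quarter turn of \<open>X\<^sub>\<plusminus>\<close>,
  and if a strand slides over a morphism, then it slides over every quarter turn and, when the
  morphism is invertible, over the inverse. The same sliding argument makes the braidings natural.
\<close>

section \<open>Arithmetic in the Hom-modules and the interchange law, in a form suited to
  rewriting\<close>

section \<open>Strict linear monoidal categories\<close>

text \<open>The first move and the antiparallel second move match their relations only once the
  values of the circle and of the partial trace of \<open>S\<close> are fixed. These values enter
  through three linear identities between [n], [n-1] and [n-2]: two say that the curls evaluate to
  1, the third cancels the cup-cap term of the antiparallel second move. The equivalences are
  therefore proved once, for an abstract pair of crossings expanded in some \<open>s\<close>, and
  applied twice: in the graph quotient the relations are known and give the moves, in the tangle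
  quotient the moves are known and give the relations. Both functors then descend from free diagram
  categories, and a rigid functor out of either quotient is determined by strands and very few
  generators, so the two composites are identities. The delicate point is the direction of turning.
  The graph relations close \<open>S\<close> on the left only; invariance of vertices under a full
  turn carries this to the right, makes the crossing of two downward strands consistent, and allows
  diagrams to be interpreted up to isotopy.\<close>

lemma HomI: "\<lbrakk>f \<in> Mor C; Src C f = A; Tgt C f = B\<rbrakk> \<Longrightarrow> f \<in> Hom C A B"
  by (simp add: Hom_def)

lemma HomD:
  assumes "f \<in> Hom C A B"
  shows "f \<in> Mor C" and "Src C f = A" and "Tgt C f = B"
  using assms by (auto simp: Hom_def)

context linear_monoidal_category
begin

abbreviation idm :: "'o \<Rightarrow> 'm" ("\<langle>_\<rangle>") where "\<langle>A\<rangle> \<equiv> ide C A"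

lemma Hom_self: "f \<in> Mor C \<Longrightarrow> f \<in> Hom C (Src C f) (Tgt C f)"
  by (rule HomI) simp_all

lemma Src_Obj [simp]: "f \<in> Mor C \<Longrightarrow> Src C f \<in> Obj C" by (rule Src_in)
lemma Tgt_Obj [simp]: "f \<in> Mor C \<Longrightarrow> Tgt C f \<in> Obj C" by (rule Tgt_in)
lemma unit_Obj [simp]: "unit_ob C \<in> Obj C" by (rule unit_in)
lemma tensor_Obj [simp]: "\<lbrakk>A \<in> Obj C; B \<in> Obj C\<rbrakk> \<Longrightarrow> tensor_ob C A B \<in> Obj C"
  by (rule tensor_ob_in)

lemma ide_Mor [simp]:
  assumes "A \<in> Obj C" shows "\<langle>A\<rangle> \<in> Mor C" "Src C \<langle>A\<rangle> = A" "Tgt C \<langle>A\<rangle> = A"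
  using HomD[OF ide_in[OF assms]] by auto

lemma zero_Mor [simp]:
  assumes "A \<in> Obj C" "B \<in> Obj C"
  shows "zero C A B \<in> Mor C" "Src C (zero C A B) = A" "Tgt C (zero C A B) = B"
  using HomD[OF zero_in[OF assms]] by auto

lemma comp_Mor [simp]:
  assumes "f \<in> Mor C" "g \<in> Mor C" "Src C g = Tgt C f"
  shows "g \<cdot> f \<in> Mor C" "Src C (g \<cdot> f) = Src C f" "Tgt C (g \<cdot> f) = Tgt C g"
  using HomD[OF comp_in[OF Hom_self[OF assms(1)], of g "Tgt C g"]] Hom_self[OF assms(2)] assms(3)
  by auto

lemma add_Mor [simp]:
  assumes "f \<in> Mor C" "g \<in> Mor C" "Src C f = Src C g" "Tgt C f = Tgt C g"
  shows "f \<oplus> g \<in> Mor C" "Src C (f \<oplus> g) = Src C g" "Tgt C (f \<oplus> g) = Tgt C g"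
  using HomD[OF add_in[of f "Src C g" "Tgt C g" g]] Hom_self[OF assms(1)] Hom_self[OF assms(2)]
    assms(3,4) by auto

lemma scale_Mor [simp]:
  assumes "f \<in> Mor C"
  shows "r \<odot> f \<in> Mor C" "Src C (r \<odot> f) = Src C f" "Tgt C (r \<odot> f) = Tgt C f"
  using HomD[OF scale_in[OF Hom_self[OF assms]]] by auto

lemma diff_Mor [simp]:
  assumes "f \<in> Mor C" "g \<in> Mor C" "Src C f = Src C g" "Tgt C f = Tgt C g"
  shows "f \<ominus> g \<in> Mor C" "Src C (f \<ominus> g) = Src C g" "Tgt C (f \<ominus> g) = Tgt C g"
  using assms by (simp_all add: diff_def)

lemma tensor_Mor [simp]:
  assumes "f \<in> Mor C" "g \<in> Mor C"
  shows "f \<otimes> g \<in> Mor C" "Src C (f \<otimes> g) = tensor_ob C (Src C f) (Src C g)"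
    "Tgt C (f \<otimes> g) = tensor_ob C (Tgt C f) (Tgt C g)"
  using HomD[OF tensor_in[OF Hom_self[OF assms(1)] Hom_self[OF assms(2)]]] by auto

lemma comp_assoc' [simp]:
  "\<lbrakk>f \<in> Mor C; g \<in> Mor C; h \<in> Mor C; Src C g = Tgt C f; Src C h = Tgt C g\<rbrakk> \<Longrightarrow>
    (h \<cdot> g) \<cdot> f = h \<cdot> (g \<cdot> f)"
  by (rule comp_assoc) (auto simp: Hom_def)

lemma tensor_assoc' [simp]:
  "\<lbrakk>f \<in> Mor C; g \<in> Mor C; h \<in> Mor C\<rbrakk> \<Longrightarrow> (f \<otimes> g) \<otimes> h = f \<otimes> (g \<otimes> h)"
  by (rule tensor_assoc)

lemma ide_comp [simp]: "\<lbrakk>f \<in> Mor C; Tgt C f = B\<rbrakk> \<Longrightarrow> \<langle>B\<rangle> \<cdot> f = f"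
  by (rule ide_left) (auto simp: Hom_def)

lemma comp_ide [simp]: "\<lbrakk>f \<in> Mor C; Src C f = A\<rbrakk> \<Longrightarrow> f \<cdot> \<langle>A\<rangle> = f"
  by (rule ide_right) (auto simp: Hom_def)

lemma interchange':
  "\<lbrakk>f \<in> Mor C; g \<in> Mor C; f' \<in> Mor C; g' \<in> Mor C; Src C g = Tgt C f; Src C g' = Tgt C f'\<rbrakk> \<Longrightarrow>
    (g \<otimes> g') \<cdot> (f \<otimes> f') = (g \<cdot> f) \<otimes> (g' \<cdot> f')"
  by (rule interchange) (auto simp: Hom_def)

lemma ide_tensor_comp:
  "\<lbrakk>A \<in> Obj C; f \<in> Mor C; g \<in> Mor C; Src C g = Tgt C f\<rbrakk> \<Longrightarrow> \<langle>A\<rangle> \<otimes> (g \<cdot> f) = (\<langle>A\<rangle> \<otimes> g) \<cdot> (\<langle>A\<rangle> \<otimes> f)"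
  by (simp add: interchange')

lemma comp_tensor_ide:
  "\<lbrakk>A \<in> Obj C; f \<in> Mor C; g \<in> Mor C; Src C g = Tgt C f\<rbrakk> \<Longrightarrow> (g \<cdot> f) \<otimes> \<langle>A\<rangle> = (g \<otimes> \<langle>A\<rangle>) \<cdot> (f \<otimes> \<langle>A\<rangle>)"
  by (simp add: interchange')

text \<open>Height exchange: two pieces standing side by side may be moved past each other. This is
  the planar move behind the diagram computations below.\<close>

lemma slide:
  "\<lbrakk>f \<in> Mor C; g \<in> Mor C; Src C f = A; Tgt C f = A'; Src C g = B; Tgt C g = B'\<rbrakk> \<Longrightarrow>
    (f \<otimes> \<langle>B'\<rangle>) \<cdot> (\<langle>A\<rangle> \<otimes> g) = (\<langle>A'\<rangle> \<otimes> g) \<cdot> (f \<otimes> \<langle>B\<rangle>)"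
  by (auto simp: interchange')

lemma tensor_split:
  "\<lbrakk>f \<in> Mor C; g \<in> Mor C\<rbrakk> \<Longrightarrow> f \<otimes> g = (f \<otimes> \<langle>Tgt C g\<rangle>) \<cdot> (\<langle>Src C f\<rangle> \<otimes> g)"
  by (simp add: interchange')

lemma tensor_split':
  "\<lbrakk>f \<in> Mor C; g \<in> Mor C\<rbrakk> \<Longrightarrow> f \<otimes> g = (\<langle>Tgt C f\<rangle> \<otimes> g) \<cdot> (f \<otimes> \<langle>Src C g\<rangle>)"
  by (simp add: interchange')

lemma add_comp:
  "\<lbrakk>f \<in> Mor C; g \<in> Mor C; h \<in> Mor C; Src C g = Src C h; Tgt C g = Tgt C h; Src C h = Tgt C f\<rbrakk> \<Longrightarrow>
    (g \<oplus> h) \<cdot> f = (g \<cdot> f) \<oplus> (h \<cdot> f)"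
  by (rule comp_add_left) (auto simp: Hom_def)

lemma comp_add:
  "\<lbrakk>f \<in> Mor C; g \<in> Mor C; h \<in> Mor C; Src C f = Src C g; Tgt C f = Tgt C g; Src C h = Tgt C g\<rbrakk> \<Longrightarrow>
    h \<cdot> (f \<oplus> g) = (h \<cdot> f) \<oplus> (h \<cdot> g)"
  by (rule comp_add_right) (auto simp: Hom_def)

lemma scale_comp:
  "\<lbrakk>f \<in> Mor C; g \<in> Mor C; Src C g = Tgt C f\<rbrakk> \<Longrightarrow> (r \<odot> g) \<cdot> f = r \<odot> (g \<cdot> f)"
  by (rule comp_scale_left) (auto simp: Hom_def)

lemma comp_scale:
  "\<lbrakk>f \<in> Mor C; g \<in> Mor C; Src C g = Tgt C f\<rbrakk> \<Longrightarrow> g \<cdot> (r \<odot> f) = r \<odot> (g \<cdot> f)"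
  by (rule comp_scale_right) (auto simp: Hom_def)

lemma add_tensor:
  "\<lbrakk>f \<in> Mor C; g \<in> Mor C; h \<in> Mor C; Src C f = Src C g; Tgt C f = Tgt C g\<rbrakk> \<Longrightarrow>
    (f \<oplus> g) \<otimes> h = (f \<otimes> h) \<oplus> (g \<otimes> h)"
  by (rule tensor_add_left) (auto simp: Hom_def)

lemma tensor_add:
  "\<lbrakk>f \<in> Mor C; g \<in> Mor C; h \<in> Mor C; Src C f = Src C g; Tgt C f = Tgt C g\<rbrakk> \<Longrightarrow>
    h \<otimes> (f \<oplus> g) = (h \<otimes> f) \<oplus> (h \<otimes> g)"
  by (rule tensor_add_right) (auto simp: Hom_def)

lemmas scale_tensor = tensor_scale_left
lemmas tensor_scale = tensor_scale_right

lemmas bilinear_simps = add_comp comp_add scale_comp comp_scale add_tensor tensor_add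
  scale_tensor tensor_scale

lemma scale_scale' [simp]: "f \<in> Mor C \<Longrightarrow> r \<odot> (s \<odot> f) = (r * s) \<odot> f"
  by (rule scale_scale[OF Hom_self])

lemma scale_one' [simp]: "f \<in> Mor C \<Longrightarrow> 1 \<odot> f = f"
  by (rule scale_one[OF Hom_self])

lemma scale_add: "f \<in> Mor C \<Longrightarrow> (r + s) \<odot> f = (r \<odot> f) \<oplus> (s \<odot> f)"
  by (rule scale_add_left[OF Hom_self])

lemma scale_sum:
  "\<lbrakk>f \<in> Mor C; g \<in> Mor C; Src C f = Src C g; Tgt C f = Tgt C g\<rbrakk> \<Longrightarrow> r \<odot> (f \<oplus> g) = (r \<odot> f) \<oplus> (r \<odot> g)"
  by (rule scale_add_right) (auto simp: Hom_def)

lemma add_assoc':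
  "\<lbrakk>f \<in> Mor C; g \<in> Mor C; h \<in> Mor C; Src C f = Src C g; Tgt C f = Tgt C g; Src C g = Src C h;
    Tgt C g = Tgt C h\<rbrakk> \<Longrightarrow> (f \<oplus> g) \<oplus> h = f \<oplus> (g \<oplus> h)"
  by (rule add_assoc) (auto simp: Hom_def)

lemma add_commute':
  "\<lbrakk>f \<in> Mor C; g \<in> Mor C; Src C f = Src C g; Tgt C f = Tgt C g\<rbrakk> \<Longrightarrow> f \<oplus> g = g \<oplus> f"
  by (rule add_commute) (auto simp: Hom_def)

lemma add_left_commute':
  "\<lbrakk>f \<in> Mor C; g \<in> Mor C; h \<in> Mor C; Src C f = Src C g; Tgt C f = Tgt C g; Src C g = Src C h;
    Tgt C g = Tgt C h\<rbrakk> \<Longrightarrow> f \<oplus> (g \<oplus> h) = g \<oplus> (f \<oplus> h)"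
  using add_assoc'[of f g h] add_assoc'[of g f h] add_commute'[of f g] by simp

lemmas add_ac = add_assoc' add_commute' add_left_commute'

lemma add_zero_right [simp]: "\<lbrakk>f \<in> Mor C; Src C f = A; Tgt C f = B\<rbrakk> \<Longrightarrow> f \<oplus> zero C A B = f"
  by (rule add_zero) (auto simp: Hom_def)

lemma add_zero_left [simp]: "\<lbrakk>f \<in> Mor C; Src C f = A; Tgt C f = B\<rbrakk> \<Longrightarrow> zero C A B \<oplus> f = f"
  using add_commute'[of "zero C A B" f] by auto

lemma diff_self [simp]: "\<lbrakk>f \<in> Mor C; Src C f = A; Tgt C f = B\<rbrakk> \<Longrightarrow> f \<ominus> f = zero C A B"
  by (rule add_inverse) (auto simp: Hom_def)

text \<open>Adding \<open>(- 1) \<odot> f\<close> undoes the addition of \<open>f\<close>; the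
  axioms provide negation only through this scalar.\<close>

lemma add_left_cancel:
  assumes "f \<in> Mor C" "g \<in> Mor C" "h \<in> Mor C" "Src C f = Src C g" "Tgt C f = Tgt C g"
    "Src C h = Src C g" "Tgt C h = Tgt C g" "f \<oplus> g = f \<oplus> h"
  shows "g = h"
proof -
  have "((- 1) \<odot> f) \<oplus> (f \<oplus> k) = k" if "k \<in> Mor C" "Src C k = Src C f" "Tgt C k = Tgt C f" for k
  proof -
    have "((- 1) \<odot> f) \<oplus> (f \<oplus> k) = (f \<ominus> f) \<oplus> k"
      using that assms by (simp add: diff_def add_ac)
    then show ?thesis using that assms by simp
  qed
  from this[of g] this[of h] show ?thesis using assms by metis
qed

text \<open>Reads 0 as 1 + (- 1), which reduces the claim to \<open>add_inverse\<close>.\<close>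

lemma scale_zero [simp]: "\<lbrakk>f \<in> Mor C; Src C f = A; Tgt C f = B\<rbrakk> \<Longrightarrow> 0 \<odot> f = zero C A B"
  using scale_add[of f 1 "- 1"] by (auto simp: diff_def[symmetric])

lemma diff_eq_zero:
  assumes "f \<in> Mor C" "g \<in> Mor C" "Src C f = A" "Tgt C f = B" "Src C g = A" "Tgt C g = B"
  shows "f \<ominus> g = zero C A B \<longleftrightarrow> f = g"
proof
  assume a: "f \<ominus> g = zero C A B"
  have *: "((- 1) \<odot> g) \<oplus> f = ((- 1) \<odot> g) \<oplus> g"
    using a assms diff_self[of g A B] add_commute'[of "(- 1) \<odot> g" f] add_commute'[of "(- 1) \<odot> g" g]
    by (simp add: diff_def)
  show "f = g" by (rule add_left_cancel[OF _ _ _ _ _ _ _ *]) (simp_all add: assms)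
qed (use assms in simp)

text \<open>The zero morphism is 0 times itself, and r * 0 = 0. The same trick gives the absorption
  laws for composition and tensor product that follow.\<close>

lemma scale_zero_Mor [simp]:
  assumes "A \<in> Obj C" "B \<in> Obj C" shows "r \<odot> zero C A B = zero C A B"
proof -
  have "r \<odot> zero C A B = r \<odot> (0 \<odot> zero C A B)" using assms by (subst scale_zero[of _ A B]) simp_all
  also have "\<dots> = zero C A B" using assms by (subst scale_scale') simp_all
  finally show ?thesis .
qed

lemma comp_zero [simp]: "\<lbrakk>A \<in> Obj C; g \<in> Mor C; Src C g = B\<rbrakk> \<Longrightarrow> g \<cdot> zero C A B = zero C A (Tgt C g)"
  using comp_scale[of "zero C A B" g 0] by auto

lemma zero_comp [simp]: "\<lbrakk>B \<in> Obj C; f \<in> Mor C; Tgt C f = A\<rbrakk> \<Longrightarrow> zero C A B \<cdot> f = zero C (Src C f) B"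
  using scale_comp[of f "zero C A B" 0] by auto

lemma tensor_zero [simp]:
  "\<lbrakk>A \<in> Obj C; B \<in> Obj C; f \<in> Mor C\<rbrakk> \<Longrightarrow>
    f \<otimes> zero C A B = zero C (tensor_ob C (Src C f) A) (tensor_ob C (Tgt C f) B)"
  using tensor_scale[of f "zero C A B" 0] by auto

lemma zero_tensor [simp]:
  "\<lbrakk>A \<in> Obj C; B \<in> Obj C; f \<in> Mor C\<rbrakk> \<Longrightarrow>
    zero C A B \<otimes> f = zero C (tensor_ob C A (Src C f)) (tensor_ob C B (Tgt C f))"
  using scale_tensor[of "zero C A B" f 0] by auto

end

section \<open>Duality on words obtained from duality on letters\<close>

section \<open>Categories of words\<close>

text \<open>The alphabet \<open>T\<close> is a parameter and not the whole type, because the objects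
  of the graph category use only edges labelled 1 while the type of edges also contains the label
  2.\<close>

locale word_monoidal = linear_monoidal_category C
  for C :: "('s list, 'm, 'r::{comm_ring, comm_monoid_mult}, 'x) rigid_cat_scheme" (structure) +
  fixes T :: "'s set"
  assumes Obj_words [simp]: "Obj C = lists T"
    and tensor_ob_words [simp]: "tensor_ob C = (@)"
    and unit_word [simp]: "unit_ob C = []"
begin

lemma ide_tensor_ide [simp]: "\<lbrakk>A \<in> lists T; B \<in> lists T\<rbrakk> \<Longrightarrow> \<langle>A\<rangle> \<otimes> \<langle>B\<rangle> = \<langle>A @ B\<rangle>"
  using tensor_ide by simp

lemma ide_tensor_ide_tensor [simp]:
  "\<lbrakk>A \<in> lists T; B \<in> lists T; f \<in> Mor C\<rbrakk> \<Longrightarrow> \<langle>A\<rangle> \<otimes> (\<langle>B\<rangle> \<otimes> f) = \<langle>A @ B\<rangle> \<otimes> f"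
  using tensor_assoc'[of "\<langle>A\<rangle>" "\<langle>B\<rangle>" f] by simp

lemma ide_Nil_tensor [simp]: "f \<in> Mor C \<Longrightarrow> \<langle>[]\<rangle> \<otimes> f = f"
  using tensor_unit_left by simp

lemma tensor_ide_Nil [simp]: "f \<in> Mor C \<Longrightarrow> f \<otimes> \<langle>[]\<rangle> = f"
  using tensor_unit_right by simp

lemma Src_lists [simp]: "f \<in> Mor C \<Longrightarrow> Src C f \<in> lists T"
  and Tgt_lists [simp]: "f \<in> Mor C \<Longrightarrow> Tgt C f \<in> lists T"
  using Src_Obj Tgt_Obj by auto

text \<open>\<open>slide\<close> with bystander strands \<open>U\<close>, \<open>V\<close>,
  \<open>W\<close> to the left, between and to the right. Later computations quote each exchange as
  an instance of it, with neighbouring identities already merged into one word.\<close>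

lemma slide_ctx:
  assumes "f \<in> Mor C" "g \<in> Mor C" "Src C f = A" "Tgt C f = A'" "Src C g = B" "Tgt C g = B'"
    "U \<in> lists T" "V \<in> lists T" "W \<in> lists T"
  shows "(\<langle>U\<rangle> \<otimes> f \<otimes> \<langle>V @ B' @ W\<rangle>) \<cdot> (\<langle>U @ A @ V\<rangle> \<otimes> g \<otimes> \<langle>W\<rangle>) =
    (\<langle>U @ A' @ V\<rangle> \<otimes> g \<otimes> \<langle>W\<rangle>) \<cdot> (\<langle>U\<rangle> \<otimes> f \<otimes> \<langle>V @ B @ W\<rangle>)"
proof -
  have obs: "A \<in> lists T" "A' \<in> lists T" "B \<in> lists T" "B' \<in> lists T" using assms(1-6) Src_lists Tgt_lists by blast+
  \<comment> \<open>The merged identities are split again into factors that fit the two pieces, so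
    that \<open>interchange'\<close> applies on both sides.\<close>
  have e: "\<langle>V @ B' @ W\<rangle> = \<langle>V\<rangle> \<otimes> \<langle>B'\<rangle> \<otimes> \<langle>W\<rangle>" "\<langle>U @ A @ V\<rangle> = \<langle>U\<rangle> \<otimes> \<langle>A\<rangle> \<otimes> \<langle>V\<rangle>"
    "\<langle>V @ B @ W\<rangle> = \<langle>V\<rangle> \<otimes> \<langle>B\<rangle> \<otimes> \<langle>W\<rangle>" "\<langle>U @ A' @ V\<rangle> = \<langle>U\<rangle> \<otimes> \<langle>A'\<rangle> \<otimes> \<langle>V\<rangle>"
    using assms obs by simp_all
  show ?thesis unfolding e using assms obs
    by (simp add: interchange' del: ide_tensor_ide ide_tensor_ide_tensor)
qed

end

text \<open>Duality is assumed for letters only. Caps and cups of words are nested arcs by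
  \<open>evl_Cons\<close> and \<open>coevl_Cons\<close>, and rigidity for all words is derived from
  this.\<close>

locale word_category = word_monoidal C T
  for C :: "('s list, 'm, 'r::{comm_ring, comm_monoid_mult}, 'x) rigid_cat_scheme" (structure)
    and T :: "'s set" +
  fixes bar :: "'s \<Rightarrow> 's"
  assumes dual_word: "dual C A = rev (map bar A)"
    and bar_in [simp]: "s \<in> T \<Longrightarrow> bar s \<in> T"
    and bar_bar [simp]: "s \<in> T \<Longrightarrow> bar (bar s) = s"
    and evl_Nil [simp]: "evl C [] = ide C []"
    and coevl_Nil [simp]: "coevl C [] = ide C []"
    and evl_Cons: "\<lbrakk>s \<in> T; A \<in> lists T\<rbrakk> \<Longrightarrow>
      evl C (s # A) = evl C [s] \<cdot> (ide C [s] \<otimes> evl C A \<otimes> ide C [bar s])"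
    and coevl_Cons: "\<lbrakk>s \<in> T; A \<in> lists T\<rbrakk> \<Longrightarrow>
      coevl C (s # A) = (ide C [s] \<otimes> coevl C A \<otimes> ide C [bar s]) \<cdot> coevl C [s]"
    and evl_strand: "s \<in> T \<Longrightarrow> evl C [s] \<in> Hom C [s, bar s] []"
    and coevl_strand: "s \<in> T \<Longrightarrow> coevl C [s] \<in> Hom C [] [s, bar s]"
    and strand_zigzag_left: "s \<in> T \<Longrightarrow> (evl C [s] \<otimes> ide C [s]) \<cdot> (ide C [s] \<otimes> coevl C [bar s]) = ide C [s]"
    and strand_zigzag_right: "s \<in> T \<Longrightarrow> (ide C [s] \<otimes> evl C [bar s]) \<cdot> (coevl C [s] \<otimes> ide C [s]) = ide C [s]"
begin

lemma dual_simps [simp]: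
  "dual C [] = []" "dual C (s # A) = dual C A @ [bar s]" "dual C (A @ B) = dual C B @ dual C A"
  by (simp_all add: dual_word)

lemma dual_lists [simp]: "A \<in> lists T \<Longrightarrow> dual C A \<in> lists T"
  by (auto simp: dual_word)

lemma dual_dual_word [simp]: "A \<in> lists T \<Longrightarrow> dual C (dual C A) = A"
  by (induction A) auto

lemma evl_Mor [simp]:
  assumes "A \<in> lists T"
  shows "evl C A \<in> Mor C" "Src C (evl C A) = A @ dual C A" "Tgt C (evl C A) = []"
  using assms
proof (induction A)
  case (Cons s A)
  { case 1 with Cons HomD[OF evl_strand, of s] show ?case by (subst evl_Cons) simp_all }
  { case 2 with Cons HomD[OF evl_strand, of s] show ?case by (subst evl_Cons) simp_all }
  { case 3 with Cons HomD[OF evl_strand, of s] show ?case by (subst evl_Cons) simp_all }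
qed simp_all

lemma coevl_Mor [simp]:
  assumes "A \<in> lists T"
  shows "coevl C A \<in> Mor C" "Src C (coevl C A) = []" "Tgt C (coevl C A) = A @ dual C A"
  using assms
proof (induction A)
  case (Cons s A)
  { case 1 with Cons HomD[OF coevl_strand, of s] show ?case by (subst coevl_Cons) simp_all }
  { case 2 with Cons HomD[OF coevl_strand, of s] show ?case by (subst coevl_Cons) simp_all }
  { case 3 with Cons HomD[OF coevl_strand, of s] show ?case by (subst coevl_Cons) simp_all }
qed simp_all

text \<open>The arcs of \<open>B\<close> lie nested inside those of \<open>A\<close>; the induction
  peels off the outermost arc.\<close>

lemma evl_append:
  assumes "A \<in> lists T" "B \<in> lists T"
  shows "evl C (A @ B) = evl C A \<cdot> (\<langle>A\<rangle> \<otimes> evl C B \<otimes> \<langle>dual C A\<rangle>)"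
  using assms
proof (induction A)
  case (Cons s A)
  then have s: "s \<in> T" "A \<in> lists T" "B \<in> lists T" by auto
  with Cons have "evl C ((s # A) @ B) = evl C [s] \<cdot> (\<langle>[s]\<rangle> \<otimes> (evl C A \<cdot> (\<langle>A\<rangle> \<otimes> evl C B \<otimes> \<langle>dual C A\<rangle>)) \<otimes> \<langle>[bar s]\<rangle>)"
    by (simp add: evl_Cons[of s "A @ B"])
  also have "\<dots> = (evl C [s] \<cdot> (\<langle>[s]\<rangle> \<otimes> evl C A \<otimes> \<langle>[bar s]\<rangle>)) \<cdot> (\<langle>s # A\<rangle> \<otimes> evl C B \<otimes> \<langle>dual C (s # A)\<rangle>)"
    using s by (simp add: ide_tensor_comp comp_tensor_ide)
  finally show ?case using s by (simp add: evl_Cons[of s A])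
qed simp

lemma coevl_append:
  assumes "A \<in> lists T" "B \<in> lists T"
  shows "coevl C (A @ B) = (\<langle>A\<rangle> \<otimes> coevl C B \<otimes> \<langle>dual C A\<rangle>) \<cdot> coevl C A"
  using assms
proof (induction A)
  case (Cons s A)
  then have s: "s \<in> T" "A \<in> lists T" "B \<in> lists T" by auto
  with Cons have "coevl C ((s # A) @ B) = (\<langle>[s]\<rangle> \<otimes> ((\<langle>A\<rangle> \<otimes> coevl C B \<otimes> \<langle>dual C A\<rangle>) \<cdot> coevl C A) \<otimes> \<langle>[bar s]\<rangle>) \<cdot> coevl C [s]"
    by (simp add: coevl_Cons[of s "A @ B"])
  also have "\<dots> = (\<langle>s # A\<rangle> \<otimes> coevl C B \<otimes> \<langle>dual C (s # A)\<rangle>) \<cdot> ((\<langle>[s]\<rangle> \<otimes> coevl C A \<otimes> \<langle>[bar s]\<rangle>) \<cdot> coevl C [s])"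
    using s by (simp add: ide_tensor_comp comp_tensor_ide)
  finally show ?case using s by (simp add: coevl_Cons[of s A])
qed simp

text \<open>The caps of the remaining word and the cup of the first letter are exchanged in height.
  After that the first letter is straightened by its own zigzag and the rest by the induction
  hypothesis.\<close>

lemma word_zigzag_left:
  "A \<in> lists T \<Longrightarrow> (evl C A \<otimes> \<langle>A\<rangle>) \<cdot> (\<langle>A\<rangle> \<otimes> coevl C (dual C A)) = \<langle>A\<rangle>"
proof (induction A)
  case (Cons s A)
  then have s: "s \<in> T" and A: "A \<in> lists T" by auto
  let ?A' = "dual C A"
  have sl: "(\<langle>[s]\<rangle> \<otimes> evl C A \<otimes> \<langle>bar s # s # A\<rangle>) \<cdot> (\<langle>s # A @ ?A'\<rangle> \<otimes> coevl C [bar s] \<otimes> \<langle>A\<rangle>) =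
    (\<langle>[s]\<rangle> \<otimes> coevl C [bar s] \<otimes> \<langle>A\<rangle>) \<cdot> (\<langle>[s]\<rangle> \<otimes> evl C A \<otimes> \<langle>A\<rangle>)"
    using slide_ctx[of "evl C A" "coevl C [bar s]" "A @ ?A'" "[]" "[]" "[bar s, s]" "[s]" "[]" A] s A
    by simp
  have "(evl C (s # A) \<otimes> \<langle>s # A\<rangle>) \<cdot> (\<langle>s # A\<rangle> \<otimes> coevl C (dual C (s # A))) =
    (evl C [s] \<otimes> \<langle>s # A\<rangle>) \<cdot> ((\<langle>[s]\<rangle> \<otimes> evl C A \<otimes> \<langle>bar s # s # A\<rangle>) \<cdot> (\<langle>s # A @ ?A'\<rangle> \<otimes> coevl C [bar s] \<otimes> \<langle>A\<rangle>)) \<cdot>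
      (\<langle>s # A\<rangle> \<otimes> coevl C ?A')"
    using s A by (simp add: evl_Cons[of s A] coevl_append comp_tensor_ide ide_tensor_comp)
  also have "\<dots> = ((evl C [s] \<otimes> \<langle>s # A\<rangle>) \<cdot> (\<langle>[s]\<rangle> \<otimes> coevl C [bar s] \<otimes> \<langle>A\<rangle>)) \<cdot>
      ((\<langle>[s]\<rangle> \<otimes> evl C A \<otimes> \<langle>A\<rangle>) \<cdot> (\<langle>s # A\<rangle> \<otimes> coevl C ?A'))"
    unfolding sl using s A by simp
  also have "(evl C [s] \<otimes> \<langle>s # A\<rangle>) \<cdot> (\<langle>[s]\<rangle> \<otimes> coevl C [bar s] \<otimes> \<langle>A\<rangle>) =
      ((evl C [s] \<otimes> \<langle>[s]\<rangle>) \<cdot> (\<langle>[s]\<rangle> \<otimes> coevl C [bar s])) \<otimes> \<langle>A\<rangle>"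
    using s A by (simp add: comp_tensor_ide del: tensor_assoc' ) simp
  also have "(\<langle>[s]\<rangle> \<otimes> evl C A \<otimes> \<langle>A\<rangle>) \<cdot> (\<langle>s # A\<rangle> \<otimes> coevl C ?A') =
      \<langle>[s]\<rangle> \<otimes> ((evl C A \<otimes> \<langle>A\<rangle>) \<cdot> (\<langle>A\<rangle> \<otimes> coevl C ?A'))"
    using s A by (simp add: ide_tensor_comp)
  finally show ?case using Cons.IH s A by (simp add: strand_zigzag_left)
qed simp

lemma word_zigzag_right:
  "A \<in> lists T \<Longrightarrow> (\<langle>A\<rangle> \<otimes> evl C (dual C A)) \<cdot> (coevl C A \<otimes> \<langle>A\<rangle>) = \<langle>A\<rangle>"
proof (induction A)
  case (Cons s A)
  then have s: "s \<in> T" and A: "A \<in> lists T" by auto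
  let ?A' = "dual C A"
  have sl: "(\<langle>s # A @ ?A'\<rangle> \<otimes> evl C [bar s] \<otimes> \<langle>A\<rangle>) \<cdot> (\<langle>[s]\<rangle> \<otimes> coevl C A \<otimes> \<langle>bar s # s # A\<rangle>) =
    (\<langle>[s]\<rangle> \<otimes> coevl C A \<otimes> \<langle>A\<rangle>) \<cdot> (\<langle>[s]\<rangle> \<otimes> evl C [bar s] \<otimes> \<langle>A\<rangle>)"
    using slide_ctx[of "coevl C A" "evl C [bar s]" "[]" "A @ ?A'" "[bar s, s]" "[]" "[s]" "[]" A] s A
    by simp
  have "(\<langle>s # A\<rangle> \<otimes> evl C (dual C (s # A))) \<cdot> (coevl C (s # A) \<otimes> \<langle>s # A\<rangle>) =
    (\<langle>s # A\<rangle> \<otimes> evl C ?A') \<cdot> ((\<langle>s # A @ ?A'\<rangle> \<otimes> evl C [bar s] \<otimes> \<langle>A\<rangle>) \<cdot> (\<langle>[s]\<rangle> \<otimes> coevl C A \<otimes> \<langle>bar s # s # A\<rangle>)) \<cdot>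
      (coevl C [s] \<otimes> \<langle>s # A\<rangle>)"
    using s A by (simp add: coevl_Cons[of s A] evl_append comp_tensor_ide ide_tensor_comp)
  also have "\<dots> = ((\<langle>s # A\<rangle> \<otimes> evl C ?A') \<cdot> (\<langle>[s]\<rangle> \<otimes> coevl C A \<otimes> \<langle>A\<rangle>)) \<cdot>
      ((\<langle>[s]\<rangle> \<otimes> evl C [bar s] \<otimes> \<langle>A\<rangle>) \<cdot> (coevl C [s] \<otimes> \<langle>s # A\<rangle>))"
    unfolding sl using s A by simp
  also have "(\<langle>[s]\<rangle> \<otimes> evl C [bar s] \<otimes> \<langle>A\<rangle>) \<cdot> (coevl C [s] \<otimes> \<langle>s # A\<rangle>) =
      ((\<langle>[s]\<rangle> \<otimes> evl C [bar s]) \<cdot> (coevl C [s] \<otimes> \<langle>[s]\<rangle>)) \<otimes> \<langle>A\<rangle>"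
    using s A by (simp add: comp_tensor_ide)
  also have "(\<langle>s # A\<rangle> \<otimes> evl C ?A') \<cdot> (\<langle>[s]\<rangle> \<otimes> coevl C A \<otimes> \<langle>A\<rangle>) =
      \<langle>[s]\<rangle> \<otimes> ((\<langle>A\<rangle> \<otimes> evl C ?A') \<cdot> (coevl C A \<otimes> \<langle>A\<rangle>))"
    using s A by (simp add: ide_tensor_comp)
  finally show ?case using Cons.IH s A by (simp add: strand_zigzag_right)
qed simp

sublocale rigid_category C
  by unfold_locales (simp_all add: word_zigzag_left word_zigzag_right Hom_def)

end

section \<open>Quotients by tensor ideals and their universal property\<close>

section \<open>Tensor ideals, quotients and functors\<close>

locale monoidal_quotient = linear_monoidal_category C
  for C :: "('o, 'm, 'r::{comm_ring, comm_monoid_mult}) rigid_cat" (structure) +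
  fixes I :: "'m set"
  assumes ideal: "tensor_ideal C I"
begin

abbreviation proj :: "'m \<Rightarrow> 'm set" ("\<pi>") where "\<pi> \<equiv> coset C I"

lemma ideal_Mor: "i \<in> I \<Longrightarrow> i \<in> Mor C"
  using ideal by (auto simp: tensor_ideal_def)

lemma ideal_closed:
  "\<lbrakk>A \<in> Obj C; B \<in> Obj C\<rbrakk> \<Longrightarrow> zero C A B \<in> I"
  "\<lbrakk>i \<in> I; j \<in> I; Src C i = Src C j; Tgt C i = Tgt C j\<rbrakk> \<Longrightarrow> i \<oplus> j \<in> I"
  "i \<in> I \<Longrightarrow> r \<odot> i \<in> I"
  "\<lbrakk>i \<in> I; g \<in> Mor C; Src C g = Tgt C i\<rbrakk> \<Longrightarrow> g \<cdot> i \<in> I"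
  "\<lbrakk>i \<in> I; g \<in> Mor C; Src C i = Tgt C g\<rbrakk> \<Longrightarrow> i \<cdot> g \<in> I"
  "\<lbrakk>i \<in> I; g \<in> Mor C\<rbrakk> \<Longrightarrow> i \<otimes> g \<in> I"
  "\<lbrakk>i \<in> I; g \<in> Mor C\<rbrakk> \<Longrightarrow> g \<otimes> i \<in> I"
  using ideal by (simp_all add: tensor_ideal_def)

lemma in_proj:
  "g \<in> \<pi> f \<longleftrightarrow> (\<exists>i \<in> I. Src C i = Src C f \<and> Tgt C i = Tgt C f \<and> g = f \<oplus> i)"
  by (auto simp: coset_def)

lemma projE:
  assumes "g \<in> \<pi> f" "f \<in> Mor C"
  obtains i where "i \<in> I" "i \<in> Mor C" "Src C i = Src C f" "Tgt C i = Tgt C f" "g = f \<oplus> i"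
    "g \<in> Mor C" "Src C g = Src C f" "Tgt C g = Tgt C f"
  using assms ideal_Mor by (auto simp: in_proj)

lemma proj_self: "f \<in> Mor C \<Longrightarrow> f \<in> \<pi> f"
  by (auto simp: in_proj intro!: bexI[of _ "zero C (Src C f) (Tgt C f)"] ideal_closed)

lemma proj_eqI:
  assumes "g \<in> \<pi> f" "f \<in> Mor C" shows "\<pi> g = \<pi> f"
proof -
  obtain i where i: "i \<in> I" "i \<in> Mor C" "Src C i = Src C f" "Tgt C i = Tgt C f" "g = f \<oplus> i"
    "g \<in> Mor C" "Src C g = Src C f" "Tgt C g = Tgt C f"
    using assms by (rule projE)
  have "h \<in> \<pi> f" if "h \<in> \<pi> g" for h
    using that i(6)
  proof (rule projE)
    fix j assume j: "j \<in> I" "j \<in> Mor C" "Src C j = Src C g" "Tgt C j = Tgt C g" "h = g \<oplus> j"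
    then have "h = f \<oplus> (i \<oplus> j)" using i assms by (simp add: add_assoc')
    then show ?thesis using i j by (auto simp: in_proj intro!: bexI[of _ "i \<oplus> j"] ideal_closed)
  qed
  moreover have "h \<in> \<pi> g" if "h \<in> \<pi> f" for h
    using that assms(2)
  proof (rule projE)
    fix j assume j: "j \<in> I" "j \<in> Mor C" "Src C j = Src C f" "Tgt C j = Tgt C f" "h = f \<oplus> j"
    \<comment> \<open>Inserting \<open>i - i\<close> rewrites \<open>f + j\<close> as
      \<open>g + (j - i)\<close>.\<close>
    have "h = (f \<oplus> (i \<ominus> i)) \<oplus> j" using j i assms by simp
    also have "\<dots> = (f \<oplus> i) \<oplus> ((- 1) \<odot> i \<oplus> j)"
      using j(2-4) i(2-4) assms by (simp add: diff_def add_assoc')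
    finally show ?thesis using i j
      by (auto simp: in_proj intro!: bexI[of _ "(- 1) \<odot> i \<oplus> j"] ideal_closed)
  qed
  ultimately show ?thesis by blast
qed

lemma proj_eq_iff:
  assumes "f \<in> Mor C" "g \<in> Mor C" "Src C f = Src C g" "Tgt C f = Tgt C g"
  shows "\<pi> f = \<pi> g \<longleftrightarrow> f \<ominus> g \<in> I"
proof
  assume "\<pi> f = \<pi> g"
  then have "f \<in> \<pi> g" using proj_self[OF assms(1)] by simp
  from this assms(2) show "f \<ominus> g \<in> I"
  proof (rule projE)
    fix i assume i: "i \<in> I" "i \<in> Mor C" "Src C i = Src C g" "Tgt C i = Tgt C g" "f = g \<oplus> i"
    have "f \<ominus> g = i \<oplus> (g \<ominus> g)" using assms i(2-4) unfolding i(5) diff_def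
      by (simp add: add_ac)
    then show "f \<ominus> g \<in> I" using i assms by simp
  qed
next
  assume "f \<ominus> g \<in> I"
  moreover have "f = g \<oplus> (f \<ominus> g)"
  proof -
    have "g \<oplus> (f \<ominus> g) = f \<oplus> (g \<ominus> g)" using assms by (simp add: diff_def add_left_commute')
    then show ?thesis using assms by simp
  qed
  ultimately have "f \<in> \<pi> g" using assms by (auto simp: in_proj intro!: bexI[of _ "f \<ominus> g"])
  then show "\<pi> f = \<pi> g" using assms by (rule_tac proj_eqI)
qed

text \<open>Quotient operations are defined as unions over all representatives. If every choice of
  representatives leads to the same coset, the union is constant and collapses, so each operation
  below needs only a computation of its error term.\<close>

lemma UN_proj_unary:
  assumes "f \<in> Mor C" "\<And>f'. f' \<in> \<pi> f \<Longrightarrow> h f' \<in> \<pi> (h f)" "h f \<in> Mor C"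
  shows "(\<Union>f' \<in> \<pi> f. \<pi> (h f')) = \<pi> (h f)"
  using assms proj_self[OF assms(1)] by (intro UN_constant_eq) (auto intro!: proj_eqI)

lemma UN_proj_binary:
  assumes "f \<in> Mor C" "g \<in> Mor C" "\<And>f' g'. \<lbrakk>f' \<in> \<pi> f; g' \<in> \<pi> g\<rbrakk> \<Longrightarrow> h f' g' \<in> \<pi> (h f g)" "h f g \<in> Mor C"
  shows "(\<Union>f' \<in> \<pi> f. \<Union>g' \<in> \<pi> g. \<pi> (h f' g')) = \<pi> (h f g)"
proof (rule UN_constant_eq[OF proj_self[OF assms(1)]], intro ballI)
  fix f' assume f': "f' \<in> \<pi> f"
  show "(\<Union>g' \<in> \<pi> g. \<pi> (h f' g')) = \<pi> (h f g)"
    using proj_self[OF assms(2)] by (rule UN_constant_eq) (use f' assms(3,4) in \<open>simp add: proj_eqI\<close>)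
qed

abbreviation Q :: "('o, 'm set, 'r) rigid_cat" where "Q \<equiv> quotient_cat C I"

lemma Q_fields [simp]: "Obj Q = Obj C" "Mor Q = \<pi> ` Mor C" "ide Q A = \<pi> (ide C A)"
  "zero Q A B = \<pi> (zero C A B)" "unit_ob Q = unit_ob C" "tensor_ob Q = tensor_ob C"
  "dual Q = dual C" "evl Q A = \<pi> (evl C A)" "coevl Q A = \<pi> (coevl C A)"
  by (simp_all add: quotient_cat_def)

text \<open>The chosen representative differs from \<open>f\<close> by an element of the ideal with
  the same ends, so the choice does not affect source and target.\<close>

lemma Q_Src_Tgt [simp]:
  assumes "f \<in> Mor C" shows "Src Q (\<pi> f) = Src C f" "Tgt Q (\<pi> f) = Tgt C f"
proof -
  have "(SOME f'. f' \<in> \<pi> f) \<in> \<pi> f" using proj_self[OF assms] by (rule someI)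
  then have "Src C (SOME f'. f' \<in> \<pi> f) = Src C f" "Tgt C (SOME f'. f' \<in> \<pi> f) = Tgt C f"
    using assms by (auto elim: projE)
  then show "Src Q (\<pi> f) = Src C f" "Tgt Q (\<pi> f) = Tgt C f" by (simp_all add: quotient_cat_def)
qed

text \<open>The error in composing \<open>g + j\<close> with \<open>f + i\<close> is
  \<open>j f + g i + j i\<close>, and all three terms lie in the two-sided ideal.\<close>

lemma Q_comp [simp]:
  assumes "f \<in> Mor C" "g \<in> Mor C" "Src C g = Tgt C f"
  shows "\<pi> g \<cdot>\<^bsub>Q\<^esub> \<pi> f = \<pi> (g \<cdot> f)"
proof -
  have "(\<Union>g' \<in> \<pi> g. \<Union>f' \<in> \<pi> f. \<pi> (g' \<cdot> f')) = \<pi> (g \<cdot> f)"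
  proof (rule UN_proj_binary)
    fix f' g' assume "f' \<in> \<pi> f" "g' \<in> \<pi> g"
    then obtain i j where i: "i \<in> I" "i \<in> Mor C" "Src C i = Src C f" "Tgt C i = Tgt C f" "f' = f \<oplus> i"
      and j: "j \<in> I" "j \<in> Mor C" "Src C j = Src C g" "Tgt C j = Tgt C g" "g' = g \<oplus> j"
      using assms by (metis projE)
    have "g' \<cdot> f' = (g \<cdot> f) \<oplus> (j \<cdot> f \<oplus> (g \<cdot> i \<oplus> j \<cdot> i))"
      using i(2-5) j(2-5) assms by (simp add: add_comp comp_add add_assoc')
    then show "g' \<cdot> f' \<in> \<pi> (g \<cdot> f)"
      using i j assms by (auto simp: in_proj ideal_closed intro!: bexI[of _ "j \<cdot> f \<oplus> (g \<cdot> i \<oplus> j \<cdot> i)"])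
  qed (use assms in auto)
  then show ?thesis by (simp add: quotient_cat_def)
qed

lemma Q_tensor [simp]:
  assumes "f \<in> Mor C" "g \<in> Mor C"
  shows "\<pi> f \<otimes>\<^bsub>Q\<^esub> \<pi> g = \<pi> (f \<otimes> g)"
proof -
  have "(\<Union>f' \<in> \<pi> f. \<Union>g' \<in> \<pi> g. \<pi> (f' \<otimes> g')) = \<pi> (f \<otimes> g)"
  proof (rule UN_proj_binary)
    fix f' g' assume "f' \<in> \<pi> f" "g' \<in> \<pi> g"
    then obtain i j where i: "i \<in> I" "i \<in> Mor C" "Src C i = Src C f" "Tgt C i = Tgt C f" "f' = f \<oplus> i"
      and j: "j \<in> I" "j \<in> Mor C" "Src C j = Src C g" "Tgt C j = Tgt C g" "g' = g \<oplus> j"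
      using assms by (metis projE)
    have "f' \<otimes> g' = (f \<otimes> g) \<oplus> (i \<otimes> g \<oplus> (f \<otimes> j \<oplus> i \<otimes> j))"
      using i(2-5) j(2-5) assms by (simp add: add_tensor tensor_add add_assoc')
    then show "f' \<otimes> g' \<in> \<pi> (f \<otimes> g)"
      using i j assms by (auto simp: in_proj ideal_closed intro!: bexI[of _ "i \<otimes> g \<oplus> (f \<otimes> j \<oplus> i \<otimes> j)"])
  qed (use assms in auto)
  then show ?thesis by (simp add: quotient_cat_def)
qed

lemma Q_add [simp]:
  assumes "f \<in> Mor C" "g \<in> Mor C" "Src C f = Src C g" "Tgt C f = Tgt C g"
  shows "\<pi> f \<oplus>\<^bsub>Q\<^esub> \<pi> g = \<pi> (f \<oplus> g)"
proof -
  have "(\<Union>f' \<in> \<pi> f. \<Union>g' \<in> \<pi> g. \<pi> (f' \<oplus> g')) = \<pi> (f \<oplus> g)"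
  proof (rule UN_proj_binary)
    fix f' g' assume "f' \<in> \<pi> f" "g' \<in> \<pi> g"
    then obtain i j where i: "i \<in> I" "i \<in> Mor C" "Src C i = Src C f" "Tgt C i = Tgt C f" "f' = f \<oplus> i"
      and j: "j \<in> I" "j \<in> Mor C" "Src C j = Src C g" "Tgt C j = Tgt C g" "g' = g \<oplus> j"
      using assms by (metis projE)
    have "f' \<oplus> g' = (f \<oplus> g) \<oplus> (i \<oplus> j)"
      using i(2-5) j(2-5) assms by (simp add: add_assoc' add_left_commute')
    then show "f' \<oplus> g' \<in> \<pi> (f \<oplus> g)"
      using i j assms by (auto simp: in_proj intro!: ideal_closed bexI[of _ "i \<oplus> j"])
  qed (use assms in auto)
  then show ?thesis by (simp add: quotient_cat_def)
qed

lemma Q_scale [simp]: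
  assumes "f \<in> Mor C"
  shows "r \<odot>\<^bsub>Q\<^esub> \<pi> f = \<pi> (r \<odot> f)"
proof -
  have "(\<Union>f' \<in> \<pi> f. \<pi> (r \<odot> f')) = \<pi> (r \<odot> f)"
  proof (rule UN_proj_unary)
    fix f' assume "f' \<in> \<pi> f"
    then obtain i where i: "i \<in> I" "i \<in> Mor C" "Src C i = Src C f" "Tgt C i = Tgt C f" "f' = f \<oplus> i"
      using assms by (metis projE)
    have "r \<odot> f' = (r \<odot> f) \<oplus> (r \<odot> i)" using i assms by (simp add: scale_sum)
    then show "r \<odot> f' \<in> \<pi> (r \<odot> f)"
      using i assms by (auto simp: in_proj intro!: ideal_closed bexI[of _ "r \<odot> i"])
  qed (use assms in auto)
  then show ?thesis by (simp add: quotient_cat_def)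
qed

lemma Q_diff [simp]:
  "\<lbrakk>f \<in> Mor C; g \<in> Mor C; Src C f = Src C g; Tgt C f = Tgt C g\<rbrakk> \<Longrightarrow> \<pi> f \<ominus>\<^bsub>Q\<^esub> \<pi> g = \<pi> (f \<ominus> g)"
  by (simp add: diff_def)

lemma Hom_Q: "F \<in> Hom Q A B \<longleftrightarrow> (\<exists>f \<in> Mor C. F = \<pi> f \<and> Src C f = A \<and> Tgt C f = B)"
  by (auto simp: Hom_def)

lemma linear_monoidal_Q: "linear_monoidal_category Q"
proof (unfold_locales, unfold Hom_Q Q_fields, goal_cases)
qed (auto simp: add_comp comp_add scale_comp comp_scale add_tensor tensor_add
  scale_tensor tensor_scale scale_add scale_sum add_assoc' interchange' tensor_ob_assoc
  tensor_ob_unit_left tensor_ob_unit_right tensor_unit_left tensor_unit_right tensor_ide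
  add_commute' add_left_commute')

end

text \<open>Since \<open>G\<close> consists of morphisms, \<open>Mor C\<close> is one of the ideals
  being intersected; this keeps the intersection inside \<open>Mor C\<close>.\<close>

lemma tensor_ideal_generated:
  assumes "linear_monoidal_category C" "G \<subseteq> Mor C"
  shows "tensor_ideal C (ideal_generated C G)"
proof -
  interpret linear_monoidal_category C by fact
  have "tensor_ideal C (Mor C)" by (simp add: tensor_ideal_def)
  then have "ideal_generated C G \<subseteq> Mor C" using assms(2) by (auto simp: ideal_generated_def)
  then show ?thesis unfolding tensor_ideal_def[of C "ideal_generated C G"]
    by (auto simp: ideal_generated_def) (auto simp: tensor_ideal_def)
qed

lemma ideal_generated_incl: "G \<subseteq> ideal_generated C G"
  by (auto simp: ideal_generated_def)

lemma word_category_quotient: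
  fixes C :: "('s list, 'm, 'r::{comm_ring, comm_monoid_mult}) rigid_cat"
  assumes "word_category C T bar" "tensor_ideal C I"
  shows "word_category (quotient_cat C I) T bar"
proof -
  interpret C: word_category C T bar by fact
  interpret monoidal_quotient C I by unfold_locales fact
  interpret Q: linear_monoidal_category Q by (rule linear_monoidal_Q)
  show ?thesis
  proof
    show "evl Q (s # A) = evl Q [s] \<cdot>\<^bsub>Q\<^esub> (ide Q [s] \<otimes>\<^bsub>Q\<^esub> evl Q A \<otimes>\<^bsub>Q\<^esub> ide Q [bar s])"
      "coevl Q (s # A) = (ide Q [s] \<otimes>\<^bsub>Q\<^esub> coevl Q A \<otimes>\<^bsub>Q\<^esub> ide Q [bar s]) \<cdot>\<^bsub>Q\<^esub> coevl Q [s]"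
      if "s \<in> T" "A \<in> lists T" for s A
      using that C.evl_Cons[OF that] C.coevl_Cons[OF that] by simp_all
  qed (auto simp: Hom_Q C.dual_word C.strand_zigzag_left C.strand_zigzag_right)
qed

text \<open>Evaluates \<open>F\<close> at an arbitrary representative; the choice is harmless once
  \<open>F\<close> kills the ideal, which \<open>rigid_functor_quotient\<close> derives from killing
  generators.\<close>

definition quotient_functor :: "('o, 'm, 'p, 'n) cat_map \<Rightarrow> ('o, 'm set, 'p, 'n) cat_map" where
  "quotient_functor F = \<lparr>on_obj = on_obj F, on_mor = (\<lambda>X. on_mor F (SOME f. f \<in> X))\<rparr>"

definition id_map :: "('o, 'm, 'o, 'm) cat_map" where
  "id_map = \<lparr>on_obj = (\<lambda>A. A), on_mor = (\<lambda>f. f)\<rparr>"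

definition comp_map :: "('p, 'n, 'q, 'l) cat_map \<Rightarrow> ('o, 'm, 'p, 'n) cat_map \<Rightarrow> ('o, 'm, 'q, 'l) cat_map" where
  "comp_map G F = \<lparr>on_obj = (\<lambda>A. on_obj G (on_obj F A)), on_mor = (\<lambda>f. on_mor G (on_mor F f))\<rparr>"

locale rigid_functor = C: rigid_category C + D: rigid_category D
  for C :: "('o, 'm, 'r::{comm_ring, comm_monoid_mult}, 'x) rigid_cat_scheme"
    and D :: "('p, 'n, 'r, 'y) rigid_cat_scheme" +
  fixes F :: "('o, 'm, 'p, 'n) cat_map"
  assumes F: "rigid_monoidal_functor C D F"
begin

lemma F_Mor [simp]:
  assumes "f \<in> Mor C"
  shows "on_mor F f \<in> Mor D" "Src D (on_mor F f) = on_obj F (Src C f)"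
    "Tgt D (on_mor F f) = on_obj F (Tgt C f)"
  using F assms by (simp_all add: rigid_monoidal_functor_def Hom_def)

lemma F_simps [simp]:
  "A \<in> Obj C \<Longrightarrow> on_obj F A \<in> Obj D"
  "A \<in> Obj C \<Longrightarrow> on_mor F (ide C A) = ide D (on_obj F A)"
  "\<lbrakk>f \<in> Mor C; g \<in> Mor C; Src C g = Tgt C f\<rbrakk> \<Longrightarrow> on_mor F (g \<cdot>\<^bsub>C\<^esub> f) = on_mor F g \<cdot>\<^bsub>D\<^esub> on_mor F f"
  "\<lbrakk>f \<in> Mor C; g \<in> Mor C; Src C f = Src C g; Tgt C f = Tgt C g\<rbrakk> \<Longrightarrow>
    on_mor F (f \<oplus>\<^bsub>C\<^esub> g) = on_mor F f \<oplus>\<^bsub>D\<^esub> on_mor F g"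
  "f \<in> Mor C \<Longrightarrow> on_mor F (r \<odot>\<^bsub>C\<^esub> f) = r \<odot>\<^bsub>D\<^esub> on_mor F f"
  "on_obj F (unit_ob C) = unit_ob D"
  "\<lbrakk>A \<in> Obj C; B \<in> Obj C\<rbrakk> \<Longrightarrow> on_obj F (tensor_ob C A B) = tensor_ob D (on_obj F A) (on_obj F B)"
  "\<lbrakk>f \<in> Mor C; g \<in> Mor C\<rbrakk> \<Longrightarrow> on_mor F (f \<otimes>\<^bsub>C\<^esub> g) = on_mor F f \<otimes>\<^bsub>D\<^esub> on_mor F g"
  "A \<in> Obj C \<Longrightarrow> on_obj F (dual C A) = dual D (on_obj F A)"
  "A \<in> Obj C \<Longrightarrow> on_mor F (evl C A) = evl D (on_obj F A)"
  "A \<in> Obj C \<Longrightarrow> on_mor F (coevl C A) = coevl D (on_obj F A)"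
  using F by (simp_all add: rigid_monoidal_functor_def)

lemma F_diff [simp]:
  "\<lbrakk>f \<in> Mor C; g \<in> Mor C; Src C f = Src C g; Tgt C f = Tgt C g\<rbrakk> \<Longrightarrow>
    on_mor F (f \<ominus>\<^bsub>C\<^esub> g) = on_mor F f \<ominus>\<^bsub>D\<^esub> on_mor F g"
  by (simp add: diff_def)

lemma F_zero [simp]:
  assumes "A \<in> Obj C" "B \<in> Obj C"
  shows "on_mor F (zero C A B) = zero D (on_obj F A) (on_obj F B)"
  using F_diff[of "zero C A B" "zero C A B"] assms by simp

text \<open>The kernel of the functor.\<close>

definition killed :: "'m set" where
  "killed = {f \<in> Mor C. on_mor F f = zero D (on_obj F (Src C f)) (on_obj F (Tgt C f))}"

lemma tensor_ideal_killed: "tensor_ideal C killed"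
  unfolding tensor_ideal_def killed_def by auto

text \<open>Half turns are built from identities, cups and caps, all of which a rigid functor
  preserves.\<close>

lemma F_mate [simp]: "f \<in> Mor C \<Longrightarrow> on_mor F (mate C f) = mate D (on_mor F f)"
  by (simp add: mate_def C.dual_in C.ev_in[THEN HomD(1)] C.ev_in[THEN HomD(2)] C.ev_in[THEN HomD(3)]
    C.coev_in[THEN HomD(1)] C.coev_in[THEN HomD(2)] C.coev_in[THEN HomD(3)] C.tensor_ob_assoc C.dual_dual
    C.tensor_ob_unit_left C.tensor_ob_unit_right)

end

lemma rigid_category_quotient:
  fixes C :: "('o, 'm, 'r::{comm_ring, comm_monoid_mult}) rigid_cat"
  assumes "rigid_category C" "tensor_ideal C I"
  shows "rigid_category (quotient_cat C I)"
proof -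
  interpret C: rigid_category C by fact
  interpret monoidal_quotient C I by unfold_locales fact
  interpret Q: linear_monoidal_category Q by (rule linear_monoidal_Q)
  note ev = C.ev_in[THEN HomD(1)] C.ev_in[THEN HomD(2)] C.ev_in[THEN HomD(3)]
    C.coev_in[THEN HomD(1)] C.coev_in[THEN HomD(2)] C.coev_in[THEN HomD(3)]
  show ?thesis
    by unfold_locales (auto simp: Hom_Q C.dual_in C.dual_dual ev C.tensor_ob_assoc C.zigzag_left C.zigzag_right)
qed

definition quotient_proj :: "('o, 'm, 'r, 'x) rigid_cat_scheme \<Rightarrow> 'm set \<Rightarrow> ('o, 'm, 'o, 'm set) cat_map" where
  "quotient_proj C I = \<lparr>on_obj = (\<lambda>A. A), on_mor = coset C I\<rparr>"

lemma rigid_functor_proj: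
  fixes C :: "('o, 'm, 'r::{comm_ring, comm_monoid_mult}) rigid_cat"
  assumes "rigid_category C" "tensor_ideal C I"
  shows "rigid_functor C (quotient_cat C I) (quotient_proj C I)"
proof -
  interpret C: rigid_category C by fact
  interpret monoidal_quotient C I by unfold_locales fact
  interpret Q: rigid_category Q using assms by (rule rigid_category_quotient)
  show ?thesis
    by unfold_locales (auto simp: rigid_monoidal_functor_def quotient_proj_def Hom_Q)
qed

text \<open>Universal property of the quotient: the kernel is a tensor ideal containing
  \<open>G\<close>, hence contains the ideal generated by \<open>G\<close>, so \<open>F\<close> is
  constant on cosets.\<close>

lemma rigid_functor_quotient:
  fixes C :: "('o, 'm, 'r::{comm_ring, comm_monoid_mult}) rigid_cat"
  assumes F: "rigid_functor C D F" and G: "G \<subseteq> Mor C"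
    and killed: "\<And>g. g \<in> G \<Longrightarrow> on_mor F g = zero D (on_obj F (Src C g)) (on_obj F (Tgt C g))"
  shows "rigid_functor (quotient_cat C (ideal_generated C G)) D (quotient_functor F)" (is ?thesis1)
    and "f \<in> Mor C \<Longrightarrow> on_mor (quotient_functor F) (coset C (ideal_generated C G) f) = on_mor F f"
proof -
  interpret F: rigid_functor C D F by fact
  define I where "I = ideal_generated C G"
  have I: "tensor_ideal C I" unfolding I_def by (rule tensor_ideal_generated[OF _ G]) unfold_locales
  interpret monoidal_quotient C I by unfold_locales fact
  interpret Q: rigid_category Q using F.C.rigid_category_axioms I by (rule rigid_category_quotient)
  have "I \<subseteq> F.killed"
    unfolding I_def ideal_generated_def using F.tensor_ideal_killed G killed
    by (auto simp: F.killed_def)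
  then have F_I: "i \<in> I \<Longrightarrow> on_mor F i = zero D (on_obj F (Src C i)) (on_obj F (Tgt C i))" for i
    by (auto simp: F.killed_def)
  have eq: "on_mor (quotient_functor F) (proj f) = on_mor F f" if f: "f \<in> Mor C" for f
  proof -
    have "(SOME f'. f' \<in> proj f) \<in> proj f" using proj_self[OF f] by (rule someI)
    then show ?thesis using f by (rule projE) (auto simp: quotient_functor_def F_I f)
  qed
  then show "f \<in> Mor C \<Longrightarrow> on_mor (quotient_functor F) (coset C (ideal_generated C G) f) = on_mor F f"
    by (simp add: I_def)
  have ob: "on_obj (quotient_functor F) = on_obj F" by (simp add: quotient_functor_def)
  have "rigid_monoidal_functor Q D (quotient_functor F)"
    using F.C.dual_in F.C.ev_in F.C.coev_in
    by (auto simp: rigid_monoidal_functor_def Hom_Q eq ob Hom_def)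
  then show ?thesis1 unfolding I_def[symmetric] by unfold_locales
qed

lemma rigid_functor_id: "rigid_category C \<Longrightarrow> rigid_functor C C id_map"
  by (auto simp: rigid_functor_def rigid_functor_axioms_def rigid_monoidal_functor_def id_map_def Hom_def)

lemma rigid_functor_comp:
  assumes "rigid_functor C D F" "rigid_functor D E G"
  shows "rigid_functor C E (comp_map G F)"
proof -
  interpret F: rigid_functor C D F by fact
  interpret G: rigid_functor D E G by fact
  show ?thesis
    by unfold_locales (auto simp: rigid_monoidal_functor_def comp_map_def Hom_def F.D.ev_in)
qed

section \<open>The free module on a set: linear extension and induction over combinations\<close>

section \<open>Formal linear combinations\<close>

abbreviation smul :: "'r \<Rightarrow> ('a \<Rightarrow>\<^sub>0 'r) \<Rightarrow> ('a \<Rightarrow>\<^sub>0 'r::{comm_ring, comm_monoid_mult})" where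
  "smul r p \<equiv> Poly_Mapping.map ((*) r) p"

lemma lookup_smul [simp]: "Poly_Mapping.lookup (smul r p) k = r * Poly_Mapping.lookup p k"
  by (simp add: Poly_Mapping.map.rep_eq when_def)

lemma smul_simps [simp]:
  "smul r 0 = 0" "smul 0 p = 0" "smul 1 p = p" "smul r (smul s p) = smul (r * s) p"
  by (rule poly_mapping_eqI; simp add: mult.assoc)+

lemma smul_add: "smul r (p + q) = smul r p + smul r q" "smul (r + s) p = smul r p + smul s p"
  by (rule poly_mapping_eqI; simp add: lookup_add algebra_simps)+

lemma smul_uminus: "smul (- 1) p = - p"
  by (rule poly_mapping_eqI) simp

lemma smul_single: "smul r (Poly_Mapping.single a s) = Poly_Mapping.single a (r * s)"
  by (rule poly_mapping_eqI) (simp add: lookup_single when_def)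

lemma keys_smul: "Poly_Mapping.keys (smul r p) \<subseteq> Poly_Mapping.keys p"
  by (auto simp: in_keys_iff)

lemma smul_sum: "smul r (\<Sum>a \<in> A. f a) = (\<Sum>a \<in> A. smul r (f a))"
  by (induction A rule: infinite_finite_induct) (simp_all add: smul_add)

text \<open>Linear extension of \<open>h\<close> from the basis of the free module. Through
  \<open>bilinear_ext_lin\<close> it replaces double sums by two extensions in one variable, for
  which linearity is a rewrite rule.\<close>

definition lin :: "('a \<Rightarrow> ('b \<Rightarrow>\<^sub>0 'r)) \<Rightarrow> ('a \<Rightarrow>\<^sub>0 'r) \<Rightarrow> ('b \<Rightarrow>\<^sub>0 'r::{comm_ring, comm_monoid_mult})" where
  "lin h p = (\<Sum>a \<in> Poly_Mapping.keys p. smul (Poly_Mapping.lookup p a) (h a))"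

lemma lin_superset:
  assumes "finite K" "Poly_Mapping.keys p \<subseteq> K"
  shows "lin h p = (\<Sum>a \<in> K. smul (Poly_Mapping.lookup p a) (h a))"
  unfolding lin_def using assms by (intro sum.mono_neutral_left) (auto simp: in_keys_iff)

lemma lin_zero [simp]: "lin h 0 = 0"
  by (simp add: lin_def)

lemma lin_add [simp]: "lin h (p + q) = lin h p + lin h q"
proof -
  \<comment> \<open>Coefficients may cancel in \<open>p + q\<close>, so the three sums are compared
    over the union of the supports.\<close>
  let ?K = "Poly_Mapping.keys p \<union> Poly_Mapping.keys q"
  have "lin h (p + q) = (\<Sum>a \<in> ?K. smul (Poly_Mapping.lookup (p + q) a) (h a))"
    by (rule lin_superset) (simp_all add: keys_add)
  also have "\<dots> = lin h p + lin h q"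
    by (simp add: lin_superset[of ?K p] lin_superset[of ?K q] lookup_add smul_add sum.distrib)
  finally show ?thesis .
qed

lemma lin_smul [simp]: "lin h (smul r p) = smul r (lin h p)"
  by (subst lin_superset[OF finite_keys keys_smul]) (simp add: lin_def smul_sum)

lemma lin_single [simp]: "lin h (Poly_Mapping.single a r) = smul r (h a)"
  by (simp add: lin_superset[of "{a}"])

lemma lin_fun_zero [simp]: "lin (\<lambda>a. 0) p = 0"
  and lin_fun_add [simp]: "lin (\<lambda>a. f a + g a) p = lin f p + lin g p"
  and lin_fun_smul [simp]: "lin (\<lambda>a. smul r (f a)) p = smul r (lin f p)"
  by (simp_all add: lin_def smul_add sum.distrib smul_sum mult.commute)

lemma keys_lin: "Poly_Mapping.keys (lin h p) \<subseteq> (\<Union>a \<in> Poly_Mapping.keys p. Poly_Mapping.keys (h a))"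
proof
  fix k assume "k \<in> Poly_Mapping.keys (lin h p)"
  then have "(\<Sum>a \<in> Poly_Mapping.keys p. Poly_Mapping.lookup p a * Poly_Mapping.lookup (h a) k) \<noteq> 0"
    by (simp add: in_keys_iff lin_def lookup_sum)
  then obtain a where "a \<in> Poly_Mapping.keys p" "Poly_Mapping.lookup p a * Poly_Mapping.lookup (h a) k \<noteq> 0"
    by (rule sum.not_neutral_contains_not_neutral)
  moreover from this(2) have "Poly_Mapping.lookup (h a) k \<noteq> 0" by auto
  ultimately show "k \<in> (\<Union>a \<in> Poly_Mapping.keys p. Poly_Mapping.keys (h a))"
    by (auto simp: in_keys_iff)
qed

lemma bilinear_ext_lin:
  "bilinear_ext m p q = lin (\<lambda>a. lin (\<lambda>b. Poly_Mapping.single (m a b) 1) q) p"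
  by (simp add: bilinear_ext_def lin_def smul_sum smul_single)

lemma bilinear_ext_simps [simp]:
  "bilinear_ext m 0 q = 0" "bilinear_ext m p 0 = 0"
  "bilinear_ext m (p + p') q = bilinear_ext m p q + bilinear_ext m p' q"
  "bilinear_ext m p (q + q') = bilinear_ext m p q + bilinear_ext m p q'"
  "bilinear_ext m (smul r p) q = smul r (bilinear_ext m p q)"
  "bilinear_ext m p (smul r q) = smul r (bilinear_ext m p q)"
  "bilinear_ext m (Poly_Mapping.single a 1) (Poly_Mapping.single b 1) = Poly_Mapping.single (m a b) 1"
  by (simp_all add: bilinear_ext_lin)

lemma keys_bilinear_ext:
  fixes p :: "'a \<Rightarrow>\<^sub>0 'r::{comm_ring, comm_monoid_mult}"
  shows "Poly_Mapping.keys (bilinear_ext m p q) \<subseteq> {m a b | a b. a \<in> Poly_Mapping.keys p \<and> b \<in> Poly_Mapping.keys q}"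
  unfolding bilinear_ext_lin
proof
  fix k assume "k \<in> Poly_Mapping.keys (lin (\<lambda>a. lin (\<lambda>b. Poly_Mapping.single (m a b) (1::'r)) q) p)"
  then obtain a where a: "a \<in> Poly_Mapping.keys p" "k \<in> Poly_Mapping.keys (lin (\<lambda>b. Poly_Mapping.single (m a b) (1::'r)) q)"
    using keys_lin by fast
  then obtain b where "b \<in> Poly_Mapping.keys q" "k \<in> Poly_Mapping.keys (Poly_Mapping.single (m a b) (1::'r))"
    using keys_lin by fast
  with a show "k \<in> {m a b | a b. a \<in> Poly_Mapping.keys p \<and> b \<in> Poly_Mapping.keys q}"
    by (auto split: if_splits)
qed

text \<open>The support is carried through the induction because the identities to be proved hold
  only for classes of diagrams with matching boundaries.\<close>

lemma lin_comb_induct [consumes 1, case_names zero single smul add]: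
  fixes p :: "'a \<Rightarrow>\<^sub>0 'r::{comm_ring, comm_monoid_mult}"
  assumes "Poly_Mapping.keys p \<subseteq> K" and "P 0" and "\<And>a. a \<in> K \<Longrightarrow> P (Poly_Mapping.single a 1)"
    and "\<And>r p. \<lbrakk>Poly_Mapping.keys p \<subseteq> K; P p\<rbrakk> \<Longrightarrow> P (smul r p)"
    and "\<And>p q. \<lbrakk>Poly_Mapping.keys p \<subseteq> K; Poly_Mapping.keys q \<subseteq> K; P p; P q\<rbrakk> \<Longrightarrow> P (p + q)"
  shows "P p"
proof -
  \<comment> \<open>A monomial with coefficient \<open>r\<close> is \<open>r\<close> times the basis
    element; its support is empty when \<open>r\<close> is 0.\<close>
  have s: "P (Poly_Mapping.single a r) \<and> Poly_Mapping.keys (Poly_Mapping.single a r) \<subseteq> K" if "a \<in> K" for a r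
    using assms(4)[of "Poly_Mapping.single a 1" r] assms(3)[OF that] that
    by (auto simp: smul_single split: if_splits)
  have "P (\<Sum>a \<in> A. Poly_Mapping.single a (Poly_Mapping.lookup p a)) \<and>
      Poly_Mapping.keys (\<Sum>a \<in> A. Poly_Mapping.single a (Poly_Mapping.lookup p a)) \<subseteq> K"
    if "finite A" "A \<subseteq> K" for A
    using that
  proof (induction A)
    case (insert a A)
    let ?q = "\<Sum>a \<in> A. Poly_Mapping.single a (Poly_Mapping.lookup p a)"
    have "Poly_Mapping.keys (Poly_Mapping.single a (Poly_Mapping.lookup p a) + ?q) \<subseteq> K"
      using insert s[of a "Poly_Mapping.lookup p a"] by (intro order.trans[OF keys_add]) blast
    then show ?case using insert s[of a "Poly_Mapping.lookup p a"] by (simp add: assms(5))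
  qed (simp add: assms(2))
  moreover have "(\<Sum>a \<in> Poly_Mapping.keys p. Poly_Mapping.single a (Poly_Mapping.lookup p a)) = p"
    by (rule poly_mapping_eqI) (simp add: lookup_sum lookup_single when_def in_keys_iff)
  ultimately show ?thesis using finite_keys assms(1) by metis
qed

section \<open>Combinations of isotopy classes form a rigid category over words\<close>

section \<open>Categories of diagrams\<close>

locale diagram_family =
  fixes \<Sigma> :: "('s, 'v) signature" and T :: "'s set" and ds :: "('s, 'v) diagram set"
  assumes opp_opp [simp]: "opp \<Sigma> (opp \<Sigma> s) = s"
    and opp_T [simp]: "s \<in> T \<Longrightarrow> opp \<Sigma> s \<in> T"
    and ds_wf: "d \<in> ds \<Longrightarrow> wf_diagram \<Sigma> d"
    and ds_src: "d \<in> ds \<Longrightarrow> src \<Sigma> d \<in> lists T"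
    and ds_tgt: "d \<in> ds \<Longrightarrow> tgt \<Sigma> d \<in> lists T"
    and ds_Strands [simp]: "w \<in> lists T \<Longrightarrow> Strands w \<in> ds"
    and ds_Cup [simp]: "s \<in> T \<Longrightarrow> Cup s \<in> ds"
    and ds_Cap [simp]: "s \<in> T \<Longrightarrow> Cap s \<in> ds"
    and ds_Stack [simp]: "\<lbrakk>g \<in> ds; f \<in> ds; src \<Sigma> g = tgt \<Sigma> f\<rbrakk> \<Longrightarrow> Stack g f \<in> ds"
    and ds_Beside [simp]: "\<lbrakk>f \<in> ds; g \<in> ds\<rbrakk> \<Longrightarrow> Beside f g \<in> ds"
begin

lemma map_opp_opp [simp]: "map (opp \<Sigma> \<circ> opp \<Sigma>) w = w"
  by (induction w) auto

lemma dual_dual_word [simp]: "dual_word \<Sigma> (dual_word \<Sigma> w) = w"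
  by (simp add: dual_word_def rev_map)

lemma wf_cups [simp]: "wf_diagram \<Sigma> (cups \<Sigma> w)" "src \<Sigma> (cups \<Sigma> w) = []" "tgt \<Sigma> (cups \<Sigma> w) = w @ dual_word \<Sigma> w"
  by (induction w) (simp_all add: dual_word_def)

lemma wf_caps [simp]: "wf_diagram \<Sigma> (caps \<Sigma> w)" "tgt \<Sigma> (caps \<Sigma> w) = []" "src \<Sigma> (caps \<Sigma> w) = w @ dual_word \<Sigma> w"
  by (induction w) (simp_all add: dual_word_def)

lemma ds_cups [simp]: "w \<in> lists T \<Longrightarrow> cups \<Sigma> w \<in> ds"
  by (induction w) (simp_all add: dual_word_def)

lemma ds_caps [simp]: "w \<in> lists T \<Longrightarrow> caps \<Sigma> w \<in> ds"
  by (induction w) (simp_all add: dual_word_def)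

lemma isotopic_typed:
  "isotopic \<Sigma> d e \<Longrightarrow> wf_diagram \<Sigma> d \<and> wf_diagram \<Sigma> e \<and> src \<Sigma> d = src \<Sigma> e \<and> tgt \<Sigma> d = tgt \<Sigma> e"
proof (induction rule: isotopic.induct)
  case (iso_turn v)
  \<comment> \<open>\<open>turn_left\<close> puts the caps of the dual target word around the
    target, which fits because dualising a word twice gives it back.\<close>
  show ?case using dual_dual_word[of "node_src \<Sigma> v"] dual_dual_word[of "node_tgt \<Sigma> v"]
    by (simp add: turn_right_def turn_left_def Let_def)
qed auto

lemma isotopy_class_eqI: "isotopic \<Sigma> d e \<Longrightarrow> isotopy_class \<Sigma> d = isotopy_class \<Sigma> e"
  by (auto simp: isotopy_class_def intro: iso_trans iso_sym)

lemma isotopy_class_simps: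
  "wf_diagram \<Sigma> (Stack h (Stack g f)) \<Longrightarrow>
    isotopy_class \<Sigma> (Stack (Stack h g) f) = isotopy_class \<Sigma> (Stack h (Stack g f))"
  "\<lbrakk>wf_diagram \<Sigma> f; wf_diagram \<Sigma> g; wf_diagram \<Sigma> h\<rbrakk> \<Longrightarrow>
    isotopy_class \<Sigma> (Beside (Beside f g) h) = isotopy_class \<Sigma> (Beside f (Beside g h))"
  "\<lbrakk>wf_diagram \<Sigma> (Stack g f); wf_diagram \<Sigma> (Stack g' f')\<rbrakk> \<Longrightarrow>
    isotopy_class \<Sigma> (Stack (Beside g g') (Beside f f')) = isotopy_class \<Sigma> (Beside (Stack g f) (Stack g' f'))"
  "wf_diagram \<Sigma> f \<Longrightarrow> isotopy_class \<Sigma> (Stack (Strands (tgt \<Sigma> f)) f) = isotopy_class \<Sigma> f"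
  "wf_diagram \<Sigma> f \<Longrightarrow> isotopy_class \<Sigma> (Stack f (Strands (src \<Sigma> f))) = isotopy_class \<Sigma> f"
  "wf_diagram \<Sigma> f \<Longrightarrow> isotopy_class \<Sigma> (Beside (Strands []) f) = isotopy_class \<Sigma> f"
  "wf_diagram \<Sigma> f \<Longrightarrow> isotopy_class \<Sigma> (Beside f (Strands [])) = isotopy_class \<Sigma> f"
  "isotopy_class \<Sigma> (Beside (Strands v) (Strands w)) = isotopy_class \<Sigma> (Strands (v @ w))"
  by (rule isotopy_class_eqI, erule iso_Stack_assoc, rule isotopy_class_eqI, erule (2) iso_Beside_assoc,
    rule isotopy_class_eqI, erule (1) iso_interchange, rule isotopy_class_eqI, erule iso_Stack_left,
    rule isotopy_class_eqI, erule iso_Stack_right, rule isotopy_class_eqI, erule iso_Beside_left,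
    rule isotopy_class_eqI, erule iso_Beside_right, rule isotopy_class_eqI, rule iso_Strands)

text \<open>Isotopy is a congruence for stacking, so the union over representatives is
  constant.\<close>

lemma class_stack_isotopy_class:
  assumes "wf_diagram \<Sigma> g" "wf_diagram \<Sigma> f" "src \<Sigma> g = tgt \<Sigma> f"
  shows "class_stack \<Sigma> (isotopy_class \<Sigma> g) (isotopy_class \<Sigma> f) = isotopy_class \<Sigma> (Stack g f)"
proof -
  have c: "isotopy_class \<Sigma> (Stack g' f') = isotopy_class \<Sigma> (Stack g f)"
    if "isotopic \<Sigma> g g'" "isotopic \<Sigma> f f'" for g' f'
    using isotopy_class_eqI[OF iso_Stack[OF that assms(3)]] by simp
  have X: "g \<in> isotopy_class \<Sigma> g" and Y: "f \<in> isotopy_class \<Sigma> f"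
    using assms by (simp_all add: isotopy_class_def iso_refl)
  show ?thesis unfolding class_stack_def
  proof (rule UN_constant_eq[OF X], intro ballI UN_constant_eq[OF Y])
    fix x y assume "x \<in> isotopy_class \<Sigma> g" "y \<in> isotopy_class \<Sigma> f"
    then show "isotopy_class \<Sigma> (Stack x y) = isotopy_class \<Sigma> (Stack g f)"
      by (intro c) (simp_all add: isotopy_class_def)
  qed
qed

lemma class_beside_isotopy_class:
  assumes "wf_diagram \<Sigma> f" "wf_diagram \<Sigma> g"
  shows "class_beside \<Sigma> (isotopy_class \<Sigma> f) (isotopy_class \<Sigma> g) = isotopy_class \<Sigma> (Beside f g)"
proof -
  have c: "isotopy_class \<Sigma> (Beside f' g') = isotopy_class \<Sigma> (Beside f g)"
    if "isotopic \<Sigma> f f'" "isotopic \<Sigma> g g'" for g' f'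
    using isotopy_class_eqI[OF iso_Beside[OF that]] by simp
  have X: "f \<in> isotopy_class \<Sigma> f" and Y: "g \<in> isotopy_class \<Sigma> g"
    using assms by (simp_all add: isotopy_class_def iso_refl)
  show ?thesis unfolding class_beside_def
  proof (rule UN_constant_eq[OF X], intro ballI UN_constant_eq[OF Y])
    fix x y assume "x \<in> isotopy_class \<Sigma> f" "y \<in> isotopy_class \<Sigma> g"
    then show "isotopy_class \<Sigma> (Beside x y) = isotopy_class \<Sigma> (Beside f g)"
      by (intro c) (simp_all add: isotopy_class_def)
  qed
qed

definition classes :: "'s list \<Rightarrow> 's list \<Rightarrow> ('s, 'v) diagram set set" where
  "classes A B = {isotopy_class \<Sigma> d | d. d \<in> ds \<and> src \<Sigma> d = A \<and> tgt \<Sigma> d = B}"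

lemma classes_stack: "\<lbrakk>a \<in> classes B D; b \<in> classes A B\<rbrakk> \<Longrightarrow> class_stack \<Sigma> a b \<in> classes A D"
  unfolding classes_def
  by clarify (rule_tac x = "Stack d da" in exI, simp add: class_stack_isotopy_class ds_wf)

lemma classes_beside: "\<lbrakk>a \<in> classes A B; b \<in> classes A' B'\<rbrakk> \<Longrightarrow> class_beside \<Sigma> a b \<in> classes (A @ A') (B @ B')"
  unfolding classes_def
  by clarify (rule_tac x = "Beside d da" in exI, simp add: class_beside_isotopy_class ds_wf)

lemma keys_stack:
  "\<lbrakk>Poly_Mapping.keys q \<subseteq> classes B D; Poly_Mapping.keys p \<subseteq> classes A B\<rbrakk> \<Longrightarrow>
    Poly_Mapping.keys (bilinear_ext (class_stack \<Sigma>) q p) \<subseteq> classes A D"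
  by (rule order.trans[OF keys_bilinear_ext]) (auto intro!: classes_stack)

lemma keys_beside:
  "\<lbrakk>Poly_Mapping.keys p \<subseteq> classes A B; Poly_Mapping.keys q \<subseteq> classes A' B'\<rbrakk> \<Longrightarrow>
    Poly_Mapping.keys (bilinear_ext (class_beside \<Sigma>) p q) \<subseteq> classes (A @ A') (B @ B')"
  by (rule order.trans[OF keys_bilinear_ext]) (auto intro!: classes_beside)

abbreviation C :: "('s list, ('s, 'v, 'r::{comm_ring, comm_monoid_mult}) diag_mor, 'r) rigid_cat" where
  "C \<equiv> diagram_cat \<Sigma> (lists T) ds"

lemma in_Hom_C:
  "f \<in> Hom C A B \<longleftrightarrow> A \<in> lists T \<and> B \<in> lists T \<and> (\<exists>p. f = (A, B, p) \<and> Poly_Mapping.keys p \<subseteq> classes A B)"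
  by (auto simp: Hom_def diagram_cat_def classes_def)

lemma in_Mor_C:
  "f \<in> Mor C \<longleftrightarrow> (\<exists>A B p. A \<in> lists T \<and> B \<in> lists T \<and> f = (A, B, p) \<and> Poly_Mapping.keys p \<subseteq> classes A B)"
  by (auto simp: diagram_cat_def classes_def)

lemma C_fields [simp]:
  "Obj C = lists T" "Src C (A, B, p) = A" "Tgt C (A, B, p) = B"
  "ide C A = of_diagram \<Sigma> (Strands A)"
  "comp C (B', D, q) (A, B, p) = (A, D, bilinear_ext (class_stack \<Sigma>) q p)"
  "zero C A B = (A, B, 0)" "add C (A, B, p) (A', B', q) = (A, B, p + q)"
  "scale C r (A, B, p) = (A, B, smul r p)" "unit_ob C = []" "tensor_ob C = (@)"
  "tensor C (A, B, p) (A', B', p') = (A @ A', B @ B', bilinear_ext (class_beside \<Sigma>) p p')"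
  "dual C = dual_word \<Sigma>" "evl C A = of_diagram \<Sigma> (caps \<Sigma> A)" "coevl C A = of_diagram \<Sigma> (cups \<Sigma> A)"
  by (simp_all add: diagram_cat_def)

lemma of_diagram_eqI: "isotopic \<Sigma> d e \<Longrightarrow> of_diagram \<Sigma> d = of_diagram \<Sigma> e"
  using isotopic_typed[of d e] isotopy_class_eqI[of d e] by (simp add: of_diagram_def)

lemma of_diagram_Mor: "d \<in> ds \<Longrightarrow> of_diagram \<Sigma> d \<in> Hom C (src \<Sigma> d) (tgt \<Sigma> d)"
  using ds_src ds_tgt by (auto simp: in_Hom_C of_diagram_def classes_def)

lemma of_diagram_Stack:
  "\<lbrakk>wf_diagram \<Sigma> g; wf_diagram \<Sigma> f; src \<Sigma> g = tgt \<Sigma> f\<rbrakk> \<Longrightarrow>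
    of_diagram \<Sigma> (Stack g f) = comp C (of_diagram \<Sigma> g) (of_diagram \<Sigma> f)"
  by (simp add: of_diagram_def class_stack_isotopy_class)

lemma of_diagram_Beside:
  "\<lbrakk>wf_diagram \<Sigma> f; wf_diagram \<Sigma> g\<rbrakk> \<Longrightarrow>
    of_diagram \<Sigma> (Beside f g) = tensor C (of_diagram \<Sigma> f) (of_diagram \<Sigma> g)"
  by (simp add: of_diagram_def class_beside_isotopy_class)

text \<open>On classes the law is the isotopy \<open>iso_Stack_assoc\<close>. It spreads to
  combinations by successive inductions, one argument at a time; \<open>beside_assoc\<close> and
  \<open>stack_beside\<close> follow the same scheme.\<close>

lemma stack_assoc:
  assumes "Poly_Mapping.keys p \<subseteq> classes A B" "Poly_Mapping.keys q \<subseteq> classes B D" "Poly_Mapping.keys r \<subseteq> classes D E"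
  shows "bilinear_ext (class_stack \<Sigma>) (bilinear_ext (class_stack \<Sigma>) r q) p =
    bilinear_ext (class_stack \<Sigma>) r (bilinear_ext (class_stack \<Sigma>) q (p :: _ \<Rightarrow>\<^sub>0 'r::{comm_ring, comm_monoid_mult}))"
proof -
  have e: "class_stack \<Sigma> (class_stack \<Sigma> a b) c = class_stack \<Sigma> a (class_stack \<Sigma> b c)"
    if "c \<in> classes A B" "b \<in> classes B D" "a \<in> classes D E" for a b c
    using that by (auto simp: classes_def class_stack_isotopy_class ds_wf isotopy_class_simps(1))
  have 1: "bilinear_ext (class_stack \<Sigma>) (bilinear_ext (class_stack \<Sigma>) (Poly_Mapping.single a 1) (Poly_Mapping.single b 1)) p =
      bilinear_ext (class_stack \<Sigma>) (Poly_Mapping.single a 1) (bilinear_ext (class_stack \<Sigma>) (Poly_Mapping.single b 1) p)"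
    if "b \<in> classes B D" "a \<in> classes D E" for a b
    using assms(1) that by (induction rule: lin_comb_induct) (simp_all add: e)
  have 2: "bilinear_ext (class_stack \<Sigma>) (bilinear_ext (class_stack \<Sigma>) (Poly_Mapping.single a 1) q) p =
      bilinear_ext (class_stack \<Sigma>) (Poly_Mapping.single a 1) (bilinear_ext (class_stack \<Sigma>) q p)"
    if "a \<in> classes D E" for a
    using assms(2) that by (induction rule: lin_comb_induct) (simp_all add: 1 del: bilinear_ext_simps(7))
  show ?thesis using assms(3)
    by (induction rule: lin_comb_induct) (simp_all add: 2 del: bilinear_ext_simps(7))
qed

lemma beside_assoc:
  assumes "Poly_Mapping.keys r \<subseteq> classes A B" "Poly_Mapping.keys q \<subseteq> classes A' B'" "Poly_Mapping.keys p \<subseteq> classes A'' B''"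
  shows "bilinear_ext (class_beside \<Sigma>) (bilinear_ext (class_beside \<Sigma>) r q) p =
    bilinear_ext (class_beside \<Sigma>) r (bilinear_ext (class_beside \<Sigma>) q (p :: _ \<Rightarrow>\<^sub>0 'r::{comm_ring, comm_monoid_mult}))"
proof -
  have e: "class_beside \<Sigma> (class_beside \<Sigma> a b) c = class_beside \<Sigma> a (class_beside \<Sigma> b c)"
    if "a \<in> classes A B" "b \<in> classes A' B'" "c \<in> classes A'' B''" for a b c
    using that by (auto simp: classes_def class_beside_isotopy_class ds_wf isotopy_class_simps(2))
  have 1: "bilinear_ext (class_beside \<Sigma>) (bilinear_ext (class_beside \<Sigma>) (Poly_Mapping.single a 1) (Poly_Mapping.single b 1)) p =
      bilinear_ext (class_beside \<Sigma>) (Poly_Mapping.single a 1) (bilinear_ext (class_beside \<Sigma>) (Poly_Mapping.single b 1) p)"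
    if "a \<in> classes A B" "b \<in> classes A' B'" for a b
    using assms(3) that by (induction rule: lin_comb_induct) (simp_all add: e)
  have 2: "bilinear_ext (class_beside \<Sigma>) (bilinear_ext (class_beside \<Sigma>) (Poly_Mapping.single a 1) q) p =
      bilinear_ext (class_beside \<Sigma>) (Poly_Mapping.single a 1) (bilinear_ext (class_beside \<Sigma>) q p)"
    if "a \<in> classes A B" for a
    using assms(2) that by (induction rule: lin_comb_induct) (simp_all add: 1 del: bilinear_ext_simps(7))
  show ?thesis using assms(1)
    by (induction rule: lin_comb_induct) (simp_all add: 2 del: bilinear_ext_simps(7))
qed

lemma stack_beside:
  assumes "Poly_Mapping.keys f \<subseteq> classes A B" "Poly_Mapping.keys g \<subseteq> classes B D"
    "Poly_Mapping.keys f' \<subseteq> classes A' B'" "Poly_Mapping.keys g' \<subseteq> classes B' D'"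
  shows "bilinear_ext (class_stack \<Sigma>) (bilinear_ext (class_beside \<Sigma>) g g') (bilinear_ext (class_beside \<Sigma>) f f') =
    bilinear_ext (class_beside \<Sigma>) (bilinear_ext (class_stack \<Sigma>) g f)
      (bilinear_ext (class_stack \<Sigma>) g' (f' :: _ \<Rightarrow>\<^sub>0 'r::{comm_ring, comm_monoid_mult}))"
proof -
  let ?s = "\<lambda>a. Poly_Mapping.single a (1::'r)"
  let ?S = "bilinear_ext (class_stack \<Sigma>) :: (_ \<Rightarrow>\<^sub>0 'r) \<Rightarrow> _" and ?B = "bilinear_ext (class_beside \<Sigma>) :: (_ \<Rightarrow>\<^sub>0 'r) \<Rightarrow> _"
  have e: "class_stack \<Sigma> (class_beside \<Sigma> b b') (class_beside \<Sigma> a a') = class_beside \<Sigma> (class_stack \<Sigma> b a) (class_stack \<Sigma> b' a')"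
    if "a \<in> classes A B" "b \<in> classes B D" "a' \<in> classes A' B'" "b' \<in> classes B' D'" for a b a' b'
    using that by (auto simp: classes_def class_beside_isotopy_class class_stack_isotopy_class ds_wf isotopy_class_simps(3))
  have 1: "?S (?B (?s b) (?s b')) (?B (?s a) f') = ?B (?S (?s b) (?s a)) (?S (?s b') f')"
    if "a \<in> classes A B" "b \<in> classes B D" "b' \<in> classes B' D'" for a b b'
    using assms(3) that by (induction rule: lin_comb_induct) (simp_all add: e)
  have 2: "?S (?B (?s b) g') (?B (?s a) f') = ?B (?S (?s b) (?s a)) (?S g' f')"
    if "a \<in> classes A B" "b \<in> classes B D" for a b
    using assms(4) that by (induction rule: lin_comb_induct) (simp_all add: 1 del: bilinear_ext_simps(7))
  have 3: "?S (?B (?s b) g') (?B f f') = ?B (?S (?s b) f) (?S g' f')" if "b \<in> classes B D" for b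
    using assms(1) that by (induction rule: lin_comb_induct) (simp_all add: 2 del: bilinear_ext_simps(7))
  show ?thesis using assms(2)
    by (induction rule: lin_comb_induct) (simp_all add: 3 del: bilinear_ext_simps(7))
qed

lemma stack_Strands:
  assumes "Poly_Mapping.keys p \<subseteq> classes A B"
  shows "bilinear_ext (class_stack \<Sigma>) (Poly_Mapping.single (isotopy_class \<Sigma> (Strands B)) 1) p = p"
    and "bilinear_ext (class_stack \<Sigma>) p (Poly_Mapping.single (isotopy_class \<Sigma> (Strands A)) 1) = p"
  using assms
  by (induction rule: lin_comb_induct)
    (auto simp: classes_def class_stack_isotopy_class ds_wf isotopy_class_simps(4,5))

lemma beside_Strands:
  assumes "Poly_Mapping.keys p \<subseteq> classes A B"
  shows "bilinear_ext (class_beside \<Sigma>) (Poly_Mapping.single (isotopy_class \<Sigma> (Strands [])) 1) p = p"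
    and "bilinear_ext (class_beside \<Sigma>) p (Poly_Mapping.single (isotopy_class \<Sigma> (Strands [])) 1) = p"
  using assms
  by (induction rule: lin_comb_induct)
    (auto simp: classes_def class_beside_isotopy_class ds_wf isotopy_class_simps(6,7))

lemma classes_Strands: "A \<in> lists T \<Longrightarrow> isotopy_class \<Sigma> (Strands A) \<in> classes A A"
  unfolding classes_def by (auto intro!: exI[of _ "Strands A"] ds_Strands simp del: in_lists_conv_set)

lemma keys_sum_classes:
  "\<lbrakk>Poly_Mapping.keys p \<subseteq> K; Poly_Mapping.keys q \<subseteq> K\<rbrakk> \<Longrightarrow> Poly_Mapping.keys (p + q) \<subseteq> K"
  by (rule order.trans[OF keys_add]) simp

lemma keys_smul_classes: "Poly_Mapping.keys p \<subseteq> K \<Longrightarrow> Poly_Mapping.keys (smul r p) \<subseteq> K"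
  by (rule order.trans[OF keys_smul])

lemma linear_monoidal_C: "linear_monoidal_category (C :: (_, ('s, 'v, 'r::{comm_ring, comm_monoid_mult}) diag_mor, 'r) rigid_cat)"
proof (unfold_locales, unfold in_Hom_C in_Mor_C)
qed (auto simp: of_diagram_def stack_assoc beside_assoc stack_beside stack_Strands beside_Strands
  keys_stack keys_beside diff_def smul_uminus smul_add keys_sum_classes keys_smul_classes classes_Strands
  class_beside_isotopy_class isotopy_class_simps ac_simps simp del: in_lists_conv_set)

end

context diagram_family
begin

text \<open>The recursive definitions of \<open>caps\<close> and \<open>cups\<close> leave an empty
  word inside the arc and identity strands next to it; bookkeeping isotopies remove both.\<close>

lemma of_diagram_caps_strand: "of_diagram \<Sigma> (caps \<Sigma> [s]) = of_diagram \<Sigma> (Cap s)"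
  and of_diagram_cups_strand: "of_diagram \<Sigma> (cups \<Sigma> [s]) = of_diagram \<Sigma> (Cup s)"
proof -
  have 1: "isotopic \<Sigma> (Beside (Strands []) (Strands [opp \<Sigma> s])) (Strands [opp \<Sigma> s])"
    by (rule iso_Beside_left) simp
  have 2: "isotopic \<Sigma> (Beside (Strands [s]) (Strands [opp \<Sigma> s])) (Strands [s, opp \<Sigma> s])"
    using iso_Strands[of \<Sigma> "[s]" "[opp \<Sigma> s]"] by simp
  have b: "isotopic \<Sigma> (Beside (Strands [s]) (Beside (Strands []) (Strands [opp \<Sigma> s]))) (Strands [s, opp \<Sigma> s])"
    by (rule iso_trans[OF iso_Beside[OF iso_refl 1] 2]) simp
  have "isotopic \<Sigma> (caps \<Sigma> [s]) (Stack (Cap s) (Strands (src \<Sigma> (Cap s))))"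
    using iso_Stack[OF iso_refl b, of "Cap s"] by simp
  then show "of_diagram \<Sigma> (caps \<Sigma> [s]) = of_diagram \<Sigma> (Cap s)"
    by (intro of_diagram_eqI) (rule iso_trans[OF _ iso_Stack_right], simp_all)
  have "isotopic \<Sigma> (cups \<Sigma> [s]) (Stack (Strands (tgt \<Sigma> (Cup s))) (Cup s))"
    using iso_Stack[OF b iso_refl, of "Cup s"] by simp
  then show "of_diagram \<Sigma> (cups \<Sigma> [s]) = of_diagram \<Sigma> (Cup s)"
    by (intro of_diagram_eqI) (rule iso_trans[OF _ iso_Stack_left], simp_all)
qed

lemma word_category_C:
  "word_category (C :: (_, ('s, 'v, 'r::{comm_ring, comm_monoid_mult}) diag_mor, 'r) rigid_cat) T (opp \<Sigma>)"
proof -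
  interpret linear_monoidal_category "C :: (_, ('s, 'v, 'r) diag_mor, 'r) rigid_cat" by (rule linear_monoidal_C)
  have z: "tensor C (evl C [s]) (ide C [s]) = of_diagram \<Sigma> (Beside (Cap s) (Strands [s]))"
    "tensor C (ide C [s]) (evl C [s']) = of_diagram \<Sigma> (Beside (Strands [s]) (Cap s'))"
    "tensor C (coevl C [s]) (ide C [s]) = of_diagram \<Sigma> (Beside (Cup s) (Strands [s]))"
    "tensor C (ide C [s]) (coevl C [s']) = of_diagram \<Sigma> (Beside (Strands [s]) (Cup s'))" for s s'
    unfolding C_fields of_diagram_caps_strand of_diagram_cups_strand by (simp_all add: of_diagram_Beside)
  show ?thesis
  proof
    fix s A assume s: "s \<in> T" and A: "A \<in> lists T"
    show "evl C (s # A) = comp C (evl C [s]) (tensor C (ide C [s]) (tensor C (evl C A) (ide C [opp \<Sigma> s])))"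
      unfolding C_fields of_diagram_caps_strand
      by (simp add: of_diagram_Stack of_diagram_Beside dual_word_def)
    show "coevl C (s # A) = comp C (tensor C (ide C [s]) (tensor C (coevl C A) (ide C [opp \<Sigma> s]))) (coevl C [s])"
      unfolding C_fields of_diagram_cups_strand
      by (simp add: of_diagram_Stack of_diagram_Beside dual_word_def)
  next
    fix s assume s: "s \<in> T"
    show "evl C [s] \<in> Hom C [s, opp \<Sigma> s] []" "coevl C [s] \<in> Hom C [] [s, opp \<Sigma> s]"
      using s of_diagram_Mor[of "Cap s"] of_diagram_Mor[of "Cup s"]
      unfolding C_fields of_diagram_caps_strand of_diagram_cups_strand by simp_all
    have "comp C (of_diagram \<Sigma> (Beside (Cap s) (Strands [s]))) (of_diagram \<Sigma> (Beside (Strands [s]) (Cup (opp \<Sigma> s)))) =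
        of_diagram \<Sigma> (Strands [s])"
      by (subst of_diagram_Stack[symmetric]) (simp_all add: of_diagram_eqI iso_zigzag_left)
    then show "comp C (tensor C (evl C [s]) (ide C [s])) (tensor C (ide C [s]) (coevl C [opp \<Sigma> s])) = ide C [s]"
      unfolding z by simp
    have "comp C (of_diagram \<Sigma> (Beside (Strands [s]) (Cap (opp \<Sigma> s)))) (of_diagram \<Sigma> (Beside (Cup s) (Strands [s]))) =
        of_diagram \<Sigma> (Strands [s])"
      by (subst of_diagram_Stack[symmetric]) (simp_all add: of_diagram_eqI iso_zigzag_right)
    then show "comp C (tensor C (ide C [s]) (evl C [opp \<Sigma> s])) (tensor C (coevl C [s]) (ide C [s])) = ide C [s]"
      unfolding z by simp
  qed (simp_all add: dual_word_def)
qed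

lemma Mor_C_induct [consumes 1, case_names zero diagram scale add]:
  fixes f :: "('s, 'v, 'r::{comm_ring, comm_monoid_mult}) diag_mor"
  assumes "f \<in> Mor C"
    and zero: "\<And>A B. \<lbrakk>A \<in> lists T; B \<in> lists T\<rbrakk> \<Longrightarrow> P (zero C A B)"
    and diagram: "\<And>d. d \<in> ds \<Longrightarrow> P (of_diagram \<Sigma> d)"
    and scale: "\<And>r f. \<lbrakk>f \<in> Mor C; P f\<rbrakk> \<Longrightarrow> P (scale C r f)"
    and add: "\<And>f g. \<lbrakk>f \<in> Mor C; g \<in> Mor C; Src C f = Src C g; Tgt C f = Tgt C g; P f; P g\<rbrakk> \<Longrightarrow> P (add C f g)"
  shows "P f"
proof -
  obtain A B p where f: "f = (A, B, p)" "A \<in> lists T" "B \<in> lists T" "Poly_Mapping.keys p \<subseteq> classes A B"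
    using assms(1) unfolding in_Mor_C by auto
  have "P (A, B, p)" using f(4)
  proof (induction rule: lin_comb_induct)
    case zero then show ?case using assms(2)[of A B] f by simp
  next
    case (single a)
    then obtain d where "a = isotopy_class \<Sigma> d" "d \<in> ds" "src \<Sigma> d = A" "tgt \<Sigma> d = B" by (auto simp: classes_def)
    then show ?case using diagram[of d] by (simp add: of_diagram_def)
  next
    case (smul r p)
    then have "(A, B, p) \<in> Mor C" using f by (auto simp: in_Mor_C)
    from scale[OF this smul(2), of r] show ?case by simp
  next
    case (add p q)
    then have "(A, B, p) \<in> Mor C" "(A, B, q) \<in> Mor C" using f by (auto simp: in_Mor_C)
    from assms(5)[OF this] add show ?case by simp
  qed
  then show ?thesis using f by simp
qed

end

section \<open>The universal property of the category of plane diagrams\<close>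

section \<open>Interpretation of diagrams\<close>

text \<open>The half turn in the direction opposite to \<open>mate\<close>. The two agree for
  morphisms invariant under a full turn, and \<open>iso_turn\<close> imposes this invariance on
  vertices.\<close>

definition comate :: "('o, 'm, 'r, 'x) rigid_cat_scheme \<Rightarrow> 'm \<Rightarrow> 'm" where
  "comate C f = comp C (tensor C (evl C (dual C (Tgt C f))) (ide C (dual C (Src C f))))
     (comp C (tensor C (ide C (dual C (Tgt C f))) (tensor C f (ide C (dual C (Src C f)))))
       (tensor C (ide C (dual C (Tgt C f))) (coevl C (Src C f))))"

text \<open>A strand may be sent to a word of any length and not only to a letter; this is what
  allows an edge labelled 2 to be read as two strands. Apart from typing, \<open>x_turn\<close> is
  the only condition on the images of vertices, as the other isotopies hold in every rigid
  category.\<close>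

locale diagram_interp = D: word_category D T' bar
  for D :: "('t list, 'm, 'r::{comm_ring, comm_monoid_mult}, 'x) rigid_cat_scheme"
    and T' :: "'t set" and bar :: "'t \<Rightarrow> 't" +
  fixes \<Sigma> :: "('s, 'v) signature" and e :: "'s \<Rightarrow> 't list" and x :: "'v \<Rightarrow> 'm"
  assumes opp_opp' [simp]: "opp \<Sigma> (opp \<Sigma> s) = s"
    and e_in [simp]: "e s \<in> lists T'"
    and e_opp [simp]: "e (opp \<Sigma> s) = dual D (e s)"
    and x_in: "x v \<in> Hom D (concat (map e (node_src \<Sigma> v))) (concat (map e (node_tgt \<Sigma> v)))"
    and x_turn: "mate D (x v) = comate D (x v)"
begin

abbreviation E :: "'s list \<Rightarrow> 't list" where "E w \<equiv> concat (map e w)"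

primrec itp :: "('s, 'v) diagram \<Rightarrow> 'm" where
  "itp (Strands w) = ide D (E w)"
| "itp (Cup s) = coevl D (e s)"
| "itp (Cap s) = evl D (e s)"
| "itp (Node v) = x v"
| "itp (Stack g f) = comp D (itp g) (itp f)"
| "itp (Beside f g) = tensor D (itp f) (itp g)"

lemma E_in [simp]: "E w \<in> lists T'"
  by (induction w) auto

lemma E_dual_word [simp]: "E (dual_word \<Sigma> w) = dual D (E w)"
  by (induction w) (simp_all add: dual_word_def)

lemma itp_Mor [simp]:
  "wf_diagram \<Sigma> d \<Longrightarrow> itp d \<in> Mor D"
  "wf_diagram \<Sigma> d \<Longrightarrow> Src D (itp d) = E (src \<Sigma> d)"
  "wf_diagram \<Sigma> d \<Longrightarrow> Tgt D (itp d) = E (tgt \<Sigma> d)"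
  by (induction d) (simp_all add: HomD[OF x_in])

lemma itp_caps [simp]: "itp (caps \<Sigma> w) = evl D (E w)"
  by (induction w) (simp_all add: D.evl_append)

lemma itp_cups [simp]: "itp (cups \<Sigma> w) = coevl D (E w)"
  by (induction w) (simp_all add: D.coevl_append)

sublocale diagram_family \<Sigma> UNIV "{d. wf_diagram \<Sigma> d}"
  by unfold_locales auto

text \<open>Straightening a strand calls for the zigzag identities of words, because a strand is
  read as a word; the full turn of a vertex is \<open>x_turn\<close>.\<close>

lemma itp_isotopic: "isotopic \<Sigma> d d' \<Longrightarrow> itp d = itp d'"
proof (induction rule: isotopic.induct)
  case (iso_Stack g g' f f')
  then show ?case by simp
next
  case (iso_interchange g f g' f')
  then show ?case by (simp add: D.interchange')
next
  case (iso_zigzag_left s)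
  then show ?case using D.word_zigzag_left[of "e s"] by simp
next
  case (iso_zigzag_right s)
  then show ?case using D.word_zigzag_right[of "e s"] by simp
next
  case (iso_turn v)
  then show ?case using x_turn[of v]
    by (simp add: turn_right_def turn_left_def Let_def mate_def comate_def HomD[OF x_in])
qed simp_all

end

locale diagram_functor = S: diagram_family \<Sigma> T ds + D: diagram_family \<Sigma>' T' ds' +
  diagram_interp D.C T' "opp \<Sigma>'" \<Sigma> e x
  for \<Sigma> :: "('s, 'v) signature" and T ds and \<Sigma>' :: "('t, 'w) signature" and T' ds'
    and e :: "'s \<Rightarrow> 't list" and x :: "'v \<Rightarrow> ('t, 'w, 'r::{comm_ring, comm_monoid_mult}) diag_mor"
begin

text \<open>The linear part of the interpretation of one class. Morphisms are triples whose ends are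
  known from the diagram, so only this component has to be extended linearly.\<close>

definition coeffs :: "('s, 'v) diagram set \<Rightarrow> (('t, 'w) diagram set \<Rightarrow>\<^sub>0 'r)" where
  "coeffs K = snd (snd (itp (SOME d. d \<in> K)))"

definition Fun :: "('s list, ('s, 'v, 'r) diag_mor, 't list, ('t, 'w, 'r) diag_mor) cat_map" where
  "Fun = \<lparr>on_obj = E, on_mor = (\<lambda>(A, B, p). (E A, E B, lin coeffs p))\<rparr>"

lemma coeffs_class:
  assumes "wf_diagram \<Sigma> d"
  shows "itp d = (E (src \<Sigma> d), E (tgt \<Sigma> d), coeffs (isotopy_class \<Sigma> d))"
proof -
  have "(SOME d'. d' \<in> isotopy_class \<Sigma> d) \<in> isotopy_class \<Sigma> d"
    using assms by (rule_tac someI[of _ d]) (simp add: isotopy_class_def iso_refl)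
  then have "itp (SOME d'. d' \<in> isotopy_class \<Sigma> d) = itp d"
    using itp_isotopic by (simp add: isotopy_class_def)
  moreover have "itp d \<in> Hom D.C (E (src \<Sigma> d)) (E (tgt \<Sigma> d))" using assms by (simp add: Hom_def del: D.C_fields)
  ultimately show ?thesis by (auto simp: coeffs_def D.in_Hom_C)
qed

lemma Fun_diagram: "wf_diagram \<Sigma> d \<Longrightarrow> on_mor Fun (of_diagram \<Sigma> d) = itp d"
  by (simp add: Fun_def of_diagram_def coeffs_class)

lemma coeffs_keys: "K \<in> S.classes A B \<Longrightarrow> Poly_Mapping.keys (coeffs K) \<subseteq> D.classes (E A) (E B)"
proof -
  assume "K \<in> S.classes A B"
  then obtain d where d: "K = isotopy_class \<Sigma> d" "wf_diagram \<Sigma> d" "src \<Sigma> d = A" "tgt \<Sigma> d = B"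
    using S.ds_wf by (auto simp: S.classes_def)
  then have "itp d \<in> Hom D.C (E A) (E B)" by (simp add: Hom_def del: D.C_fields)
  then show ?thesis unfolding coeffs_class[OF d(2)] using d by (simp add: D.in_Hom_C)
qed

lemma coeffs_stack:
  assumes "b \<in> S.classes B G" "a \<in> S.classes A B"
  shows "coeffs (class_stack \<Sigma> b a) = bilinear_ext (class_stack \<Sigma>') (coeffs b) (coeffs a)"
proof -
  obtain d d' where "b = isotopy_class \<Sigma> d" "a = isotopy_class \<Sigma> d'" "wf_diagram \<Sigma> d" "wf_diagram \<Sigma> d'" "src \<Sigma> d = tgt \<Sigma> d'"
    using assms S.ds_wf by (auto simp: S.classes_def)
  moreover from this have "itp (Stack d d') = comp D.C (itp d) (itp d')" by simp
  ultimately show ?thesis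
    by (simp add: S.class_stack_isotopy_class coeffs_class del: itp.simps)
qed

lemma coeffs_beside:
  assumes "a \<in> S.classes A B" "b \<in> S.classes A' B'"
  shows "coeffs (class_beside \<Sigma> a b) = bilinear_ext (class_beside \<Sigma>') (coeffs a) (coeffs b)"
proof -
  obtain d d' where "a = isotopy_class \<Sigma> d" "b = isotopy_class \<Sigma> d'" "wf_diagram \<Sigma> d" "wf_diagram \<Sigma> d'"
    using assms S.ds_wf by (auto simp: S.classes_def)
  moreover from this have "itp (Beside d d') = tensor D.C (itp d) (itp d')" by simp
  ultimately show ?thesis
    by (simp add: S.class_beside_isotopy_class coeffs_class del: itp.simps)
qed

lemma lin_coeffs_stack:
  assumes "Poly_Mapping.keys q \<subseteq> S.classes B G" "Poly_Mapping.keys p \<subseteq> S.classes A B"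
  shows "lin coeffs (bilinear_ext (class_stack \<Sigma>) q p) =
    bilinear_ext (class_stack \<Sigma>') (lin coeffs q) (lin coeffs p)"
proof -
  have l: "lin coeffs (bilinear_ext (class_stack \<Sigma>) (Poly_Mapping.single b 1) p) =
      bilinear_ext (class_stack \<Sigma>') (coeffs b) (lin coeffs p)" if "b \<in> S.classes B G" for b
    using assms(2) by (induction rule: lin_comb_induct) (simp_all add: coeffs_stack[OF that])
  show ?thesis using assms(1) by (induction rule: lin_comb_induct) (simp_all add: l)
qed

lemma lin_coeffs_beside:
  assumes "Poly_Mapping.keys p \<subseteq> S.classes A B" "Poly_Mapping.keys q \<subseteq> S.classes A' B'"
  shows "lin coeffs (bilinear_ext (class_beside \<Sigma>) p q) =
    bilinear_ext (class_beside \<Sigma>') (lin coeffs p) (lin coeffs q)"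
proof -
  have l: "lin coeffs (bilinear_ext (class_beside \<Sigma>) (Poly_Mapping.single b 1) q) =
      bilinear_ext (class_beside \<Sigma>') (coeffs b) (lin coeffs q)" if "b \<in> S.classes A B" for b
    using assms(2) by (induction rule: lin_comb_induct) (simp_all add: coeffs_beside[OF that])
  show ?thesis using assms(1) by (induction rule: lin_comb_induct) (simp_all add: l)
qed

lemma Fun_Hom: "f \<in> Hom S.C A B \<Longrightarrow> on_mor Fun f \<in> Hom D.C (E A) (E B)"
proof -
  assume "f \<in> Hom S.C A B"
  then obtain p where p: "f = (A, B, p)" "Poly_Mapping.keys p \<subseteq> S.classes A B" by (auto simp: S.in_Hom_C)
  have "Poly_Mapping.keys (lin coeffs p) \<subseteq> D.classes (E A) (E B)"
    by (rule order.trans[OF keys_lin]) (use p coeffs_keys in blast)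
  then show ?thesis using p by (simp add: D.in_Hom_C Fun_def)
qed

text \<open>An interpretation of strands and vertices that is invariant under turning extends
  linearly to a rigid functor. It is evaluated on all well-formed diagrams, so isotopies leaving
  \<open>ds\<close> cause no ambiguity.\<close>

lemma rigid_functor_Fun: "rigid_functor S.C D.C Fun"
proof -
  interpret S': word_category "S.C :: (_, ('s, 'v, 'r) diag_mor, 'r) rigid_cat" T "opp \<Sigma>"
    by (rule S.word_category_C)
  have "rigid_monoidal_functor S.C D.C Fun"
    unfolding rigid_monoidal_functor_def
  proof (intro conjI ballI allI impI)
    show "on_mor Fun f \<in> Hom D.C (on_obj Fun (Src S.C f)) (on_obj Fun (Tgt S.C f))" if "f \<in> Mor S.C" for f
      using Fun_Hom[of f "Src S.C f" "Tgt S.C f"] that by (simp add: Hom_def Fun_def)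
    show "on_mor Fun (comp S.C g f) = comp D.C (on_mor Fun g) (on_mor Fun f)"
      if "f \<in> Mor S.C" "g \<in> Mor S.C" "Src S.C g = Tgt S.C f" for f g
      using that by (auto simp: S.in_Mor_C Fun_def lin_coeffs_stack)
    show "on_mor Fun (tensor S.C f g) = tensor D.C (on_mor Fun f) (on_mor Fun g)"
      if "f \<in> Mor S.C" "g \<in> Mor S.C" for f g
      using that by (auto simp: S.in_Mor_C Fun_def lin_coeffs_beside)
    show "on_mor Fun (ide S.C A) = ide D.C (on_obj Fun A)" if "A \<in> Obj S.C" for A
      using Fun_diagram[of "Strands A"] by (simp add: Fun_def)
    show "on_mor Fun (evl S.C A) = evl D.C (on_obj Fun A)" if "A \<in> Obj S.C" for A
      using Fun_diagram[of "caps \<Sigma> A"] by (simp add: Fun_def)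
    show "on_mor Fun (coevl S.C A) = coevl D.C (on_obj Fun A)" if "A \<in> Obj S.C" for A
      using Fun_diagram[of "cups \<Sigma> A"] by (simp add: Fun_def)
  qed (auto simp: Fun_def S.in_Mor_C simp del: in_lists_conv_set)
  then show ?thesis by unfold_locales
qed

end

section \<open>Quarter turns and the crossings of all orientations\<close>

section \<open>Crossings of strands\<close>

lemma reverse_reverse [simp]: "reverse (reverse a) = a"
  by (cases a) simp_all

context linear_monoidal_category
begin

text \<open>Composites are bracketed to the right, so an equation between two-fold composites does
  not match inside a longer chain. These two rules attach the remaining tail \<open>t\<close>;
  \<open>reassoc1\<close> serves composites that collapse to one morphism.\<close>

lemma reassoc:
  "\<lbrakk>g \<cdot> f = g' \<cdot> f'; f \<in> Mor C; g \<in> Mor C; Src C g = Tgt C f; f' \<in> Mor C; g' \<in> Mor C; Src C g' = Tgt C f';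
    t \<in> Mor C; Tgt C t = Src C f; Src C f' = Src C f\<rbrakk> \<Longrightarrow> g \<cdot> (f \<cdot> t) = g' \<cdot> (f' \<cdot> t)"
  by (metis comp_assoc')

lemma reassoc1:
  "\<lbrakk>g \<cdot> f = h; f \<in> Mor C; g \<in> Mor C; Src C g = Tgt C f; t \<in> Mor C; Tgt C t = Src C f\<rbrakk> \<Longrightarrow>
    g \<cdot> (f \<cdot> t) = h \<cdot> t"
  by (metis comp_assoc')

end

text \<open>Only the two crossings of upward strands are given, and \<open>crossing\<close> turns
  the others out of them. \<open>e\<close> embeds orientations into letters and \<open>d\<close>
  reads them back. By \<open>p_turn\<close> and \<open>m_turn\<close> a half turn of either crossing
  does not depend on its direction.\<close>

locale crossing_category = word_category C T bar
  for C :: "('s list, 'm, 'r::{comm_ring, comm_monoid_mult}, 'x) rigid_cat_scheme" (structure)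
    and T :: "'s set" and bar :: "'s \<Rightarrow> 's" +
  fixes e :: "ori \<Rightarrow> 's" and d :: "'s \<Rightarrow> ori" and p m :: 'm
  assumes d_e [simp]: "d (e a) = a"
    and T_range: "T = range e"
    and bar_e [simp]: "bar (e a) = e (reverse a)"
    and p_in: "p \<in> Hom C [e Up, e Up] [e Up, e Up]"
    and m_in: "m \<in> Hom C [e Up, e Up] [e Up, e Up]"
    and p_turn: "mate C p = comate C p"
    and m_turn: "mate C m = comate C m"
begin

abbreviation cap :: "ori \<Rightarrow> 'm" ("\<epsilon>") where "\<epsilon> a \<equiv> evl C [e a]"
abbreviation cup :: "ori \<Rightarrow> 'm" ("\<eta>") where "\<eta> a \<equiv> coevl C [e a]"
abbreviation X :: "bool \<Rightarrow> ori \<Rightarrow> ori \<Rightarrow> 'm" where "X over a b \<equiv> crossing C e p m over a b"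

lemma e_in [simp]: "e a \<in> T" by (simp add: T_range)

lemma zigzag_ctx:
  assumes "U \<in> lists T" "W \<in> lists T"
  shows "(\<langle>U\<rangle> \<otimes> \<epsilon> a \<otimes> \<langle>e a # W\<rangle>) \<cdot> (\<langle>U @ [e a]\<rangle> \<otimes> \<eta> (reverse a) \<otimes> \<langle>W\<rangle>) = \<langle>U @ [e a] @ W\<rangle>"
    and "(\<langle>U @ [e a]\<rangle> \<otimes> \<epsilon> (reverse a) \<otimes> \<langle>W\<rangle>) \<cdot> (\<langle>U\<rangle> \<otimes> \<eta> a \<otimes> \<langle>e a # W\<rangle>) = \<langle>U @ [e a] @ W\<rangle>"
proof -
  have "\<langle>U @ [e a] @ W\<rangle> = \<langle>U\<rangle> \<otimes> \<langle>[e a]\<rangle> \<otimes> \<langle>W\<rangle>" using assms by simp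
  also have "\<dots> = \<langle>U\<rangle> \<otimes> ((\<epsilon> a \<otimes> \<langle>[e a]\<rangle>) \<cdot> (\<langle>[e a]\<rangle> \<otimes> \<eta> (reverse a))) \<otimes> \<langle>W\<rangle>"
    using strand_zigzag_left[of "e a"] by simp
  finally show "(\<langle>U\<rangle> \<otimes> \<epsilon> a \<otimes> \<langle>e a # W\<rangle>) \<cdot> (\<langle>U @ [e a]\<rangle> \<otimes> \<eta> (reverse a) \<otimes> \<langle>W\<rangle>) = \<langle>U @ [e a] @ W\<rangle>"
    using assms by (simp add: ide_tensor_comp comp_tensor_ide)
  have "\<langle>U @ [e a] @ W\<rangle> = \<langle>U\<rangle> \<otimes> \<langle>[e a]\<rangle> \<otimes> \<langle>W\<rangle>" using assms by simp
  also have "\<dots> = \<langle>U\<rangle> \<otimes> ((\<langle>[e a]\<rangle> \<otimes> \<epsilon> (reverse a)) \<cdot> (\<eta> a \<otimes> \<langle>[e a]\<rangle>)) \<otimes> \<langle>W\<rangle>"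
    using strand_zigzag_right[of "e a"] by simp
  finally show "(\<langle>U @ [e a]\<rangle> \<otimes> \<epsilon> (reverse a) \<otimes> \<langle>W\<rangle>) \<cdot> (\<langle>U\<rangle> \<otimes> \<eta> a \<otimes> \<langle>e a # W\<rangle>) = \<langle>U @ [e a] @ W\<rangle>"
    using assms by (simp add: ide_tensor_comp comp_tensor_ide)
qed

text \<open>Quarter turns of \<open>c : a b \<rightarrow> g h\<close>.\<close>

definition L :: "ori \<Rightarrow> ori \<Rightarrow> ori \<Rightarrow> ori \<Rightarrow> 'm \<Rightarrow> 'm" where
  "L a b g h c = (\<epsilon> (reverse g) \<otimes> \<langle>[e h, e (reverse b)]\<rangle>) \<cdot>
    (\<langle>[e (reverse g)]\<rangle> \<otimes> c \<otimes> \<langle>[e (reverse b)]\<rangle>) \<cdot> (\<langle>[e (reverse g), e a]\<rangle> \<otimes> \<eta> b)"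

definition R :: "ori \<Rightarrow> ori \<Rightarrow> ori \<Rightarrow> ori \<Rightarrow> 'm \<Rightarrow> 'm" where
  "R a b g h c = (\<langle>[e (reverse a), e g]\<rangle> \<otimes> \<epsilon> h) \<cdot>
    (\<langle>[e (reverse a)]\<rangle> \<otimes> c \<otimes> \<langle>[e (reverse h)]\<rangle>) \<cdot> (\<eta> (reverse a) \<otimes> \<langle>[e b, e (reverse h)]\<rangle>)"

lemma L_Mor [simp]:
  assumes "c \<in> Hom C [e a, e b] [e g, e h]"
  shows "L a b g h c \<in> Mor C" "Src C (L a b g h c) = [e (reverse g), e a]"
    "Tgt C (L a b g h c) = [e h, e (reverse b)]"
  using HomD[OF assms] by (simp_all add: L_def)

lemma R_Mor [simp]:
  assumes "c \<in> Hom C [e a, e b] [e g, e h]"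
  shows "R a b g h c \<in> Mor C" "Src C (R a b g h c) = [e b, e (reverse h)]"
    "Tgt C (R a b g h c) = [e (reverse a), e g]"
  using HomD[OF assms] by (simp_all add: R_def)

text \<open>Two strands are bent by the counterclockwise turn and bent back by the clockwise one.
  The new arcs slide past \<open>c\<close>, and each double bend is straightened by a zigzag. In
  particular \<open>L\<close> is injective, which is used to transport relations.\<close>

lemma R_L:
  assumes "c \<in> Hom C [e a, e b] [e g, e h]"
  shows "R (reverse g) a h (reverse b) (L a b g h c) = c"
proof -
  note c [simp] = HomD[OF assms]
  have s1: "(\<langle>[e g, e (reverse g), e a]\<rangle> \<otimes> \<eta> b \<otimes> \<langle>[e b]\<rangle>) \<cdot> (\<eta> g \<otimes> \<langle>[e a, e b]\<rangle>) =
      (\<eta> g \<otimes> \<langle>[e a, e b, e (reverse b), e b]\<rangle>) \<cdot> (\<langle>[e a]\<rangle> \<otimes> \<eta> b \<otimes> \<langle>[e b]\<rangle>)"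
    using slide_ctx[of "\<eta> g" "\<eta> b" "[]" "[e g, e (reverse g)]" "[]" "[e b, e (reverse b)]" "[]" "[e a]" "[e b]"]
    by simp
  have s2: "(\<langle>[e g, e (reverse g)]\<rangle> \<otimes> c \<otimes> \<langle>[e (reverse b), e b]\<rangle>) \<cdot> (\<eta> g \<otimes> \<langle>[e a, e b, e (reverse b), e b]\<rangle>) =
      (\<eta> g \<otimes> \<langle>[e g, e h, e (reverse b), e b]\<rangle>) \<cdot> (c \<otimes> \<langle>[e (reverse b), e b]\<rangle>)"
    using slide_ctx[of "\<eta> g" c "[]" "[e g, e (reverse g)]" "[e a, e b]" "[e g, e h]" "[]" "[]" "[e (reverse b), e b]"]
    by simp
  have s3: "(\<langle>[e g]\<rangle> \<otimes> \<epsilon> (reverse g) \<otimes> \<langle>[e h, e (reverse b), e b]\<rangle>) \<cdot> (\<eta> g \<otimes> \<langle>[e g, e h, e (reverse b), e b]\<rangle>) =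
      \<langle>[e g, e h, e (reverse b), e b]\<rangle>"
    using zigzag_ctx(2)[of "[]" "[e h, e (reverse b), e b]" g] by simp
  have s4: "(\<langle>[e g, e h]\<rangle> \<otimes> \<epsilon> (reverse b)) \<cdot> (c \<otimes> \<langle>[e (reverse b), e b]\<rangle>) = c \<cdot> (\<langle>[e a, e b]\<rangle> \<otimes> \<epsilon> (reverse b))"
    using slide_ctx[of c "\<epsilon> (reverse b)" "[e a, e b]" "[e g, e h]" "[e (reverse b), e b]" "[]" "[]" "[]" "[]"] by simp
  have s5: "(\<langle>[e a, e b]\<rangle> \<otimes> \<epsilon> (reverse b)) \<cdot> (\<langle>[e a]\<rangle> \<otimes> \<eta> b \<otimes> \<langle>[e b]\<rangle>) = \<langle>[e a, e b]\<rangle>"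
    using zigzag_ctx(2)[of "[e a]" "[]" b] by simp
  have "R (reverse g) a h (reverse b) (L a b g h c) =
     (\<langle>[e g, e h]\<rangle> \<otimes> \<epsilon> (reverse b)) \<cdot> (\<langle>[e g]\<rangle> \<otimes> \<epsilon> (reverse g) \<otimes> \<langle>[e h, e (reverse b), e b]\<rangle>) \<cdot>
     (\<langle>[e g, e (reverse g)]\<rangle> \<otimes> c \<otimes> \<langle>[e (reverse b), e b]\<rangle>) \<cdot>
     (\<langle>[e g, e (reverse g), e a]\<rangle> \<otimes> \<eta> b \<otimes> \<langle>[e b]\<rangle>) \<cdot> (\<eta> g \<otimes> \<langle>[e a, e b]\<rangle>)"
    by (simp add: R_def L_def ide_tensor_comp comp_tensor_ide)
  also have "\<dots> = c"
    by (simp add: s1 s2[THEN reassoc] s3[THEN reassoc1] s4[THEN reassoc] s5)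
  finally show ?thesis .
qed

lemma L_R:
  assumes "c \<in> Hom C [e a, e b] [e g, e h]"
  shows "L b (reverse h) (reverse a) g (R a b g h c) = c"
proof -
  note c [simp] = HomD[OF assms]
  have s1: "(\<langle>[e a]\<rangle> \<otimes> \<eta> (reverse a) \<otimes> \<langle>[e b, e (reverse h), e h]\<rangle>) \<cdot> (\<langle>[e a, e b]\<rangle> \<otimes> \<eta> (reverse h)) =
      (\<langle>[e a, e (reverse a), e a, e b]\<rangle> \<otimes> \<eta> (reverse h)) \<cdot> (\<langle>[e a]\<rangle> \<otimes> \<eta> (reverse a) \<otimes> \<langle>[e b]\<rangle>)"
    using slide_ctx[of "\<eta> (reverse a)" "\<eta> (reverse h)" "[]" "[e (reverse a), e a]" "[]" "[e (reverse h), e h]" "[e a]" "[e b]" "[]"]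
    by simp
  have s2: "(\<langle>[e a, e (reverse a)]\<rangle> \<otimes> c \<otimes> \<langle>[e (reverse h), e h]\<rangle>) \<cdot> (\<langle>[e a, e (reverse a), e a, e b]\<rangle> \<otimes> \<eta> (reverse h)) =
      (\<langle>[e a, e (reverse a), e g, e h]\<rangle> \<otimes> \<eta> (reverse h)) \<cdot> (\<langle>[e a, e (reverse a)]\<rangle> \<otimes> c)"
    using slide_ctx[of c "\<eta> (reverse h)" "[e a, e b]" "[e g, e h]" "[]" "[e (reverse h), e h]" "[e a, e (reverse a)]" "[]" "[]"]
    by simp
  have s3: "(\<langle>[e a, e (reverse a), e g]\<rangle> \<otimes> \<epsilon> h \<otimes> \<langle>[e h]\<rangle>) \<cdot> (\<langle>[e a, e (reverse a), e g, e h]\<rangle> \<otimes> \<eta> (reverse h)) =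
      \<langle>[e a, e (reverse a), e g, e h]\<rangle>"
    using zigzag_ctx(1)[of "[e a, e (reverse a), e g]" "[]" h] by simp
  have s4: "(\<epsilon> a \<otimes> \<langle>[e g, e h]\<rangle>) \<cdot> (\<langle>[e a, e (reverse a)]\<rangle> \<otimes> c) = c \<cdot> (\<epsilon> a \<otimes> \<langle>[e a, e b]\<rangle>)"
    using slide_ctx[of "\<epsilon> a" c "[e a, e (reverse a)]" "[]" "[e a, e b]" "[e g, e h]" "[]" "[]" "[]"] by simp
  have s5: "(\<epsilon> a \<otimes> \<langle>[e a, e b]\<rangle>) \<cdot> (\<langle>[e a]\<rangle> \<otimes> \<eta> (reverse a) \<otimes> \<langle>[e b]\<rangle>) = \<langle>[e a, e b]\<rangle>"
    using zigzag_ctx(1)[of "[]" "[e b]" a] by simp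
  have "L b (reverse h) (reverse a) g (R a b g h c) =
     (\<epsilon> a \<otimes> \<langle>[e g, e h]\<rangle>) \<cdot> (\<langle>[e a, e (reverse a), e g]\<rangle> \<otimes> \<epsilon> h \<otimes> \<langle>[e h]\<rangle>) \<cdot>
     (\<langle>[e a, e (reverse a)]\<rangle> \<otimes> c \<otimes> \<langle>[e (reverse h), e h]\<rangle>) \<cdot>
     (\<langle>[e a]\<rangle> \<otimes> \<eta> (reverse a) \<otimes> \<langle>[e b, e (reverse h), e h]\<rangle>) \<cdot> (\<langle>[e a, e b]\<rangle> \<otimes> \<eta> (reverse h))"
    by (simp add: R_def L_def ide_tensor_comp comp_tensor_ide)
  also have "\<dots> = c"
    by (simp add: s1 s2[THEN reassoc] s3[THEN reassoc1] s4[THEN reassoc] s5)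
  finally show ?thesis .
qed

text \<open>The arcs of a two-letter word are nested, one for each quarter turn, so a half turn is
  two quarter turns in the same direction. \<open>mate_R\<close> is the mirror image.\<close>

lemma comate_L:
  assumes "c \<in> Hom C [e a, e b] [e g, e h]"
  shows "comate C c = L (reverse g) a h (reverse b) (L a b g h c)"
proof -
  note c [simp] = HomD[OF assms]
  show ?thesis
    using evl_Cons[of "e (reverse h)" "[e (reverse g)]"] coevl_Cons[of "e a" "[e b]"]
    by (simp add: comate_def L_def ide_tensor_comp comp_tensor_ide)
qed

lemma mate_R:
  assumes "c \<in> Hom C [e a, e b] [e g, e h]"
  shows "mate C c = R b (reverse h) (reverse a) g (R a b g h c)"
proof -
  note c [simp] = HomD[OF assms]
  show ?thesis
    using evl_Cons[of "e g" "[e h]"] coevl_Cons[of "e (reverse b)" "[e (reverse a)]"]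
    by (simp add: mate_def R_def ide_tensor_comp comp_tensor_ide)
qed

lemma pm_in: "(if over then p else m) \<in> Hom C [e Up, e Up] [e Up, e Up]"
  using p_in m_in by simp

lemma pm_turn: "mate C (if over then p else m) = comate C (if over then p else m)"
  using p_turn m_turn by simp

lemma X_simps:
  "X over Up Up = (if over then p else m)"
  "X over Down Up = L Up Up Up Up (X (\<not> over) Up Up)"
  "X over Up Down = R Up Up Up Up (X (\<not> over) Up Up)"
  "X over Down Down = mate C (X over Up Up)"
  by (simp_all add: crossing_def L_def R_def Let_def)

text \<open>By definition this crossing is a \<open>mate\<close>, hence two clockwise turns;
  invariance under a full turn makes it two counterclockwise turns as well. So it is one quarter
  turn away from either antiparallel crossing.\<close>

lemma X_down_down: "X over Down Down = L Down Up Up Down (X (\<not> over) Down Up)"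
  "X over Down Down = R Up Down Down Up (X (\<not> over) Up Down)"
  using comate_L[OF pm_in] mate_R[OF pm_in] pm_turn by (simp_all add: X_simps)

lemma X_in: "X over a b \<in> Hom C [e a, e b] [e b, e a]"
proof -
  have "L Up Up Up Up (X over' Up Up) \<in> Hom C [e Down, e Up] [e Up, e Down]" for over'
    using L_Mor[OF pm_in] by (simp add: X_simps(1) Hom_def)
  moreover have "R Up Up Up Up (X over' Up Up) \<in> Hom C [e Up, e Down] [e Down, e Up]" for over'
    using R_Mor[OF pm_in] by (simp add: X_simps(1) Hom_def)
  ultimately show ?thesis
    using L_Mor[of "X (\<not> over) Down Up" Down Up Up Down] pm_in
    by (cases a; cases b) (simp_all add: X_simps(1-3) X_down_down(1) Hom_def)
qed

lemma X_Mor [simp]: "X over a b \<in> Mor C" "Src C (X over a b) = [e a, e b]" "Tgt C (X over a b) = [e b, e a]"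
  using HomD[OF X_in] by simp_all

text \<open>A counterclockwise turn runs through the four pairs of orientations in a cycle and
  exchanges the over-strand at each step. Two steps of the cycle are read off the formulas for the
  crossings, the other two undo a clockwise turn.\<close>

lemma X_L: "L a b b a (X over a b) = X (\<not> over) (reverse b) a"
proof (cases a; cases b)
  assume "a = Up" "b = Down"
  then show ?thesis using L_R[OF X_in[of "\<not> over" Up Up]] by (simp add: X_simps(3))
next
  assume "a = Down" "b = Down"
  then show ?thesis using L_R[OF X_in[of "\<not> over" Up Down]] by (simp add: X_down_down(2))
qed (simp_all add: X_simps(2) X_down_down(1))

end

section \<open>Naturality along one strand, and reduction of the third move to a single case\<close>

section \<open>Sliding strands over morphisms\<close>

context crossing_category
begin

abbreviation x :: "bool \<Rightarrow> 's \<Rightarrow> 's \<Rightarrow> 'm" where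
  "x over s t \<equiv> X over (d s) (d t)"

text \<open>The strand of orientation \<open>c\<close> starts to the left of the word and ends to
  its right; \<open>over\<close> says whether it lies above or below all letters.\<close>

abbreviation sow :: "bool \<Rightarrow> ori \<Rightarrow> 's list \<Rightarrow> 'm" where
  "sow over c A \<equiv> strand_over_word C (x over) (e c) A"

lemma e_d [simp]: "s \<in> T \<Longrightarrow> e (d s) = s"
  by (auto simp: T_range)

lemma sow_Mor [simp]:
  "A \<in> lists T \<Longrightarrow> sow over c A \<in> Mor C"
  "A \<in> lists T \<Longrightarrow> Src C (sow over c A) = e c # A"
  "A \<in> lists T \<Longrightarrow> Tgt C (sow over c A) = A @ [e c]"
  by (induction A) simp_all

lemma sow_append:
  assumes "A \<in> lists T" "B \<in> lists T"
  shows "sow over c (A @ B) = (\<langle>A\<rangle> \<otimes> sow over c B) \<cdot> (sow over c A \<otimes> \<langle>B\<rangle>)"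
  using assms(1)
proof (induction A)
  case (Cons s A)
  then have A: "s \<in> T" "A \<in> lists T" by simp_all
  show ?case using Cons.IH A assms(2) by (simp add: ide_tensor_comp comp_tensor_ide)
qed (use assms in simp)

text \<open>Naturality of the passage of one strand, at the single morphism \<open>f\<close>. The
  morphisms with this property are closed under the linear and monoidal operations and under
  inverses, so it has to be checked on generators only.\<close>

definition slides :: "bool \<Rightarrow> ori \<Rightarrow> 'm \<Rightarrow> bool" where
  "slides over c f \<longleftrightarrow>
    sow over c (Tgt C f) \<cdot> (\<langle>[e c]\<rangle> \<otimes> f) = (f \<otimes> \<langle>[e c]\<rangle>) \<cdot> sow over c (Src C f)"

lemma slides_ide: "A \<in> lists T \<Longrightarrow> slides over c \<langle>A\<rangle>"
  by (simp add: slides_def)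

lemma slides_comp:
  assumes "slides over c f" "slides over c g" and [simp]: "f \<in> Mor C" "g \<in> Mor C" "Src C g = Tgt C f"
  shows "slides over c (g \<cdot> f)"
proof -
  have "sow over c (Tgt C g) \<cdot> (\<langle>[e c]\<rangle> \<otimes> (g \<cdot> f)) =
      (sow over c (Tgt C g) \<cdot> (\<langle>[e c]\<rangle> \<otimes> g)) \<cdot> (\<langle>[e c]\<rangle> \<otimes> f)"
    by (simp add: ide_tensor_comp)
  also have "\<dots> = (g \<otimes> \<langle>[e c]\<rangle>) \<cdot> (sow over c (Tgt C f) \<cdot> (\<langle>[e c]\<rangle> \<otimes> f))"
    using assms(2) by (simp add: slides_def)
  also have "\<dots> = ((g \<cdot> f) \<otimes> \<langle>[e c]\<rangle>) \<cdot> sow over c (Src C f)"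
    using assms(1) by (simp add: slides_def comp_tensor_ide)
  finally show ?thesis by (simp add: slides_def)
qed

lemma slides_tensor:
  assumes "slides over c f" "slides over c g" and [simp]: "f \<in> Mor C" "g \<in> Mor C"
  shows "slides over c (f \<otimes> g)"
proof -
  let ?A = "Src C f" and ?A' = "Tgt C f" and ?B = "Src C g" and ?B' = "Tgt C g"
  have "sow over c (?A' @ ?B') \<cdot> (\<langle>[e c]\<rangle> \<otimes> f \<otimes> g) =
      (\<langle>?A'\<rangle> \<otimes> sow over c ?B') \<cdot> ((sow over c ?A' \<cdot> (\<langle>[e c]\<rangle> \<otimes> f)) \<otimes> g)"
    using interchange'[of "\<langle>[e c]\<rangle> \<otimes> f" "sow over c ?A'" g "\<langle>?B'\<rangle>"] by (simp add: sow_append)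
  also have "\<dots> = (\<langle>?A'\<rangle> \<otimes> sow over c ?B') \<cdot> (f \<otimes> \<langle>[e c]\<rangle> \<otimes> g) \<cdot> (sow over c ?A \<otimes> \<langle>?B\<rangle>)"
    using assms(1) interchange'[of "sow over c ?A" "f \<otimes> \<langle>[e c]\<rangle>" "\<langle>?B\<rangle>" g] by (simp add: slides_def)
  also have "\<dots> = ((\<langle>?A'\<rangle> \<otimes> sow over c ?B') \<cdot> (f \<otimes> (\<langle>[e c]\<rangle> \<otimes> g))) \<cdot> (sow over c ?A \<otimes> \<langle>?B\<rangle>)"
    by simp
  also have "(\<langle>?A'\<rangle> \<otimes> sow over c ?B') \<cdot> (f \<otimes> (\<langle>[e c]\<rangle> \<otimes> g)) = (f \<otimes> g \<otimes> \<langle>[e c]\<rangle>) \<cdot> (\<langle>?A\<rangle> \<otimes> sow over c ?B)"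
    using assms(2) interchange'[of f "\<langle>?A'\<rangle>" "\<langle>[e c]\<rangle> \<otimes> g" "sow over c ?B'"]
      interchange'[of "\<langle>?A\<rangle>" f "sow over c ?B" "g \<otimes> \<langle>[e c]\<rangle>"]
    by (simp add: slides_def)
  finally show ?thesis by (simp add: slides_def sow_append)
qed

lemma slides_add:
  "\<lbrakk>slides over c f; slides over c g; f \<in> Mor C; g \<in> Mor C; Src C f = Src C g; Tgt C f = Tgt C g\<rbrakk> \<Longrightarrow>
    slides over c (f \<oplus> g)"
  by (simp add: slides_def tensor_add add_tensor comp_add add_comp)

lemma slides_scale: "\<lbrakk>slides over c f; f \<in> Mor C\<rbrakk> \<Longrightarrow> slides over c (r \<odot> f)"
  by (simp add: slides_def tensor_scale scale_tensor comp_scale scale_comp)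

lemma slides_zero: "\<lbrakk>A \<in> lists T; B \<in> lists T\<rbrakk> \<Longrightarrow> slides over c (zero C A B)"
  by (simp add: slides_def)

text \<open>Composes the sliding equation for \<open>f\<close> with \<open>g\<close> on both sides;
  it gives access to the negative crossings as inverses of the positive ones.\<close>

lemma slides_inverse:
  assumes "slides over c f" and [simp]: "f \<in> Mor C" "g \<in> Mor C" "Src C g = Tgt C f" "Tgt C g = Src C f"
    and gf: "g \<cdot> f = \<langle>Src C f\<rangle>" "f \<cdot> g = \<langle>Tgt C f\<rangle>"
  shows "slides over c g"
proof -
  let ?A = "Src C f" and ?B = "Tgt C f"
  have gf': "(g \<otimes> \<langle>[e c]\<rangle>) \<cdot> (f \<otimes> \<langle>[e c]\<rangle>) = \<langle>?A @ [e c]\<rangle>" "(\<langle>[e c]\<rangle> \<otimes> f) \<cdot> (\<langle>[e c]\<rangle> \<otimes> g) = \<langle>e c # ?B\<rangle>"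
    by (simp_all add: interchange' gf)
  have "sow over c ?A \<cdot> (\<langle>[e c]\<rangle> \<otimes> g) =
      (g \<otimes> \<langle>[e c]\<rangle>) \<cdot> ((f \<otimes> \<langle>[e c]\<rangle>) \<cdot> sow over c ?A) \<cdot> (\<langle>[e c]\<rangle> \<otimes> g)"
    by (simp add: gf'(1)[THEN reassoc1])
  also have "\<dots> = (g \<otimes> \<langle>[e c]\<rangle>) \<cdot> (sow over c ?B \<cdot> (\<langle>[e c]\<rangle> \<otimes> f)) \<cdot> (\<langle>[e c]\<rangle> \<otimes> g)"
    using assms(1) by (simp add: slides_def)
  also have "\<dots> = (g \<otimes> \<langle>[e c]\<rangle>) \<cdot> sow over c ?B"
    by (simp add: gf')
  finally show ?thesis by (simp add: slides_def)
qed

end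

locale invertible_crossing = crossing_category C T bar e d p m
  for C :: "('s list, 'm, 'r::{comm_ring, comm_monoid_mult}, 'x) rigid_cat_scheme" (structure)
    and T :: "'s set" and bar e d and p m :: 'm +
  assumes R2: "X (\<not> over) b a \<cdot> X over a b = \<langle>[e a, e b]\<rangle>"
begin

lemma R2_ctx:
  assumes "U \<in> lists T" "W \<in> lists T"
  shows "(\<langle>U\<rangle> \<otimes> X (\<not> over) b a \<otimes> \<langle>W\<rangle>) \<cdot> (\<langle>U\<rangle> \<otimes> X over a b \<otimes> \<langle>W\<rangle>) = \<langle>U @ [e a, e b] @ W\<rangle>"
    and "(\<langle>U\<rangle> \<otimes> X over b a \<otimes> \<langle>W\<rangle>) \<cdot> (\<langle>U\<rangle> \<otimes> X (\<not> over) a b \<otimes> \<langle>W\<rangle>) = \<langle>U @ [e a, e b] @ W\<rangle>"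
  using assms R2[of over b a] R2[of "\<not> over" b a] by (simp_all add: interchange')

text \<open>By \<open>X_L\<close> the crossing with the reversed strand is a quarter turn of the
  inverse crossing. One arc of this turn is straightened against the cup, and what remains cancels
  by the second move.\<close>

lemma cup_under:
  "(X over a c \<otimes> \<langle>[e (reverse a)]\<rangle>) \<cdot> (\<langle>[e a]\<rangle> \<otimes> X over (reverse a) c) \<cdot> (\<eta> a \<otimes> \<langle>[e c]\<rangle>) = \<langle>[e c]\<rangle> \<otimes> \<eta> a"
proof -
  let ?a' = "reverse a" and ?Y = "X (\<not> over) c a"
  have s1: "(\<langle>[e a, e ?a', e c]\<rangle> \<otimes> \<eta> a) \<cdot> (\<eta> a \<otimes> \<langle>[e c]\<rangle>) = (\<eta> a \<otimes> \<langle>[e c, e a, e ?a']\<rangle>) \<cdot> (\<langle>[e c]\<rangle> \<otimes> \<eta> a)"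
    using slide_ctx[of "\<eta> a" "\<eta> a" "[]" "[e a, e ?a']" "[]" "[e a, e ?a']" "[]" "[e c]" "[]"] by simp
  have s2: "(\<langle>[e a, e ?a']\<rangle> \<otimes> ?Y \<otimes> \<langle>[e ?a']\<rangle>) \<cdot> (\<eta> a \<otimes> \<langle>[e c, e a, e ?a']\<rangle>) =
      (\<eta> a \<otimes> \<langle>[e a, e c, e ?a']\<rangle>) \<cdot> (?Y \<otimes> \<langle>[e ?a']\<rangle>)"
    using slide_ctx[of "\<eta> a" ?Y "[]" "[e a, e ?a']" "[e c, e a]" "[e a, e c]" "[]" "[]" "[e ?a']"] by simp
  have s3: "(\<langle>[e a]\<rangle> \<otimes> \<epsilon> ?a' \<otimes> \<langle>[e c, e ?a']\<rangle>) \<cdot> (\<eta> a \<otimes> \<langle>[e a, e c, e ?a']\<rangle>) = \<langle>[e a, e c, e ?a']\<rangle>"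
    using zigzag_ctx(2)[of "[]" "[e c, e ?a']" a] by simp
  have s4: "(X over a c \<otimes> \<langle>[e ?a']\<rangle>) \<cdot> (?Y \<otimes> \<langle>[e ?a']\<rangle>) = \<langle>[e c, e a, e ?a']\<rangle>"
    using R2_ctx(2)[of "[]" "[e ?a']" over a c] by simp
  have x: "X over ?a' c = (\<epsilon> ?a' \<otimes> \<langle>[e c, e ?a']\<rangle>) \<cdot> (\<langle>[e ?a']\<rangle> \<otimes> ?Y \<otimes> \<langle>[e ?a']\<rangle>) \<cdot> (\<langle>[e ?a', e c]\<rangle> \<otimes> \<eta> a)"
    using X_L[of c a "\<not> over"] by (simp add: L_def)
  show ?thesis unfolding x
    by (simp add: ide_tensor_comp s1 s2[THEN reassoc] s3[THEN reassoc1] s4[THEN reassoc1])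
qed

lemma cap_under:
  "(\<langle>[e c]\<rangle> \<otimes> \<epsilon> a) \<cdot> (X over a c \<otimes> \<langle>[e (reverse a)]\<rangle>) \<cdot> (\<langle>[e a]\<rangle> \<otimes> X over (reverse a) c) = \<epsilon> a \<otimes> \<langle>[e c]\<rangle>"
proof -
  let ?a' = "reverse a" and ?Y = "X (\<not> over) c (reverse a)"
  have s1: "(\<langle>[e c]\<rangle> \<otimes> \<epsilon> a) \<cdot> (\<epsilon> a \<otimes> \<langle>[e c, e a, e ?a']\<rangle>) = (\<epsilon> a \<otimes> \<langle>[e c]\<rangle>) \<cdot> (\<langle>[e a, e ?a', e c]\<rangle> \<otimes> \<epsilon> a)"
    using slide_ctx[of "\<epsilon> a" "\<epsilon> a" "[e a, e ?a']" "[]" "[e a, e ?a']" "[]" "[]" "[e c]" "[]"] by simp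
  have s2: "(\<langle>[e a, e ?a', e c]\<rangle> \<otimes> \<epsilon> a) \<cdot> (\<langle>[e a]\<rangle> \<otimes> ?Y \<otimes> \<langle>[e a, e ?a']\<rangle>) =
      (\<langle>[e a]\<rangle> \<otimes> ?Y) \<cdot> (\<langle>[e a, e c, e ?a']\<rangle> \<otimes> \<epsilon> a)"
    using slide_ctx[of ?Y "\<epsilon> a" "[e c, e ?a']" "[e ?a', e c]" "[e a, e ?a']" "[]" "[e a]" "[]" "[]"] by simp
  have s3: "(\<langle>[e a, e c, e ?a']\<rangle> \<otimes> \<epsilon> a) \<cdot> (\<langle>[e a, e c]\<rangle> \<otimes> \<eta> ?a' \<otimes> \<langle>[e ?a']\<rangle>) = \<langle>[e a, e c, e ?a']\<rangle>"
    using zigzag_ctx(2)[of "[e a, e c]" "[]" ?a'] by simp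
  have s4: "(\<langle>[e a]\<rangle> \<otimes> ?Y) \<cdot> (\<langle>[e a]\<rangle> \<otimes> X over ?a' c) = \<langle>[e a, e ?a', e c]\<rangle>"
    using R2_ctx(1)[of "[e a]" "[]" over c ?a'] by simp
  have x: "X over a c = (\<epsilon> a \<otimes> \<langle>[e c, e a]\<rangle>) \<cdot> (\<langle>[e a]\<rangle> \<otimes> ?Y \<otimes> \<langle>[e a]\<rangle>) \<cdot> (\<langle>[e a, e c]\<rangle> \<otimes> \<eta> ?a')"
    using X_L[of c ?a' "\<not> over"] by (simp add: L_def)
  show ?thesis unfolding x
    by (simp add: comp_tensor_ide s1[THEN reassoc] s2[THEN reassoc] s3[THEN reassoc1] s4)
qed

text \<open>\<open>cup_under\<close> moves the strand across the cup from right to left; composing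
  with inverse crossings turns this into a passage from left to right.\<close>

lemma slides_cup: "slides over c (\<eta> a)"
proof -
  let ?a' = "reverse a"
  have r: "(X over c a \<otimes> \<langle>[e ?a']\<rangle>) \<cdot> (X (\<not> over) a c \<otimes> \<langle>[e ?a']\<rangle>) = \<langle>[e a, e c, e ?a']\<rangle>"
    "(\<langle>[e a]\<rangle> \<otimes> X over c ?a') \<cdot> (\<langle>[e a]\<rangle> \<otimes> X (\<not> over) ?a' c) = \<langle>[e a, e ?a', e c]\<rangle>"
    using R2_ctx(2)[of "[]" "[e ?a']" over c a] R2_ctx(2)[of "[e a]" "[]" over c ?a'] by simp_all
  have "(\<langle>[e a]\<rangle> \<otimes> X over c ?a') \<cdot> (X over c a \<otimes> \<langle>[e ?a']\<rangle>) \<cdot> (\<langle>[e c]\<rangle> \<otimes> \<eta> a) = \<eta> a \<otimes> \<langle>[e c]\<rangle>"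
    unfolding cup_under[of "\<not> over" a c, symmetric]
    by (simp add: r(1)[THEN reassoc1] r(2)[THEN reassoc1])
  then show ?thesis by (simp add: slides_def)
qed

lemma slides_cap: "slides over c (\<epsilon> a)"
proof -
  let ?a' = "reverse a"
  have r: "(X (\<not> over) a c \<otimes> \<langle>[e ?a']\<rangle>) \<cdot> (X over c a \<otimes> \<langle>[e ?a']\<rangle>) = \<langle>[e c, e a, e ?a']\<rangle>"
    "(\<langle>[e a]\<rangle> \<otimes> X (\<not> over) ?a' c) \<cdot> (\<langle>[e a]\<rangle> \<otimes> X over c ?a') = \<langle>[e a, e c, e ?a']\<rangle>"
    using R2_ctx(1)[of "[]" "[e ?a']" over a c] R2_ctx(1)[of "[e a]" "[]" over ?a' c] by simp_all
  have "\<langle>[e c]\<rangle> \<otimes> \<epsilon> a = ((\<langle>[e c]\<rangle> \<otimes> \<epsilon> a) \<cdot> (X (\<not> over) a c \<otimes> \<langle>[e ?a']\<rangle>) \<cdot> (\<langle>[e a]\<rangle> \<otimes> X (\<not> over) ?a' c)) \<cdot>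
      (\<langle>[e a]\<rangle> \<otimes> X over c ?a') \<cdot> (X over c a \<otimes> \<langle>[e ?a']\<rangle>)"
    by (simp add: r(2)[THEN reassoc1] r(1))
  also have "\<dots> = (\<epsilon> a \<otimes> \<langle>[e c]\<rangle>) \<cdot> (\<langle>[e a]\<rangle> \<otimes> X over c ?a') \<cdot> (X over c a \<otimes> \<langle>[e ?a']\<rangle>)"
    unfolding cap_under ..
  finally show ?thesis by (simp add: slides_def)
qed

text \<open>A quarter turn consists of the morphism, a cup and a cap, all of which the strand can
  cross.\<close>

lemma slides_L:
  assumes "slides over c f" and f: "f \<in> Hom C [e a, e b] [e g, e h]"
  shows "slides over c (L a b g h f)"
  unfolding L_def using HomD[OF f] assms(1)
  by (intro slides_comp slides_tensor slides_ide slides_cap slides_cup) simp_all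

lemma slides_X_L: "slides over c (X over' a b) \<Longrightarrow> slides over c (X (\<not> over') (reverse b) a)"
  using slides_L[OF _ X_in, of over c over' a b] by (simp add: X_L)

lemma slides_X_inverse: "slides over c (X over' a b) \<Longrightarrow> slides over c (X (\<not> over') b a)"
  by (rule slides_inverse[of over c "X over' a b"]) (use R2[of over' b a] R2[of "\<not> over'" a b] in simp_all)

abbreviation wow :: "bool \<Rightarrow> 's list \<Rightarrow> 's list \<Rightarrow> 'm" where
  "wow over A B \<equiv> word_over_word C (x over) A B"

lemma wow_Mor [simp]:
  assumes "A \<in> lists T" "B \<in> lists T"
  shows "wow over A B \<in> Mor C" "Src C (wow over A B) = A @ B" "Tgt C (wow over A B) = B @ A"
proof -
  have "wow over A B \<in> Mor C \<and> Src C (wow over A B) = A @ B \<and> Tgt C (wow over A B) = B @ A"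
    using assms(1)
  proof (induction A)
    case (Cons s A)
    then have s: "s \<in> T" "A \<in> lists T" by simp_all
    show ?case using Cons.IH sow_Mor[OF assms(2), of over "d s"] s assms(2) by simp
  qed (use assms in simp)
  then show "wow over A B \<in> Mor C" "Src C (wow over A B) = A @ B" "Tgt C (wow over A B) = B @ A" by auto
qed

text \<open>The crossings are undone one letter at a time by the second move; exchanging the heights
  is what makes the two passages mutually inverse.\<close>

lemma wow_sow_inverse:
  assumes "A \<in> lists T"
  shows "wow over A [e c] \<cdot> sow (\<not> over) c A = \<langle>e c # A\<rangle>" "sow (\<not> over) c A \<cdot> wow over A [e c] = \<langle>A @ [e c]\<rangle>"
proof -
  have "wow over A [e c] \<cdot> sow (\<not> over) c A = \<langle>e c # A\<rangle> \<and> sow (\<not> over) c A \<cdot> wow over A [e c] = \<langle>A @ [e c]\<rangle>"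
    using assms
  proof (induction A)
    case (Cons s A)
    then have s [simp]: "s \<in> T" "A \<in> lists T" by simp_all
    note IH = Cons.IH
    have w: "(\<langle>[s]\<rangle> \<otimes> wow over A [e c]) \<cdot> (\<langle>[s]\<rangle> \<otimes> sow (\<not> over) c A) = \<langle>s # e c # A\<rangle>"
      "(\<langle>[s]\<rangle> \<otimes> sow (\<not> over) c A) \<cdot> (\<langle>[s]\<rangle> \<otimes> wow over A [e c]) = \<langle>s # A @ [e c]\<rangle>"
      using IH by (simp_all add: interchange')
    have r: "(X over (d s) c \<otimes> \<langle>A\<rangle>) \<cdot> (X (\<not> over) c (d s) \<otimes> \<langle>A\<rangle>) = \<langle>e c # s # A\<rangle>"
      "(X (\<not> over) c (d s) \<otimes> \<langle>A\<rangle>) \<cdot> (X over (d s) c \<otimes> \<langle>A\<rangle>) = \<langle>s # e c # A\<rangle>"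
      using R2_ctx[of "[]" A over "d s" c] R2_ctx[of "[]" A over c "d s"] by simp_all
    show ?case
      by (simp add: w[THEN reassoc1] r r[THEN reassoc1] w)
  qed simp
  then show "wow over A [e c] \<cdot> sow (\<not> over) c A = \<langle>e c # A\<rangle>" "sow (\<not> over) c A \<cdot> wow over A [e c] = \<langle>A @ [e c]\<rangle>" by auto
qed

text \<open>A morphism past which \<open>c\<close> slides from left to right also lets \<open>c\<close> slide from right to left,
  on the other side of the plane.\<close>

lemma slides_iff_wow:
  assumes [simp]: "f \<in> Mor C"
  shows "slides (\<not> over) c f \<longleftrightarrow>
    wow over (Tgt C f) [e c] \<cdot> (f \<otimes> \<langle>[e c]\<rangle>) = (\<langle>[e c]\<rangle> \<otimes> f) \<cdot> wow over (Src C f) [e c]"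
proof -
  let ?A = "Src C f" and ?B = "Tgt C f"
  let ?w = "\<lambda>A. wow over A [e c]" and ?s = "\<lambda>A. sow (\<not> over) c A"
  note i = wow_sow_inverse[of ?A over c] wow_sow_inverse[of ?B over c]
  show ?thesis
  proof
    assume "slides (\<not> over) c f"
    then have s: "?s ?B \<cdot> (\<langle>[e c]\<rangle> \<otimes> f) = (f \<otimes> \<langle>[e c]\<rangle>) \<cdot> ?s ?A" by (simp add: slides_def)
    have "?w ?B \<cdot> (f \<otimes> \<langle>[e c]\<rangle>) = ?w ?B \<cdot> ((f \<otimes> \<langle>[e c]\<rangle>) \<cdot> ?s ?A) \<cdot> ?w ?A" using i by simp
    also have "\<dots> = ?w ?B \<cdot> (?s ?B \<cdot> (\<langle>[e c]\<rangle> \<otimes> f)) \<cdot> ?w ?A" unfolding s ..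
    also have "\<dots> = (\<langle>[e c]\<rangle> \<otimes> f) \<cdot> ?w ?A" by (simp add: i(3)[THEN reassoc1])
    finally show "?w ?B \<cdot> (f \<otimes> \<langle>[e c]\<rangle>) = (\<langle>[e c]\<rangle> \<otimes> f) \<cdot> ?w ?A" .
  next
    assume w: "?w ?B \<cdot> (f \<otimes> \<langle>[e c]\<rangle>) = (\<langle>[e c]\<rangle> \<otimes> f) \<cdot> ?w ?A"
    have "?s ?B \<cdot> (\<langle>[e c]\<rangle> \<otimes> f) = ?s ?B \<cdot> ((\<langle>[e c]\<rangle> \<otimes> f) \<cdot> ?w ?A) \<cdot> ?s ?A" using i by simp
    also have "\<dots> = ?s ?B \<cdot> (?w ?B \<cdot> (f \<otimes> \<langle>[e c]\<rangle>)) \<cdot> ?s ?A" unfolding w ..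
    also have "\<dots> = (f \<otimes> \<langle>[e c]\<rangle>) \<cdot> ?s ?A" by (simp add: i(4)[THEN reassoc1])
    finally show "slides (\<not> over) c f" by (simp add: slides_def)
  qed
qed

text \<open>Both sides are the same third move, with \<open>c\<close> above \<open>a\<close> above
  \<open>b\<close>: either the top strand slides over the crossing of the lower two, or the bottom
  strand slides under the crossing of the upper two.\<close>

lemma slides_swap: "slides True c (X True a b) \<longleftrightarrow> slides False b (X True c a)"
proof -
  have "slides False b (X True c a) \<longleftrightarrow>
      wow True [e a, e c] [e b] \<cdot> (X True c a \<otimes> \<langle>[e b]\<rangle>) = (\<langle>[e b]\<rangle> \<otimes> X True c a) \<cdot> wow True [e c, e a] [e b]"
    using slides_iff_wow[of "X True c a" True b] by simp
  also have "\<dots> \<longleftrightarrow> (X True a b \<otimes> \<langle>[e c]\<rangle>) \<cdot> (\<langle>[e a]\<rangle> \<otimes> X True c b) \<cdot> (X True c a \<otimes> \<langle>[e b]\<rangle>) =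
      (\<langle>[e b]\<rangle> \<otimes> X True c a) \<cdot> (X True c b \<otimes> \<langle>[e a]\<rangle>) \<cdot> (\<langle>[e c]\<rangle> \<otimes> X True a b)"
    by simp
  also have "\<dots> \<longleftrightarrow> slides True c (X True a b)"
    by (auto simp: slides_def)
  finally show ?thesis ..
qed

text \<open>Inverting and then turning a crossing reverses its first strand, turning and then
  inverting reverses its second. The sliding strand is reversed through \<open>slides_swap\<close>,
  which trades it for a strand of the crossing. Thus the upward case reaches all orientations, and
  the other heights follow from \<open>slides_swap\<close> and inverses.\<close>

lemma slides_all_crossings:
  assumes base: "slides True Up (X True Up Up)"
  shows "slides over c (X over' a b)"
proof -
  have ra: "slides over c (X True (reverse a) b)" if "slides over c (X True a b)" for over c a b
    using slides_X_L[OF slides_X_inverse[OF that]] by simp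
  have rb: "slides over c (X True a (reverse b))" if "slides over c (X True a b)" for over c a b
    using slides_X_inverse[OF slides_X_L[OF that]] by simp
  have rc: "slides True (reverse c) (X True a b)" if "slides True c (X True a b)" for c a b
    using that ra[of False b c a] by (simp add: slides_swap)
  have 1: "slides True c (X True a b)" if "slides True Up (X True Up Up)" for c a b
    using that rc[of Up] ra[of True c Up] rb[of True c a Up]
    by (cases c; cases a; cases b; metis ra rb rc reverse.simps)
  have 2: "slides True c (X True a b)" for c a b using 1[OF base] .
  then have 3: "slides over c (X True a b)" for over c a b
    by (cases over) (simp_all add: slides_swap)
  show ?thesis using 3[of over c a b] slides_X_inverse[OF 3[of over c b a]] by (cases over') simp_all
qed

end

section \<open>Relations for \<open>S\<close> against moves for the crossings\<close>

section \<open>The skein calculus\<close>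

context word_category
begin

lemma mate_ide [simp]: "A \<in> lists T \<Longrightarrow> mate C \<langle>A\<rangle> = \<langle>dual C A\<rangle>"
  using word_zigzag_right[of "dual C A"] by (simp add: mate_def)

lemma comate_ide [simp]: "A \<in> lists T \<Longrightarrow> comate C \<langle>A\<rangle> = \<langle>dual C A\<rangle>"
  using word_zigzag_left[of "dual C A"] by (simp add: comate_def)

lemma mate_scale [simp]: "f \<in> Mor C \<Longrightarrow> mate C (r \<odot> f) = r \<odot> mate C f"
  and comate_scale [simp]: "f \<in> Mor C \<Longrightarrow> comate C (r \<odot> f) = r \<odot> comate C f"
  by (simp_all add: mate_def comate_def bilinear_simps)

lemma mate_add [simp]:
  "\<lbrakk>f \<in> Mor C; g \<in> Mor C; Src C f = Src C g; Tgt C f = Tgt C g\<rbrakk> \<Longrightarrow> mate C (f \<oplus> g) = mate C f \<oplus> mate C g"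
  and comate_add [simp]:
  "\<lbrakk>f \<in> Mor C; g \<in> Mor C; Src C f = Src C g; Tgt C f = Tgt C g\<rbrakk> \<Longrightarrow> comate C (f \<oplus> g) = comate C f \<oplus> comate C g"
  by (simp_all add: mate_def comate_def bilinear_simps)

lemma mate_Mor [simp]:
  "f \<in> Mor C \<Longrightarrow> mate C f \<in> Mor C"
  "f \<in> Mor C \<Longrightarrow> Src C (mate C f) = dual C (Tgt C f)"
  "f \<in> Mor C \<Longrightarrow> Tgt C (mate C f) = dual C (Src C f)"
  by (simp_all add: mate_def)

end

context crossing_category
begin

lemma L_scale [simp]: "f \<in> Hom C [e a, e b] [e g, e h] \<Longrightarrow> L a b g h (r \<odot> f) = r \<odot> L a b g h f"
  using HomD[of f C] by (simp add: L_def bilinear_simps)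

lemma L_add [simp]:
  "\<lbrakk>f \<in> Hom C [e a, e b] [e g, e h]; f' \<in> Hom C [e a, e b] [e g, e h]\<rbrakk> \<Longrightarrow>
    L a b g h (f \<oplus> f') = L a b g h f \<oplus> L a b g h f'"
  using HomD[of f C] HomD[of f' C] by (simp add: L_def bilinear_simps)

text \<open>A quarter turn exchanges the two planar ways of joining four endpoints: parallel strands
  become a cap below a cup, and conversely in \<open>L_cup_cap\<close>.\<close>

lemma L_ide: "L a b a b \<langle>[e a, e b]\<rangle> = \<eta> b \<cdot> \<epsilon> (reverse a)"
  using slide_ctx[of "\<epsilon> (reverse a)" "\<eta> b" "[e (reverse a), e a]" "[]" "[]" "[e b, e (reverse b)]" "[]" "[]" "[]"]
  by (simp add: L_def)

lemma L_cup_cap: "L a (reverse a) b (reverse b) (\<eta> b \<cdot> \<epsilon> a) = \<langle>[e (reverse b), e a]\<rangle> \<cdot> (\<langle>[e (reverse b)]\<rangle> \<otimes> \<langle>[e a]\<rangle>)"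
proof -
  have z: "(\<epsilon> (reverse b) \<otimes> \<langle>[e (reverse b), e a]\<rangle>) \<cdot> (\<langle>[e (reverse b)]\<rangle> \<otimes> \<eta> b \<otimes> \<langle>[e a]\<rangle>) = \<langle>[e (reverse b), e a]\<rangle>"
    "(\<langle>[e (reverse b)]\<rangle> \<otimes> \<epsilon> a \<otimes> \<langle>[e a]\<rangle>) \<cdot> (\<langle>[e (reverse b), e a]\<rangle> \<otimes> \<eta> (reverse a)) = \<langle>[e (reverse b), e a]\<rangle>"
    using zigzag_ctx(1)[of "[]" "[e a]" "reverse b"] zigzag_ctx(1)[of "[e (reverse b)]" "[]" a] by simp_all
  show ?thesis by (simp add: L_def ide_tensor_comp comp_tensor_ide z[THEN reassoc1] z)
qed

text \<open>Bending the output into a cap loses nothing: a cup straightens the strand again and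
  returns the morphism.\<close>

lemma cap_cancel:
  assumes "f \<in> Hom C [e a] [e a]" "g \<in> Hom C [e a] [e a]"
    and eq: "\<epsilon> (reverse a) \<cdot> (\<langle>[e (reverse a)]\<rangle> \<otimes> f) = \<epsilon> (reverse a) \<cdot> (\<langle>[e (reverse a)]\<rangle> \<otimes> g)"
  shows "f = g"
proof -
  have "(\<langle>[e a]\<rangle> \<otimes> (\<epsilon> (reverse a) \<cdot> (\<langle>[e (reverse a)]\<rangle> \<otimes> h))) \<cdot> (\<eta> a \<otimes> \<langle>[e a]\<rangle>) = h"
    if h: "h \<in> Hom C [e a] [e a]" for h
  proof -
    note [simp] = HomD[OF h]
    have s: "(\<langle>[e a, e (reverse a)]\<rangle> \<otimes> h) \<cdot> (\<eta> a \<otimes> \<langle>[e a]\<rangle>) = (\<eta> a \<otimes> \<langle>[e a]\<rangle>) \<cdot> h"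
      using slide_ctx[of "\<eta> a" h "[]" "[e a, e (reverse a)]" "[e a]" "[e a]" "[]" "[]" "[]"] by simp
    show ?thesis using strand_zigzag_right[of "e a"]
      by (simp add: ide_tensor_comp s reassoc1)
  qed
  from this[OF assms(1)] this[OF assms(2)] eq show ?thesis by metis
qed

end

text \<open>\<open>\<alpha>'\<close> and \<open>\<zeta>'\<close> stand for inverses, and
  \<open>q\<^sub>0\<close>, \<open>q\<^sub>1\<close>, \<open>q\<^sub>2\<close> for [n], [n-1],
  [n-2]. The equations \<open>q_p\<close> and \<open>q_m\<close> make the curls of \<open>p\<close>
  and \<open>m\<close> trivial, and \<open>q_sum\<close> cancels the cup-cap term in the
  antiparallel second move. No graph relation is assumed of \<open>s\<close>, only invariance under
  turning, so that the locale fits both quotients.\<close>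

locale hecke_crossing = crossing_category C T bar e d p m
  for C :: "('s list, 'm, 'r::{comm_ring, comm_monoid_mult}, 'x) rigid_cat_scheme" (structure)
    and T :: "'s set" and bar e d and p m :: 'm +
  fixes s :: 'm and \<alpha> \<alpha>' \<zeta> \<zeta>' q\<^sub>0 q\<^sub>1 q\<^sub>2 :: 'r
  assumes s_in: "s \<in> Hom C [e Up, e Up] [e Up, e Up]"
    and s_turn: "mate C s = comate C s"
    and p_eq: "p = \<alpha>' \<odot> ((\<zeta>' \<odot> \<langle>[e Up, e Up]\<rangle>) \<oplus> s)"
    and m_eq: "m = \<alpha> \<odot> ((\<zeta> \<odot> \<langle>[e Up, e Up]\<rangle>) \<oplus> s)"
    and \<alpha>: "\<alpha> * \<alpha>' = 1" and \<zeta>: "\<zeta> * \<zeta>' = 1"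
    and q_sum: "q\<^sub>0 + (\<zeta> + \<zeta>') * q\<^sub>1 + q\<^sub>2 = 0"
    and q_p: "\<zeta>' * q\<^sub>0 + q\<^sub>1 = \<alpha>" and q_m: "\<zeta> * q\<^sub>0 + q\<^sub>1 = \<alpha>'"
begin

definition S :: "ori \<Rightarrow> 'm" where
  "S a = (case a of Up \<Rightarrow> s | Down \<Rightarrow> mate C s)"

text \<open>\<open>S\<close> turned by a quarter, between antiparallel strands. The relation for the
  square becomes a statement about stacking two of these.\<close>

definition K :: "ori \<Rightarrow> 'm" where
  "K a = L a a a a (S a)"

lemma S_Mor [simp]: "S a \<in> Mor C" "Src C (S a) = [e a, e a]" "Tgt C (S a) = [e a, e a]"
  using HomD[OF s_in] by (cases a; simp add: S_def)+

lemma S_in: "S a \<in> Hom C [e a, e a] [e a, e a]"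
  by (simp add: Hom_def)

lemma K_Mor [simp]: "K a \<in> Mor C" "Src C (K a) = [e (reverse a), e a]" "Tgt C (K a) = [e a, e (reverse a)]"
  by (simp_all add: K_def S_in)

text \<open>\<open>K a\<close> arises from \<open>S a\<close> by a counterclockwise turn and, thanks
  to invariance under a full turn, also from the reversed \<open>S\<close> by a clockwise one. This
  link between the two orientations later relates left and right closures.\<close>

lemma R_S: "R (reverse a) (reverse a) (reverse a) (reverse a) (S (reverse a)) = K a"
proof (cases a)
  case Up
  have "S Down = L Down Up Up Down (L Up Up Up Up s)"
    using comate_L[OF s_in] s_turn by (simp add: S_def)
  then show ?thesis using R_L[of "K Up" Down Up Up Down] Up
    by (simp add: K_def[of Up] Hom_def) (simp add: S_def)
next
  case Down
  have "S Down = R Up Down Down Up (R Up Up Up Up s)"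
    using mate_R[OF s_in] by (simp add: S_def)
  moreover have "R Up Up Up Up s \<in> Hom C [e Up, e Down] [e Down, e Up]"
    using R_Mor[OF s_in] by (simp add: Hom_def)
  ultimately show ?thesis using L_R[of "R Up Up Up Up s" Up Down Down Up] Down
    by (simp add: K_def S_def)
qed

text \<open>Indexing the scalars by \<open>over\<close> lets one computation serve both crossings;
  negating \<open>over\<close> inverts \<open>\<kappa>\<close> and \<open>\<mu>\<close>.\<close>

definition \<kappa> :: "bool \<Rightarrow> 'r" where "\<kappa> over = (if over then \<alpha>' else \<alpha>)"
definition \<mu> :: "bool \<Rightarrow> 'r" where "\<mu> over = (if over then \<zeta>' else \<zeta>)"

lemma scalars: "\<kappa> over * \<kappa> (\<not> over) = 1" "\<mu> over * \<mu> (\<not> over) = 1" "\<mu> over + \<mu> (\<not> over) = \<zeta> + \<zeta>'"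
  "\<kappa> (\<not> over) * \<kappa> over = 1" "\<mu> (\<not> over) * \<mu> over = 1"
  "\<kappa> over * (\<mu> over * q\<^sub>0 + q\<^sub>1) = 1"
  using \<alpha> \<zeta> q_p q_m by (auto simp: \<kappa>_def \<mu>_def mult.commute add.commute)

lemma X_parallel: "X over a a = \<kappa> over \<odot> ((\<mu> over \<odot> \<langle>[e a, e a]\<rangle>) \<oplus> S a)"
proof -
  have "(if over then p else m) = \<kappa> over \<odot> ((\<mu> over \<odot> \<langle>[e Up, e Up]\<rangle>) \<oplus> s)"
    by (simp add: \<kappa>_def \<mu>_def p_eq[symmetric] m_eq[symmetric])
  then show ?thesis
    using HomD[OF s_in] by (cases a) (simp_all only: X_simps(1,4), simp_all add: S_def)
qed

text \<open>The quarter turn of \<open>X_parallel\<close>. It exchanges the over-strand, hence the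
  negated arguments of the scalars, and turns the identity into a cup-cap.\<close>

lemma X_antiparallel:
  "X over (reverse a) a = \<kappa> (\<not> over) \<odot> ((\<mu> (\<not> over) \<odot> (\<eta> a \<cdot> \<epsilon> (reverse a))) \<oplus> K a)"
  using X_L[of a a "\<not> over"] S_in[of a] by (simp add: X_parallel K_def L_ide Hom_def)

text \<open>Partial closure of \<open>S\<close> on the left, the left-hand side of
  \<open>relation3\<close>. The closure \<open>rtrace\<close> on the right does not occur in the
  graph relations and has to be computed from this one.\<close>

definition ltrace :: "ori \<Rightarrow> 'm" where
  "ltrace a = (\<epsilon> (reverse a) \<otimes> \<langle>[e a]\<rangle>) \<cdot> (\<langle>[e (reverse a)]\<rangle> \<otimes> S a) \<cdot> (\<eta> (reverse a) \<otimes> \<langle>[e a]\<rangle>)"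

definition rtrace :: "ori \<Rightarrow> 'm" where
  "rtrace a = (\<langle>[e a]\<rangle> \<otimes> \<epsilon> a) \<cdot> (S a \<otimes> \<langle>[e (reverse a)]\<rangle>) \<cdot> (\<langle>[e a]\<rangle> \<otimes> \<eta> a)"

definition square :: "ori \<Rightarrow> 'm" where
  "square a = (\<langle>[e a]\<rangle> \<otimes> \<epsilon> a \<otimes> \<langle>[e (reverse a)]\<rangle>) \<cdot> (S a \<otimes> S (reverse a)) \<cdot> (\<langle>[e a]\<rangle> \<otimes> \<eta> a \<otimes> \<langle>[e (reverse a)]\<rangle>)"

lemma trace_Mor [simp]:
  "ltrace a \<in> Mor C" "Src C (ltrace a) = [e a]" "Tgt C (ltrace a) = [e a]"
  "rtrace a \<in> Mor C" "Src C (rtrace a) = [e a]" "Tgt C (rtrace a) = [e a]"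
  by (simp_all add: ltrace_def rtrace_def)

lemma square_Mor [simp]:
  "square a \<in> Mor C" "Src C (square a) = [e a, e (reverse a)]" "Tgt C (square a) = [e a, e (reverse a)]"
  by (simp_all add: square_def)

text \<open>One leg of the turn can be pulled around the cup, so that closing \<open>K\<close>
  becomes a partial trace of \<open>S\<close>.\<close>

lemma K_cup: "K (reverse a) \<cdot> \<eta> a = (ltrace (reverse a) \<otimes> \<langle>[e a]\<rangle>) \<cdot> \<eta> (reverse a)"
proof -
  have "(\<langle>[e a, e (reverse a)]\<rangle> \<otimes> \<eta> (reverse a)) \<cdot> \<eta> a = (\<eta> a \<otimes> \<langle>[e (reverse a), e a]\<rangle>) \<cdot> \<eta> (reverse a)"
    using slide_ctx[of "\<eta> a" "\<eta> (reverse a)" "[]" "[e a, e (reverse a)]" "[]" "[e (reverse a), e a]" "[]" "[]" "[]"]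
    by simp
  then show ?thesis by (simp add: K_def L_def ltrace_def comp_tensor_ide)
qed

text \<open>Evaluated through the clockwise form of \<open>K\<close>, whereas \<open>cap_K'\<close>
  uses the counterclockwise form. Comparing the two relates the left trace of the reversed strand to
  the right trace of the strand.\<close>

lemma cap_K: "\<epsilon> a \<cdot> K a = \<epsilon> (reverse a) \<cdot> (ltrace (reverse a) \<otimes> \<langle>[e a]\<rangle>)"
proof -
  have s: "\<epsilon> a \<cdot> (\<langle>[e a, e (reverse a)]\<rangle> \<otimes> \<epsilon> (reverse a)) = \<epsilon> (reverse a) \<cdot> (\<epsilon> a \<otimes> \<langle>[e (reverse a), e a]\<rangle>)"
    using slide_ctx[of "\<epsilon> a" "\<epsilon> (reverse a)" "[e a, e (reverse a)]" "[]" "[e (reverse a), e a]" "[]" "[]" "[]" "[]"]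
    by simp
  show ?thesis unfolding R_S[symmetric]
    by (simp add: R_def ltrace_def comp_tensor_ide s[THEN reassoc])
qed

lemma cap_K': "\<epsilon> a \<cdot> K a = \<epsilon> (reverse a) \<cdot> (\<langle>[e (reverse a)]\<rangle> \<otimes> rtrace a)"
proof -
  have s: "\<epsilon> a \<cdot> (\<epsilon> (reverse a) \<otimes> \<langle>[e a, e (reverse a)]\<rangle>) = \<epsilon> (reverse a) \<cdot> (\<langle>[e (reverse a), e a]\<rangle> \<otimes> \<epsilon> a)"
    using slide_ctx[of "\<epsilon> (reverse a)" "\<epsilon> a" "[e (reverse a), e a]" "[]" "[e a, e (reverse a)]" "[]" "[]" "[]" "[]"]
    by simp
  show ?thesis by (simp add: K_def L_def rtrace_def ide_tensor_comp s[THEN reassoc])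
qed

text \<open>A quarter turn takes two copies of \<open>S\<close> that stand side by side and are
  joined in the middle to two stacked ones; the proof only moves arcs past the two copies.\<close>

lemma L_square: "L a (reverse a) a (reverse a) (square a) = K (reverse a) \<cdot> K a"
proof -
  let ?a = "e a" and ?b = "e (reverse a)"
  have st: "S a \<otimes> S (reverse a) = (\<langle>[?a, ?a]\<rangle> \<otimes> S (reverse a)) \<cdot> (S a \<otimes> \<langle>[?b, ?b]\<rangle>)"
    using tensor_split'[of "S a" "S (reverse a)"] by simp
  have t1: "(\<epsilon> (reverse a) \<otimes> \<langle>[?b, ?a]\<rangle>) \<cdot> (\<langle>[?b, ?a]\<rangle> \<otimes> \<epsilon> a \<otimes> \<langle>[?b, ?a]\<rangle>) =
      (\<epsilon> a \<otimes> \<langle>[?b, ?a]\<rangle>) \<cdot> (\<epsilon> (reverse a) \<otimes> \<langle>[?a, ?b, ?b, ?a]\<rangle>)"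
    using slide_ctx[of "\<epsilon> (reverse a)" "\<epsilon> a" "[?b, ?a]" "[]" "[?a, ?b]" "[]" "[]" "[]" "[?b, ?a]"] by simp
  have t2: "(\<epsilon> (reverse a) \<otimes> \<langle>[?a, ?b, ?b, ?a]\<rangle>) \<cdot> (\<langle>[?b, ?a, ?a]\<rangle> \<otimes> S (reverse a) \<otimes> \<langle>[?a]\<rangle>) =
      (\<langle>[?a]\<rangle> \<otimes> S (reverse a) \<otimes> \<langle>[?a]\<rangle>) \<cdot> (\<epsilon> (reverse a) \<otimes> \<langle>[?a, ?b, ?b, ?a]\<rangle>)"
    using slide_ctx[of "\<epsilon> (reverse a)" "S (reverse a)" "[?b, ?a]" "[]" "[?b, ?b]" "[?b, ?b]" "[]" "[?a]" "[?a]"] by simp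
  have t3: "(\<langle>[?b, ?a]\<rangle> \<otimes> \<eta> a \<otimes> \<langle>[?b, ?a]\<rangle>) \<cdot> (\<langle>[?b, ?a]\<rangle> \<otimes> \<eta> (reverse a)) =
      (\<langle>[?b, ?a, ?a, ?b]\<rangle> \<otimes> \<eta> (reverse a)) \<cdot> (\<langle>[?b, ?a]\<rangle> \<otimes> \<eta> a)"
    using slide_ctx[of "\<eta> a" "\<eta> (reverse a)" "[]" "[?a, ?b]" "[]" "[?b, ?a]" "[?b, ?a]" "[]" "[]"] by simp
  have t4: "(\<langle>[?b]\<rangle> \<otimes> S a \<otimes> \<langle>[?b, ?b, ?a]\<rangle>) \<cdot> (\<langle>[?b, ?a, ?a, ?b]\<rangle> \<otimes> \<eta> (reverse a)) =
      (\<langle>[?b, ?a, ?a, ?b]\<rangle> \<otimes> \<eta> (reverse a)) \<cdot> (\<langle>[?b]\<rangle> \<otimes> S a \<otimes> \<langle>[?b]\<rangle>)"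
    using slide_ctx[of "S a" "\<eta> (reverse a)" "[?a, ?a]" "[?a, ?a]" "[]" "[?b, ?a]" "[?b]" "[?b]" "[]"] by simp
  have t5: "(\<epsilon> (reverse a) \<otimes> \<langle>[?a, ?b, ?b, ?a]\<rangle>) \<cdot> (\<langle>[?b, ?a, ?a, ?b]\<rangle> \<otimes> \<eta> (reverse a)) =
      (\<langle>[?a, ?b]\<rangle> \<otimes> \<eta> (reverse a)) \<cdot> (\<epsilon> (reverse a) \<otimes> \<langle>[?a, ?b]\<rangle>)"
    using slide_ctx[of "\<epsilon> (reverse a)" "\<eta> (reverse a)" "[?b, ?a]" "[]" "[]" "[?b, ?a]" "[]" "[?a, ?b]" "[]"] by simp
  show ?thesis
    by (simp add: square_def L_def K_def st ide_tensor_comp comp_tensor_ide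
        t1[THEN reassoc] t2[THEN reassoc] t3 t4[THEN reassoc] t5[THEN reassoc])
qed

text \<open>Quarter turns are injective by \<open>R_L\<close>, so the relation can be compared after
  turning, where the cup-cap and the identity exchange roles.\<close>

lemma square_iff:
  "square a = (\<eta> a \<cdot> \<epsilon> a) \<oplus> (r \<odot> (\<langle>[e a]\<rangle> \<otimes> \<langle>[e (reverse a)]\<rangle>)) \<longleftrightarrow>
    K (reverse a) \<cdot> K a = \<langle>[e (reverse a), e a]\<rangle> \<oplus> (r \<odot> (\<eta> (reverse a) \<cdot> \<epsilon> (reverse a)))"
    (is "square a = ?f \<longleftrightarrow> _")
proof -
  have f: "?f \<in> Hom C [e a, e (reverse a)] [e a, e (reverse a)]" "square a \<in> Hom C [e a, e (reverse a)] [e a, e (reverse a)]"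
    by (simp_all add: Hom_def)
  have "square a = ?f \<longleftrightarrow> L a (reverse a) a (reverse a) (square a) = L a (reverse a) a (reverse a) ?f"
    using R_L[OF f(1)] R_L[OF f(2)] by metis
  also have "L a (reverse a) a (reverse a) ?f = \<langle>[e (reverse a), e a]\<rangle> \<oplus> (r \<odot> (\<eta> (reverse a) \<cdot> \<epsilon> (reverse a)))"
    using L_cup_cap[of a a] L_ide[of a "reverse a"] by (simp add: Hom_def)
  finally show ?thesis by (simp add: L_square)
qed

text \<open>Both crossings are expanded by \<open>X_antiparallel\<close>. The mixed terms close up
  to partial traces and the product of the two cup-caps contains a circle, so everything except the
  stacked \<open>K\<close> is a multiple of one cup-cap.\<close>

lemma antiparallel_product:
  assumes circle: "\<epsilon> a \<cdot> \<eta> a = q\<^sub>0 \<odot> \<langle>[]\<rangle>" and lt: "ltrace (reverse a) = q\<^sub>1 \<odot> \<langle>[e (reverse a)]\<rangle>"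
  shows "X (\<not> over) a (reverse a) \<cdot> X over (reverse a) a =
    (K (reverse a) \<cdot> K a) \<oplus> ((q\<^sub>0 + (\<zeta> + \<zeta>') * q\<^sub>1) \<odot> (\<eta> (reverse a) \<cdot> \<epsilon> (reverse a)))"
proof -
  let ?E = "\<eta> (reverse a) \<cdot> \<epsilon> (reverse a)"
  have y: "X (\<not> over) a (reverse a) = \<kappa> over \<odot> ((\<mu> over \<odot> (\<eta> (reverse a) \<cdot> \<epsilon> a)) \<oplus> K (reverse a))"
    using X_antiparallel[of "\<not> over" "reverse a"] by simp
  have k1: "\<eta> (reverse a) \<cdot> \<epsilon> a \<cdot> K a = q\<^sub>1 \<odot> ?E"
    by (simp add: cap_K lt bilinear_simps)
  have k2: "K (reverse a) \<cdot> \<eta> a \<cdot> \<epsilon> (reverse a) = q\<^sub>1 \<odot> ?E"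
    using K_cup[of a, THEN reassoc1] lt by (simp add: K_cup[THEN reassoc] bilinear_simps)
  have k3: "\<eta> (reverse a) \<cdot> \<epsilon> a \<cdot> \<eta> a \<cdot> \<epsilon> (reverse a) = q\<^sub>0 \<odot> ?E"
    by (simp add: circle[THEN reassoc1] bilinear_simps)
  have "X (\<not> over) a (reverse a) \<cdot> X over (reverse a) a =
      ((\<mu> over * (\<mu> (\<not> over) * q\<^sub>0)) \<odot> ?E) \<oplus> ((\<mu> over * q\<^sub>1) \<odot> ?E) \<oplus> ((\<mu> (\<not> over) * q\<^sub>1) \<odot> ?E) \<oplus> (K (reverse a) \<cdot> K a)"
  proof -
    have "X (\<not> over) a (reverse a) \<cdot> X over (reverse a) a =
        ((\<mu> over \<odot> (\<eta> (reverse a) \<cdot> \<epsilon> a)) \<oplus> K (reverse a)) \<cdot> ((\<mu> (\<not> over) \<odot> (\<eta> a \<cdot> \<epsilon> (reverse a))) \<oplus> K a)"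
      unfolding y X_antiparallel by (simp add: scale_comp comp_scale scalars)
    then show ?thesis by (simp add: bilinear_simps scale_sum k1 k2 k3 mult_ac add_ac)
  qed
  also have "\<dots> = (K (reverse a) \<cdot> K a) \<oplus> ((\<mu> over * (\<mu> (\<not> over) * q\<^sub>0) + \<mu> over * q\<^sub>1 + \<mu> (\<not> over) * q\<^sub>1) \<odot> ?E)"
    by (simp add: scale_add add_ac)
  \<comment> \<open>In the circle term the two values of \<open>\<mu>\<close> multiply to 1; in the
    trace terms they add up to \<open>\<zeta> + \<zeta>'\<close>.\<close>
  also have "\<mu> over * (\<mu> (\<not> over) * q\<^sub>0) + \<mu> over * q\<^sub>1 + \<mu> (\<not> over) * q\<^sub>1 = q\<^sub>0 + (\<zeta> + \<zeta>') * q\<^sub>1"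
    unfolding scalars(3)[of over, symmetric] mult.assoc[symmetric] scalars(2) by (simp add: algebra_simps)
  finally show ?thesis .
qed

lemma parallel_product:
  "X (\<not> over) a a \<cdot> X over a a = (\<langle>[e a, e a]\<rangle> \<oplus> ((\<zeta> + \<zeta>') \<odot> S a)) \<oplus> (S a \<cdot> S a)"
proof -
  have "X (\<not> over) a a \<cdot> X over a a = (\<langle>[e a, e a]\<rangle> \<oplus> ((\<mu> over + \<mu> (\<not> over)) \<odot> S a)) \<oplus> (S a \<cdot> S a)"
  proof -
    have "X (\<not> over) a a \<cdot> X over a a =
        ((\<mu> (\<not> over) \<odot> \<langle>[e a, e a]\<rangle>) \<oplus> S a) \<cdot> ((\<mu> over \<odot> \<langle>[e a, e a]\<rangle>) \<oplus> S a)"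
      unfolding X_parallel by (simp add: scale_comp comp_scale scalars)
    then show ?thesis by (simp add: bilinear_simps scale_sum scale_add scalars(2,5) add_ac)
  qed
  then show ?thesis by (simp add: scalars)
qed

lemma left_curl_X:
  assumes "\<epsilon> (reverse a) \<cdot> \<eta> (reverse a) = q\<^sub>0 \<odot> \<langle>[]\<rangle>"
  shows "left_curl C [e a] (X over a a) = \<kappa> over \<odot> (((\<mu> over * q\<^sub>0) \<odot> \<langle>[e a]\<rangle>) \<oplus> ltrace a)"
proof -
  have "(\<epsilon> (reverse a) \<otimes> \<langle>[e a]\<rangle>) \<cdot> (\<eta> (reverse a) \<otimes> \<langle>[e a]\<rangle>) = q\<^sub>0 \<odot> \<langle>[e a]\<rangle>"
    using assms by (simp add: interchange' bilinear_simps)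
  then show ?thesis
    by (simp add: left_curl_def X_parallel ltrace_def bilinear_simps scale_sum mult_ac)
qed

lemma right_curl_X:
  assumes "\<epsilon> a \<cdot> \<eta> a = q\<^sub>0 \<odot> \<langle>[]\<rangle>"
  shows "right_curl C [e a] (X over a a) = \<kappa> over \<odot> (((\<mu> over * q\<^sub>0) \<odot> \<langle>[e a]\<rangle>) \<oplus> rtrace a)"
proof -
  have "(\<langle>[e a]\<rangle> \<otimes> \<epsilon> a) \<cdot> (\<langle>[e a]\<rangle> \<otimes> \<eta> a) = q\<^sub>0 \<odot> \<langle>[e a]\<rangle>"
    using assms by (simp add: interchange' bilinear_simps)
  then show ?thesis
    by (simp add: right_curl_def X_parallel rtrace_def bilinear_simps scale_sum mult_ac)
qed

end

context linear_monoidal_category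
begin

text \<open>The first bracket is symmetric in \<open>P\<close> and \<open>Q\<close>, so the braid
  relation reduces to comparing the second ones. \<open>P\<close> occurs twice with coefficient
  \<open>l * l\<close> and, through \<open>P \<cdot> P = c \<odot> P\<close>, once with
  \<open>l * c\<close>; one \<open>l * l\<close> stays in the bracket and the rest adds up to
  -1.\<close>

lemma braid_word_expansion:
  assumes P: "P \<in> Hom C A A" and Q: "Q \<in> Hom C A A" and PP: "P \<cdot> P = c \<odot> P" and l: "l * l + l * c = - 1"
  shows "((l \<odot> \<langle>A\<rangle>) \<oplus> P) \<cdot> ((l \<odot> \<langle>A\<rangle>) \<oplus> Q) \<cdot> ((l \<odot> \<langle>A\<rangle>) \<oplus> P) =
    (((l * l * l) \<odot> \<langle>A\<rangle>) \<oplus> ((l * l) \<odot> P) \<oplus> ((l * l) \<odot> Q) \<oplus> (l \<odot> (P \<cdot> Q)) \<oplus> (l \<odot> (Q \<cdot> P))) \<oplus>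
    ((P \<cdot> Q \<cdot> P) \<ominus> P)"
proof -
  note [simp] = HomD[OF P] HomD[OF Q]
  have A: "A \<in> Obj C" using Src_Obj[OF HomD(1)[OF P]] by simp
  have "((l \<odot> \<langle>A\<rangle>) \<oplus> P) \<cdot> ((l \<odot> \<langle>A\<rangle>) \<oplus> Q) \<cdot> ((l \<odot> \<langle>A\<rangle>) \<oplus> P) =
     ((l * l * l) \<odot> \<langle>A\<rangle>) \<oplus> ((l * l) \<odot> P) \<oplus> ((l * l) \<odot> Q) \<oplus> (l \<odot> (P \<cdot> Q)) \<oplus> (l \<odot> (Q \<cdot> P)) \<oplus>
     (((l * l) \<odot> P) \<oplus> ((l * c) \<odot> P) \<oplus> (P \<cdot> Q \<cdot> P))"
    using A by (simp add: bilinear_simps scale_sum PP add_ac mult_ac)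
  also have "((l * l) \<odot> P) \<oplus> ((l * c) \<odot> P) \<oplus> (P \<cdot> Q \<cdot> P) = (P \<cdot> Q \<cdot> P) \<ominus> P"
  proof -
    have "((l * l) \<odot> P) \<oplus> ((l * c) \<odot> P) = (- 1) \<odot> P" by (simp add: scale_add[symmetric] l)
    then show ?thesis by (simp add: diff_def add_commute')
  qed
  finally show ?thesis using A by (simp add: add_ac)
qed

lemma add_cancel_iff:
  assumes "f \<in> Hom C A B" "g \<in> Hom C A B" "h \<in> Hom C A B"
  shows "f \<oplus> g = f \<oplus> h \<longleftrightarrow> g = h"
  using add_left_cancel[of f g h] HomD[OF assms(1)] HomD[OF assms(2)] HomD[OF assms(3)] by auto

lemma diff_eq_diff_iff:
  assumes "f \<in> Hom C A B" "g \<in> Hom C A B" "f' \<in> Hom C A B" "g' \<in> Hom C A B"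
  shows "f \<ominus> g = f' \<ominus> g' \<longleftrightarrow> f \<oplus> g' = f' \<oplus> g"
proof -
  note [simp] = HomD[OF assms(1)] HomD[OF assms(2)] HomD[OF assms(3)] HomD[OF assms(4)]
  have AB: "A \<in> Obj C" "B \<in> Obj C" using Src_Obj[of f] Tgt_Obj[of f] by simp_all
  have "(g \<oplus> g') \<oplus> (f \<ominus> g) = (f \<oplus> g') \<oplus> (g \<ominus> g)" "(g \<oplus> g') \<oplus> (f' \<ominus> g') = (f' \<oplus> g) \<oplus> (g' \<ominus> g')"
    by (simp_all add: diff_def add_ac)
  then have "(g \<oplus> g') \<oplus> (f \<ominus> g) = f \<oplus> g'" "(g \<oplus> g') \<oplus> (f' \<ominus> g') = f' \<oplus> g"
    using AB by simp_all
  moreover have "f \<ominus> g = f' \<ominus> g' \<longleftrightarrow> (g \<oplus> g') \<oplus> (f \<ominus> g) = (g \<oplus> g') \<oplus> (f' \<ominus> g')"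
    using add_cancel_iff[of "g \<oplus> g'" A B] by (simp add: Hom_def)
  ultimately show ?thesis by simp
qed

end

context invertible_crossing
begin

text \<open>Of three distinct heights, \<open>i\<close> or \<open>k\<close> is extreme, and the
  strand at that height slides past the crossing of the other two.\<close>

lemma R3_general:
  assumes sl: "\<And>over over' a b c. slides over c (X over' a b)" and d: "distinct [i, j, k :: nat]"
  shows "(X (j > k) b c \<otimes> \<langle>[e a]\<rangle>) \<cdot> (\<langle>[e b]\<rangle> \<otimes> X (i > k) a c) \<cdot> (X (i > j) a b \<otimes> \<langle>[e c]\<rangle>) =
    (\<langle>[e c]\<rangle> \<otimes> X (i > j) a b) \<cdot> (X (i > k) a c \<otimes> \<langle>[e b]\<rangle>) \<cdot> (\<langle>[e a]\<rangle> \<otimes> X (j > k) b c)"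
proof (cases "(i > j) = (i > k)")
  case True
  then show ?thesis using sl[of "i > k" a "j > k" b c] by (simp add: slides_def)
next
  case False
  \<comment> \<open>Here \<open>i\<close> is the middle height, so \<open>k\<close> is extreme. Its
    strand runs from right to left, which calls for the form of sliding in
    \<open>slides_iff_wow\<close>.\<close>
  then have "(j > k) = (i > k)" using d by auto
  then show ?thesis using sl[of "\<not> i > k" c "i > j" a b] by (simp add: slides_iff_wow)
qed

end

context hecke_crossing
begin

abbreviation relation1 :: "ori \<Rightarrow> bool" where
  "relation1 a \<equiv> \<epsilon> a \<cdot> \<eta> a = q\<^sub>0 \<odot> \<langle>[]\<rangle>"
abbreviation relation2 :: "ori \<Rightarrow> bool" where
  "relation2 a \<equiv> S a \<cdot> S a = (- (\<zeta> + \<zeta>')) \<odot> S a"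
abbreviation relation3 :: "ori \<Rightarrow> bool" where
  "relation3 a \<equiv> ltrace a = q\<^sub>1 \<odot> \<langle>[e a]\<rangle>"
abbreviation relation4 :: "ori \<Rightarrow> bool" where
  "relation4 a \<equiv> square a = (\<eta> a \<cdot> \<epsilon> a) \<oplus> (q\<^sub>2 \<odot> (\<langle>[e a]\<rangle> \<otimes> \<langle>[e (reverse a)]\<rangle>))"
abbreviation relation5 :: "ori \<Rightarrow> bool" where
  "relation5 a \<equiv>
    ((S a \<otimes> \<langle>[e a]\<rangle>) \<cdot> (\<langle>[e a]\<rangle> \<otimes> S a) \<cdot> (S a \<otimes> \<langle>[e a]\<rangle>)) \<oplus> (\<langle>[e a]\<rangle> \<otimes> S a) =
    ((\<langle>[e a]\<rangle> \<otimes> S a) \<cdot> (S a \<otimes> \<langle>[e a]\<rangle>) \<cdot> (\<langle>[e a]\<rangle> \<otimes> S a)) \<oplus> (S a \<otimes> \<langle>[e a]\<rangle>)"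

lemma relation2_iff: "X (\<not> over) a a \<cdot> X over a a = \<langle>[e a, e a]\<rangle> \<longleftrightarrow> relation2 a"
proof -
  have h: "\<langle>[e a, e a]\<rangle> \<in> Hom C [e a, e a] [e a, e a]" "((\<zeta> + \<zeta>') \<odot> S a) \<oplus> (S a \<cdot> S a) \<in> Hom C [e a, e a] [e a, e a]"
    "(\<zeta> + \<zeta>') \<odot> S a \<in> Hom C [e a, e a] [e a, e a]" "S a \<cdot> S a \<in> Hom C [e a, e a] [e a, e a]"
    "(- (\<zeta> + \<zeta>')) \<odot> S a \<in> Hom C [e a, e a] [e a, e a]"
    "zero C [e a, e a] [e a, e a] \<in> Hom C [e a, e a] [e a, e a]" by (simp_all add: Hom_def)
  have "X (\<not> over) a a \<cdot> X over a a = \<langle>[e a, e a]\<rangle> \<oplus> (((\<zeta> + \<zeta>') \<odot> S a) \<oplus> (S a \<cdot> S a))"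
    by (simp add: parallel_product add_assoc')
  then have "X (\<not> over) a a \<cdot> X over a a = \<langle>[e a, e a]\<rangle> \<longleftrightarrow>
      \<langle>[e a, e a]\<rangle> \<oplus> (((\<zeta> + \<zeta>') \<odot> S a) \<oplus> (S a \<cdot> S a)) = \<langle>[e a, e a]\<rangle> \<oplus> zero C [e a, e a] [e a, e a]"
    by simp
  also have "\<dots> \<longleftrightarrow> ((\<zeta> + \<zeta>') \<odot> S a) \<oplus> (S a \<cdot> S a) = zero C [e a, e a] [e a, e a]"
    using h(1,2,6) by (rule add_cancel_iff)
  also have "\<dots> \<longleftrightarrow> ((\<zeta> + \<zeta>') \<odot> S a) \<oplus> (S a \<cdot> S a) = ((\<zeta> + \<zeta>') \<odot> S a) \<oplus> ((- (\<zeta> + \<zeta>')) \<odot> S a)"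
    using scale_add[of "S a" "\<zeta> + \<zeta>'" "- (\<zeta> + \<zeta>')"] by (simp del: minus_add_distrib)
  also have "\<dots> \<longleftrightarrow> relation2 a" using h(3,4,5) by (rule add_cancel_iff)
  finally show ?thesis .
qed

text \<open>By \<open>q_sum\<close> the cup-cap in the antiparallel product has coefficient
  \<open>- q\<^sub>2\<close>, exactly what the turned relation for the square compensates.\<close>

lemma relation4_iff:
  assumes "relation1 a" "relation3 (reverse a)"
  shows "X (\<not> over) a (reverse a) \<cdot> X over (reverse a) a = \<langle>[e (reverse a), e a]\<rangle> \<longleftrightarrow> relation4 a"
proof -
  let ?E = "\<eta> (reverse a) \<cdot> \<epsilon> (reverse a)" and ?K = "K (reverse a) \<cdot> K a" and ?i = "\<langle>[e (reverse a), e a]\<rangle>"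
  let ?H = "Hom C [e (reverse a), e a] [e (reverse a), e a]"
  have h: "((- q\<^sub>2) \<odot> ?E) \<in> ?H" "?K \<in> ?H" "?i \<oplus> (q\<^sub>2 \<odot> ?E) \<in> ?H" by (simp_all add: Hom_def)
  have q: "q\<^sub>0 + (\<zeta> + \<zeta>') * q\<^sub>1 = - q\<^sub>2" using q_sum by (simp add: eq_neg_iff_add_eq_0)
  have "X (\<not> over) a (reverse a) \<cdot> X over (reverse a) a = ((- q\<^sub>2) \<odot> ?E) \<oplus> ?K"
    unfolding antiparallel_product[OF assms] q by (simp add: add_commute')
  moreover have "?i = ((- q\<^sub>2) \<odot> ?E) \<oplus> (?i \<oplus> (q\<^sub>2 \<odot> ?E))"
  proof -
    have "((- q\<^sub>2) \<odot> ?E) \<oplus> (q\<^sub>2 \<odot> ?E) = zero C [e (reverse a), e a] [e (reverse a), e a]"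
      by (simp add: scale_add[symmetric])
    moreover have "((- q\<^sub>2) \<odot> ?E) \<oplus> (?i \<oplus> (q\<^sub>2 \<odot> ?E)) = ?i \<oplus> (((- q\<^sub>2) \<odot> ?E) \<oplus> (q\<^sub>2 \<odot> ?E))"
      by (rule add_left_commute') simp_all
    ultimately show ?thesis by simp
  qed
  ultimately have "X (\<not> over) a (reverse a) \<cdot> X over (reverse a) a = ?i \<longleftrightarrow> ?K = ?i \<oplus> (q\<^sub>2 \<odot> ?E)"
    using add_cancel_iff[OF h] by metis
  then show ?thesis by (simp only: square_iff)
qed

text \<open>The curl is \<open>\<kappa> over\<close> times the sum of
  \<open>\<mu> over * q\<^sub>0\<close> and the trace. By \<open>q_p\<close> and \<open>q_m\<close>
  the inverse of \<open>\<kappa> over\<close> is \<open>\<mu> over * q\<^sub>0 + q\<^sub>1\<close>,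
  so the curl is trivial precisely when the trace is \<open>q\<^sub>1\<close>.\<close>

lemma left_curl_iff:
  assumes "relation1 (reverse a)"
  shows "left_curl C [e a] (X over a a) = \<langle>[e a]\<rangle> \<longleftrightarrow> relation3 a"
proof -
  let ?i = "\<langle>[e a]\<rangle>"
  have h: "(\<mu> over * q\<^sub>0) \<odot> ?i \<in> Hom C [e a] [e a]" "ltrace a \<in> Hom C [e a] [e a]" "q\<^sub>1 \<odot> ?i \<in> Hom C [e a] [e a]"
    by (simp_all add: Hom_def)
  let ?f = "((\<mu> over * q\<^sub>0) \<odot> ?i) \<oplus> ltrace a"
  have "?f = \<kappa> (\<not> over) \<odot> (\<kappa> over \<odot> ?f)" by (simp add: scalars)
  moreover have "\<kappa> over \<odot> (\<kappa> (\<not> over) \<odot> ?i) = ?i" by (simp add: scalars)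
  ultimately have "\<kappa> over \<odot> ?f = ?i \<longleftrightarrow> ?f = \<kappa> (\<not> over) \<odot> ?i" by metis
  also have "\<kappa> (\<not> over) = \<mu> over * q\<^sub>0 + q\<^sub>1" using q_p q_m by (auto simp: \<kappa>_def \<mu>_def)
  finally show ?thesis unfolding left_curl_X[OF assms] using add_cancel_iff[OF h] by (simp add: scale_add)
qed

text \<open>After the unit factor, the cube of \<open>\<alpha>'\<close>, is cancelled, both braid
  words expand by \<open>braid_word_expansion\<close> with \<open>l = \<zeta>'\<close> and
  \<open>c = - (\<zeta> + \<zeta>')\<close>. Its condition on \<open>l\<close> and \<open>c\<close>
  then reads \<open>- \<zeta> * \<zeta>' = - 1\<close>.\<close>

lemma relation5_iff:
  assumes "relation2 a"
  shows "(X True a a \<otimes> \<langle>[e a]\<rangle>) \<cdot> (\<langle>[e a]\<rangle> \<otimes> X True a a) \<cdot> (X True a a \<otimes> \<langle>[e a]\<rangle>) =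
    (\<langle>[e a]\<rangle> \<otimes> X True a a) \<cdot> (X True a a \<otimes> \<langle>[e a]\<rangle>) \<cdot> (\<langle>[e a]\<rangle> \<otimes> X True a a) \<longleftrightarrow> relation5 a"
proof -
  let ?A = "[e a, e a, e a]" and ?P = "S a \<otimes> \<langle>[e a]\<rangle>" and ?Q = "\<langle>[e a]\<rangle> \<otimes> S a" and ?c = "- (\<zeta> + \<zeta>')"
  let ?x = "X True a a \<otimes> \<langle>[e a]\<rangle>" and ?y = "\<langle>[e a]\<rangle> \<otimes> X True a a"
  define p' q' where "p' = (\<zeta>' \<odot> \<langle>?A\<rangle>) \<oplus> ?P" and "q' = (\<zeta>' \<odot> \<langle>?A\<rangle>) \<oplus> ?Q"
  have PQ: "?P \<in> Hom C ?A ?A" "?Q \<in> Hom C ?A ?A" by (simp_all add: Hom_def)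
  have sq: "?P \<cdot> ?P = ?c \<odot> ?P" "?Q \<cdot> ?Q = ?c \<odot> ?Q"
    using assms by (simp_all add: interchange' bilinear_simps)
  have l: "\<zeta>' * \<zeta>' + \<zeta>' * ?c = - 1" using \<zeta> by (simp add: algebra_simps)
  have x: "?x = \<alpha>' \<odot> p'" "?y = \<alpha>' \<odot> q'"
    by (simp_all add: X_parallel \<kappa>_def \<mu>_def bilinear_simps p'_def q'_def)
  have [simp]: "p' \<in> Mor C" "Src C p' = ?A" "Tgt C p' = ?A" "q' \<in> Mor C" "Src C q' = ?A" "Tgt C q' = ?A"
    by (simp_all add: p'_def q'_def)
  have r: "f = g" if "r \<odot> f = r \<odot> g" "r * r' = 1" "f \<in> Mor C" "g \<in> Mor C" for r r' f g
  proof -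
    have "r' \<odot> (r \<odot> f) = r' \<odot> (r \<odot> g)" "r' * r = 1" using that by (simp_all add: mult.commute)
    then show ?thesis using that(3,4) by simp
  qed
  have "\<alpha>' * (\<alpha>' * \<alpha>') * (\<alpha> * (\<alpha> * \<alpha>)) = (\<alpha> * \<alpha>') * (\<alpha> * \<alpha>') * (\<alpha> * \<alpha>')"
    by (simp only: mult_ac)
  then have u: "\<alpha>' * (\<alpha>' * \<alpha>') * (\<alpha> * (\<alpha> * \<alpha>)) = 1" using \<alpha> by simp
  have "?x \<cdot> ?y \<cdot> ?x = ?y \<cdot> ?x \<cdot> ?y \<longleftrightarrow> (\<alpha>' * (\<alpha>' * \<alpha>')) \<odot> (p' \<cdot> q' \<cdot> p') = (\<alpha>' * (\<alpha>' * \<alpha>')) \<odot> (q' \<cdot> p' \<cdot> q')"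
    unfolding x by (simp add: scale_comp comp_scale mult.assoc)
  also have "\<dots> \<longleftrightarrow> p' \<cdot> q' \<cdot> p' = q' \<cdot> p' \<cdot> q'"
    using r[OF _ u, of "p' \<cdot> q' \<cdot> p'" "q' \<cdot> p' \<cdot> q'"] by auto
  also have "\<dots> \<longleftrightarrow> (?P \<cdot> ?Q \<cdot> ?P) \<ominus> ?P = (?Q \<cdot> ?P \<cdot> ?Q) \<ominus> ?Q"
  proof -
    let ?W = "((\<zeta>' * \<zeta>' * \<zeta>') \<odot> \<langle>?A\<rangle>) \<oplus> ((\<zeta>' * \<zeta>') \<odot> ?P) \<oplus> ((\<zeta>' * \<zeta>') \<odot> ?Q) \<oplus> (\<zeta>' \<odot> (?P \<cdot> ?Q)) \<oplus> (\<zeta>' \<odot> (?Q \<cdot> ?P))"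
    have "p' \<cdot> q' \<cdot> p' = ?W \<oplus> ((?P \<cdot> ?Q \<cdot> ?P) \<ominus> ?P)"
      unfolding p'_def q'_def by (rule braid_word_expansion[OF PQ sq(1) l])
    moreover have "q' \<cdot> p' \<cdot> q' = (((\<zeta>' * \<zeta>' * \<zeta>') \<odot> \<langle>?A\<rangle>) \<oplus> ((\<zeta>' * \<zeta>') \<odot> ?Q) \<oplus> ((\<zeta>' * \<zeta>') \<odot> ?P) \<oplus>
        (\<zeta>' \<odot> (?Q \<cdot> ?P)) \<oplus> (\<zeta>' \<odot> (?P \<cdot> ?Q))) \<oplus> ((?Q \<cdot> ?P \<cdot> ?Q) \<ominus> ?Q)"
      unfolding p'_def q'_def by (rule braid_word_expansion[OF PQ(2,1) sq(2) l])
    moreover have "((\<zeta>' * \<zeta>' * \<zeta>') \<odot> \<langle>?A\<rangle>) \<oplus> ((\<zeta>' * \<zeta>') \<odot> ?Q) \<oplus> ((\<zeta>' * \<zeta>') \<odot> ?P) \<oplus>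
        (\<zeta>' \<odot> (?Q \<cdot> ?P)) \<oplus> (\<zeta>' \<odot> (?P \<cdot> ?Q)) = ?W"
      by (simp add: add_ac)
    moreover have "?W \<oplus> ((?P \<cdot> ?Q \<cdot> ?P) \<ominus> ?P) = ?W \<oplus> ((?Q \<cdot> ?P \<cdot> ?Q) \<ominus> ?Q) \<longleftrightarrow>
        (?P \<cdot> ?Q \<cdot> ?P) \<ominus> ?P = (?Q \<cdot> ?P \<cdot> ?Q) \<ominus> ?Q"
      by (rule add_cancel_iff[of _ ?A ?A]) (simp_all add: Hom_def)
    ultimately show ?thesis by simp
  qed
  also have "\<dots> \<longleftrightarrow> relation5 a"
    by (rule diff_eq_diff_iff[of _ ?A ?A]) (simp_all add: Hom_def)
  finally show ?thesis .
qed

lemma R2_from_relations: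
  assumes "\<And>a. relation1 a" "\<And>a. relation2 a" "\<And>a. relation3 a" "\<And>a. relation4 a"
  shows "X (\<not> over) b a \<cdot> X over a b = \<langle>[e a, e b]\<rangle>"
proof (cases "a = b")
  case True
  then show ?thesis using relation2_iff assms(2) by simp
next
  case False
  then have "a = reverse b" by (cases a; cases b) simp_all
  then show ?thesis using relation4_iff[of b over] assms by simp
qed

text \<open>A cap on \<open>K a\<close> yields the left trace of the reversed strand and also the
  right trace of \<open>a\<close>. Cancelling the cap gives the right trace the value
  \<open>q\<^sub>1\<close> too, and the curl is then evaluated as on the left.\<close>

lemma right_curl_from_relations:
  assumes "\<And>a. relation1 a" "\<And>a. relation3 a"
  shows "right_curl C [e a] (X over a a) = \<langle>[e a]\<rangle>"
proof -
  have "\<epsilon> (reverse a) \<cdot> (\<langle>[e (reverse a)]\<rangle> \<otimes> rtrace a) = \<epsilon> (reverse a) \<cdot> (\<langle>[e (reverse a)]\<rangle> \<otimes> (q\<^sub>1 \<odot> \<langle>[e a]\<rangle>))"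
    using cap_K[of a] cap_K'[of a] assms(2)[of "reverse a"] by (simp add: bilinear_simps)
  then have rt: "rtrace a = q\<^sub>1 \<odot> \<langle>[e a]\<rangle>" by (rule cap_cancel[rotated 2]) (simp_all add: Hom_def)
  show ?thesis unfolding right_curl_X[OF assms(1)] rt
    by (simp add: scale_add[symmetric] scalars)
qed

lemma slides_from_relations:
  assumes "relation2 a" "relation5 a"
  shows "slides True a (X True a a)"
  using relation5_iff[OF assms(1)] assms(2) by (simp add: slides_def)

end

section \<open>From strands that slide over every morphism to a natural braiding\<close>

section \<open>Braided categories from crossings\<close>

lemma with_braiding_fields [simp]:
  "Obj (with_braiding C x U) = Obj C" "Mor (with_braiding C x U) = Mor C" "Src (with_braiding C x U) = Src C"
  "Tgt (with_braiding C x U) = Tgt C" "ide (with_braiding C x U) = ide C" "comp (with_braiding C x U) = comp C"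
  "zero (with_braiding C x U) = zero C" "add (with_braiding C x U) = add C" "scale (with_braiding C x U) = scale C"
  "unit_ob (with_braiding C x U) = unit_ob C" "tensor_ob (with_braiding C x U) = tensor_ob C"
  "tensor (with_braiding C x U) = tensor C" "dual (with_braiding C x U) = dual C"
  "evl (with_braiding C x U) = evl C" "coevl (with_braiding C x U) = coevl C"
  "braid (with_braiding C x U) = word_over_word C x" "strands (with_braiding C x U) = {[s] | s. s \<in> U}"
  by (simp_all add: with_braiding_def rigid_cat.defs braided_cat.defs)

lemma with_braiding_Hom [simp]: "Hom (with_braiding C x U) = Hom C"
  by (intro ext) (simp add: Hom_def)

lemma with_braiding_diff [simp]: "diff (with_braiding C x U) = diff C"
  by (intro ext) (simp add: diff_def)

lemma with_braiding_curl [simp]: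
  "right_curl (with_braiding C x U) = right_curl C" "left_curl (with_braiding C x U) = left_curl C"
  by (intro ext; simp add: right_curl_def left_curl_def)+

lemma rigid_category_with_braiding:
  "rigid_category (with_braiding C x U) = rigid_category C"
  unfolding rigid_category_def rigid_category_axioms_def linear_monoidal_category_def
  by (simp only: with_braiding_fields with_braiding_Hom with_braiding_diff)

lemma rigid_monoidal_functor_with_braiding [simp]:
  "rigid_monoidal_functor (with_braiding C x U) D F = rigid_monoidal_functor C D F"
  "rigid_monoidal_functor D (with_braiding C x U) G = rigid_monoidal_functor D C G"
  by (simp_all add: rigid_monoidal_functor_def)

text \<open>Naturality along one strand is demanded of every morphism; in both quotients it is
  verified by induction over generating morphisms.\<close>

locale braided_crossing = invertible_crossing C T bar e d p m
  for C :: "('s list, 'm, 'r::{comm_ring, comm_monoid_mult}) rigid_cat" (structure)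
    and T :: "'s set" and bar e d and p m :: 'm +
  assumes slides_all: "f \<in> Mor C \<Longrightarrow> slides over c f"
    and right_R1: "right_curl C [e a] (X over a a) = ide C [e a]"
    and left_R1: "left_curl C [e a] (X over a a) = ide C [e a]"
begin

abbreviation B :: "'s list \<Rightarrow> 's list \<Rightarrow> 'm" where "B \<equiv> wow True"

lemma B_right_strand:
  assumes "f \<in> Mor C"
  shows "B (Tgt C f) [e c] \<cdot> (f \<otimes> \<langle>[e c]\<rangle>) = (\<langle>[e c]\<rangle> \<otimes> f) \<cdot> B (Src C f) [e c]"
  using slides_iff_wow[OF assms, of True c] slides_all[OF assms] by simp

lemma B_append_left:
  assumes "A \<in> lists T" "A' \<in> lists T" "D \<in> lists T"
  shows "B (A @ A') D = (B A D \<otimes> \<langle>A'\<rangle>) \<cdot> (\<langle>A\<rangle> \<otimes> B A' D)"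
  using assms(1)
proof (induction A)
  case (Cons s A)
  then have s [simp]: "s \<in> T" "A \<in> lists T" by simp_all
  have [simp]: "strand_over_word C (x True) s D \<in> Mor C" "Src C (strand_over_word C (x True) s D) = s # D"
    "Tgt C (strand_over_word C (x True) s D) = D @ [s]"
    using sow_Mor[OF assms(3), of True "d s"] by simp_all
  show ?case using Cons.IH assms(2,3)
    by (simp add: ide_tensor_comp comp_tensor_ide)
qed (use assms in simp)

text \<open>Letting each letter of \<open>A\<close> cross \<open>D @ D'\<close> in one go, or all of
  \<open>A\<close> cross \<open>D\<close> before \<open>D'\<close>, differs only in the height order
  of two distant blocks, which \<open>sl\<close> exchanges.\<close>

lemma B_append_right:
  assumes "A \<in> lists T" "D \<in> lists T" "D' \<in> lists T"
  shows "B A (D @ D') = (\<langle>D\<rangle> \<otimes> B A D') \<cdot> (B A D \<otimes> \<langle>D'\<rangle>)"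
  using assms(1)
proof (induction A)
  case (Cons s A)
  then have s [simp]: "s \<in> T" "A \<in> lists T" by simp_all
  note [simp] = assms(2,3)
  define \<sigma> where "\<sigma> = (\<lambda>D. strand_over_word C (x True) s D)"
  have [simp]: "\<sigma> D \<in> Mor C" "Src C (\<sigma> D) = s # D" "Tgt C (\<sigma> D) = D @ [s]" if "D \<in> lists T" for D
    using sow_Mor[OF that, of True "d s"] by (simp_all add: \<sigma>_def)
  have \<sigma>: "\<sigma> (D @ D') = (\<langle>D\<rangle> \<otimes> \<sigma> D') \<cdot> (\<sigma> D \<otimes> \<langle>D'\<rangle>)"
    using sow_append[of D D' True "d s"] by (simp add: \<sigma>_def)
  have sl: "(\<sigma> D \<otimes> \<langle>D' @ A\<rangle>) \<cdot> (\<langle>s # D\<rangle> \<otimes> B A D') = (\<langle>D @ [s]\<rangle> \<otimes> B A D') \<cdot> (\<sigma> D \<otimes> \<langle>A @ D'\<rangle>)"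
    using slide[of "\<sigma> D" "B A D'"] by simp
  have "B (s # A) (D @ D') = (\<sigma> (D @ D') \<otimes> \<langle>A\<rangle>) \<cdot> (\<langle>[s]\<rangle> \<otimes> B A (D @ D'))"
    by (simp add: \<sigma>_def)
  also have "\<dots> = (\<langle>D\<rangle> \<otimes> \<sigma> D' \<otimes> \<langle>A\<rangle>) \<cdot> ((\<sigma> D \<otimes> \<langle>D' @ A\<rangle>) \<cdot> (\<langle>s # D\<rangle> \<otimes> B A D')) \<cdot> (\<langle>[s]\<rangle> \<otimes> B A D \<otimes> \<langle>D'\<rangle>)"
    using Cons.IH by (simp add: \<sigma> ide_tensor_comp comp_tensor_ide)
  also have "\<dots> = (\<langle>D\<rangle> \<otimes> B (s # A) D') \<cdot> (B (s # A) D \<otimes> \<langle>D'\<rangle>)"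
    unfolding sl by (simp add: \<sigma>_def[symmetric] ide_tensor_comp comp_tensor_ide)
  finally show ?case .
qed (use assms in simp)

text \<open>The strands of \<open>A\<close> slide over \<open>g\<close> one after another.\<close>

lemma B_natural_right:
  assumes A: "A \<in> lists T" and g [simp]: "g \<in> Mor C"
  shows "B A (Tgt C g) \<cdot> (\<langle>A\<rangle> \<otimes> g) = (g \<otimes> \<langle>A\<rangle>) \<cdot> B A (Src C g)"
  using A
proof (induction A)
  case (Cons s A)
  then have s [simp]: "s \<in> T" "A \<in> lists T" by simp_all
  define \<sigma> where "\<sigma> = (\<lambda>D. strand_over_word C (x True) s D)"
  have [simp]: "\<sigma> D \<in> Mor C" "Src C (\<sigma> D) = s # D" "Tgt C (\<sigma> D) = D @ [s]" if "D \<in> lists T" for D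
    using sow_Mor[OF that, of True "d s"] by (simp_all add: \<sigma>_def)
  have B: "B (s # A) D = (\<sigma> D \<otimes> \<langle>A\<rangle>) \<cdot> (\<langle>[s]\<rangle> \<otimes> B A D)" for D by (simp add: \<sigma>_def)
  have 1: "\<sigma> (Tgt C g) \<cdot> (\<langle>[s]\<rangle> \<otimes> g) = (g \<otimes> \<langle>[s]\<rangle>) \<cdot> \<sigma> (Src C g)"
    using slides_all[OF g, of True "d s"] by (simp add: slides_def \<sigma>_def)
  have "B (s # A) (Tgt C g) \<cdot> (\<langle>s # A\<rangle> \<otimes> g) =
      (\<sigma> (Tgt C g) \<otimes> \<langle>A\<rangle>) \<cdot> (\<langle>[s]\<rangle> \<otimes> (B A (Tgt C g) \<cdot> (\<langle>A\<rangle> \<otimes> g)))"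
    by (simp add: B ide_tensor_comp del: word_over_word.simps)
  also have "\<dots> = ((\<sigma> (Tgt C g) \<cdot> (\<langle>[s]\<rangle> \<otimes> g)) \<otimes> \<langle>A\<rangle>) \<cdot> (\<langle>[s]\<rangle> \<otimes> B A (Src C g))"
    unfolding Cons.IH by (simp add: ide_tensor_comp comp_tensor_ide)
  also have "\<dots> = (g \<otimes> \<langle>s # A\<rangle>) \<cdot> B (s # A) (Src C g)"
    unfolding 1 by (simp add: B comp_tensor_ide del: word_over_word.simps)
  finally show ?case .
qed simp

text \<open>The induction runs over the word on the right, since source and target of
  \<open>f\<close> may differ in length. Each letter passes from right to left in the form
  \<open>B_right_strand\<close>.\<close>

lemma B_natural_left:
  assumes D: "D \<in> lists T" and f [simp]: "f \<in> Mor C"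
  shows "B (Tgt C f) D \<cdot> (f \<otimes> \<langle>D\<rangle>) = (\<langle>D\<rangle> \<otimes> f) \<cdot> B (Src C f) D"
  using D
proof (induction D)
  case Nil
  have "B A [] = \<langle>A\<rangle>" if "A \<in> lists T" for A
    using that by (induction A) simp_all
  then show ?case by simp
next
  case (Cons s D)
  then have s [simp]: "s \<in> T" "D \<in> lists T" by simp_all
  have B: "B A (s # D) = (\<langle>[s]\<rangle> \<otimes> B A D) \<cdot> (B A [s] \<otimes> \<langle>D\<rangle>)" if "A \<in> lists T" for A
    using B_append_right[of A "[s]" D] that by simp
  have 1: "B (Tgt C f) [s] \<cdot> (f \<otimes> \<langle>[s]\<rangle>) = (\<langle>[s]\<rangle> \<otimes> f) \<cdot> B (Src C f) [s]"
    using B_right_strand[OF f, of "d s"] by simp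
  have "B (Tgt C f) (s # D) \<cdot> (f \<otimes> \<langle>s # D\<rangle>) =
      (\<langle>[s]\<rangle> \<otimes> B (Tgt C f) D) \<cdot> ((B (Tgt C f) [s] \<cdot> (f \<otimes> \<langle>[s]\<rangle>)) \<otimes> \<langle>D\<rangle>)"
    by (simp add: B comp_tensor_ide)
  also have "\<dots> = (\<langle>[s]\<rangle> \<otimes> (B (Tgt C f) D \<cdot> (f \<otimes> \<langle>D\<rangle>))) \<cdot> (B (Src C f) [s] \<otimes> \<langle>D\<rangle>)"
    unfolding 1 by (simp add: ide_tensor_comp comp_tensor_ide)
  also have "\<dots> = (\<langle>s # D\<rangle> \<otimes> f) \<cdot> B (Src C f) (s # D)"
    unfolding Cons.IH by (simp add: B ide_tensor_comp)
  finally show ?case .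
qed

text \<open>Each strand is carried back by the passage with exchanged heights, inverse to it by
  \<open>wow_sow_inverse\<close>.\<close>

lemma B_invertible:
  assumes "A \<in> lists T" and D [simp]: "D \<in> lists T"
  shows "\<exists>g \<in> Hom C (D @ A) (A @ D). g \<cdot> B A D = \<langle>A @ D\<rangle> \<and> B A D \<cdot> g = \<langle>D @ A\<rangle>"
  using assms(1)
proof (induction A)
  case Nil
  then show ?case by (intro bexI[of _ "\<langle>D\<rangle>"]) (simp_all add: Hom_def)
next
  case (Cons s A)
  then have s [simp]: "s \<in> T" "A \<in> lists T" by simp_all
  define \<sigma> \<tau> where "\<sigma> = strand_over_word C (x True) s D" and "\<tau> = wow False D [s]"
  have [simp]: "\<sigma> \<in> Mor C" "Src C \<sigma> = s # D" "Tgt C \<sigma> = D @ [s]" "\<tau> \<in> Mor C" "Tgt C \<tau> = s # D" "Src C \<tau> = D @ [s]"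
    using sow_Mor[OF D, of True "d s"] by (simp_all add: \<sigma>_def \<tau>_def)
  have i: "\<tau> \<cdot> \<sigma> = \<langle>s # D\<rangle>" "\<sigma> \<cdot> \<tau> = \<langle>D @ [s]\<rangle>"
    using wow_sow_inverse[OF D, of False "d s"] by (simp_all add: \<sigma>_def \<tau>_def)
  have i': "(\<tau> \<otimes> \<langle>A\<rangle>) \<cdot> (\<sigma> \<otimes> \<langle>A\<rangle>) = \<langle>s # D @ A\<rangle>" "(\<sigma> \<otimes> \<langle>A\<rangle>) \<cdot> (\<tau> \<otimes> \<langle>A\<rangle>) = \<langle>D @ s # A\<rangle>"
    by (simp_all add: interchange' i)
  obtain g where g: "g \<in> Hom C (D @ A) (A @ D)" and gB: "g \<cdot> B A D = \<langle>A @ D\<rangle>" "B A D \<cdot> g = \<langle>D @ A\<rangle>"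
    using Cons.IH by auto
  note [simp] = HomD[OF g]
  have g': "(\<langle>[s]\<rangle> \<otimes> g) \<cdot> (\<langle>[s]\<rangle> \<otimes> B A D) = \<langle>s # A @ D\<rangle>" "(\<langle>[s]\<rangle> \<otimes> B A D) \<cdot> (\<langle>[s]\<rangle> \<otimes> g) = \<langle>s # D @ A\<rangle>"
    by (simp_all add: interchange' gB)
  have B: "B (s # A) D = (\<sigma> \<otimes> \<langle>A\<rangle>) \<cdot> (\<langle>[s]\<rangle> \<otimes> B A D)" by (simp add: \<sigma>_def)
  show ?case unfolding B
    by (intro bexI[of _ "(\<langle>[s]\<rangle> \<otimes> g) \<cdot> (\<tau> \<otimes> \<langle>A\<rangle>)"])
      (simp_all add: Hom_def i'[THEN reassoc1] i' g'[THEN reassoc1] g')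
qed

theorem rigid_braided_untwisted: "rigid_braided_untwisted (with_braiding C (x True) T)"
proof -
  interpret W: rigid_category "with_braiding C (x True) T"
    unfolding rigid_category_with_braiding by (rule rigid_category_axioms)
  have sw: "strand_words (with_braiding C (x True) T) = lists T"
  proof (intro equalityI subsetI)
    show "A \<in> lists T" if "A \<in> strand_words (with_braiding C (x True) T)" for A
      using that by induction auto
    show "A \<in> strand_words (with_braiding C (x True) T)" if "A \<in> lists T" for A
      using that
    proof (induction A)
      case Nil
      then show ?case using strand_words.intros(1)[of "with_braiding C (x True) T"] by simp
    next
      case (Cons s A)
      then show ?case using strand_words.intros(2)[of "[s]" "with_braiding C (x True) T" A] by auto
    qed
  qed
  show ?thesis
  proof (unfold_locales, unfold with_braiding_fields with_braiding_Hom with_braiding_curl Obj_words tensor_ob_words sw)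
    fix f g A A' D D'
    assume "f \<in> Hom C A A'" "g \<in> Hom C D D'"
    then have [simp]: "f \<in> Mor C" "Src C f = A" "Tgt C f = A'" "g \<in> Mor C" "Src C g = D" "Tgt C g = D'"
      by (simp_all add: HomD)
    have [simp]: "A \<in> lists T" "D \<in> lists T" "A' \<in> lists T" "D' \<in> lists T"
      using Src_lists[of f] Src_lists[of g] Tgt_lists[of f] Tgt_lists[of g] by simp_all
    \<comment> \<open>\<open>f\<close> and \<open>g\<close> are separated in height and pulled
      through the braiding one at a time.\<close>
    have "B A' D' \<cdot> (f \<otimes> g) = (B A' D' \<cdot> (f \<otimes> \<langle>D'\<rangle>)) \<cdot> (\<langle>A\<rangle> \<otimes> g)"
      using tensor_split[of f g] by simp
    also have "\<dots> = (\<langle>D'\<rangle> \<otimes> f) \<cdot> (B A D' \<cdot> (\<langle>A\<rangle> \<otimes> g))"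
      using B_natural_left[of D' f] by simp
    also have "\<dots> = ((\<langle>D'\<rangle> \<otimes> f) \<cdot> (g \<otimes> \<langle>A\<rangle>)) \<cdot> B A D"
      using B_natural_right[of A g] by simp
    also have "(\<langle>D'\<rangle> \<otimes> f) \<cdot> (g \<otimes> \<langle>A\<rangle>) = g \<otimes> f"
      using tensor_split'[of g f] by simp
    finally show "B A' D' \<cdot> (f \<otimes> g) = (g \<otimes> f) \<cdot> B A D" .
  next
    fix A assume "A \<in> {[s] | s. s \<in> T}"
    then obtain a where a: "A = [e a]" by (auto simp: T_range)
    have "B [e a] [e a] = X True a a" by simp
    then show "right_curl C A (B A A) = \<langle>A\<rangle>" "left_curl C A (B A A) = \<langle>A\<rangle>" "dual C A \<in> {[s] | s. s \<in> T}"
      using right_R1 left_R1 a by auto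
  qed (simp_all add: B_append_left B_append_right B_invertible HomI)
qed

end

section \<open>Half turns of composites, and functors that send letters to letters\<close>

section \<open>Functors between categories of words\<close>

context word_category
begin

text \<open>The characteristic property of the mate: a morphism can be pulled over a cap to its
  other leg, where it appears turned. The cup inside the mate is straightened against the
  cap.\<close>

lemma cap_mate:
  assumes [simp]: "g \<in> Mor C" "Src C g = B" "Tgt C g = D"
  shows "evl C B \<cdot> (\<langle>B\<rangle> \<otimes> mate C g) = evl C D \<cdot> (g \<otimes> \<langle>dual C D\<rangle>)"
proof -
  have [simp]: "B \<in> lists T" "D \<in> lists T" using Src_lists[of g] Tgt_lists[of g] by simp_all
  have 1: "evl C B \<cdot> (\<langle>B @ dual C B\<rangle> \<otimes> evl C D) = evl C D \<cdot> (evl C B \<otimes> \<langle>D @ dual C D\<rangle>)"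
    using slide[of "evl C B" "evl C D"] by simp
  have 2: "(evl C B \<otimes> \<langle>D @ dual C D\<rangle>) \<cdot> (\<langle>B @ dual C B\<rangle> \<otimes> g \<otimes> \<langle>dual C D\<rangle>) = (g \<otimes> \<langle>dual C D\<rangle>) \<cdot> (evl C B \<otimes> \<langle>B @ dual C D\<rangle>)"
    using slide[of "evl C B" "g \<otimes> \<langle>dual C D\<rangle>"] by simp
  have 3: "(evl C B \<otimes> \<langle>B @ dual C D\<rangle>) \<cdot> (\<langle>B\<rangle> \<otimes> coevl C (dual C B) \<otimes> \<langle>dual C D\<rangle>) = \<langle>B @ dual C D\<rangle>"
    using arg_cong[OF word_zigzag_left[of B], of "\<lambda>f. f \<otimes> \<langle>dual C D\<rangle>"] by (simp add: comp_tensor_ide)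
  show ?thesis
    by (simp add: mate_def ide_tensor_comp 1[THEN reassoc] 2[THEN reassoc] 3)
qed

lemma comate_Mor [simp]:
  "f \<in> Mor C \<Longrightarrow> comate C f \<in> Mor C"
  "f \<in> Mor C \<Longrightarrow> Src C (comate C f) = dual C (Tgt C f)"
  "f \<in> Mor C \<Longrightarrow> Tgt C (comate C f) = dual C (Src C f)"
  by (simp_all add: comate_def)

lemma cap_comate:
  assumes [simp]: "g \<in> Mor C" "Src C g = B" "Tgt C g = D"
  shows "evl C (dual C B) \<cdot> (comate C g \<otimes> \<langle>B\<rangle>) = evl C (dual C D) \<cdot> (\<langle>dual C D\<rangle> \<otimes> g)"
proof -
  have [simp]: "B \<in> lists T" "D \<in> lists T" using Src_lists[of g] Tgt_lists[of g] by simp_all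
  have 1: "evl C (dual C B) \<cdot> (evl C (dual C D) \<otimes> \<langle>dual C B @ B\<rangle>) = evl C (dual C D) \<cdot> (\<langle>dual C D @ D\<rangle> \<otimes> evl C (dual C B))"
    using slide[of "evl C (dual C D)" "evl C (dual C B)"] by simp
  have 2: "(\<langle>dual C D @ D\<rangle> \<otimes> evl C (dual C B)) \<cdot> (\<langle>dual C D\<rangle> \<otimes> g \<otimes> \<langle>dual C B @ B\<rangle>) =
      (\<langle>dual C D\<rangle> \<otimes> g) \<cdot> (\<langle>dual C D @ B\<rangle> \<otimes> evl C (dual C B))"
    using slide[of "\<langle>dual C D\<rangle> \<otimes> g" "evl C (dual C B)"] by simp
  have 3: "(\<langle>dual C D @ B\<rangle> \<otimes> evl C (dual C B)) \<cdot> (\<langle>dual C D\<rangle> \<otimes> coevl C B \<otimes> \<langle>B\<rangle>) = \<langle>dual C D @ B\<rangle>"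
    using arg_cong[OF word_zigzag_right[of B], of "\<lambda>f. \<langle>dual C D\<rangle> \<otimes> f"] by (simp add: ide_tensor_comp)
  show ?thesis
    by (simp add: comate_def comp_tensor_ide 1[THEN reassoc] 2[THEN reassoc] 3)
qed

text \<open>\<open>mate C g\<close> is moved upwards past the cup and past \<open>f\<close> until it
  meets the cap, where \<open>cap_mate\<close> turns it back into \<open>g\<close> on top of
  \<open>f\<close>.\<close>

lemma mate_comp:
  assumes [simp]: "f \<in> Mor C" "g \<in> Mor C" "Src C g = Tgt C f"
  shows "mate C (g \<cdot> f) = mate C f \<cdot> mate C g"
proof -
  let ?A = "Src C f" and ?B = "Tgt C f" and ?D = "Tgt C g"
  have 1: "(coevl C (dual C ?A) \<otimes> \<langle>dual C ?B\<rangle>) \<cdot> mate C g = (\<langle>dual C ?A @ ?A\<rangle> \<otimes> mate C g) \<cdot> (coevl C (dual C ?A) \<otimes> \<langle>dual C ?D\<rangle>)"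
    using slide[of "coevl C (dual C ?A)" "mate C g"] by simp
  have 2: "(\<langle>dual C ?A\<rangle> \<otimes> f \<otimes> \<langle>dual C ?B\<rangle>) \<cdot> (\<langle>dual C ?A @ ?A\<rangle> \<otimes> mate C g) =
      (\<langle>dual C ?A @ ?B\<rangle> \<otimes> mate C g) \<cdot> (\<langle>dual C ?A\<rangle> \<otimes> f \<otimes> \<langle>dual C ?D\<rangle>)"
    using slide[of "\<langle>dual C ?A\<rangle> \<otimes> f" "mate C g" "dual C ?A @ ?A" "dual C ?A @ ?B" "dual C ?D" "dual C ?B"] by simp
  have 3: "(\<langle>dual C ?A\<rangle> \<otimes> evl C ?B) \<cdot> (\<langle>dual C ?A @ ?B\<rangle> \<otimes> mate C g) = (\<langle>dual C ?A\<rangle> \<otimes> evl C ?D) \<cdot> (\<langle>dual C ?A\<rangle> \<otimes> g \<otimes> \<langle>dual C ?D\<rangle>)"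
    using arg_cong[OF cap_mate[of g ?B ?D], of "\<lambda>h. \<langle>dual C ?A\<rangle> \<otimes> h"] by (simp add: ide_tensor_comp)
  have "mate C f \<cdot> mate C g = (\<langle>dual C ?A\<rangle> \<otimes> evl C ?B) \<cdot> (\<langle>dual C ?A\<rangle> \<otimes> f \<otimes> \<langle>dual C ?B\<rangle>) \<cdot>
      ((coevl C (dual C ?A) \<otimes> \<langle>dual C ?B\<rangle>) \<cdot> mate C g)"
    by (simp add: mate_def[of _ f])
  also have "\<dots> = mate C (g \<cdot> f)"
    unfolding 1 by (simp add: 2[THEN reassoc] 3[THEN reassoc]) (simp add: mate_def ide_tensor_comp comp_tensor_ide)
  finally show ?thesis ..
qed

lemma comate_comp:
  assumes [simp]: "f \<in> Mor C" "g \<in> Mor C" "Src C g = Tgt C f"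
  shows "comate C (g \<cdot> f) = comate C f \<cdot> comate C g"
proof -
  let ?A = "Src C f" and ?B = "Tgt C f" and ?D = "Tgt C g"
  have 1: "(\<langle>dual C ?B\<rangle> \<otimes> coevl C ?A) \<cdot> comate C g = (comate C g \<otimes> \<langle>?A @ dual C ?A\<rangle>) \<cdot> (\<langle>dual C ?D\<rangle> \<otimes> coevl C ?A)"
    using slide[of "comate C g" "coevl C ?A"] by simp
  have 2: "(\<langle>dual C ?B\<rangle> \<otimes> f \<otimes> \<langle>dual C ?A\<rangle>) \<cdot> (comate C g \<otimes> \<langle>?A @ dual C ?A\<rangle>) =
      (comate C g \<otimes> \<langle>?B @ dual C ?A\<rangle>) \<cdot> (\<langle>dual C ?D\<rangle> \<otimes> f \<otimes> \<langle>dual C ?A\<rangle>)"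
    using slide[of "comate C g" "f \<otimes> \<langle>dual C ?A\<rangle>"] by simp
  have 3: "(evl C (dual C ?B) \<otimes> \<langle>dual C ?A\<rangle>) \<cdot> (comate C g \<otimes> \<langle>?B @ dual C ?A\<rangle>) = (evl C (dual C ?D) \<otimes> \<langle>dual C ?A\<rangle>) \<cdot> (\<langle>dual C ?D\<rangle> \<otimes> g \<otimes> \<langle>dual C ?A\<rangle>)"
    using arg_cong[OF cap_comate[of g ?B ?D], of "\<lambda>h. h \<otimes> \<langle>dual C ?A\<rangle>"] by (simp add: comp_tensor_ide)
  have "comate C f \<cdot> comate C g = (evl C (dual C ?B) \<otimes> \<langle>dual C ?A\<rangle>) \<cdot> (\<langle>dual C ?B\<rangle> \<otimes> f \<otimes> \<langle>dual C ?A\<rangle>) \<cdot>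
      ((\<langle>dual C ?B\<rangle> \<otimes> coevl C ?A) \<cdot> comate C g)"
    by (simp add: comate_def[of _ f])
  also have "\<dots> = comate C (g \<cdot> f)"
    unfolding 1 by (simp add: 2[THEN reassoc] 3[THEN reassoc]) (simp add: comate_def ide_tensor_comp comp_tensor_ide)
  finally show ?thesis ..
qed

end

text \<open>A rigid functor sending letters to letters, so that its effect on words is a
  \<open>map\<close>. The interpretation reading edges labelled 2 as two strands also takes this
  form after restriction to words of edges labelled 1.\<close>

locale word_functor = C: word_category C T bar + D: word_category D T' bar' + rigid_functor C D F
  for C :: "('s list, 'm, 'r::{comm_ring, comm_monoid_mult}, 'x) rigid_cat_scheme" and T :: "'s set" and bar
    and D :: "('t list, 'n, 'r, 'y) rigid_cat_scheme" and T' :: "'t set" and bar' and F +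
  fixes t :: "'s \<Rightarrow> 't"
  assumes F_strand: "s \<in> T \<Longrightarrow> on_obj F [s] = [t s]"
begin

lemma F_word [simp]: "w \<in> lists T \<Longrightarrow> on_obj F w = map t w"
proof (induction w)
  case Nil
  then show ?case using F_simps(6) by simp
next
  case (Cons s w)
  then show ?case using F_simps(7)[of "[s]" w] F_strand by simp
qed

lemma t_in: "s \<in> T \<Longrightarrow> t s \<in> T'"
  using F_simps(1)[of "[s]"] F_strand[of s] by simp

lemma F_comate [simp]: "f \<in> Mor C \<Longrightarrow> on_mor F (comate C f) = comate D (on_mor F f)"
  by (simp add: comate_def del: F_word)

text \<open>Every crossing is assembled from \<open>p\<close>, \<open>m\<close>, cups and caps, so
  only the images of the two upward crossings matter.\<close>

lemma F_crossing:
  assumes "crossing_category C T bar e d p m"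
  shows "on_mor F (crossing C e p m over a b) = crossing D (\<lambda>a. t (e a)) (on_mor F p) (on_mor F m) over a b"
proof -
  interpret crossing_category C T bar e d p m by fact
  note [simp] = HomD[OF p_in] HomD[OF m_in]
  show ?thesis
    by (cases a; cases b) (simp_all add: crossing_def Let_def)
qed

lemma F_right_curl:
  "\<lbrakk>s \<in> T; c \<in> Hom C [s, s] [s, s]\<rbrakk> \<Longrightarrow> on_mor F (right_curl C [s] c) = right_curl D [t s] (on_mor F c)"
  and F_left_curl:
  "\<lbrakk>s \<in> T; c \<in> Hom C [s, s] [s, s]\<rbrakk> \<Longrightarrow> on_mor F (left_curl C [s] c) = left_curl D [t s] (on_mor F c)"
proof -
  assume s: "s \<in> T" and c: "c \<in> Hom C [s, s] [s, s]"
  note [simp] = HomD[OF c] s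
  have [simp]: "bar' (t s) = t (bar s)"
    using F_simps(9)[of "[s]"] by simp
  show "on_mor F (right_curl C [s] c) = right_curl D [t s] (on_mor F c)"
    "on_mor F (left_curl C [s] c) = left_curl D [t s] (on_mor F c)"
    by (simp_all add: right_curl_def left_curl_def)
qed

lemma F_strand_over_word:
  assumes x: "\<And>s s'. \<lbrakk>s \<in> T; s' \<in> T\<rbrakk> \<Longrightarrow> x s s' \<in> Hom C [s, s'] [s', s]"
    and y: "\<And>s s'. \<lbrakk>s \<in> T; s' \<in> T\<rbrakk> \<Longrightarrow> on_mor F (x s s') = y (t s) (t s')"
    and s: "s \<in> T" and A: "A \<in> lists T"
  shows "strand_over_word C x s A \<in> Hom C (s # A) (A @ [s])"
    and "on_mor F (strand_over_word C x s A) = strand_over_word D y (t s) (map t A)"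
proof -
  have "strand_over_word C x s A \<in> Hom C (s # A) (A @ [s]) \<and>
      on_mor F (strand_over_word C x s A) = strand_over_word D y (t s) (map t A)"
    using A
  proof (induction A)
    case Nil
    then show ?case using s by (simp add: Hom_def)
  next
    case (Cons s' A)
    then have s' [simp]: "s' \<in> T" "A \<in> lists T" by simp_all
    have [simp]: "strand_over_word C x s A \<in> Mor C" "Src C (strand_over_word C x s A) = s # A"
      "Tgt C (strand_over_word C x s A) = A @ [s]"
      using Cons.IH by (simp_all add: Hom_def)
    show ?case using Cons.IH s HomD[OF x[OF s s'(1)]] y[OF s s'(1)] by (simp add: Hom_def)
  qed
  then show "strand_over_word C x s A \<in> Hom C (s # A) (A @ [s])"
    "on_mor F (strand_over_word C x s A) = strand_over_word D y (t s) (map t A)" by auto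
qed

lemma F_word_over_word:
  assumes x: "\<And>s s'. \<lbrakk>s \<in> T; s' \<in> T\<rbrakk> \<Longrightarrow> x s s' \<in> Hom C [s, s'] [s', s]"
    and y: "\<And>s s'. \<lbrakk>s \<in> T; s' \<in> T\<rbrakk> \<Longrightarrow> on_mor F (x s s') = y (t s) (t s')"
    and A: "A \<in> lists T" and B: "B \<in> lists T"
  shows "on_mor F (word_over_word C x A B) = word_over_word D y (map t A) (map t B)"
proof -
  have "word_over_word C x A B \<in> Hom C (A @ B) (B @ A) \<and>
      on_mor F (word_over_word C x A B) = word_over_word D y (map t A) (map t B)"
    using A
  proof (induction A)
    case Nil
    then show ?case using B by (simp add: Hom_def)
  next
    case (Cons s A)
    then have s [simp]: "s \<in> T" "A \<in> lists T" by simp_all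
    have [simp]: "word_over_word C x A B \<in> Mor C" "Src C (word_over_word C x A B) = A @ B"
      "Tgt C (word_over_word C x A B) = B @ A"
      using Cons.IH by (simp_all add: Hom_def)
    show ?case using Cons.IH B HomD[OF F_strand_over_word(1)[OF x y s(1) B]] F_strand_over_word(2)[OF x y s(1) B]
      by (simp add: Hom_def)
  qed
  then show ?thesis by simp
qed

end

context diagram_family
begin

lemma of_diagram_turn:
  fixes d :: "('s, 'v) diagram"
  assumes "d \<in> ds"
  shows "of_diagram \<Sigma> (turn_right \<Sigma> d) = mate C (of_diagram \<Sigma> d :: ('s, 'v, 'r::{comm_ring, comm_monoid_mult}) diag_mor)"
    and "of_diagram \<Sigma> (turn_left \<Sigma> d) = comate C (of_diagram \<Sigma> d :: ('s, 'v, 'r) diag_mor)"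
proof -
  have st: "Src C (of_diagram \<Sigma> d :: ('s, 'v, 'r) diag_mor) = src \<Sigma> d" "Tgt C (of_diagram \<Sigma> d :: ('s, 'v, 'r) diag_mor) = tgt \<Sigma> d"
    by (simp_all add: of_diagram_def)
  show "of_diagram \<Sigma> (turn_right \<Sigma> d) = mate C (of_diagram \<Sigma> d :: ('s, 'v, 'r) diag_mor)"
    "of_diagram \<Sigma> (turn_left \<Sigma> d) = comate C (of_diagram \<Sigma> d :: ('s, 'v, 'r) diag_mor)"
    unfolding mate_def comate_def st turn_right_def turn_left_def Let_def
    using ds_wf[OF assms] by (simp_all add: of_diagram_Stack of_diagram_Beside)
qed

end

lemma functors_agree:
  assumes F: "rigid_functor C D F" and G: "rigid_functor C D G" and C: "word_category C T bar"
    and ob: "\<And>s. s \<in> T \<Longrightarrow> on_obj F [s] = on_obj G [s]"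
    and A: "A \<in> lists T"
  shows "on_obj F A = on_obj G A"
proof -
  interpret F: rigid_functor C D F by fact
  interpret G: rigid_functor C D G by fact
  interpret C: word_category C T bar by fact
  show ?thesis using A
  proof (induction A)
    case Nil
    then show ?case using F.F_simps(6) G.F_simps(6) by simp
  next
    case (Cons s A)
    then show ?case using F.F_simps(7)[of "[s]" A] G.F_simps(7)[of "[s]" A] ob by simp
  qed
qed

context diagram_family
begin
declare C_fields [simp del]
end

text \<open>For the identity embedding \<open>e = (\<lambda>a. a)\<close> this equation would rewrite a term to itself.\<close>

context crossing_category
begin
declare bar_e [simp del]
end

section \<open>Tangles modulo the moves and the skein relations\<close>

section \<open>The HOMFLY-PT category\<close>

interpretation tangle: diagram_family tangle_sig UNIV "{d. wf_diagram tangle_sig d}"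
  by unfold_locales (auto simp: tangle_sig_def)

lemma PTD_eq: "PTD = tangle.C"
  by (simp add: PTD_def)

lemma PTD_Obj [simp]: "Obj PTD = UNIV"
  by (simp add: PTD_def diagram_cat_def)

lemma word_category_PTD: "word_category (PTD :: (_, 'r::{comm_ring, comm_monoid_mult} tangle_mor, 'r) rigid_cat) UNIV reverse"
  using tangle.word_category_C unfolding PTD_eq by (simp add: tangle_sig_def)

text \<open>Invariance of the two crossings under a full turn is the isotopy rule for
  vertices.\<close>

lemma crossing_category_PTD:
  "crossing_category (PTD :: (_, 'r::{comm_ring, comm_monoid_mult} tangle_mor, 'r) rigid_cat) UNIV reverse (\<lambda>a. a) (\<lambda>a. a)
    (of_diagram tangle_sig (Node Xp)) (of_diagram tangle_sig (Node Xm))"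
proof -
  interpret word_category "PTD :: (_, 'r tangle_mor, 'r) rigid_cat" UNIV reverse
    by (rule word_category_PTD)
  have i: "of_diagram tangle_sig (Node v) \<in> Hom (PTD :: (_, 'r tangle_mor, 'r) rigid_cat) [Up, Up] [Up, Up]" for v
    using tangle.of_diagram_Mor[of "Node v"] unfolding PTD_eq by (simp add: tangle_sig_def)
  have t: "mate PTD (of_diagram tangle_sig (Node v) :: 'r tangle_mor) = comate PTD (of_diagram tangle_sig (Node v))" for v
  proof -
    have "mate PTD (of_diagram tangle_sig (Node v) :: 'r tangle_mor) = of_diagram tangle_sig (turn_right tangle_sig (Node v))"
      "comate PTD (of_diagram tangle_sig (Node v) :: 'r tangle_mor) = of_diagram tangle_sig (turn_left tangle_sig (Node v))"
      unfolding PTD_eq by (rule tangle.of_diagram_turn[symmetric]; simp)+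
    then show ?thesis using tangle.of_diagram_eqI[OF iso_turn[of tangle_sig v]] by metis
  qed
  show ?thesis
    by unfold_locales (simp_all add: i t)
qed

lemma reidemeister_Mor:
  "reidemeister1 \<union> reidemeister2 \<union> reidemeister3 \<subseteq> Mor (PTD :: (_, 'r::{comm_ring, comm_monoid_mult} tangle_mor, 'r) rigid_cat)"
proof -
  interpret crossing_category "PTD :: (_, 'r tangle_mor, 'r) rigid_cat" UNIV reverse "\<lambda>a. a" "\<lambda>a. a"
    "of_diagram tangle_sig (Node Xp)" "of_diagram tangle_sig (Node Xm)"
    by (rule crossing_category_PTD)
  show ?thesis
    unfolding reidemeister1_def reidemeister2_def reidemeister3_def tangle_crossing_def
    by (auto simp: right_curl_def left_curl_def)
qed

text \<open>Relators are differences, so killing one means equality of the images of its two sides.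
  Read forwards this yields the moves in the tangle quotient; read backwards it lets a functor
  descend to tangles.\<close>

lemma reidemeister_killed_iff:
  fixes D :: "('t list, 'n, 'r::{comm_ring, comm_monoid_mult}, 'y) rigid_cat_scheme"
  assumes F: "word_functor (PTD :: (_, 'r tangle_mor, 'r) rigid_cat) UNIV reverse D T' bar' F t"
  defines "X \<equiv> crossing D t (on_mor F (of_diagram tangle_sig (Node Xp))) (on_mor F (of_diagram tangle_sig (Node Xm)))"
  shows "(\<forall>g \<in> reidemeister1 \<union> reidemeister2 \<union> reidemeister3.
      on_mor F g = zero D (on_obj F (Src PTD g)) (on_obj F (Tgt PTD g))) \<longleftrightarrow>
    (\<forall>over a. right_curl D [t a] (X over a a) = ide D [t a] \<and> left_curl D [t a] (X over a a) = ide D [t a]) \<and>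
    (\<forall>over a b. comp D (X (\<not> over) b a) (X over a b) = ide D [t a, t b]) \<and>
    (\<forall>(i::nat) (j::nat) (k::nat) a b c. distinct [i, j, k] \<longrightarrow>
      comp D (tensor D (X (j > k) b c) (ide D [t a]))
        (comp D (tensor D (ide D [t b]) (X (i > k) a c)) (tensor D (X (i > j) a b) (ide D [t c]))) =
      comp D (tensor D (ide D [t c]) (X (i > j) a b))
        (comp D (tensor D (X (i > k) a c) (ide D [t b])) (tensor D (ide D [t a]) (X (j > k) b c))))"
    (is "?killed \<longleftrightarrow> ?R1 \<and> ?R2 \<and> ?R3")
proof -
  interpret F: word_functor "PTD :: (_, 'r tangle_mor, 'r) rigid_cat" UNIV reverse D T' bar' F t by fact
  interpret P: crossing_category "PTD :: (_, 'r tangle_mor, 'r) rigid_cat" UNIV reverse "\<lambda>a. a" "\<lambda>a. a"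
    "of_diagram tangle_sig (Node Xp)" "of_diagram tangle_sig (Node Xm)"
    by (rule crossing_category_PTD)
  have X: "on_mor F (tangle_crossing over a b) = X over a b" for over a b
    using F.F_crossing[OF crossing_category_PTD] by (simp add: tangle_crossing_def X_def)
  have t: "tangle_crossing over a b \<in> Mor (PTD :: (_, 'r tangle_mor, 'r) rigid_cat)"
    "Src PTD (tangle_crossing over a b :: 'r tangle_mor) = [a, b]"
    "Tgt PTD (tangle_crossing over a b :: 'r tangle_mor) = [b, a]" for over a b
    by (simp_all add: tangle_crossing_def)
  have curl: "right_curl PTD [a] (tangle_crossing over a a) \<in> Mor (PTD :: (_, 'r tangle_mor, 'r) rigid_cat)"
    "Src PTD (right_curl PTD [a] (tangle_crossing over a a :: 'r tangle_mor)) = [a]"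
    "Tgt PTD (right_curl PTD [a] (tangle_crossing over a a :: 'r tangle_mor)) = [a]"
    "left_curl PTD [a] (tangle_crossing over a a) \<in> Mor (PTD :: (_, 'r tangle_mor, 'r) rigid_cat)"
    "Src PTD (left_curl PTD [a] (tangle_crossing over a a :: 'r tangle_mor)) = [a]"
    "Tgt PTD (left_curl PTD [a] (tangle_crossing over a a :: 'r tangle_mor)) = [a]" for over a
    by (simp_all add: right_curl_def left_curl_def t)
  have FX: "X over a b \<in> Mor D" "Src D (X over a b) = [t a, t b]" "Tgt D (X over a b) = [t b, t a]" for over a b
    using F.F_Mor[OF t(1)[of over a b]] by (simp_all add: X t)
  have FC: "on_mor F (right_curl PTD [a] (tangle_crossing over a a)) = right_curl D [t a] (X over a a)"
    "on_mor F (left_curl PTD [a] (tangle_crossing over a a)) = left_curl D [t a] (X over a a)" for over a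
    using F.F_right_curl[of a "tangle_crossing over a a"] F.F_left_curl[of a "tangle_crossing over a a"]
    by (simp_all add: X t Hom_def)
  let ?kill = "\<lambda>g :: 'r tangle_mor. on_mor F g = zero D (on_obj F (Src PTD g)) (on_obj F (Tgt PTD g))"
  have dz: "?kill (f \<ominus>\<^bsub>PTD\<^esub> g) \<longleftrightarrow>
      on_mor F f = on_mor F g"
    if "f \<in> Mor PTD" "g \<in> Mor PTD" "Src PTD f = Src PTD g" "Tgt PTD f = Tgt PTD g" for f g
    using that F.D.diff_eq_zero[of "on_mor F f" "on_mor F g"] by simp
  have ti [simp]: "t a \<in> T'" for a using F.t_in by simp
  have 1: "(\<forall>g \<in> reidemeister1. on_mor F g = zero D (on_obj F (Src PTD g)) (on_obj F (Tgt PTD g))) \<longleftrightarrow> ?R1"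
  proof -
    have r: "?kill (right_curl PTD [a] (tangle_crossing over a a) \<ominus>\<^bsub>PTD\<^esub> ide PTD [a]) \<longleftrightarrow>
        right_curl D [t a] (X over a a) = ide D [t a]" for over a
      by (subst dz) (simp_all add: curl FC)
    have l: "?kill (left_curl PTD [a] (tangle_crossing over a a) \<ominus>\<^bsub>PTD\<^esub> ide PTD [a]) \<longleftrightarrow>
        left_curl D [t a] (X over a a) = ide D [t a]" for over a
      by (subst dz) (simp_all add: curl FC)
    show ?thesis unfolding reidemeister1_def by (simp only: ball_UN ball_simps r l) blast
  qed
  have 2: "(\<forall>g \<in> reidemeister2. on_mor F g = zero D (on_obj F (Src PTD g)) (on_obj F (Tgt PTD g))) \<longleftrightarrow> ?R2"
  proof -
    have "?kill ((tangle_crossing (\<not> over) b a \<cdot>\<^bsub>PTD\<^esub> tangle_crossing over a b) \<ominus>\<^bsub>PTD\<^esub> ide PTD [a, b]) \<longleftrightarrow>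
        comp D (X (\<not> over) b a) (X over a b) = ide D [t a, t b]" for over a b
      by (subst dz) (simp_all add: t X)
    note eq = this
    have "(\<forall>g \<in> reidemeister2. ?kill g) \<longleftrightarrow> (\<forall>over a b.
        ?kill ((tangle_crossing (\<not> over) b a \<cdot>\<^bsub>PTD\<^esub> tangle_crossing over a b) \<ominus>\<^bsub>PTD\<^esub> ide PTD [a, b]))"
      unfolding reidemeister2_def by blast
    then show ?thesis by (simp only: eq)
  qed
  have 3: "(\<forall>g \<in> reidemeister3. on_mor F g = zero D (on_obj F (Src PTD g)) (on_obj F (Tgt PTD g))) \<longleftrightarrow> ?R3"
  proof -
    let ?l = "\<lambda>i j k a b c. (tangle_crossing (j > k) b c \<otimes>\<^bsub>PTD\<^esub> ide PTD [a]) \<cdot>\<^bsub>PTD\<^esub>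
      (ide PTD [b] \<otimes>\<^bsub>PTD\<^esub> tangle_crossing (i > k) a c) \<cdot>\<^bsub>PTD\<^esub> (tangle_crossing (i > j) a b \<otimes>\<^bsub>PTD\<^esub> ide PTD [c])"
    let ?r = "\<lambda>i j k a b c. (ide PTD [c] \<otimes>\<^bsub>PTD\<^esub> tangle_crossing (i > j) a b) \<cdot>\<^bsub>PTD\<^esub>
      (tangle_crossing (i > k) a c \<otimes>\<^bsub>PTD\<^esub> ide PTD [b]) \<cdot>\<^bsub>PTD\<^esub> (ide PTD [a] \<otimes>\<^bsub>PTD\<^esub> tangle_crossing (j > k) b c)"
    have "?kill (?l i j k a b c \<ominus>\<^bsub>PTD\<^esub> ?r i j k a b c) \<longleftrightarrow>
      comp D (tensor D (X (j > k) b c) (ide D [t a]))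
        (comp D (tensor D (ide D [t b]) (X (i > k) a c)) (tensor D (X (i > j) a b) (ide D [t c]))) =
      comp D (tensor D (ide D [t c]) (X (i > j) a b))
        (comp D (tensor D (X (i > k) a c) (ide D [t b])) (tensor D (ide D [t a]) (X (j > k) b c)))"
      for i j k :: nat and a b c
      by (subst dz) (simp_all add: t X)
    note eq = this
    have "(\<forall>g \<in> reidemeister3. ?kill g) \<longleftrightarrow> (\<forall>(i::nat) (j::nat) (k::nat) a b c. distinct [i, j, k] \<longrightarrow>
        ?kill (?l i j k a b c \<ominus>\<^bsub>PTD\<^esub> ?r i j k a b c))"
      unfolding reidemeister3_def by blast
    then show ?thesis by (simp only: eq)
  qed
  show ?thesis unfolding 1[symmetric] 2[symmetric] 3[symmetric] by blast
qed

lemma tensor_ideal_TD: "tensor_ideal PTD (TD_ideal :: 'r::{comm_ring, comm_monoid_mult} tangle_mor set)"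
proof -
  interpret word_category "PTD :: (_, 'r tangle_mor, 'r) rigid_cat" UNIV reverse by (rule word_category_PTD)
  show ?thesis unfolding TD_ideal_def
    by (rule tensor_ideal_generated[OF _ reidemeister_Mor]) unfold_locales
qed

lemma word_category_TD: "word_category (TD :: (_, 'r::{comm_ring, comm_monoid_mult} tangle_mor set, 'r) rigid_cat) UNIV reverse"
  unfolding TD_def using word_category_PTD tensor_ideal_TD by (rule word_category_quotient)

lemma rigid_functor_TD:
  "rigid_functor PTD (TD :: (_, 'r::{comm_ring, comm_monoid_mult} tangle_mor set, 'r) rigid_cat) (quotient_proj PTD TD_ideal)"
proof -
  interpret word_category "PTD :: (_, 'r tangle_mor, 'r) rigid_cat" UNIV reverse by (rule word_category_PTD)
  show ?thesis unfolding TD_def using rigid_category_axioms tensor_ideal_TD by (rule rigid_functor_proj)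
qed

lemma TD_xing_in: "TD_xing v \<in> Hom (TD :: (_, 'r::{comm_ring, comm_monoid_mult} tangle_mor set, 'r) rigid_cat) [Up, Up] [Up, Up]"
proof -
  interpret F: rigid_functor PTD "TD :: (_, 'r tangle_mor set, 'r) rigid_cat" "quotient_proj PTD TD_ideal"
    by (rule rigid_functor_TD)
  have "of_diagram tangle_sig (Node v) \<in> Hom (PTD :: (_, 'r tangle_mor, 'r) rigid_cat) [Up, Up] [Up, Up]"
    using tangle.of_diagram_Mor[of "Node v"] unfolding PTD_eq by (simp add: tangle_sig_def)
  then show ?thesis
    using F.F_Mor[of "of_diagram tangle_sig (Node v)"] by (simp add: quotient_proj_def TD_xing_def Hom_def)
qed

definition HOMFLY_relators :: "'r::{comm_ring, comm_monoid_mult} \<Rightarrow> 'r \<Rightarrow> 'r tangle_mor set set" where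
  "HOMFLY_relators \<alpha> z =
    {(\<alpha> \<odot>\<^bsub>TD\<^esub> TD_xing Xp) \<ominus>\<^bsub>TD\<^esub> (uinv \<alpha> \<odot>\<^bsub>TD\<^esub> TD_xing Xm) \<ominus>\<^bsub>TD\<^esub> (z \<odot>\<^bsub>TD\<^esub> ide TD [Up, Up])} \<union>
    {(evl TD [a] \<cdot>\<^bsub>TD\<^esub> coevl TD [a]) \<ominus>\<^bsub>TD\<^esub> (((\<alpha> - uinv \<alpha>) * uinv z) \<odot>\<^bsub>TD\<^esub> ide TD []) | a. True}"

lemma HOMFLY_ideal_eq: "HOMFLY_ideal \<alpha> z = ideal_generated TD (HOMFLY_relators \<alpha> z)"
  by (simp add: HOMFLY_ideal_def HOMFLY_relators_def)

lemma HOMFLY_relators_killed_iff: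
  fixes D :: "('t list, 'n, 'r::{comm_ring, comm_monoid_mult}, 'y) rigid_cat_scheme"
  assumes F: "word_functor (TD :: (_, 'r tangle_mor set, 'r) rigid_cat) UNIV reverse D T' bar' F t"
  shows "HOMFLY_relators \<alpha> z \<subseteq> Mor TD" (is ?incl)
    and "(\<forall>g \<in> HOMFLY_relators \<alpha> z. on_mor F g = zero D (on_obj F (Src TD g)) (on_obj F (Tgt TD g))) \<longleftrightarrow>
      diff D (scale D \<alpha> (on_mor F (TD_xing Xp))) (scale D (uinv \<alpha>) (on_mor F (TD_xing Xm))) = scale D z (ide D [t Up, t Up]) \<and>
      (\<forall>a. comp D (evl D [t a]) (coevl D [t a]) = scale D ((\<alpha> - uinv \<alpha>) * uinv z) (ide D []))" (is ?iff)
proof -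
  interpret F: word_functor "TD :: (_, 'r tangle_mor set, 'r) rigid_cat" UNIV reverse D T' bar' F t by fact
  have [simp]: "TD_xing v \<in> Mor TD" "Src TD (TD_xing v :: 'r tangle_mor set) = [Up, Up]"
    "Tgt TD (TD_xing v :: 'r tangle_mor set) = [Up, Up]" for v
    using HomD[OF TD_xing_in[of v]] by simp_all
  have [simp]: "t a \<in> T'" for a using F.t_in by simp
  show ?incl by (auto simp: HOMFLY_relators_def)
  let ?kill = "\<lambda>g :: 'r tangle_mor set. on_mor F g = zero D (on_obj F (Src TD g)) (on_obj F (Tgt TD g))"
  have dz: "?kill (f \<ominus>\<^bsub>TD\<^esub> g) \<longleftrightarrow>
      on_mor F f = on_mor F g"
    if "f \<in> Mor TD" "g \<in> Mor TD" "Src TD f = Src TD g" "Tgt TD f = Tgt TD g" for f g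
    using that F.D.diff_eq_zero[of "on_mor F f" "on_mor F g"] by simp
  have s: "?kill (((\<alpha> \<odot>\<^bsub>TD\<^esub> TD_xing Xp) \<ominus>\<^bsub>TD\<^esub> (uinv \<alpha> \<odot>\<^bsub>TD\<^esub> TD_xing Xm)) \<ominus>\<^bsub>TD\<^esub> (z \<odot>\<^bsub>TD\<^esub> ide TD [Up, Up])) \<longleftrightarrow>
      diff D (scale D \<alpha> (on_mor F (TD_xing Xp))) (scale D (uinv \<alpha>) (on_mor F (TD_xing Xm))) = scale D z (ide D [t Up, t Up])"
    by (subst dz) simp_all
  have c: "?kill ((evl TD [a] \<cdot>\<^bsub>TD\<^esub> coevl TD [a]) \<ominus>\<^bsub>TD\<^esub> (r \<odot>\<^bsub>TD\<^esub> ide TD [])) \<longleftrightarrow>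
      comp D (evl D [t a]) (coevl D [t a]) = scale D r (ide D [])" for a r
    by (subst dz) simp_all
  have "(\<forall>g \<in> HOMFLY_relators \<alpha> z. ?kill g) \<longleftrightarrow>
      ?kill (((\<alpha> \<odot>\<^bsub>TD\<^esub> TD_xing Xp) \<ominus>\<^bsub>TD\<^esub> (uinv \<alpha> \<odot>\<^bsub>TD\<^esub> TD_xing Xm)) \<ominus>\<^bsub>TD\<^esub> (z \<odot>\<^bsub>TD\<^esub> ide TD [Up, Up])) \<and>
      (\<forall>a. ?kill ((evl TD [a] \<cdot>\<^bsub>TD\<^esub> coevl TD [a]) \<ominus>\<^bsub>TD\<^esub> (((\<alpha> - uinv \<alpha>) * uinv z) \<odot>\<^bsub>TD\<^esub> ide TD [])))"
    unfolding HOMFLY_relators_def by blast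
  then show ?iff by (simp only: s c)
qed

context
  fixes \<alpha> z :: "'r::{comm_ring, comm_monoid_mult}"
begin

abbreviation H :: "(ori list, 'r tangle_mor set set, 'r) rigid_cat" where
  "H \<equiv> HOMFLY_rigid \<alpha> z"

definition HOMFLY_proj :: "(ori list, 'r tangle_mor, ori list, 'r tangle_mor set set) cat_map" where
  "HOMFLY_proj = comp_map (quotient_proj TD (HOMFLY_ideal \<alpha> z)) (quotient_proj PTD TD_ideal)"

lemma tensor_ideal_HOMFLY: "tensor_ideal TD (HOMFLY_ideal \<alpha> z)"
proof -
  interpret word_category "TD :: (_, 'r tangle_mor set, 'r) rigid_cat" UNIV reverse by (rule word_category_TD)
  \<comment> \<open>The criterion is stated for a functor; the identity serves to extract from it
    that the relators are morphisms.\<close>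
  interpret I: word_functor "TD :: (_, 'r tangle_mor set, 'r) rigid_cat" UNIV reverse TD UNIV reverse id_map "\<lambda>a. a"
    using rigid_functor_id[OF rigid_category_axioms]
    by (intro word_functor.intro word_functor_axioms.intro) (auto simp: word_category_axioms id_map_def)
  show ?thesis unfolding HOMFLY_ideal_eq
    by (rule tensor_ideal_generated[OF _ HOMFLY_relators_killed_iff(1)[OF I.word_functor_axioms]]) unfold_locales
qed

lemma word_category_H: "word_category H UNIV reverse"
  unfolding HOMFLY_rigid_def using word_category_TD tensor_ideal_HOMFLY by (rule word_category_quotient)

lemma rigid_functor_TD_H: "rigid_functor TD H (quotient_proj TD (HOMFLY_ideal \<alpha> z))"
proof -
  interpret word_category "TD :: (_, 'r tangle_mor set, 'r) rigid_cat" UNIV reverse by (rule word_category_TD)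
  show ?thesis unfolding HOMFLY_rigid_def using rigid_category_axioms tensor_ideal_HOMFLY by (rule rigid_functor_proj)
qed

lemma word_functor_TD_H: "word_functor TD UNIV reverse H UNIV reverse (quotient_proj TD (HOMFLY_ideal \<alpha> z)) (\<lambda>a. a)"
  using word_category_TD word_category_H rigid_functor_TD_H
  by (intro word_functor.intro word_functor_axioms.intro) (auto simp: quotient_proj_def)

lemma word_functor_PTD_H: "word_functor PTD UNIV reverse H UNIV reverse HOMFLY_proj (\<lambda>a. a)"
  unfolding HOMFLY_proj_def
  using word_category_PTD word_category_H rigid_functor_comp[OF rigid_functor_TD rigid_functor_TD_H]
  by (intro word_functor.intro word_functor_axioms.intro) (auto simp: quotient_proj_def comp_map_def)

lemma HOMFLY_proj_Node: "on_mor HOMFLY_proj (of_diagram tangle_sig (Node v)) = HOMFLY_xing \<alpha> z v"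
  by (simp add: HOMFLY_proj_def comp_map_def quotient_proj_def HOMFLY_xing_def TD_xing_def)

lemma coset_killed:
  fixes C :: "('o, 'm, 'r) rigid_cat"
  assumes "rigid_category C" "tensor_ideal C I" "i \<in> I"
  shows "coset C I i = zero (quotient_cat C I) (Src C i) (Tgt C i)"
proof -
  interpret C: rigid_category C by fact
  interpret monoidal_quotient C I by unfold_locales fact
  have "coset C I i = coset C I (zero C (Src C i) (Tgt C i))"
    using assms(3) ideal_Mor[OF assms(3)] by (subst proj_eq_iff) (auto simp: diff_def ideal_closed)
  then show ?thesis by simp
qed

lemma HOMFLY_proj_reidemeister:
  assumes "g \<in> reidemeister1 \<union> reidemeister2 \<union> reidemeister3"
  shows "on_mor HOMFLY_proj g = zero H (on_obj HOMFLY_proj (Src PTD g)) (on_obj HOMFLY_proj (Tgt PTD g))"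
proof -
  interpret P: word_category "PTD :: (_, 'r tangle_mor, 'r) rigid_cat" UNIV reverse by (rule word_category_PTD)
  interpret F: word_functor TD UNIV reverse H UNIV reverse "quotient_proj TD (HOMFLY_ideal \<alpha> z)" "\<lambda>a. a"
    by (rule word_functor_TD_H)
  have "g \<in> TD_ideal" unfolding TD_ideal_def by (rule subsetD[OF ideal_generated_incl assms])
  then have "coset PTD TD_ideal g = zero TD (Src PTD g) (Tgt PTD g)"
    unfolding TD_def by (rule coset_killed[OF P.rigid_category_axioms tensor_ideal_TD])
  moreover have "on_mor HOMFLY_proj g = on_mor (quotient_proj TD (HOMFLY_ideal \<alpha> z)) (coset PTD TD_ideal g)"
    by (simp add: HOMFLY_proj_def comp_map_def) (simp add: quotient_proj_def)
  moreover have "on_obj HOMFLY_proj A = A" for A by (simp add: HOMFLY_proj_def comp_map_def quotient_proj_def)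
  ultimately show ?thesis using F.F_zero[of "Src PTD g" "Tgt PTD g"] by (simp del: F.F_zero) 
qed

end

section \<open>Units and the quantum integers\<close>

lemma uinv_eqI:
  fixes x :: "'r::{comm_ring, comm_monoid_mult}"
  assumes xy: "x * y = 1" shows "uinv x = y"
  unfolding uinv_def
proof (rule the_equality)
  show "x * y = 1" by (rule xy)
next
  fix y' assume "x * y' = 1"
  have "y' = (x * y) * y'" using xy by simp
  also have "\<dots> = (x * y') * y" by (simp only: mult_ac)
  finally show "y' = y" using \<open>x * y' = 1\<close> by simp
qed

lemma uinv_mult:
  fixes x :: "'r::{comm_ring, comm_monoid_mult}"
  assumes "x dvd 1" shows "x * uinv x = 1"
proof -
  obtain y where "x * y = 1" using assms unfolding dvd_def by auto
  then show ?thesis using uinv_eqI[of x y] by simp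
qed

locale skein_parameters =
  fixes \<alpha> z \<zeta> :: "'r::{comm_ring, comm_monoid_mult}" and n :: nat
  assumes \<alpha>_unit: "\<alpha> dvd 1" and z_unit: "z dvd 1" and \<zeta>_unit: "\<zeta> dvd 1" and z_eq: "uinv \<zeta> - \<zeta> = z"
begin

abbreviation q :: "int \<Rightarrow> 'r" where "q \<equiv> quantum_int \<alpha> \<zeta> (int n)"

text \<open>The exponents \<open>k - n\<close> are 0, -1 and -2, so \<open>n\<close> disappears from
  the values. The denominator \<open>\<zeta> - uinv \<zeta>\<close> is -z, and the remaining signs
  come from the powers of \<open>- \<zeta>\<close>.\<close>

lemma quantum_int_values:
  "q (int n) = (\<alpha> - uinv \<alpha>) * uinv z"
  "q (int n - 1) = (uinv \<alpha> * uinv \<zeta> - \<alpha> * \<zeta>) * uinv z"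
  "q (int n - 2) = (\<alpha> * (\<zeta> * \<zeta>) - uinv \<alpha> * (uinv \<zeta> * uinv \<zeta>)) * uinv z"
proof -
  have "(\<zeta> - uinv \<zeta>) * (- uinv z) = z * uinv z"
    using z_eq by (simp add: algebra_simps flip: z_eq)
  then have d: "uinv (\<zeta> - uinv \<zeta>) = - uinv z"
    using uinv_mult[OF z_unit] by (intro uinv_eqI) simp
  have m: "uinv (- \<zeta>) = - uinv \<zeta>"
    using uinv_mult[OF \<zeta>_unit] by (intro uinv_eqI) simp
  show "q (int n) = (\<alpha> - uinv \<alpha>) * uinv z"
    "q (int n - 1) = (uinv \<alpha> * uinv \<zeta> - \<alpha> * \<zeta>) * uinv z"
    "q (int n - 2) = (\<alpha> * (\<zeta> * \<zeta>) - uinv \<alpha> * (uinv \<zeta> * uinv \<zeta>)) * uinv z"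
    by (simp_all add: quantum_int_def unit_power_def d m power2_eq_square algebra_simps)
qed

text \<open>The first identity is a cancellation using \<open>\<zeta> * uinv \<zeta> = 1\<close>.
  The other two factor through \<open>uinv \<zeta> * uinv z - \<zeta> * uinv z\<close>, which is z
  divided by itself.\<close>

lemma quantum_int_relations:
  "q (int n) + (\<zeta> + uinv \<zeta>) * q (int n - 1) + q (int n - 2) = 0"
  "uinv \<zeta> * q (int n) + q (int n - 1) = \<alpha>"
  "\<zeta> * q (int n) + q (int n - 1) = uinv \<alpha>"
proof -
  define a y u where "a = uinv \<alpha>" and "y = uinv \<zeta>" and "u = uinv z"
  have y: "\<zeta> * y = 1" "\<zeta> * (y * r) = r" for r
    using uinv_mult[OF \<zeta>_unit] by (simp_all add: y_def mult.assoc[symmetric])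
  have y' [simp]: "\<zeta> * (r * y) = r" for r
    using y(2)[of r] by (simp add: mult.commute)
  note y [simp]
  have z: "y * u - \<zeta> * u = 1"
    using uinv_mult[OF z_unit] z_eq by (simp add: y_def u_def left_diff_distrib[symmetric])
  show "q (int n) + (\<zeta> + uinv \<zeta>) * q (int n - 1) + q (int n - 2) = 0"
    unfolding quantum_int_values a_def[symmetric] y_def[symmetric] u_def[symmetric]
    by (simp add: algebra_simps)
  have "y * ((\<alpha> - a) * u) + (a * y - \<alpha> * \<zeta>) * u = \<alpha> * (y * u - \<zeta> * u)"
    "\<zeta> * ((\<alpha> - a) * u) + (a * y - \<alpha> * \<zeta>) * u = a * (y * u - \<zeta> * u)"
    by (simp_all add: algebra_simps)
  then show "uinv \<zeta> * q (int n) + q (int n - 1) = \<alpha>" "\<zeta> * q (int n) + q (int n - 1) = uinv \<alpha>"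
    unfolding quantum_int_values a_def[symmetric] y_def[symmetric] u_def[symmetric] z by simp_all
qed

end

text \<open>The tangle category is generated by single cups, single caps and the two crossings; arcs
  of longer words are composites of these.\<close>

lemma PTD_induct [consumes 1, case_names zero scale add ide cup cap node comp tensor]:
  fixes f :: "'r::{comm_ring, comm_monoid_mult} tangle_mor"
  assumes f: "f \<in> Mor PTD" and zero: "\<And>A B. P (zero PTD A B)"
    and scale: "\<And>r f. \<lbrakk>f \<in> Mor PTD; P f\<rbrakk> \<Longrightarrow> P (scale PTD r f)"
    and add: "\<And>f g. \<lbrakk>f \<in> Mor PTD; g \<in> Mor PTD; Src PTD f = Src PTD g; Tgt PTD f = Tgt PTD g; P f; P g\<rbrakk> \<Longrightarrow> P (add PTD f g)"
    and ide: "\<And>A. P (ide PTD A)" and cup: "\<And>a. P (coevl PTD [a])" and cap: "\<And>a. P (evl PTD [a])"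
    and node: "\<And>v. P (of_diagram tangle_sig (Node v))"
    and comp: "\<And>f g. \<lbrakk>f \<in> Mor PTD; g \<in> Mor PTD; Src PTD g = Tgt PTD f; P f; P g\<rbrakk> \<Longrightarrow> P (comp PTD g f)"
    and tensor: "\<And>f g. \<lbrakk>f \<in> Mor PTD; g \<in> Mor PTD; P f; P g\<rbrakk> \<Longrightarrow> P (tensor PTD f g)"
  shows "P f"
proof -
  have m: "of_diagram tangle_sig d \<in> Mor (PTD :: (_, 'r tangle_mor, 'r) rigid_cat)"
    "Src PTD (of_diagram tangle_sig d :: 'r tangle_mor) = src tangle_sig d"
    "Tgt PTD (of_diagram tangle_sig d :: 'r tangle_mor) = tgt tangle_sig d" if "wf_diagram tangle_sig d" for d
  proof -
    have "of_diagram tangle_sig d \<in> Hom (PTD :: (_, 'r tangle_mor, 'r) rigid_cat) (src tangle_sig d) (tgt tangle_sig d)"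
      unfolding PTD_eq by (rule tangle.of_diagram_Mor) (simp add: that)
    from HomD[OF this] show "of_diagram tangle_sig d \<in> Mor (PTD :: (_, 'r tangle_mor, 'r) rigid_cat)"
      "Src PTD (of_diagram tangle_sig d :: 'r tangle_mor) = src tangle_sig d"
      "Tgt PTD (of_diagram tangle_sig d :: 'r tangle_mor) = tgt tangle_sig d" .
  qed
  have "P (of_diagram tangle_sig d)" if "wf_diagram tangle_sig d" for d
    using that
  proof (induction d)
    case (Strands w)
    then show ?case using ide[of w] by (simp add: PTD_def diagram_cat_def)
  next
    case (Cup a)
    then show ?case using cup[of a] unfolding PTD_eq tangle.C_fields tangle.of_diagram_cups_strand by simp
  next
    case (Cap a)
    then show ?case using cap[of a] unfolding PTD_eq tangle.C_fields tangle.of_diagram_caps_strand by simp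
  next
    case (Node v)
    show ?case by (rule node)
  next
    case (Stack g f)
    then have "P (comp PTD (of_diagram tangle_sig g) (of_diagram tangle_sig f))" by (intro comp) (simp_all add: m)
    then show ?case unfolding PTD_eq using Stack.prems by (subst tangle.of_diagram_Stack) simp_all
  next
    case (Beside f g)
    then have "P (tensor PTD (of_diagram tangle_sig f) (of_diagram tangle_sig g))" by (intro tensor) (simp_all add: m)
    then show ?case unfolding PTD_eq using Beside.prems by (subst tangle.of_diagram_Beside) simp_all
  qed
  then show ?thesis
    using f zero scale add unfolding PTD_eq
    by (intro tangle.Mor_C_induct[of f P]) simp_all
qed

context
  fixes \<alpha> z :: "'r::{comm_ring, comm_monoid_mult}"
begin

lemma Mor_H: "f \<in> Mor (H \<alpha> z) \<longleftrightarrow> (\<exists>f' \<in> Mor PTD. f = on_mor (HOMFLY_proj \<alpha> z) f')"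
proof -
  interpret P: word_category "PTD :: (_, 'r tangle_mor, 'r) rigid_cat" UNIV reverse by (rule word_category_PTD)
  interpret T: word_category "TD :: (_, 'r tangle_mor set, 'r) rigid_cat" UNIV reverse by (rule word_category_TD)
  interpret QP: monoidal_quotient PTD "TD_ideal :: 'r tangle_mor set" by unfold_locales (rule tensor_ideal_TD)
  interpret QT: monoidal_quotient TD "HOMFLY_ideal \<alpha> z" by unfold_locales (rule tensor_ideal_HOMFLY)
  have "Mor TD = coset PTD TD_ideal ` Mor (PTD :: (_, 'r tangle_mor, 'r) rigid_cat)"
    unfolding TD_def by (rule QP.Q_fields(2))
  then have "Mor (H \<alpha> z) = coset TD (HOMFLY_ideal \<alpha> z) ` coset PTD TD_ideal ` Mor (PTD :: (_, 'r tangle_mor, 'r) rigid_cat)"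
    unfolding HOMFLY_rigid_def using QT.Q_fields(2) by simp
  then show ?thesis by (auto simp: HOMFLY_proj_def comp_map_def quotient_proj_def)
qed

lemma crossing_category_H:
  "crossing_category (H \<alpha> z) UNIV reverse (\<lambda>a. a) (\<lambda>a. a) (HOMFLY_xing \<alpha> z Xp) (HOMFLY_xing \<alpha> z Xm)"
proof -
  interpret F: word_functor PTD UNIV reverse "H \<alpha> z" UNIV reverse "HOMFLY_proj \<alpha> z" "\<lambda>a. a"
    by (rule word_functor_PTD_H)
  interpret P: crossing_category "PTD :: (_, 'r tangle_mor, 'r) rigid_cat" UNIV reverse "\<lambda>a. a" "\<lambda>a. a"
    "of_diagram tangle_sig (Node Xp)" "of_diagram tangle_sig (Node Xm)"
    by (rule crossing_category_PTD)
  note pm = HomD[OF P.p_in] HomD[OF P.m_in]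
  have "HOMFLY_xing \<alpha> z Xp \<in> Hom (H \<alpha> z) [Up, Up] [Up, Up]" "HOMFLY_xing \<alpha> z Xm \<in> Hom (H \<alpha> z) [Up, Up] [Up, Up]"
    unfolding HOMFLY_proj_Node[symmetric] using pm by (simp_all add: Hom_def)
  moreover have "mate (H \<alpha> z) (HOMFLY_xing \<alpha> z Xp) = comate (H \<alpha> z) (HOMFLY_xing \<alpha> z Xp)"
    "mate (H \<alpha> z) (HOMFLY_xing \<alpha> z Xm) = comate (H \<alpha> z) (HOMFLY_xing \<alpha> z Xm)"
    unfolding HOMFLY_proj_Node[symmetric] F.F_mate[OF pm(1), symmetric] F.F_comate[OF pm(1), symmetric]
      F.F_mate[OF pm(4), symmetric] F.F_comate[OF pm(4), symmetric] P.p_turn P.m_turn by (rule refl)+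
  ultimately show ?thesis by unfold_locales simp_all
qed

text \<open>The projection kills the relators, so the criterion for killing is read from left to
  right.\<close>

lemma H_reidemeister:
  defines "X \<equiv> crossing (H \<alpha> z) (\<lambda>a. a) (HOMFLY_xing \<alpha> z Xp) (HOMFLY_xing \<alpha> z Xm)"
  shows "right_curl (H \<alpha> z) [a] (X over a a) = ide (H \<alpha> z) [a]"
    and "left_curl (H \<alpha> z) [a] (X over a a) = ide (H \<alpha> z) [a]"
    and "comp (H \<alpha> z) (X (\<not> over) b a) (X over a b) = ide (H \<alpha> z) [a, b]"
    and "distinct [i, j, k :: nat] \<Longrightarrow>
      comp (H \<alpha> z) (tensor (H \<alpha> z) (X (j > k) b c) (ide (H \<alpha> z) [a]))
        (comp (H \<alpha> z) (tensor (H \<alpha> z) (ide (H \<alpha> z) [b]) (X (i > k) a c)) (tensor (H \<alpha> z) (X (i > j) a b) (ide (H \<alpha> z) [c]))) =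
      comp (H \<alpha> z) (tensor (H \<alpha> z) (ide (H \<alpha> z) [c]) (X (i > j) a b))
        (comp (H \<alpha> z) (tensor (H \<alpha> z) (X (i > k) a c) (ide (H \<alpha> z) [b])) (tensor (H \<alpha> z) (ide (H \<alpha> z) [a]) (X (j > k) b c)))"
  using iffD1[OF reidemeister_killed_iff[OF word_functor_PTD_H[of \<alpha> z]], OF ballI[OF HOMFLY_proj_reidemeister]]
  unfolding HOMFLY_proj_Node X_def[symmetric] by blast+

lemma invertible_crossing_H:
  "invertible_crossing (H \<alpha> z) UNIV reverse (\<lambda>a. a) (\<lambda>a. a) (HOMFLY_xing \<alpha> z Xp) (HOMFLY_xing \<alpha> z Xm)"
  using crossing_category_H H_reidemeister(3)
  by (intro invertible_crossing.intro invertible_crossing_axioms.intro)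

lemma braided_crossing_H:
  "braided_crossing (H \<alpha> z) UNIV reverse (\<lambda>a. a) (\<lambda>a. a) (HOMFLY_xing \<alpha> z Xp) (HOMFLY_xing \<alpha> z Xm)"
proof -
  interpret invertible_crossing "H \<alpha> z" UNIV reverse "\<lambda>a. a" "\<lambda>a. a" "HOMFLY_xing \<alpha> z Xp" "HOMFLY_xing \<alpha> z Xm"
    by (rule invertible_crossing_H)
  interpret F: word_functor PTD UNIV reverse "H \<alpha> z" UNIV reverse "HOMFLY_proj \<alpha> z" "\<lambda>a. a"
    by (rule word_functor_PTD_H)
  \<comment> \<open>With heights 2, 1, 0 on three upward strands, the third move says that the top
    strand slides over a positive crossing.\<close>
  have base: "slides True Up (X True Up Up)"
    using H_reidemeister(4)[of 2 1 0 Up Up Up] by (simp add: slides_def)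
  have X: "slides over c (HOMFLY_xing \<alpha> z v)" for over c v
    using slides_all_crossings[OF base, of over c True Up Up] slides_all_crossings[OF base, of over c False Up Up]
    by (cases v) (simp_all add: X_simps)
  have sl: "slides over c (on_mor (HOMFLY_proj \<alpha> z) f)" if "f \<in> Mor PTD" for over c f
    using that
  proof (induction rule: PTD_induct)
    case (node v)
    show ?case unfolding HOMFLY_proj_Node by (rule X)
  qed (use slides_cup[of over c] slides_cap[of over c] in
      \<open>simp_all add: slides_zero slides_ide slides_scale slides_add slides_comp slides_tensor\<close>)
  show ?thesis
    by unfold_locales (auto simp: Mor_H sl H_reidemeister)
qed

lemma rigid_braided_untwisted_HOMFLY: "rigid_braided_untwisted (HOMFLY \<alpha> z)"
  unfolding HOMFLY_def using braided_crossing.rigid_braided_untwisted[OF braided_crossing_H] by simp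

lemma H_skein:
  "diff (H \<alpha> z) (scale (H \<alpha> z) \<alpha> (HOMFLY_xing \<alpha> z Xp)) (scale (H \<alpha> z) (uinv \<alpha>) (HOMFLY_xing \<alpha> z Xm)) =
    scale (H \<alpha> z) z (ide (H \<alpha> z) [Up, Up])"
  "comp (H \<alpha> z) (evl (H \<alpha> z) [a]) (coevl (H \<alpha> z) [a]) = scale (H \<alpha> z) ((\<alpha> - uinv \<alpha>) * uinv z) (ide (H \<alpha> z) [])"
proof -
  interpret T: word_category "TD :: (_, 'r tangle_mor set, 'r) rigid_cat" UNIV reverse by (rule word_category_TD)
  let ?F = "quotient_proj TD (HOMFLY_ideal \<alpha> z)"
  have "on_mor ?F g = zero (H \<alpha> z) (on_obj ?F (Src TD g)) (on_obj ?F (Tgt TD g))" if "g \<in> HOMFLY_relators \<alpha> z" for g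
    using coset_killed[OF T.rigid_category_axioms tensor_ideal_HOMFLY, of g \<alpha> z] subsetD[OF ideal_generated_incl that, of TD]
    unfolding HOMFLY_ideal_eq HOMFLY_rigid_def quotient_proj_def by simp
  then have "\<forall>g \<in> HOMFLY_relators \<alpha> z. on_mor ?F g = zero (H \<alpha> z) (on_obj ?F (Src TD g)) (on_obj ?F (Tgt TD g))"
    by blast
  from iffD1[OF HOMFLY_relators_killed_iff(2)[OF word_functor_TD_H[of \<alpha> z]] this]
  show "diff (H \<alpha> z) (scale (H \<alpha> z) \<alpha> (HOMFLY_xing \<alpha> z Xp)) (scale (H \<alpha> z) (uinv \<alpha>) (HOMFLY_xing \<alpha> z Xm)) =
      scale (H \<alpha> z) z (ide (H \<alpha> z) [Up, Up])"
    "comp (H \<alpha> z) (evl (H \<alpha> z) [a]) (coevl (H \<alpha> z) [a]) = scale (H \<alpha> z) ((\<alpha> - uinv \<alpha>) * uinv z) (ide (H \<alpha> z) [])"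
    by (simp_all add: quotient_proj_def HOMFLY_xing_def)
qed

end

context skein_parameters
begin

definition HOMFLY_S :: "'r tangle_mor set set" where
  "HOMFLY_S = add (H \<alpha> z) (scale (H \<alpha> z) \<alpha> (HOMFLY_xing \<alpha> z Xp)) (scale (H \<alpha> z) (- uinv \<zeta>) (ide (H \<alpha> z) [Up, Up]))"

text \<open>The formula for the positive crossing is the definition of \<open>HOMFLY_S\<close>
  solved for it. The one for the negative crossing is the skein relation, as
  \<open>\<zeta> - uinv \<zeta>\<close> is -z.\<close>

lemma hecke_crossing_H:
  "hecke_crossing (H \<alpha> z) UNIV reverse (\<lambda>a. a) (\<lambda>a. a) (HOMFLY_xing \<alpha> z Xp) (HOMFLY_xing \<alpha> z Xm) HOMFLY_S
    \<alpha> (uinv \<alpha>) \<zeta> (uinv \<zeta>) (q (int n)) (q (int n - 1)) (q (int n - 2))"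
proof -
  interpret crossing_category "H \<alpha> z" UNIV reverse "\<lambda>a. a" "\<lambda>a. a" "HOMFLY_xing \<alpha> z Xp" "HOMFLY_xing \<alpha> z Xm"
    by (rule crossing_category_H)
  let ?H = "H \<alpha> z" and ?p = "HOMFLY_xing \<alpha> z Xp" and ?m = "HOMFLY_xing \<alpha> z Xm"
  let ?i = "ide ?H [Up, Up]"
  note [simp] = HomD[OF p_in] HomD[OF m_in]
  have u: "\<alpha> * uinv \<alpha> = 1" "uinv \<alpha> * \<alpha> = 1" using uinv_mult[OF \<alpha>_unit] by (simp_all add: mult.commute)
  have S: "add ?H (scale ?H r ?i) HOMFLY_S = add ?H (scale ?H \<alpha> ?p) (scale ?H (r - uinv \<zeta>) ?i)" for r
    using scale_add[of ?i r "- uinv \<zeta>"] by (simp add: HOMFLY_S_def add_ac)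
  have m: "scale ?H (uinv \<alpha>) ?m = add ?H (scale ?H \<alpha> ?p) (scale ?H (- z) ?i)"
  proof -
    have "scale ?H (uinv \<alpha>) ?m = add ?H (diff ?H (scale ?H \<alpha> ?p) (scale ?H \<alpha> ?p)) (scale ?H (uinv \<alpha>) ?m)"
      by simp
    also have "\<dots> = diff ?H (scale ?H \<alpha> ?p) (diff ?H (scale ?H \<alpha> ?p) (scale ?H (uinv \<alpha>) ?m))"
      by (simp only: diff_def) (simp add: scale_sum add_assoc')
    also have "\<dots> = diff ?H (scale ?H \<alpha> ?p) (scale ?H z ?i)" unfolding H_skein ..
    finally show ?thesis by (simp add: diff_def)
  qed
  have "?p = scale ?H (uinv \<alpha>) (add ?H (scale ?H (uinv \<zeta>) ?i) HOMFLY_S)"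
    unfolding S by (simp add: scale_sum u)
  moreover have "?m = scale ?H \<alpha> (add ?H (scale ?H \<zeta> ?i) HOMFLY_S)"
  proof -
    have "\<zeta> - uinv \<zeta> = - z" using z_eq by (simp add: algebra_simps flip: z_eq)
    then have "scale ?H \<alpha> (add ?H (scale ?H \<zeta> ?i) HOMFLY_S) = scale ?H \<alpha> (scale ?H (uinv \<alpha>) ?m)"
      unfolding S m by simp
    then show ?thesis by (simp add: u)
  qed
  moreover have "mate ?H HOMFLY_S = comate ?H HOMFLY_S"
    unfolding HOMFLY_S_def by (simp add: p_turn)
  moreover have "HOMFLY_S \<in> Hom ?H [Up, Up] [Up, Up]" by (simp add: HOMFLY_S_def Hom_def)
  ultimately show ?thesis
    using uinv_mult[OF \<zeta>_unit] u(1) quantum_int_relations by unfold_locales simp_all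
qed

end

section \<open>Trivalent graphs modulo the relations for \<open>S\<close>\<close>

section \<open>The MOY category\<close>

abbreviation edges :: "edge set" where "edges \<equiv> range (Pair One)"

lemma lists_edges: "{w. fst ` set w \<subseteq> {One}} = lists edges"
  by (auto simp: image_iff)

lemma opp_trivalent [simp]: "opp trivalent_sig = (\<lambda>(l, a). (l, reverse a))"
  "node_src trivalent_sig v = (case v of Merge \<Rightarrow> [(One, Up), (One, Up)] | Split \<Rightarrow> [(Two, Up)])"
  "node_tgt trivalent_sig v = (case v of Merge \<Rightarrow> [(Two, Up)] | Split \<Rightarrow> [(One, Up), (One, Up)])"
  by (simp_all add: trivalent_sig_def)

lemma trivalent_graphs_typed:
  "g \<in> trivalent_graphs \<Longrightarrow> wf_diagram trivalent_sig g \<and> src trivalent_sig g \<in> lists edges \<and> tgt trivalent_sig g \<in> lists edges"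
proof (induction rule: trivalent_graphs.induct)
  case (1 w)
  then show ?case using lists_edges by auto
qed (simp_all add: S_dual_graph_def S_graph_def turn_right_def dual_word_def Let_def)

interpretation graph: diagram_family trivalent_sig edges trivalent_graphs
  by unfold_locales (use trivalent_graphs_typed in \<open>auto simp: lists_edges[symmetric] simp del: in_lists_conv_set intro: trivalent_graphs.intros\<close>)

interpretation all_graphs: diagram_family trivalent_sig UNIV "{d. wf_diagram trivalent_sig d}"
  by unfold_locales auto

lemma TrPD_eq: "TrPD = graph.C"
  by (simp add: TrPD_def lists_edges)

abbreviation edge_dual :: "edge \<Rightarrow> edge" where "edge_dual \<equiv> \<lambda>(l, a). (l, reverse a)"

lemma word_category_TrPD: "word_category (TrPD :: (_, 'r::{comm_ring, comm_monoid_mult} graph_mor, 'r) rigid_cat) edges edge_dual"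
  using graph.word_category_C unfolding TrPD_eq by simp

text \<open>\<open>S\<close> is a splitting vertex on top of a merging one, and neither of them is a
  morphism of \<open>TrPD\<close>. In the category of all graphs the turn of a composite is the
  composite of the turns, so invariance of the vertices passes to \<open>S\<close>.\<close>

lemma S_graph_turn: "of_diagram trivalent_sig (turn_right trivalent_sig S_graph) =
  (of_diagram trivalent_sig (turn_left trivalent_sig S_graph) :: 'r::{comm_ring, comm_monoid_mult} graph_mor)"
proof -
  let ?C = "all_graphs.C :: (_, 'r graph_mor, 'r) rigid_cat"
  interpret word_category ?C UNIV "opp trivalent_sig"
    using all_graphs.word_category_C by simp
  have N: "of_diagram trivalent_sig (Node v) \<in> Hom ?C (node_src trivalent_sig v) (node_tgt trivalent_sig v)" for v
    using all_graphs.of_diagram_Mor[of "Node v"] by simp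
  have turn: "mate ?C (of_diagram trivalent_sig (Node v)) = comate ?C (of_diagram trivalent_sig (Node v))" for v
  proof -
    have "mate ?C (of_diagram trivalent_sig (Node v)) = of_diagram trivalent_sig (turn_right trivalent_sig (Node v))"
      "comate ?C (of_diagram trivalent_sig (Node v)) = of_diagram trivalent_sig (turn_left trivalent_sig (Node v))"
      by (rule all_graphs.of_diagram_turn[symmetric]; simp)+
    then show ?thesis using all_graphs.of_diagram_eqI[OF iso_turn[of trivalent_sig v]] by metis
  qed
  have S: "of_diagram trivalent_sig S_graph = comp ?C (of_diagram trivalent_sig (Node Split)) (of_diagram trivalent_sig (Node Merge))"
    unfolding S_graph_def by (rule all_graphs.of_diagram_Stack) simp_all
  note N' = HomD[OF N[of Merge]] HomD[OF N[of Split]]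
  have "mate ?C (of_diagram trivalent_sig S_graph) = comate ?C (of_diagram trivalent_sig S_graph)"
  proof -
    have st: "Src ?C (of_diagram trivalent_sig (Node Split)) = Tgt ?C (of_diagram trivalent_sig (Node Merge))"
      unfolding N' by simp
    show ?thesis unfolding S mate_comp[OF N'(1,4) st] comate_comp[OF N'(1,4) st] turn ..
  qed
  moreover have "mate ?C (of_diagram trivalent_sig S_graph) = of_diagram trivalent_sig (turn_right trivalent_sig S_graph)"
    "comate ?C (of_diagram trivalent_sig S_graph) = of_diagram trivalent_sig (turn_left trivalent_sig S_graph)"
    by (rule all_graphs.of_diagram_turn[symmetric]; simp add: S_graph_def)+
  ultimately show ?thesis by simp
qed

lemma TrPD_S_in: "TrPD_S a \<in> Hom (TrPD :: (_, 'r::{comm_ring, comm_monoid_mult} graph_mor, 'r) rigid_cat) [(One, a), (One, a)] [(One, a), (One, a)]"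
proof -
  have "of_diagram trivalent_sig S_graph \<in> Hom (TrPD :: (_, 'r graph_mor, 'r) rigid_cat) (src trivalent_sig S_graph) (tgt trivalent_sig S_graph)"
    "of_diagram trivalent_sig S_dual_graph \<in> Hom (TrPD :: (_, 'r graph_mor, 'r) rigid_cat) (src trivalent_sig S_dual_graph) (tgt trivalent_sig S_dual_graph)"
    unfolding TrPD_eq by (rule graph.of_diagram_Mor; simp add: trivalent_graphs.intros)+
  then show ?thesis
    by (cases a) (simp_all add: TrPD_S_def S_dual_graph_def S_graph_def turn_right_def dual_word_def Let_def)
qed

lemma TrPD_S_mate:
  "mate TrPD (TrPD_S Up) = (TrPD_S Down :: 'r::{comm_ring, comm_monoid_mult} graph_mor)"
  "comate TrPD (TrPD_S Up) = (TrPD_S Down :: 'r graph_mor)"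
proof -
  have "mate TrPD (of_diagram trivalent_sig S_graph :: 'r graph_mor) = of_diagram trivalent_sig (turn_right trivalent_sig S_graph)"
    "comate TrPD (of_diagram trivalent_sig S_graph :: 'r graph_mor) = of_diagram trivalent_sig (turn_left trivalent_sig S_graph)"
    unfolding TrPD_eq by (rule graph.of_diagram_turn[symmetric]; simp add: trivalent_graphs.intros)+
  then show "mate TrPD (TrPD_S Up) = (TrPD_S Down :: 'r graph_mor)" "comate TrPD (TrPD_S Up) = (TrPD_S Down :: 'r graph_mor)"
    using S_graph_turn[where 'r = 'r] by (simp_all add: TrPD_S_def S_dual_graph_def)
qed

text \<open>The inductive set of graphs has \<open>S\<close> and its dual as indivisible pieces, so
  the vertices themselves never enter the induction.\<close>

lemma TrPD_induct [consumes 1, case_names zero scale add ide cup cap S comp tensor]: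
  fixes f :: "'r::{comm_ring, comm_monoid_mult} graph_mor"
  assumes f: "f \<in> Mor TrPD" and zero: "\<And>A B. \<lbrakk>A \<in> lists edges; B \<in> lists edges\<rbrakk> \<Longrightarrow> P (zero TrPD A B)"
    and scale: "\<And>r f. \<lbrakk>f \<in> Mor TrPD; P f\<rbrakk> \<Longrightarrow> P (scale TrPD r f)"
    and add: "\<And>f g. \<lbrakk>f \<in> Mor TrPD; g \<in> Mor TrPD; Src TrPD f = Src TrPD g; Tgt TrPD f = Tgt TrPD g; P f; P g\<rbrakk> \<Longrightarrow> P (add TrPD f g)"
    and ide: "\<And>A. A \<in> lists edges \<Longrightarrow> P (ide TrPD A)"
    and cup: "\<And>a. P (coevl TrPD [(One, a)])" and cap: "\<And>a. P (evl TrPD [(One, a)])"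
    and S: "\<And>a. P (TrPD_S a)"
    and comp: "\<And>f g. \<lbrakk>f \<in> Mor TrPD; g \<in> Mor TrPD; Src TrPD g = Tgt TrPD f; P f; P g\<rbrakk> \<Longrightarrow> P (comp TrPD g f)"
    and tensor: "\<And>f g. \<lbrakk>f \<in> Mor TrPD; g \<in> Mor TrPD; P f; P g\<rbrakk> \<Longrightarrow> P (tensor TrPD f g)"
  shows "P f"
proof -
  have m: "of_diagram trivalent_sig d \<in> Mor (TrPD :: (_, 'r graph_mor, 'r) rigid_cat)"
    "Src TrPD (of_diagram trivalent_sig d :: 'r graph_mor) = src trivalent_sig d"
    "Tgt TrPD (of_diagram trivalent_sig d :: 'r graph_mor) = tgt trivalent_sig d" if "d \<in> trivalent_graphs" for d
  proof -
    have "of_diagram trivalent_sig d \<in> Hom (TrPD :: (_, 'r graph_mor, 'r) rigid_cat) (src trivalent_sig d) (tgt trivalent_sig d)"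
      unfolding TrPD_eq by (rule graph.of_diagram_Mor) (simp add: that)
    from HomD[OF this] show "of_diagram trivalent_sig d \<in> Mor (TrPD :: (_, 'r graph_mor, 'r) rigid_cat)"
      "Src TrPD (of_diagram trivalent_sig d :: 'r graph_mor) = src trivalent_sig d"
      "Tgt TrPD (of_diagram trivalent_sig d :: 'r graph_mor) = tgt trivalent_sig d" .
  qed
  have "P (of_diagram trivalent_sig d)" if "d \<in> trivalent_graphs" for d
    using that
  proof (induction d rule: trivalent_graphs.induct)
    case (1 w)
    then show ?case using ide[of w] lists_edges by (simp add: TrPD_def diagram_cat_def) blast
  next
    case (2 a)
    then show ?case using cup[of a] unfolding TrPD_eq graph.C_fields graph.of_diagram_cups_strand by simp
  next
    case (3 a)
    then show ?case using cap[of a] unfolding TrPD_eq graph.C_fields graph.of_diagram_caps_strand by simp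
  next
    case 4
    then show ?case using S[of Up] by (simp add: TrPD_S_def)
  next
    case 5
    then show ?case using S[of Down] by (simp add: TrPD_S_def)
  next
    case (6 g f)
    then have "P (comp TrPD (of_diagram trivalent_sig g) (of_diagram trivalent_sig f))" by (intro comp) (simp_all add: m)
    then show ?case unfolding TrPD_eq using 6 graph.ds_wf by (subst graph.of_diagram_Stack) simp_all
  next
    case (7 f g)
    then have "P (tensor TrPD (of_diagram trivalent_sig f) (of_diagram trivalent_sig g))" by (intro tensor) (simp_all add: m)
    then show ?case unfolding TrPD_eq using 7 graph.ds_wf by (subst graph.of_diagram_Beside) simp_all
  qed
  then show ?thesis
    using f zero scale add unfolding TrPD_eq
    by (intro graph.Mor_C_induct[of f P]) simp_all
qed

definition MOY_relators :: "'r::{comm_ring, comm_monoid_mult} \<Rightarrow> 'r \<Rightarrow> nat \<Rightarrow> 'r graph_mor set" where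
  "MOY_relators \<alpha> \<zeta> n = (\<Union>a. MOY_relations TrPD TrPD_S \<alpha> \<zeta> n a)"

lemma MOY_relators_Mor: "MOY_relators \<alpha> \<zeta> n \<subseteq> Mor TrPD"
proof -
  interpret word_category "TrPD :: (_, 'a graph_mor, 'a) rigid_cat" edges edge_dual by (rule word_category_TrPD)
  note [simp] = HomD[OF TrPD_S_in]
  show ?thesis by (auto simp: MOY_relators_def MOY_relations_def Let_def)
qed

text \<open>A functor on graphs whose value on \<open>S\<close> is the element \<open>s\<close> of a
  Hecke crossing. It covers the projection to the graph quotient as well as the functor into the
  tangle quotient.\<close>

locale graph_functor =
  F: word_functor "TrPD :: (_, 'r graph_mor, 'r) rigid_cat" edges edge_dual D T' bar' F t +
  hecke_crossing D T' bar' e d p m s \<alpha> \<alpha>' \<zeta> "uinv \<zeta>"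
    "quantum_int \<alpha> \<zeta> (int n) (int n)" "quantum_int \<alpha> \<zeta> (int n) (int n - 1)" "quantum_int \<alpha> \<zeta> (int n) (int n - 2)"
  for D :: "('t list, 'n, 'r::{comm_ring, comm_monoid_mult}, 'y) rigid_cat_scheme" and T' bar' F t e d p m s \<alpha> \<alpha>' \<zeta> n +
  assumes t_One [simp]: "t (One, a) = e a"
    and F_S_Up: "on_mor F (TrPD_S Up) = s"
begin

lemma F_S [simp]: "on_mor F (TrPD_S a) = S a"
proof (cases a)
  case Down
  have "on_mor F (TrPD_S Down) = mate D (on_mor F (TrPD_S Up))"
    unfolding TrPD_S_mate(1)[symmetric] using HomD(1)[OF TrPD_S_in] by (rule F.F_mate)
  then show ?thesis using Down by (simp add: S_def F_S_Up)
qed (simp add: S_def F_S_Up)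

text \<open>For the projection, the forward direction makes the relations available in the quotient;
  the backward direction lets the functor into the tangle quotient descend.\<close>

lemma MOY_relators_killed_iff:
  "(\<forall>g \<in> MOY_relators \<alpha> \<zeta> n. on_mor F g = zero D (on_obj F (Src TrPD g)) (on_obj F (Tgt TrPD g))) \<longleftrightarrow>
    (\<forall>a. relation1 a \<and> relation2 a \<and> relation3 a \<and> relation4 a \<and> relation5 a)"
proof -
  let ?kill = "\<lambda>g :: 'r graph_mor. on_mor F g = zero D (on_obj F (Src TrPD g)) (on_obj F (Tgt TrPD g))"
  note [simp] = HomD[OF TrPD_S_in]
  have dz: "?kill (f \<ominus>\<^bsub>TrPD\<^esub> g) \<longleftrightarrow> on_mor F f = on_mor F g"
    if "f \<in> Mor TrPD" "g \<in> Mor TrPD" "Src TrPD f = Src TrPD g" "Tgt TrPD f = Tgt TrPD g" for f g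
    using that F.D.diff_eq_zero[of "on_mor F f" "on_mor F g"] by simp
  let ?q = "quantum_int \<alpha> \<zeta> (int n)"
  let ?i = "\<lambda>a. ide TrPD [(One, a)]" and ?ev = "\<lambda>a. evl TrPD [(One, a)]" and ?coev = "\<lambda>a. coevl TrPD [(One, a)]"
  have 1: "?kill ((?ev a \<cdot>\<^bsub>TrPD\<^esub> ?coev a) \<ominus>\<^bsub>TrPD\<^esub> (?q (int n) \<odot>\<^bsub>TrPD\<^esub> ide TrPD [])) \<longleftrightarrow> relation1 a" for a
    by (subst dz) simp_all
  have 2: "?kill ((TrPD_S a \<cdot>\<^bsub>TrPD\<^esub> TrPD_S a) \<ominus>\<^bsub>TrPD\<^esub> ((- (\<zeta> + uinv \<zeta>)) \<odot>\<^bsub>TrPD\<^esub> TrPD_S a)) \<longleftrightarrow> relation2 a" for a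
    by (subst dz) simp_all
  have 3: "?kill (((?ev (reverse a) \<otimes>\<^bsub>TrPD\<^esub> ?i a) \<cdot>\<^bsub>TrPD\<^esub> (?i (reverse a) \<otimes>\<^bsub>TrPD\<^esub> TrPD_S a) \<cdot>\<^bsub>TrPD\<^esub> (?coev (reverse a) \<otimes>\<^bsub>TrPD\<^esub> ?i a)) \<ominus>\<^bsub>TrPD\<^esub>
      (?q (int n - 1) \<odot>\<^bsub>TrPD\<^esub> ?i a)) \<longleftrightarrow> relation3 a" for a
    by (subst dz) (simp_all add: ltrace_def)
  have 4: "?kill (((?i a \<otimes>\<^bsub>TrPD\<^esub> ?ev a \<otimes>\<^bsub>TrPD\<^esub> ?i (reverse a)) \<cdot>\<^bsub>TrPD\<^esub> (TrPD_S a \<otimes>\<^bsub>TrPD\<^esub> TrPD_S (reverse a)) \<cdot>\<^bsub>TrPD\<^esub>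
      (?i a \<otimes>\<^bsub>TrPD\<^esub> ?coev a \<otimes>\<^bsub>TrPD\<^esub> ?i (reverse a))) \<ominus>\<^bsub>TrPD\<^esub>
      ((?coev a \<cdot>\<^bsub>TrPD\<^esub> ?ev a) \<oplus>\<^bsub>TrPD\<^esub> (?q (int n - 2) \<odot>\<^bsub>TrPD\<^esub> (?i a \<otimes>\<^bsub>TrPD\<^esub> ?i (reverse a))))) \<longleftrightarrow> relation4 a" for a
    by (subst dz) (simp_all add: square_def)
  have 5: "?kill ((((TrPD_S a \<otimes>\<^bsub>TrPD\<^esub> ?i a) \<cdot>\<^bsub>TrPD\<^esub> (?i a \<otimes>\<^bsub>TrPD\<^esub> TrPD_S a) \<cdot>\<^bsub>TrPD\<^esub> (TrPD_S a \<otimes>\<^bsub>TrPD\<^esub> ?i a)) \<oplus>\<^bsub>TrPD\<^esub>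
        (?i a \<otimes>\<^bsub>TrPD\<^esub> TrPD_S a)) \<ominus>\<^bsub>TrPD\<^esub>
      (((?i a \<otimes>\<^bsub>TrPD\<^esub> TrPD_S a) \<cdot>\<^bsub>TrPD\<^esub> (TrPD_S a \<otimes>\<^bsub>TrPD\<^esub> ?i a) \<cdot>\<^bsub>TrPD\<^esub> (?i a \<otimes>\<^bsub>TrPD\<^esub> TrPD_S a)) \<oplus>\<^bsub>TrPD\<^esub>
        (TrPD_S a \<otimes>\<^bsub>TrPD\<^esub> ?i a))) \<longleftrightarrow> relation5 a" for a
    by (subst dz) simp_all
  show ?thesis
    unfolding MOY_relators_def MOY_relations_def Let_def
    by (simp only: ball_UN ball_simps 1 2 3 4 5) simp
qed

declare t_One [simp del]

end

context
  fixes \<alpha> \<zeta> :: "'r::{comm_ring, comm_monoid_mult}" and n :: nat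
begin

abbreviation M :: "(edge list, 'r graph_mor set, 'r) rigid_cat" where "M \<equiv> MOY_rigid \<alpha> \<zeta> n"

definition MOY_proj :: "(edge list, 'r graph_mor, edge list, 'r graph_mor set) cat_map" where
  "MOY_proj = quotient_proj TrPD (MOY_ideal \<alpha> \<zeta> n)"

lemma tensor_ideal_MOY: "tensor_ideal TrPD (MOY_ideal \<alpha> \<zeta> n)"
proof -
  interpret word_category "TrPD :: (_, 'r graph_mor, 'r) rigid_cat" edges edge_dual by (rule word_category_TrPD)
  show ?thesis unfolding MOY_ideal_def MOY_relators_def[symmetric]
    by (rule tensor_ideal_generated[OF _ MOY_relators_Mor]) unfold_locales
qed

lemma word_category_M: "word_category M edges edge_dual"
  unfolding MOY_rigid_def using word_category_TrPD tensor_ideal_MOY by (rule word_category_quotient)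

lemma word_functor_TrPD_M: "word_functor TrPD edges edge_dual M edges edge_dual MOY_proj (\<lambda>s. s)"
proof -
  interpret word_category "TrPD :: (_, 'r graph_mor, 'r) rigid_cat" edges edge_dual by (rule word_category_TrPD)
  have "rigid_functor TrPD M MOY_proj"
    unfolding MOY_rigid_def MOY_proj_def using rigid_category_axioms tensor_ideal_MOY by (rule rigid_functor_proj)
  then show ?thesis using word_category_TrPD word_category_M
    by (intro word_functor.intro word_functor_axioms.intro) (auto simp: MOY_proj_def quotient_proj_def)
qed

lemma MOY_proj_S: "on_mor MOY_proj (TrPD_S Up) = MOY_S \<alpha> \<zeta> n"
  by (simp add: MOY_proj_def quotient_proj_def MOY_S_def)

lemma Mor_M: "f \<in> Mor M \<longleftrightarrow> (\<exists>f' \<in> Mor TrPD. f = on_mor MOY_proj f')"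
proof -
  interpret P: word_category "TrPD :: (_, 'r graph_mor, 'r) rigid_cat" edges edge_dual by (rule word_category_TrPD)
  interpret QP: monoidal_quotient TrPD "MOY_ideal \<alpha> \<zeta> n" by unfold_locales (rule tensor_ideal_MOY)
  show ?thesis unfolding MOY_rigid_def MOY_proj_def quotient_proj_def QP.Q_fields(2) by auto
qed

end

context hecke_crossing
begin

text \<open>The formula for the positive crossing, solved for \<open>S\<close>; strands that slide
  over the crossing therefore slide over \<open>S\<close>.\<close>

lemma S_eq_X: "S a = (\<alpha> \<odot> X True a a) \<oplus> ((- \<zeta>') \<odot> \<langle>[e a, e a]\<rangle>)"
proof -
  have "(\<alpha> \<odot> X True a a) \<oplus> ((- \<zeta>') \<odot> \<langle>[e a, e a]\<rangle>) = S a \<oplus> ((\<zeta>' \<odot> \<langle>[e a, e a]\<rangle>) \<oplus> ((- \<zeta>') \<odot> \<langle>[e a, e a]\<rangle>))"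
    using \<alpha> by (simp add: X_parallel \<kappa>_def \<mu>_def scale_sum mult.assoc[symmetric] add_ac)
  also have "\<dots> = S a" by (simp add: scale_add[symmetric])
  finally show ?thesis ..
qed

lemma slides_S: "slides over c (X True a a) \<Longrightarrow> slides over c (S a)"
  unfolding S_eq_X by (simp add: slides_add slides_scale slides_ide)

text \<open>The terms in \<open>s\<close> cancel because \<open>\<alpha> * \<alpha>' = 1\<close>,
  and the coefficients of the identity are left with their difference.\<close>

lemma skein: "(\<alpha> \<odot> p) \<ominus> (\<alpha>' \<odot> m) = (\<zeta>' - \<zeta>) \<odot> \<langle>[e Up, e Up]\<rangle>"
proof -
  note [simp] = HomD[OF s_in]
  have "\<alpha>' * \<alpha> = 1" using \<alpha> by (simp add: mult.commute)
  then have "(\<alpha> \<odot> p) \<ominus> (\<alpha>' \<odot> m) = ((\<zeta>' \<odot> \<langle>[e Up, e Up]\<rangle>) \<oplus> ((- \<zeta>) \<odot> \<langle>[e Up, e Up]\<rangle>)) \<oplus> (s \<ominus> s)"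
    using \<alpha> by (simp only: p_eq m_eq diff_def) (simp add: scale_sum mult.assoc[symmetric] add_ac)
  then show ?thesis by (simp add: scale_add[symmetric])
qed

text \<open>\<open>relation3\<close> has to precede \<open>relation4\<close>, whose criterion
  presupposes the value of the partial trace, and \<open>relation2\<close> has to precede
  \<open>relation5\<close>, whose criterion uses the square of \<open>S\<close>.\<close>

lemma relations_from_moves:
  assumes circle: "\<And>a. relation1 a"
    and R1: "\<And>a. left_curl C [e a] (X True a a) = \<langle>[e a]\<rangle>"
    and R2: "\<And>over a b. X (\<not> over) b a \<cdot> X over a b = \<langle>[e a, e b]\<rangle>"
    and R3: "\<And>a. (X True a a \<otimes> \<langle>[e a]\<rangle>) \<cdot> (\<langle>[e a]\<rangle> \<otimes> X True a a) \<cdot> (X True a a \<otimes> \<langle>[e a]\<rangle>) =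
      (\<langle>[e a]\<rangle> \<otimes> X True a a) \<cdot> (X True a a \<otimes> \<langle>[e a]\<rangle>) \<cdot> (\<langle>[e a]\<rangle> \<otimes> X True a a)"
  shows "relation1 a \<and> relation2 a \<and> relation3 a \<and> relation4 a \<and> relation5 a"
proof -
  have 2: "relation2 a" for a using relation2_iff[of True a] R2[of True a a] by simp
  have 3: "relation3 a" for a using left_curl_iff[where a = a and over = True, OF circle] R1 by simp
  have "relation4 a" using relation4_iff[where a = a and over = True, OF circle 3] R2[of True a "reverse a"] by simp
  moreover have "relation5 a" using relation5_iff[OF 2] R3 by simp
  ultimately show ?thesis using circle 2 3 by simp
qed

end

text \<open>Rigid functors preserve cups and caps, so among the generators only the crossings are
  left to compare.\<close>

lemma H_functor_unique:
  fixes \<alpha> z :: "'r::{comm_ring, comm_monoid_mult}"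
  assumes F: "rigid_functor (H \<alpha> z) D F" and G: "rigid_functor (H \<alpha> z) D G"
    and ob: "\<And>a. on_obj F [a] = on_obj G [a]"
    and x: "\<And>v. on_mor F (HOMFLY_xing \<alpha> z v) = on_mor G (HOMFLY_xing \<alpha> z v)"
  shows "on_obj F A = on_obj G A" and "f \<in> Mor (H \<alpha> z) \<Longrightarrow> on_mor F f = on_mor G f"
proof -
  interpret F: rigid_functor "H \<alpha> z" D F by fact
  interpret G: rigid_functor "H \<alpha> z" D G by fact
  interpret P: word_functor PTD UNIV reverse "H \<alpha> z" UNIV reverse "HOMFLY_proj \<alpha> z" "\<lambda>a. a"
    by (rule word_functor_PTD_H)
  have ob': "on_obj F A = on_obj G A" for A
    using functors_agree[OF F G word_category_H, of A] ob by simp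
  then show "on_obj F A = on_obj G A" .
  have "on_mor F (on_mor (HOMFLY_proj \<alpha> z) f) = on_mor G (on_mor (HOMFLY_proj \<alpha> z) f)" if "f \<in> Mor PTD" for f
    using that
    by (induction rule: PTD_induct) (simp_all add: ob' HOMFLY_proj_Node x)
  then show "f \<in> Mor (H \<alpha> z) \<Longrightarrow> on_mor F f = on_mor G f" by (auto simp: Mor_H)
qed

text \<open>Agreement on the dual of \<open>S\<close> follows from agreement on \<open>S\<close>,
  because the dual is the mate and rigid functors preserve mates.\<close>

lemma M_functor_unique:
  fixes \<alpha> \<zeta> :: "'r::{comm_ring, comm_monoid_mult}"
  assumes F: "rigid_functor (M \<alpha> \<zeta> n) D F" and G: "rigid_functor (M \<alpha> \<zeta> n) D G"
    and ob: "\<And>a. on_obj F [(One, a)] = on_obj G [(One, a)]"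
    and S: "on_mor F (MOY_S \<alpha> \<zeta> n) = on_mor G (MOY_S \<alpha> \<zeta> n)"
  shows "A \<in> lists edges \<Longrightarrow> on_obj F A = on_obj G A" and "f \<in> Mor (M \<alpha> \<zeta> n) \<Longrightarrow> on_mor F f = on_mor G f"
proof -
  interpret F: rigid_functor "M \<alpha> \<zeta> n" D F by fact
  interpret G: rigid_functor "M \<alpha> \<zeta> n" D G by fact
  interpret P: word_functor TrPD edges edge_dual "M \<alpha> \<zeta> n" edges edge_dual "MOY_proj \<alpha> \<zeta> n" "\<lambda>s. s"
    by (rule word_functor_TrPD_M)
  have ob': "on_obj F A = on_obj G A" if "A \<in> lists edges" for A
    using functors_agree[OF F G word_category_M _ that] ob by auto
  then show "A \<in> lists edges \<Longrightarrow> on_obj F A = on_obj G A" .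
  note [simp] = HomD[OF TrPD_S_in]
  have Up: "on_mor F (on_mor (MOY_proj \<alpha> \<zeta> n) (TrPD_S Up)) = on_mor G (on_mor (MOY_proj \<alpha> \<zeta> n) (TrPD_S Up))"
    unfolding MOY_proj_S by (rule S)
  have Down: "on_mor F (on_mor (MOY_proj \<alpha> \<zeta> n) (TrPD_S Down)) = on_mor G (on_mor (MOY_proj \<alpha> \<zeta> n) (TrPD_S Down))"
    unfolding TrPD_S_mate(1)[symmetric] using Up by simp
  have "on_mor F (on_mor (MOY_proj \<alpha> \<zeta> n) f) = on_mor G (on_mor (MOY_proj \<alpha> \<zeta> n) f)" if "f \<in> Mor TrPD" for f
    using that
  proof (induction rule: TrPD_induct)
    case (S a)
    then show ?case using Up Down by (cases a) simp_all
  qed (simp_all add: ob')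
  then show "f \<in> Mor (M \<alpha> \<zeta> n) \<Longrightarrow> on_mor F f = on_mor G f" by (auto simp: Mor_M)
qed

context skein_parameters
begin

abbreviation MM :: "(edge list, 'r graph_mor set, 'r) rigid_cat" where "MM \<equiv> M \<alpha> \<zeta> n"
abbreviation HH :: "(ori list, 'r tangle_mor set set, 'r) rigid_cat" where "HH \<equiv> H \<alpha> z"

text \<open>Lift of the crossings to the category before the quotient, where a functor from plane
  tangle diagrams can be given by interpreting vertices.\<close>

definition graph_sigma :: "xing \<Rightarrow> 'r graph_mor" where
  "graph_sigma v = (let i = ide TrPD [(One, Up), (One, Up)] in case v of
     Xp \<Rightarrow> scale TrPD (uinv \<alpha>) (add TrPD (scale TrPD (uinv \<zeta>) i) (TrPD_S Up))
   | Xm \<Rightarrow> scale TrPD \<alpha> (add TrPD (scale TrPD \<zeta> i) (TrPD_S Up)))"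

lemma graph_sigma_in: "graph_sigma v \<in> Hom TrPD [(One, Up), (One, Up)] [(One, Up), (One, Up)]"
  and graph_sigma_turn: "mate TrPD (graph_sigma v) = comate TrPD (graph_sigma v)"
proof -
  interpret word_category "TrPD :: (_, 'r graph_mor, 'r) rigid_cat" edges edge_dual by (rule word_category_TrPD)
  note [simp] = HomD[OF TrPD_S_in]
  show "graph_sigma v \<in> Hom TrPD [(One, Up), (One, Up)] [(One, Up), (One, Up)]"
    by (cases v) (simp_all add: graph_sigma_def Hom_def)
  show "mate TrPD (graph_sigma v) = comate TrPD (graph_sigma v)"
    by (cases v) (simp_all add: graph_sigma_def TrPD_S_mate)
qed

lemma MOY_proj_sigma: "on_mor (MOY_proj \<alpha> \<zeta> n) (graph_sigma v) = MOY_sigma \<alpha> \<zeta> n v"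
proof -
  interpret P: word_functor TrPD edges edge_dual MM edges edge_dual "MOY_proj \<alpha> \<zeta> n" "\<lambda>s. s"
    by (rule word_functor_TrPD_M)
  note [simp] = HomD[OF TrPD_S_in]
  show ?thesis
    by (cases v) (simp_all add: graph_sigma_def MOY_sigma_def Let_def MOY_proj_S)
qed

lemma hecke_crossing_M:
  "hecke_crossing MM edges edge_dual (Pair One) snd (MOY_sigma \<alpha> \<zeta> n Xp) (MOY_sigma \<alpha> \<zeta> n Xm) (MOY_S \<alpha> \<zeta> n)
    \<alpha> (uinv \<alpha>) \<zeta> (uinv \<zeta>) (q (int n)) (q (int n - 1)) (q (int n - 2))"
proof -
  interpret P: word_functor TrPD edges edge_dual MM edges edge_dual "MOY_proj \<alpha> \<zeta> n" "\<lambda>s. s"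
    by (rule word_functor_TrPD_M)
  note S = HomD[OF TrPD_S_in[where 'r = 'r, of Up]] and g = HomD[OF graph_sigma_in]
  have s: "MOY_S \<alpha> \<zeta> n \<in> Hom MM [(One, Up), (One, Up)] [(One, Up), (One, Up)]"
    unfolding MOY_proj_S[symmetric] using S by (simp add: Hom_def)
  have s': "mate MM (MOY_S \<alpha> \<zeta> n) = comate MM (MOY_S \<alpha> \<zeta> n)"
    unfolding MOY_proj_S[symmetric] P.F_mate[OF S(1), symmetric] P.F_comate[OF S(1), symmetric] TrPD_S_mate ..
  have \<sigma>: "MOY_sigma \<alpha> \<zeta> n v \<in> Hom MM [(One, Up), (One, Up)] [(One, Up), (One, Up)]" for v
    unfolding MOY_proj_sigma[symmetric] using g by (simp add: Hom_def)
  have \<sigma>': "mate MM (MOY_sigma \<alpha> \<zeta> n v) = comate MM (MOY_sigma \<alpha> \<zeta> n v)" for v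
    unfolding MOY_proj_sigma[symmetric] P.F_mate[OF g(1), symmetric] P.F_comate[OF g(1), symmetric] graph_sigma_turn ..
  have "crossing_category MM edges edge_dual (Pair One) snd (MOY_sigma \<alpha> \<zeta> n Xp) (MOY_sigma \<alpha> \<zeta> n Xm)"
    by unfold_locales (simp_all add: \<sigma> \<sigma>')
  then show ?thesis
    by (rule hecke_crossing.intro)
      (unfold_locales; simp add: s s' uinv_mult \<zeta>_unit \<alpha>_unit quantum_int_relations MOY_sigma_def Let_def)
qed

lemma MOY_relations_hold:
  "graph_functor MM edges edge_dual (MOY_proj \<alpha> \<zeta> n) (\<lambda>s. s) (Pair One) snd (MOY_sigma \<alpha> \<zeta> n Xp) (MOY_sigma \<alpha> \<zeta> n Xm)
    (MOY_S \<alpha> \<zeta> n) \<alpha> (uinv \<alpha>) \<zeta> n"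
  using word_functor_TrPD_M hecke_crossing_M
  by (intro graph_functor.intro graph_functor_axioms.intro) (simp_all add: MOY_proj_S)

lemma MOY_proj_relators:
  assumes "g \<in> MOY_relators \<alpha> \<zeta> n"
  shows "on_mor (MOY_proj \<alpha> \<zeta> n) g = zero MM (on_obj (MOY_proj \<alpha> \<zeta> n) (Src TrPD g)) (on_obj (MOY_proj \<alpha> \<zeta> n) (Tgt TrPD g))"
proof -
  interpret word_category "TrPD :: (_, 'r graph_mor, 'r) rigid_cat" edges edge_dual by (rule word_category_TrPD)
  have "g \<in> MOY_ideal \<alpha> \<zeta> n"
    unfolding MOY_ideal_def MOY_relators_def[symmetric] using assms by (rule subsetD[OF ideal_generated_incl])
  then have "coset TrPD (MOY_ideal \<alpha> \<zeta> n) g = zero (quotient_cat TrPD (MOY_ideal \<alpha> \<zeta> n)) (Src TrPD g) (Tgt TrPD g)"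
    by (rule coset_killed[OF rigid_category_axioms tensor_ideal_MOY])
  then show ?thesis by (simp add: MOY_proj_def quotient_proj_def MOY_rigid_def)
qed

text \<open>The relations give the second move and one third move, hence strands slide over all
  crossings. As \<open>S\<close> combines a crossing with the identity, sliding extends to all
  generators of the graph category.\<close>

lemma braided_crossing_M:
  "braided_crossing MM edges edge_dual (Pair One) snd (MOY_sigma \<alpha> \<zeta> n Xp) (MOY_sigma \<alpha> \<zeta> n Xm)"
proof -
  interpret M: graph_functor MM edges edge_dual "MOY_proj \<alpha> \<zeta> n" "\<lambda>s. s" "Pair One" snd
    "MOY_sigma \<alpha> \<zeta> n Xp" "MOY_sigma \<alpha> \<zeta> n Xm" "MOY_S \<alpha> \<zeta> n" \<alpha> "uinv \<alpha>" \<zeta> n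
    by (rule MOY_relations_hold)
  have rel: "M.relation1 a" "M.relation2 a" "M.relation3 a" "M.relation4 a" "M.relation5 a" for a
    using iffD1[OF M.MOY_relators_killed_iff] MOY_proj_relators by blast+
  interpret I: invertible_crossing MM edges edge_dual "Pair One" snd "MOY_sigma \<alpha> \<zeta> n Xp" "MOY_sigma \<alpha> \<zeta> n Xm"
    using M.R2_from_relations[OF rel(1-4)] by unfold_locales
  have X: "M.slides over c (M.X over' a b)" for over over' a b c
    by (rule I.slides_all_crossings) (rule M.slides_from_relations[OF rel(2,5)])
  have S: "M.slides over c (M.S a)" for over c a
    by (rule M.slides_S[OF X])
  have sl: "M.slides over c (on_mor (MOY_proj \<alpha> \<zeta> n) f)" if "f \<in> Mor TrPD" for over c f
    using that
  proof (induction rule: TrPD_induct)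
    case (S a)
    then show ?case using \<open>M.slides over c (M.S a)\<close> by simp
  qed (use I.slides_cup[of over c] I.slides_cap[of over c] in
      \<open>simp_all add: M.slides_zero M.slides_ide M.slides_scale M.slides_add M.slides_comp M.slides_tensor\<close>)
  show ?thesis
  proof
    show "M.slides over c f" if "f \<in> Mor MM" for f over c using that sl by (auto simp: Mor_M)
    show "right_curl MM [(One, a)] (M.X over a a) = ide MM [(One, a)]" for over a
      by (rule M.right_curl_from_relations[OF rel(1,3)])
    show "left_curl MM [(One, a)] (M.X over a a) = ide MM [(One, a)]" for over a
      using M.left_curl_iff[OF rel(1)] rel(3) by blast
  qed
qed

lemma edges_eq: "edges = {(One, Up), (One, Down)}"
  using reverse.cases by (auto simp: image_iff) 

lemma rigid_braided_untwisted_MOY: "rigid_braided_untwisted (MOY \<alpha> \<zeta> n)"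
  unfolding MOY_def using braided_crossing.rigid_braided_untwisted[OF braided_crossing_M] unfolding edges_eq .

end

section \<open>Functors in both directions, inverse to each other by uniqueness\<close>

section \<open>The isomorphism\<close>

lemma word_functor_comp:
  assumes "word_functor C T b D T' b' F t" "word_functor D T' b' E T'' b'' G u"
  shows "word_functor C T b E T'' b'' (comp_map G F) (\<lambda>s. u (t s))"
proof -
  interpret F: word_functor C T b D T' b' F t by fact
  interpret G: word_functor D T' b' E T'' b'' G u by fact
  have "on_obj (comp_map G F) [s] = [u (t s)]" if "s \<in> T" for s
    using F.F_strand[OF that] G.F_strand[OF F.t_in[OF that]] by (simp add: comp_map_def)
  then show ?thesis
    using F.C.word_category_axioms G.D.word_category_axioms
      rigid_functor_comp[OF F.rigid_functor_axioms G.rigid_functor_axioms]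
    by (intro word_functor.intro word_functor_axioms.intro)
qed

lemma word_functor_quotient:
  fixes C :: "('s list, 'm, 'r::{comm_ring, comm_monoid_mult}) rigid_cat"
  assumes F: "word_functor C T b D T' b' F t" and G: "G \<subseteq> Mor C"
    and killed: "\<And>g. g \<in> G \<Longrightarrow> on_mor F g = zero D (on_obj F (Src C g)) (on_obj F (Tgt C g))"
  shows "word_functor (quotient_cat C (ideal_generated C G)) T b D T' b' (quotient_functor F) t"
proof -
  interpret F: word_functor C T b D T' b' F t by fact
  have "word_category (quotient_cat C (ideal_generated C G)) T b"
    by (rule word_category_quotient[OF F.C.word_category_axioms])
      (rule tensor_ideal_generated[OF F.C.linear_monoidal_category_axioms G])
  moreover have "on_obj (quotient_functor F) [s] = [t s]" if "s \<in> T" for s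
    using F.F_strand[OF that] by (simp add: quotient_functor_def)
  ultimately show ?thesis
    using F.D.word_category_axioms rigid_functor_quotient(1)[OF F.rigid_functor_axioms G killed]
    by (intro word_functor.intro word_functor_axioms.intro)
qed

context skein_parameters
begin

text \<open>A strand becomes an edge labelled 1 and a crossing its expansion in \<open>S\<close>.
  Such an expansion is a combination of graphs, which is why vertices are interpreted by morphisms
  and not by single diagrams.\<close>

lemma tangle_to_graph:
  "\<exists>F. word_functor PTD UNIV reverse TrPD edges edge_dual F (Pair One) \<and>
    (\<forall>v. on_mor F (of_diagram tangle_sig (Node v)) = graph_sigma v)"
proof -
  interpret W: word_category "TrPD :: (_, 'r graph_mor, 'r) rigid_cat" edges edge_dual by (rule word_category_TrPD)
  interpret F: diagram_functor tangle_sig UNIV "{d. wf_diagram tangle_sig d}" trivalent_sig edges trivalent_graphs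
    "\<lambda>a. [(One, a)]" graph_sigma
  proof (intro diagram_functor.intro diagram_interp.intro diagram_interp_axioms.intro)
    show "diagram_family tangle_sig UNIV {d. wf_diagram tangle_sig d}" by (rule tangle.diagram_family_axioms)
    show "diagram_family trivalent_sig edges trivalent_graphs" by (rule graph.diagram_family_axioms)
    show "word_category (graph.C :: (_, 'r graph_mor, 'r) rigid_cat) edges (opp trivalent_sig)" by (rule graph.word_category_C)
  qed (use graph_sigma_in graph_sigma_turn in \<open>simp_all add: TrPD_eq[symmetric] tangle_sig_def\<close>)
  have "rigid_functor PTD TrPD F.Fun"
    unfolding PTD_eq TrPD_eq by (rule F.rigid_functor_Fun)
  then have "word_functor PTD UNIV reverse TrPD edges edge_dual F.Fun (Pair One)"
    using word_category_PTD word_category_TrPD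
    by (intro word_functor.intro word_functor_axioms.intro) (simp_all add: F.Fun_def)
  moreover have "on_mor F.Fun (of_diagram tangle_sig (Node v)) = graph_sigma v" for v
    by (subst F.Fun_diagram) simp_all
  ultimately show ?thesis by blast
qed

text \<open>Lift of \<open>HOMFLY_S\<close> to plane diagrams, where the skein relation is not yet
  imposed. The expression by the negative crossing would be another lift of the same class.\<close>

definition tangle_S :: "'r tangle_mor" where
  "tangle_S = add PTD (scale PTD \<alpha> (of_diagram tangle_sig (Node Xp))) (scale PTD (- uinv \<zeta>) (ide PTD [Up, Up]))"

text \<open>
  An isotopy of graphs may cut across the edges labelled 2, so all diagrams have to be interpreted,
  not only those built from \<open>S\<close>: an edge labelled 2 becomes two parallel strands, a splitting
  vertex the identity and a merging vertex \<open>S\<close> itself.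
\<close>

lemma graph_to_tangle:
  "\<exists>F. word_functor TrPD edges edge_dual PTD UNIV reverse F snd \<and> on_mor F (TrPD_S Up) = tangle_S"
proof -
  interpret W: crossing_category "PTD :: (_, 'r tangle_mor, 'r) rigid_cat" UNIV reverse "\<lambda>a. a" "\<lambda>a. a"
    "of_diagram tangle_sig (Node Xp)" "of_diagram tangle_sig (Node Xm)"
    by (rule crossing_category_PTD)
  note [simp] = HomD[OF W.p_in]
  define e where "e = (\<lambda>s :: edge. case s of (One, a) \<Rightarrow> [a] | (Two, a) \<Rightarrow> [a, a])"
  define x where "x = (\<lambda>v. case v of Merge \<Rightarrow> tangle_S | Split \<Rightarrow> ide (PTD :: (_, 'r tangle_mor, 'r) rigid_cat) [Up, Up])"
  have S: "tangle_S \<in> Mor PTD" "Src PTD tangle_S = [Up, Up]" "Tgt PTD tangle_S = [Up, Up]"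
    by (simp_all add: tangle_S_def)
  have S_turn: "mate PTD tangle_S = comate PTD tangle_S"
    by (simp add: tangle_S_def W.p_turn)
  interpret F: diagram_functor trivalent_sig edges trivalent_graphs tangle_sig UNIV "{d. wf_diagram tangle_sig d}" e x
  proof (intro diagram_functor.intro diagram_interp.intro diagram_interp_axioms.intro)
    show "diagram_family tangle_sig UNIV {d. wf_diagram tangle_sig d}" by (rule tangle.diagram_family_axioms)
    show "diagram_family trivalent_sig edges trivalent_graphs" by (rule graph.diagram_family_axioms)
    show "word_category (tangle.C :: (_, 'r tangle_mor, 'r) rigid_cat) UNIV (opp tangle_sig)" by (rule tangle.word_category_C)
    show "opp trivalent_sig (opp trivalent_sig s) = s" for s by (cases s) simp
    show "e s \<in> lists UNIV" for s by simp
    show "e (opp trivalent_sig s) = dual (tangle.C :: (_, 'r tangle_mor, 'r) rigid_cat) (e s)" for s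
      unfolding PTD_eq[symmetric] by (cases s; cases "fst s") (simp_all add: e_def)
    show "x v \<in> Hom tangle.C (concat (map e (node_src trivalent_sig v))) (concat (map e (node_tgt trivalent_sig v)))" for v
      unfolding PTD_eq[symmetric] using S by (cases v) (simp_all add: e_def x_def Hom_def)
    show "mate tangle.C (x v) = comate tangle.C (x v)" for v
      unfolding PTD_eq[symmetric] using S_turn by (cases v) (simp_all add: x_def)
  qed
  have "rigid_functor TrPD PTD F.Fun"
    unfolding PTD_eq TrPD_eq by (rule F.rigid_functor_Fun)
  then have "word_functor TrPD edges edge_dual PTD UNIV reverse F.Fun snd"
    using word_category_PTD word_category_TrPD
  proof (intro word_functor.intro word_functor_axioms.intro)
    show "on_obj F.Fun [s] = [snd s]" if "s \<in> edges" for s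
      unfolding F.Fun_def using that by (auto simp: e_def)
  qed
  moreover have "on_mor F.Fun (TrPD_S Up) = comp PTD (ide PTD [Up, Up]) tangle_S"
  proof -
    have "on_mor F.Fun (of_diagram trivalent_sig S_graph) = F.itp S_graph"
      by (rule F.Fun_diagram) (simp add: S_graph_def)
    also have "\<dots> = comp PTD (x Split) (x Merge)"
      by (simp only: S_graph_def F.itp.simps PTD_eq)
    finally show ?thesis by (simp add: TrPD_S_def x_def)
  qed
  ultimately show ?thesis using S by auto
qed

lemma MOY_circle: "comp MM (evl MM [(One, a)]) (coevl MM [(One, a)]) = scale MM (q (int n)) (ide MM [])"
proof -
  interpret M: graph_functor MM edges edge_dual "MOY_proj \<alpha> \<zeta> n" "\<lambda>s. s" "Pair One" snd
    "MOY_sigma \<alpha> \<zeta> n Xp" "MOY_sigma \<alpha> \<zeta> n Xm" "MOY_S \<alpha> \<zeta> n" \<alpha> "uinv \<alpha>" \<zeta> n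
    by (rule MOY_relations_hold)
  show ?thesis using iffD1[OF M.MOY_relators_killed_iff] MOY_proj_relators by blast
qed

text \<open>The functor descends in two stages, past the Reidemeister relators and then past the
  skein relators, because the source is a quotient of a quotient.\<close>

lemma HOMFLY_to_MOY:
  "\<exists>Z. word_functor HH UNIV reverse MM edges edge_dual Z (Pair One) \<and>
    (\<forall>v. on_mor Z (HOMFLY_xing \<alpha> z v) = MOY_sigma \<alpha> \<zeta> n v)"
proof -
  obtain F where F: "word_functor PTD UNIV reverse TrPD edges edge_dual F (Pair One)"
    and Fv: "\<And>v. on_mor F (of_diagram tangle_sig (Node v)) = graph_sigma v"
    using tangle_to_graph by blast
  define Z0 where "Z0 = comp_map (MOY_proj \<alpha> \<zeta> n) F"
  have Z0: "word_functor PTD UNIV reverse MM edges edge_dual Z0 (Pair One)"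
    unfolding Z0_def by (rule word_functor_comp[OF F word_functor_TrPD_M])
  have Z0v: "on_mor Z0 (of_diagram tangle_sig (Node v)) = MOY_sigma \<alpha> \<zeta> n v" for v
    by (simp add: Z0_def comp_map_def Fv MOY_proj_sigma)
  interpret M: braided_crossing MM edges edge_dual "Pair One" snd "MOY_sigma \<alpha> \<zeta> n Xp" "MOY_sigma \<alpha> \<zeta> n Xm"
    by (rule braided_crossing_M)
  interpret S: hecke_crossing MM edges edge_dual "Pair One" snd "MOY_sigma \<alpha> \<zeta> n Xp" "MOY_sigma \<alpha> \<zeta> n Xm"
    "MOY_S \<alpha> \<zeta> n" \<alpha> "uinv \<alpha>" \<zeta> "uinv \<zeta>" "q (int n)" "q (int n - 1)" "q (int n - 2)"
    by (rule hecke_crossing_M)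
  \<comment> \<open>Every morphism slides, in particular every crossing; so the third move holds for
    all orientations and heights.\<close>
  have R3: "comp MM (tensor MM (M.X (j > k) b c) (ide MM [(One, a)]))
        (comp MM (tensor MM (ide MM [(One, b)]) (M.X (i > k) a c)) (tensor MM (M.X (i > j) a b) (ide MM [(One, c)]))) =
      comp MM (tensor MM (ide MM [(One, c)]) (M.X (i > j) a b))
        (comp MM (tensor MM (M.X (i > k) a c) (ide MM [(One, b)])) (tensor MM (ide MM [(One, a)]) (M.X (j > k) b c)))"
    if "distinct [i, j, k]" for i j k :: nat and a b c
    using M.R3_general[OF M.slides_all[OF M.X_Mor(1)] that] .
  have killed: "\<forall>g \<in> reidemeister1 \<union> reidemeister2 \<union> reidemeister3.
      on_mor Z0 g = zero MM (on_obj Z0 (Src PTD g)) (on_obj Z0 (Tgt PTD g))"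
    unfolding reidemeister_killed_iff[OF Z0] Z0v
    using M.right_R1 M.left_R1 M.R2 R3 by blast
  have Z1: "word_functor TD UNIV reverse MM edges edge_dual (quotient_functor Z0) (Pair One)"
    unfolding TD_def TD_ideal_def by (rule word_functor_quotient[OF Z0 reidemeister_Mor bspec[OF killed]])
  interpret Z0: word_functor "PTD :: (_, 'r tangle_mor, 'r) rigid_cat" UNIV reverse MM edges edge_dual Z0 "Pair One"
    by (rule Z0)
  have Z1v: "on_mor (quotient_functor Z0) (TD_xing v) = MOY_sigma \<alpha> \<zeta> n v" for v
  proof -
    have "of_diagram tangle_sig (Node v) \<in> Mor (PTD :: (_, 'r tangle_mor, 'r) rigid_cat)"
      unfolding PTD_eq by (rule HomD(1)[OF tangle.of_diagram_Mor]) simp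
    then show ?thesis
      unfolding TD_xing_def TD_ideal_def Z0v[symmetric]
      by (intro rigid_functor_quotient(2)[OF Z0.rigid_functor_axioms reidemeister_Mor] bspec[OF killed])
  qed
  \<comment> \<open>The circle value prescribed for tangles is the quantum integer [n], and the
    scalar in \<open>S.skein\<close> is z.\<close>
  have killed': "\<forall>g \<in> HOMFLY_relators \<alpha> z.
      on_mor (quotient_functor Z0) g = zero MM (on_obj (quotient_functor Z0) (Src TD g)) (on_obj (quotient_functor Z0) (Tgt TD g))"
    unfolding HOMFLY_relators_killed_iff(2)[OF Z1] Z1v
    using S.skein MOY_circle quantum_int_values(1) z_eq by simp
  note incl = HOMFLY_relators_killed_iff(1)[OF Z1, of \<alpha> z]
  interpret Z1: word_functor "TD :: (_, 'r tangle_mor set, 'r) rigid_cat" UNIV reverse MM edges edge_dual "quotient_functor Z0" "Pair One"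
    by (rule Z1)
  have Z: "word_functor HH UNIV reverse MM edges edge_dual (quotient_functor (quotient_functor Z0)) (Pair One)"
    unfolding HOMFLY_rigid_def HOMFLY_ideal_eq
    by (rule word_functor_quotient[OF Z1 incl bspec[OF killed']])
  have "on_mor (quotient_functor (quotient_functor Z0)) (HOMFLY_xing \<alpha> z v) = MOY_sigma \<alpha> \<zeta> n v" for v
    unfolding HOMFLY_xing_def HOMFLY_ideal_eq Z1v[symmetric]
    by (rule rigid_functor_quotient(2)[OF Z1.rigid_functor_axioms incl bspec[OF killed'] HomD(1)[OF TD_xing_in]])
  with Z show ?thesis by blast
qed

text \<open>Here the moves are known in the target and \<open>relations_from_moves\<close> produces
  the graph relations, so the graph relators are killed.\<close>

lemma MOY_to_HOMFLY:
  "\<exists>G. word_functor MM edges edge_dual HH UNIV reverse G snd \<and> on_mor G (MOY_S \<alpha> \<zeta> n) = HOMFLY_S"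
proof -
  obtain F where F: "word_functor TrPD edges edge_dual PTD UNIV reverse F snd" and FS: "on_mor F (TrPD_S Up) = tangle_S"
    using graph_to_tangle by blast
  define G0 where "G0 = comp_map (HOMFLY_proj \<alpha> z) F"
  have G0: "word_functor TrPD edges edge_dual HH UNIV reverse G0 snd"
    unfolding G0_def by (rule word_functor_comp[OF F word_functor_PTD_H])
  interpret P: word_functor "PTD :: (_, 'r tangle_mor, 'r) rigid_cat" UNIV reverse HH UNIV reverse "HOMFLY_proj \<alpha> z" "\<lambda>a. a"
    by (rule word_functor_PTD_H)
  have "on_mor (HOMFLY_proj \<alpha> z) tangle_S = HOMFLY_S"
  proof -
    have "of_diagram tangle_sig (Node Xp) \<in> Hom (PTD :: (_, 'r tangle_mor, 'r) rigid_cat) [Up, Up] [Up, Up]"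
      using crossing_category.p_in[OF crossing_category_PTD] .
    from HomD[OF this] show ?thesis by (simp add: tangle_S_def HOMFLY_S_def HOMFLY_proj_Node)
  qed
  then have G0S: "on_mor G0 (TrPD_S Up) = HOMFLY_S" by (simp add: G0_def comp_map_def FS)
  interpret H: graph_functor HH UNIV reverse G0 snd "\<lambda>a. a" "\<lambda>a. a" "HOMFLY_xing \<alpha> z Xp" "HOMFLY_xing \<alpha> z Xm" HOMFLY_S \<alpha> "uinv \<alpha>" \<zeta> n
    using G0 hecke_crossing_H G0S
    by (intro graph_functor.intro graph_functor_axioms.intro) simp_all
  have R3: "comp HH (tensor HH (H.X True a a) (ide HH [a])) (comp HH (tensor HH (ide HH [a]) (H.X True a a)) (tensor HH (H.X True a a) (ide HH [a]))) =
      comp HH (tensor HH (ide HH [a]) (H.X True a a)) (comp HH (tensor HH (H.X True a a) (ide HH [a])) (tensor HH (ide HH [a]) (H.X True a a)))" for a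
    using H_reidemeister(4)[of 2 1 0 \<alpha> z a a a] by simp
  have "H.relation1 a \<and> H.relation2 a \<and> H.relation3 a \<and> H.relation4 a \<and> H.relation5 a" for a
    by (rule H.relations_from_moves[OF _ H_reidemeister(2,3) R3])
      (simp add: H_skein quantum_int_values)
  then have killed: "\<forall>g \<in> MOY_relators \<alpha> \<zeta> n. on_mor G0 g = zero HH (on_obj G0 (Src TrPD g)) (on_obj G0 (Tgt TrPD g))"
    unfolding H.MOY_relators_killed_iff by blast
  have "word_functor MM edges edge_dual HH UNIV reverse (quotient_functor G0) snd"
    unfolding MOY_rigid_def MOY_ideal_def MOY_relators_def[symmetric]
    by (rule word_functor_quotient[OF G0 MOY_relators_Mor bspec[OF killed]])
  moreover have "on_mor (quotient_functor G0) (MOY_S \<alpha> \<zeta> n) = HOMFLY_S"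
    unfolding MOY_S_def MOY_ideal_def MOY_relators_def[symmetric] G0S[symmetric]
    by (rule rigid_functor_quotient(2)[OF H.F.rigid_functor_axioms MOY_relators_Mor bspec[OF killed] HomD(1)[OF TrPD_S_in]])
  ultimately show ?thesis by blast
qed

text \<open>The composites agree with the identity functors on letters and generating morphisms, and
  uniqueness of functors does the rest. The braidings correspond because both are assembled from
  crossings of single strands.\<close>

theorem Z_isomorphism:
  "\<exists>Z. is_Z \<alpha> z \<zeta> n Z \<and> (\<forall>Z'. is_Z \<alpha> z \<zeta> n Z' \<longrightarrow> cat_map_eq (HOMFLY \<alpha> z) Z' Z) \<and>
    rbu_isomorphism (HOMFLY \<alpha> z) (MOY \<alpha> \<zeta> n) Z"
proof -
  obtain Z where wZ: "word_functor HH UNIV reverse MM edges edge_dual Z (Pair One)"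
    and Zx: "\<And>v. on_mor Z (HOMFLY_xing \<alpha> z v) = MOY_sigma \<alpha> \<zeta> n v"
    using HOMFLY_to_MOY by blast
  obtain G where wG: "word_functor MM edges edge_dual HH UNIV reverse G snd" and GS: "on_mor G (MOY_S \<alpha> \<zeta> n) = HOMFLY_S"
    using MOY_to_HOMFLY by blast
  interpret Z: word_functor HH UNIV reverse MM edges edge_dual Z "Pair One" by (rule wZ)
  interpret G: word_functor MM edges edge_dual HH UNIV reverse G snd by (rule wG)
  note Hh = hecke_crossing_H and Mh = hecke_crossing_M
  note MS = hecke_crossing.s_in[OF Mh]
  \<comment> \<open>On both sides the crossings are the same expressions in \<open>S\<close>, so
    matching \<open>S\<close> is enough.\<close>
  have Gx: "on_mor G (MOY_sigma \<alpha> \<zeta> n v) = HOMFLY_xing \<alpha> z v" for v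
    using HomD[OF MS] hecke_crossing.p_eq[OF Hh] hecke_crossing.m_eq[OF Hh]
    by (cases v) (simp_all add: MOY_sigma_def Let_def GS)
  \<comment> \<open>Conversely \<open>S\<close> is recovered from the positive crossing by
    \<open>S_eq_X\<close>.\<close>
  have ZS: "on_mor Z HOMFLY_S = MOY_S \<alpha> \<zeta> n"
  proof -
    have "HOMFLY_xing \<alpha> z Xp \<in> Hom HH [Up, Up] [Up, Up]" using crossing_category.p_in[OF crossing_category_H] .
    from HomD[OF this] have "on_mor Z HOMFLY_S =
        add MM (scale MM \<alpha> (MOY_sigma \<alpha> \<zeta> n Xp)) (scale MM (- uinv \<zeta>) (ide MM [(One, Up), (One, Up)]))"
      by (simp add: HOMFLY_S_def Zx)
    also have "\<dots> = MOY_S \<alpha> \<zeta> n"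
      using hecke_crossing.S_eq_X[OF Mh, of Up] by (simp add: hecke_crossing.S_def[OF Mh] crossing_def)
    finally show ?thesis .
  qed
  have GZ_functor: "rigid_functor HH HH (comp_map G Z)" and ZG_functor: "rigid_functor MM MM (comp_map Z G)"
    using rigid_functor_comp Z.rigid_functor_axioms G.rigid_functor_axioms by blast+
  have GZ: "on_obj G (on_obj Z A) = A" "f \<in> Mor HH \<Longrightarrow> on_mor G (on_mor Z f) = f" for A f
    using H_functor_unique[OF GZ_functor rigid_functor_id[OF Z.C.rigid_category_axioms]] Z.F_strand G.F_strand
    by (simp_all add: comp_map_def id_map_def Zx Gx)
  have ZG: "A \<in> lists edges \<Longrightarrow> on_obj Z (on_obj G A) = A" "f \<in> Mor MM \<Longrightarrow> on_mor Z (on_mor G f) = f" for A f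
    using M_functor_unique[OF ZG_functor rigid_functor_id[OF Z.D.rigid_category_axioms]] Z.F_strand G.F_strand
    by (simp_all add: comp_map_def id_map_def GS ZS)
  have rZ: "rigid_monoidal_functor (HOMFLY \<alpha> z) (MOY \<alpha> \<zeta> n) Z" and rG: "rigid_monoidal_functor (MOY \<alpha> \<zeta> n) (HOMFLY \<alpha> z) G"
    using Z.F G.F by (simp_all add: HOMFLY_def MOY_def)
  have is_Z: "is_Z \<alpha> z \<zeta> n Z"
    using rZ Z.F_strand by (simp add: is_Z_def Zx)
  have unique: "cat_map_eq (HOMFLY \<alpha> z) Z' Z" if "is_Z \<alpha> z \<zeta> n Z'" for Z'
  proof -
    have "rigid_monoidal_functor HH MM Z'" using that by (simp add: is_Z_def HOMFLY_def MOY_def)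
    then interpret Z': rigid_functor HH MM Z'
      using Z.C.rigid_category_axioms Z.D.rigid_category_axioms by (intro rigid_functor.intro rigid_functor_axioms.intro)
    have Up: "on_obj Z' [Up] = [(One, Up)]" using that by (simp add: is_Z_def)
    \<comment> \<open>The downward strand is the dual of the upward one, so its image is forced by
      rigidity.\<close>
    have ob: "on_obj Z' [a] = on_obj Z [a]" for a
    proof (cases a)
      case Down
      then show ?thesis using Z'.F_simps(9)[of "[Up]"] Up Z.F_strand[of Down] by simp
    qed (use Up Z.F_strand[of Up] in simp)
    show ?thesis
      using H_functor_unique[OF Z'.rigid_functor_axioms Z.rigid_functor_axioms ob] that
      by (simp add: cat_map_eq_def is_Z_def Zx HOMFLY_def)
  qed
  interpret Hc: crossing_category HH UNIV reverse "\<lambda>a. a" "\<lambda>a. a" "HOMFLY_xing \<alpha> z Xp" "HOMFLY_xing \<alpha> z Xm"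
    by (rule crossing_category_H)
  interpret Mc: crossing_category MM edges edge_dual "Pair One" snd "MOY_sigma \<alpha> \<zeta> n Xp" "MOY_sigma \<alpha> \<zeta> n Xm"
    by (rule braided_crossing_M[THEN braided_crossing.axioms(1), THEN invertible_crossing.axioms(1)])
  have "on_mor Z (braid (HOMFLY \<alpha> z) A B) = braid (MOY \<alpha> \<zeta> n) (on_obj Z A) (on_obj Z B)" for A B
    unfolding HOMFLY_def MOY_def with_braiding_fields
    using Z.F_word_over_word[OF Hc.X_in[of True], of "\<lambda>s t. Mc.X True (snd s) (snd t)" A B] Z.F_crossing[OF crossing_category_H]
    by (simp add: Zx)
  then have bZ: "rigid_braided_functor (HOMFLY \<alpha> z) (MOY \<alpha> \<zeta> n) Z"
    using rZ Z.F_strand by (auto simp: rigid_braided_functor_def HOMFLY_def MOY_def edges_eq[symmetric])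
  have "on_mor G (braid (MOY \<alpha> \<zeta> n) A B) = braid (HOMFLY \<alpha> z) (on_obj G A) (on_obj G B)" if "A \<in> lists edges" "B \<in> lists edges" for A B
  proof -
    have X: "Mc.X True (snd s) (snd s') \<in> Hom MM [s, s'] [s', s]" if "s \<in> edges" "s' \<in> edges" for s s'
      using Mc.X_in[of True "snd s" "snd s'"] that by (auto simp: edges_eq)
    have GX: "on_mor G (Mc.X True a b) = Hc.X True a b" for a b
      using G.F_crossing[OF Mc.crossing_category_axioms] by (simp add: Gx)
    show ?thesis
      unfolding HOMFLY_def MOY_def with_braiding_fields
      using G.F_word_over_word[OF X, of "Hc.X True" A B] GX that by simp
  qed
  then have bG: "rigid_braided_functor (MOY \<alpha> \<zeta> n) (HOMFLY \<alpha> z) G"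
    using rG G.F_strand by (auto simp: rigid_braided_functor_def HOMFLY_def MOY_def edges_eq[symmetric])
  have "rbu_isomorphism (HOMFLY \<alpha> z) (MOY \<alpha> \<zeta> n) Z"
    unfolding rbu_isomorphism_def
    using rigid_braided_untwisted_HOMFLY rigid_braided_untwisted_MOY bZ bG GZ ZG[unfolded in_lists_conv_set]
    by (auto simp: HOMFLY_def MOY_def simp del: Z.F_word G.F_word intro!: exI[of _ G])
  with is_Z unique show ?thesis by blast
qed

end

theorem theorem2:
  fixes \<alpha> z \<zeta> :: "'r::{comm_ring, comm_monoid_mult}" and n :: nat
  assumes "\<alpha> dvd 1" and "z dvd 1" and "\<zeta> dvd 1"
    and "uinv \<zeta> - \<zeta> = z"
    and "n \<ge> 2"
  shows "\<exists>Z. is_Z \<alpha> z \<zeta> n Z \<and>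
           (\<forall>Z'. is_Z \<alpha> z \<zeta> n Z' \<longrightarrow> cat_map_eq (HOMFLY \<alpha> z) Z' Z) \<and>
           rbu_isomorphism (HOMFLY \<alpha> z) (MOY \<alpha> \<zeta> n) Z"
  using assms(1-4) by (intro skein_parameters.Z_isomorphism skein_parameters.intro)

end
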